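(* Let $\alpha\in(0,\frac12)$ and let $\Omega\subset\mathbb{R}^2$ be a bounded simply-connected domain with a $C^{1,1}$ boundary. There exist $\varepsilon_0=\varepsilon_0(\alpha,\partial\Omega)>0$ and a constant $C=C(\alpha,\partial\Omega)>0$, depending only on $\alpha$ and on the geometry of $\partial\Omega$, such that for every $0<\varepsilon<\varepsilon_0$ the following holds. Put $r^*=\frac1{|\log\varepsilon|^3}$. If $m':\Omega\to\overline{B^2}$ is a $C^1$ vector field that satisfies $m'\cdot\nu=0$ on $\partial\Omega$ and $$\int_\Omega g_\varepsilon(m')\,dx\le2\pi(1+\alpha)|\log\varepsilon|,$$ then there exists either a ball $B(x_1^*,r^* )\subset\Omega$ with $$\int_{B(x_1^*,r^* )}g_\varepsilon(m')\,dx\ge2\pi\Big|\log\frac{r^*}{\varepsilon}\Big|-C,$$ or two balls $B(x_2^*,r^* )$ and $B(x_3^*,r^* )$ with $x_2^*,x_3^*\in\partial\Omega$ and $$\int_{(B(x_2^*,r^* )\cup B(x_3^*,r^* ))\cap\Omega}g_\varepsilon(m')\,dx\ge2\pi\Big|\log\frac{r^*}{\varepsilon}\Big|-C.$$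
   Context: $\overline{B^2}$ is the closed unit disk of $\mathbb{R}^2$; $B(x,r)$ is the disk of center $x$ and radius $r$; $\nu$ is the outer unit normal to $\partial\Omega$, and the boundary condition is understood in the sense of traces (finite energy gives $m'\in H^1(\Omega)$). The Ginzburg–Landau energy density is $$g_\varepsilon(m')=|\nabla m'|^2+\frac1{\varepsilon^2}\left(1-|m'|^2\right)^2.$$ The two points $x_2^*,x_3^*$ are not required to be distinct. *)

theory Defs
  imports "HOL-Analysis.Analysis"
begin

definition hausdorff1_delta :: "real \<Rightarrow> 'a::metric_space set \<Rightarrow> ennreal" where
  "hausdorff1_delta \<delta> A =
     (INF U\<in>{U :: nat \<Rightarrow> 'a set. A \<subseteq> (\<Union>i. U i) \<and> (\<forall>i. bounded (U i) \<and> diameter (U i) \<le> \<delta>)}.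
        \<Sum>i. ennreal (diameter (U i)))"

definition hausdorff1_outer :: "'a::metric_space set \<Rightarrow> ennreal" where
  "hausdorff1_outer A = (SUP \<delta>\<in>{0<..}. hausdorff1_delta \<delta> A)"

text \<open>One-dimensional Hausdorff measure, normalised so that it is arc length on rectifiable curves;
  it serves as the surface measure on the boundary. Since \<open>measure_of\<close> yields the zero measure when its argument is not countably additive,
  the lemma \<open>emeasure_hausdorff1\<close> below is what justifies this definition.\<close>

definition hausdorff1 :: "'a::metric_space measure" where
  "hausdorff1 = measure_of UNIV (sets borel) hausdorff1_outer"

lemma space_hausdorff1 [simp]: "space hausdorff1 = UNIV"
  by (simp add: hausdorff1_def)

lemma sets_hausdorff1 [simp, measurable_cong]: "sets hausdorff1 = sets borel"
  unfolding hausdorff1_def using sets.sigma_sets_eq[of borel] by (simp add: space_borel)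

lemma hausdorff1_delta_mono: "A \<subseteq> B \<Longrightarrow> hausdorff1_delta \<delta> A \<le> hausdorff1_delta \<delta> B"
  unfolding hausdorff1_delta_def by (rule INF_superset_mono) auto

lemma hausdorff1_delta_antimono:
  "\<delta> \<le> \<delta>' \<Longrightarrow> hausdorff1_delta \<delta>' A \<le> hausdorff1_delta \<delta> A"
  unfolding hausdorff1_delta_def by (rule INF_superset_mono) (auto intro: order_trans)

lemma hausdorff1_delta_le:
  "A \<subseteq> (\<Union>i. U i) \<Longrightarrow> (\<And>i. bounded (U i)) \<Longrightarrow> (\<And>i. diameter (U i) \<le> \<delta>)
    \<Longrightarrow> hausdorff1_delta \<delta> A \<le> (\<Sum>i. ennreal (diameter (U i)))"
  unfolding hausdorff1_delta_def by (rule INF_lower) auto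

lemma hausdorff1_delta_subadd:
  "hausdorff1_delta \<delta> (\<Union>i. A i) \<le> (\<Sum>i::nat. hausdorff1_delta \<delta> (A i))"
proof (rule ennreal_le_epsilon)
  fix e :: real assume e: "0 < e" and "(\<Sum>n. hausdorff1_delta \<delta> (A n)) < top"
  then have *: "\<And>n. hausdorff1_delta \<delta> (A n) < hausdorff1_delta \<delta> (A n) + e * (1/2)^Suc n"
    by (auto simp add: less_top dest!: ennreal_suminf_lessD)
  have "\<exists>U. A n \<subseteq> (\<Union>i::nat. U i) \<and> (\<forall>i. bounded (U i) \<and> diameter (U i) \<le> \<delta>) \<and>
      (\<Sum>i. ennreal (diameter (U i))) \<le> hausdorff1_delta \<delta> (A n) + e * (1/2)^Suc n" for n
    using *[of n] unfolding hausdorff1_delta_def[of _ "A n"] INF_less_iff by (blast intro: less_imp_le)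
  then obtain U where U: "\<And>n. A n \<subseteq> (\<Union>i::nat. U n i)" "\<And>n i. bounded (U n i)"
      "\<And>n i. diameter (U n i) \<le> \<delta>"
      "\<And>n. (\<Sum>i. ennreal (diameter (U n i))) \<le> hausdorff1_delta \<delta> (A n) + e * (1/2)^Suc n"
    by metis
  define C where "C = case_prod U o prod_decode"
  have "(\<Union>i. A i) \<subseteq> (\<Union>i. C i)"
    using U(1) by (auto simp add: C_def subset_eq) (metis prod.case prod_encode_inverse)
  then have "hausdorff1_delta \<delta> (\<Union>i. A i) \<le> (\<Sum>i. ennreal (diameter (C i)))"
    using U(2,3) by (intro hausdorff1_delta_le) (auto simp: C_def split_def)
  also have "\<dots> = (\<Sum>n. \<Sum>i. ennreal (diameter (U n i)))"
    unfolding C_def comp_def by (intro suminf_ennreal_2dimen) auto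
  also have "\<dots> \<le> (\<Sum>n. hausdorff1_delta \<delta> (A n) + e * (1/2) ^ Suc n)"
    by (intro suminf_le allI U(4)) auto
  also have "\<dots> = (\<Sum>n. hausdorff1_delta \<delta> (A n)) + (\<Sum>n. ennreal e * ennreal ((1/2) ^ Suc n))"
    using e by (subst suminf_add[symmetric])
               (auto simp del: ennreal_suminf_cmult simp add: ennreal_mult[symmetric])
  also have "\<dots> = (\<Sum>n. hausdorff1_delta \<delta> (A n)) + e"
    unfolding ennreal_suminf_cmult
    by (subst suminf_ennreal_eq[OF zero_le_power power_half_series]) auto
  finally show "hausdorff1_delta \<delta> (\<Union>i. A i) \<le> (\<Sum>n. hausdorff1_delta \<delta> (A n)) + e" .
qed

lemma hausdorff1_outer_subadd_countable:
  "hausdorff1_outer (\<Union>i. A i) \<le> (\<Sum>i::nat. hausdorff1_outer (A i))"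
  unfolding hausdorff1_outer_def[of "\<Union>i. A i"]
proof (rule SUP_least)
  fix \<delta> :: real assume "\<delta> \<in> {0<..}"
  then have "(\<Sum>i. hausdorff1_delta \<delta> (A i)) \<le> (\<Sum>i. hausdorff1_outer (A i))"
    by (auto intro!: suminf_le SUP_upper simp: hausdorff1_outer_def)
  with hausdorff1_delta_subadd[of \<delta> A]
  show "hausdorff1_delta \<delta> (\<Union>i. A i) \<le> (\<Sum>i. hausdorff1_outer (A i))"
    by (rule order_trans)
qed

lemma outer_measure_space_hausdorff1:
  "outer_measure_space UNIV (hausdorff1_outer :: 'a::metric_space set \<Rightarrow> ennreal)"
proof -
  have "hausdorff1_delta \<delta> ({}::'a set) = 0" if "\<delta> > 0" for \<delta>
    using hausdorff1_delta_le[of "{}::'a set" "\<lambda>_. {}" \<delta>] that by simp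
  then have "positive UNIV (hausdorff1_outer :: 'a set \<Rightarrow> ennreal)"
    by (simp add: positive_def hausdorff1_outer_def)
  moreover have "increasing UNIV (hausdorff1_outer :: 'a set \<Rightarrow> ennreal)"
    by (auto simp: increasing_def hausdorff1_outer_def intro!: SUP_mono hausdorff1_delta_mono)
  ultimately show ?thesis
    using hausdorff1_outer_subadd_countable
    by (auto simp: outer_measure_space_def countably_subadditive_def)
qed

lemma hausdorff1_outer_mono: "A \<subseteq> B \<Longrightarrow> hausdorff1_outer A \<le> hausdorff1_outer B"
  using outer_measure_space_hausdorff1 by (auto simp: outer_measure_space_def increasing_def)

lemma hausdorff1_outer_subadd:
  "hausdorff1_outer (A \<union> B :: 'a::metric_space set) \<le> hausdorff1_outer A + hausdorff1_outer B"
proof -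
  have "ring_of_sets UNIV (UNIV :: 'a set set)" by (metis Pow_UNIV ring_of_sets_Pow)
  then have "subadditive UNIV (hausdorff1_outer :: 'a set \<Rightarrow> ennreal)"
    using outer_measure_space_hausdorff1
    by (auto simp: outer_measure_space_def intro: ring_of_sets.countably_subadditive_subadditive)
  then have "hausdorff1_outer (A \<union> (B - A)) \<le> hausdorff1_outer A + hausdorff1_outer (B - A)"
    unfolding subadditive_def by blast
  also have "\<dots> \<le> hausdorff1_outer A + hausdorff1_outer B"
    by (intro add_left_mono hausdorff1_outer_mono) auto
  finally show ?thesis by simp
qed

lemma hausdorff1_outer_separated:
  assumes d: "d > 0" and sep: "\<And>x y. x \<in> A \<Longrightarrow> y \<in> B \<Longrightarrow> d \<le> dist x y"
  shows "hausdorff1_outer A + hausdorff1_outer B \<le> hausdorff1_outer (A \<union> B)"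
proof -
  have small: "hausdorff1_delta \<delta> A + hausdorff1_delta \<delta> B \<le> hausdorff1_outer (A \<union> B)"
    if "0 < \<delta>" "\<delta> < d" for \<delta>
  proof -
    have "hausdorff1_delta \<delta> A + hausdorff1_delta \<delta> B \<le> (\<Sum>i. ennreal (diameter (U i)))"
      if U: "A \<union> B \<subseteq> (\<Union>i::nat. U i)" "\<And>i. bounded (U i)" "\<And>i. diameter (U i) \<le> \<delta>" for U
    proof -
      define V W where "V i = (if U i \<inter> A = {} then {} else U i)"
        and "W i = (if U i \<inter> B = {} then {} else U i)" for i
      have "U i \<inter> A = {} \<or> U i \<inter> B = {}" for i
      proof (rule ccontr)
        assume "\<not> ?thesis"
        then obtain x y where "x \<in> U i \<inter> A" "y \<in> U i \<inter> B" by blast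
        then show False
          using sep[of x y] diameter_bounded_bound[OF U(2)[of i], of x y] U(3)[of i] \<open>\<delta> < d\<close> by auto
      qed
      then have le: "ennreal (diameter (V i)) + ennreal (diameter (W i)) \<le> ennreal (diameter (U i))" for i
        by (auto simp: V_def W_def)
      have "hausdorff1_delta \<delta> A \<le> (\<Sum>i. ennreal (diameter (V i)))"
      proof (rule hausdorff1_delta_le)
        show "A \<subseteq> (\<Union>i. V i)" using U(1) unfolding V_def by fastforce
      qed (use U \<open>0 < \<delta>\<close> in \<open>auto simp: V_def\<close>)
      moreover have "hausdorff1_delta \<delta> B \<le> (\<Sum>i. ennreal (diameter (W i)))"
      proof (rule hausdorff1_delta_le)
        show "B \<subseteq> (\<Union>i. W i)" using U(1) unfolding W_def by fastforce
      qed (use U \<open>0 < \<delta>\<close> in \<open>auto simp: W_def\<close>)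
      ultimately have "hausdorff1_delta \<delta> A + hausdorff1_delta \<delta> B
          \<le> (\<Sum>i. ennreal (diameter (V i)) + ennreal (diameter (W i)))"
        by (subst suminf_add[symmetric]) (auto intro: add_mono)
      also have "\<dots> \<le> (\<Sum>i. ennreal (diameter (U i)))"
        by (intro suminf_le le) auto
      finally show ?thesis .
    qed
    then have "hausdorff1_delta \<delta> A + hausdorff1_delta \<delta> B \<le> hausdorff1_delta \<delta> (A \<union> B)"
      unfolding hausdorff1_delta_def[of \<delta> "A \<union> B"] by (intro INF_greatest) auto
    also have "\<dots> \<le> hausdorff1_outer (A \<union> B)"
      using \<open>0 < \<delta>\<close> by (auto simp: hausdorff1_outer_def intro: SUP_upper)
    finally show ?thesis .
  qed
  have "hausdorff1_delta \<delta> A + hausdorff1_delta \<delta>' B \<le> hausdorff1_outer (A \<union> B)"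
    if "0 < \<delta>" "0 < \<delta>'" for \<delta> \<delta>'
  proof -
    define \<eta> where "\<eta> = min (d/2) (min \<delta> \<delta>')"
    have "hausdorff1_delta \<delta> A + hausdorff1_delta \<delta>' B
        \<le> hausdorff1_delta \<eta> A + hausdorff1_delta \<eta> B"
      by (intro add_mono hausdorff1_delta_antimono) (auto simp: \<eta>_def)
    also have "\<dots> \<le> hausdorff1_outer (A \<union> B)"
      using that d by (intro small) (auto simp: \<eta>_def)
    finally show ?thesis .
  qed
  then have "hausdorff1_delta \<delta> A + hausdorff1_outer B \<le> hausdorff1_outer (A \<union> B)" if "0 < \<delta>" for \<delta>
    using that unfolding hausdorff1_outer_def[of B]
    by (subst ennreal_SUP_add_right) (auto intro: SUP_least)
  then show ?thesis
    unfolding hausdorff1_outer_def[of A]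
    by (subst ennreal_SUP_add_left[symmetric]) (auto intro: SUP_least)
qed

lemma closed_in_lambda_system:
  assumes "closed (C :: 'a::metric_space set)"
  shows "hausdorff1_outer (A \<inter> C) + hausdorff1_outer (A - C) \<le> hausdorff1_outer A"
proof (cases "C = {} \<or> hausdorff1_outer A = top")
  case True
  then show ?thesis
    using outer_measure_space_hausdorff1 by (auto simp: outer_measure_space_def positive_def)
next
  case False
  then have fin: "hausdorff1_outer A \<noteq> top" and ne: "C \<noteq> {}" by auto
  let ?H = "hausdorff1_outer :: 'a set \<Rightarrow> ennreal"
  define E where "E n = {x\<in>A. infdist x C \<ge> 1 / real (Suc n)}" for n
  define R where "R n = E (Suc n) - E n" for n
  have Emono: "E i \<subseteq> E j" if "i \<le> j" for i j
  proof -
    have "1 / real (Suc j) \<le> 1 / real (Suc i)" using that by (simp add: frac_le)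
    then show ?thesis unfolding E_def using order_trans by blast
  qed
  have gap: "hausdorff1_outer X + hausdorff1_outer Y \<le> hausdorff1_outer (X \<union> Y)"
    if "s < t" "\<And>x. x \<in> X \<Longrightarrow> infdist x C \<ge> t" "\<And>x. x \<in> Y \<Longrightarrow> infdist x C \<le> s"
    for X Y s t
  proof (rule hausdorff1_outer_separated[of "t - s"])
    fix x y assume "x \<in> X" "y \<in> Y"
    with that(2)[of x] that(3)[of y] show "t - s \<le> dist x y"
      using infdist_triangle[of x C y] by linarith
  qed (use that in auto)
  have step: "?H (E n) + ?H (R (Suc n)) \<le> ?H (E (Suc (Suc n)))" for n
  proof -
    have "?H (E n) + ?H (R (Suc n)) \<le> ?H (E n \<union> R (Suc n))"
      by (rule gap[of "1 / real (Suc (Suc n))" "1 / real (Suc n)"])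
         (auto simp: R_def E_def frac_less2)
    also have "\<dots> \<le> ?H (E (Suc (Suc n)))"
    proof (rule hausdorff1_outer_mono)
      have "E n \<subseteq> E (Suc (Suc n))" by (rule Emono) simp
      then show "E n \<union> R (Suc n) \<subseteq> E (Suc (Suc n))" by (auto simp: R_def)
    qed
    finally show ?thesis .
  qed
  have "(\<Sum>i<n. ?H (R (Suc i))) \<le> ?H (E n) + ?H (E (Suc n))" for n
  proof (induction n)
    case (Suc n)
    have "(\<Sum>i<Suc n. ?H (R (Suc i))) \<le> ?H (E (Suc n)) + (?H (E n) + ?H (R (Suc n)))"
      using add_right_mono[OF Suc, of "?H (R (Suc n))"] by (simp add: ac_simps)
    also have "\<dots> \<le> ?H (E (Suc n)) + ?H (E (Suc (Suc n)))"
      by (intro add_left_mono step)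
    finally show ?case .
  qed simp
  moreover have E_le: "?H (E n) \<le> ?H A" for n
    by (rule hausdorff1_outer_mono) (auto simp: E_def)
  ultimately have "(\<Sum>i<n. ?H (R (Suc i))) \<le> ?H A + ?H A" for n
    by (meson add_mono order_trans)
  then have "(\<Sum>i. ?H (R (Suc i))) \<le> ?H A + ?H A"
    by (intro suminf_le_const summableI)
  then have Sfin: "(\<Sum>i. ?H (R (Suc i))) \<noteq> top"
    using fin by (auto simp: top_unique)
  show ?thesis
  proof (rule ennreal_le_epsilon)
    fix e :: real assume e: "0 < e"
    have "\<exists>n. (\<Sum>i. ?H (R (Suc (i + n)))) \<le> e"
    proof -
      have "(\<lambda>n. (\<Sum>i<n. ?H (R (Suc i)))) \<longlonglongrightarrow> (\<Sum>i. ?H (R (Suc i)))"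
        by (intro summable_LIMSEQ summableI)
      then have "(\<lambda>n. (\<Sum>i<n. ?H (R (Suc i))) + e) \<longlonglongrightarrow> (\<Sum>i. ?H (R (Suc i))) + e"
        by (intro tendsto_add tendsto_const)
      moreover have "(\<Sum>i. ?H (R (Suc i))) < (\<Sum>i. ?H (R (Suc i))) + e"
        using Sfin e by (simp add: less_top)
      ultimately have "\<forall>\<^sub>F n in sequentially. (\<Sum>i. ?H (R (Suc i))) < (\<Sum>i<n. ?H (R (Suc i))) + e"
        by (rule order_tendstoD)
      then obtain n where n: "(\<Sum>i. ?H (R (Suc i))) < (\<Sum>i<n. ?H (R (Suc i))) + e"
        by (auto simp: eventually_sequentially)
      have sp: "(\<Sum>i. ?H (R (Suc i))) = (\<Sum>i<n. ?H (R (Suc i))) + (\<Sum>i. ?H (R (Suc (i + n))))"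
        using suminf_offset[of "\<lambda>i. ?H (R (Suc i))" n] by (simp add: summableI add.commute)
      then have "(\<Sum>i<n. ?H (R (Suc i))) \<noteq> top" using Sfin by auto
      moreover have "(\<Sum>i<n. ?H (R (Suc i))) + (\<Sum>i. ?H (R (Suc (i + n)))) \<le> (\<Sum>i<n. ?H (R (Suc i))) + e"
        using n unfolding sp by (rule less_imp_le)
      ultimately have "(\<Sum>i. ?H (R (Suc (i + n)))) \<le> e"
        by (auto simp: ennreal_add_left_cancel_le infinity_ennreal_def)
      then show ?thesis ..
    qed
    then obtain n where n: "(\<Sum>i. ?H (R (Suc (i + n)))) \<le> e" ..
    have "A - C \<subseteq> E (Suc n) \<union> (\<Union>i. R (Suc (i + n)))"
    proof
      fix x assume x: "x \<in> A - C"
      then have "infdist x C > 0"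
        using assms ne by (simp add: infdist_pos_not_in_closed)
      then obtain N where "inverse (real (Suc N)) < infdist x C"
        using reals_Archimedean by blast
      with x have "x \<in> E N" by (simp add: E_def inverse_eq_divide)
      then have ex: "\<exists>N. x \<in> E N" ..
      define M where "M = (LEAST N. x \<in> E N)"
      have M: "x \<in> E M" "\<And>k. k < M \<Longrightarrow> x \<notin> E k"
        unfolding M_def using ex by (rule LeastI_ex) (rule not_less_Least)
      show "x \<in> E (Suc n) \<union> (\<Union>i. R (Suc (i + n)))"
      proof (cases "M \<le> Suc n")
        case True
        then show ?thesis using Emono[of M "Suc n"] M(1) by auto
      next
        case False
        then obtain k where "M = Suc (Suc (k + n))"
          by (metis add.commute add_Suc_right not_less_eq_eq less_imp_Suc_add not_le)
        with M have "x \<in> R (Suc (k + n))" by (simp add: R_def)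
        then show ?thesis by blast
      qed
    qed
    then have "?H (A - C) \<le> ?H (E (Suc n)) + ?H (\<Union>i. R (Suc (i + n)))"
      by (rule order_trans[OF hausdorff1_outer_mono hausdorff1_outer_subadd])
    also have "\<dots> \<le> ?H (E (Suc n)) + (\<Sum>i. ?H (R (Suc (i + n))))"
      by (intro add_left_mono hausdorff1_outer_subadd_countable)
    also have "\<dots> \<le> ?H (E (Suc n)) + e"
      using n by (rule add_left_mono)
    finally have "?H (A - C) \<le> ?H (E (Suc n)) + e" .
    then have "?H (A \<inter> C) + ?H (A - C) \<le> ?H (A \<inter> C) + (?H (E (Suc n)) + e)"
      by (rule add_left_mono)
    also have "\<dots> = (?H (E (Suc n)) + ?H (A \<inter> C)) + e"
      by (simp only: ac_simps)
    also have "\<dots> \<le> ?H A + e"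
    proof (rule add_right_mono)
      have "?H (E (Suc n)) + ?H (A \<inter> C) \<le> ?H (E (Suc n) \<union> A \<inter> C)"
        by (rule gap[of 0 "1 / real (Suc (Suc n))"]) (simp_all add: E_def)
      also have "\<dots> \<le> ?H A"
        by (rule hausdorff1_outer_mono) (auto simp: E_def)
      finally show "?H (E (Suc n)) + ?H (A \<inter> C) \<le> ?H A" .
    qed
    finally show "?H (A \<inter> C) + ?H (A - C) \<le> ?H A + e" .
  qed
qed

lemma emeasure_hausdorff1:
  assumes "A \<in> sets (borel :: 'a::metric_space measure)"
  shows "emeasure hausdorff1 A = hausdorff1_outer A"
proof -
  let ?L = "lambda_system UNIV UNIV (hausdorff1_outer :: 'a set \<Rightarrow> ennreal)"
  have alg: "sigma_algebra UNIV (UNIV :: 'a set set)" by (metis Pow_UNIV sigma_algebra_Pow)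
  have ms: "measure_space UNIV ?L hausdorff1_outer"
    by (rule sigma_algebra.caratheodory_lemma[OF alg outer_measure_space_hausdorff1])
  have "C \<in> ?L" if "closed C" for C
  proof -
    have "hausdorff1_outer (C \<inter> X) + hausdorff1_outer ((UNIV - C) \<inter> X) = hausdorff1_outer X" for X
    proof (rule antisym)
      show "hausdorff1_outer (C \<inter> X) + hausdorff1_outer ((UNIV - C) \<inter> X) \<le> hausdorff1_outer X"
        using closed_in_lambda_system[OF that, of X] by (simp add: Int_commute Diff_eq)
      have "X = (C \<inter> X) \<union> ((UNIV - C) \<inter> X)" by auto
      then show "hausdorff1_outer X \<le> hausdorff1_outer (C \<inter> X) + hausdorff1_outer ((UNIV - C) \<inter> X)"
        using hausdorff1_outer_subadd[of "C \<inter> X" "(UNIV - C) \<inter> X"] by metis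
    qed
    then show ?thesis by (simp add: lambda_system_def)
  qed
  then have "sigma_sets UNIV {C. closed C} \<subseteq> ?L"
    using ms by (intro sigma_algebra.sigma_sets_subset) (auto simp: measure_space_def)
  moreover have "sets borel = sigma_sets UNIV {C::'a set. closed C}"
    by (simp add: borel_eq_closed)
  ultimately have sub: "sets borel \<subseteq> ?L" by simp
  have "measure_space UNIV (sets borel) (hausdorff1_outer :: 'a set \<Rightarrow> ennreal)"
    using ms sub sets.sigma_algebra_axioms[of "borel :: 'a measure"]
    unfolding measure_space_def positive_def countably_additive_def
    by (auto simp: subset_eq)
  then show ?thesis
    unfolding hausdorff1_def using assms sets.sigma_sets_eq[of "borel :: 'a measure"]
    by (intro emeasure_measure_of_sigma) (auto simp: measure_space_def)
qed


text \<open>\<open>x \<bullet> \<tau>\<close> and \<open>x \<bullet> e\<close> are the coordinates of \<open>x\<close> in a rotated (or reflected) orthonormal frame.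
  That \<open>\<gamma>\<close> is defined and \<open>C\<close>(1,1) on the whole line is no restriction, as only its values near
  \<open>p \<bullet> \<tau>\<close> matter.\<close>

definition C11_chart ::
  "(real^2) set \<Rightarrow> real^2 \<Rightarrow> real \<Rightarrow> real^2 \<Rightarrow> real^2 \<Rightarrow> (real \<Rightarrow> real) \<Rightarrow> bool" where
  "C11_chart \<Omega> p r \<tau> e \<gamma> \<longleftrightarrow>
     r > 0 \<and> norm \<tau> = 1 \<and> norm e = 1 \<and> \<tau> \<bullet> e = 0 \<and>
     (\<forall>s. \<gamma> field_differentiable (at s)) \<and> (\<exists>L. L-lipschitz_on UNIV (deriv \<gamma>)) \<and>
     (\<forall>x\<in>ball p r. x \<in> \<Omega> \<longleftrightarrow> \<gamma> (x \<bullet> \<tau>) < x \<bullet> e)"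

definition C11_boundary :: "(real^2) set \<Rightarrow> bool" where
  "C11_boundary \<Omega> \<longleftrightarrow> (\<forall>p\<in>frontier \<Omega>. \<exists>r \<tau> e \<gamma>. C11_chart \<Omega> p r \<tau> e \<gamma>)"

definition chart_normal :: "real^2 \<Rightarrow> real^2 \<Rightarrow> real^2 \<Rightarrow> (real \<Rightarrow> real) \<Rightarrow> real^2" where
  "chart_normal p \<tau> e \<gamma> =
     (deriv \<gamma> (p \<bullet> \<tau>) *\<^sub>R \<tau> - e) /\<^sub>R sqrt (1 + (deriv \<gamma> (p \<bullet> \<tau>))\<^sup>2)"

text \<open>Inside a chart, \<open>\<Omega>\<close> is the set where \<open>\<gamma> (x \<bullet> \<tau>) - x \<bullet> e\<close> is negative; the outer normal is the
  normalised gradient of this function. Independence of the chart is the lemma \<open>outer_unit_normal_eq\<close> below.\<close>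

definition outer_unit_normal :: "(real^2) set \<Rightarrow> real^2 \<Rightarrow> real^2" where
  "outer_unit_normal \<Omega> p = (THE \<nu>. \<exists>r \<tau> e \<gamma>. C11_chart \<Omega> p r \<tau> e \<gamma> \<and> \<nu> = chart_normal p \<tau> e \<gamma>)"

lemma C11_chart_frontier:
  assumes ch: "C11_chart \<Omega> p r \<tau> e \<gamma>" and p: "p \<in> frontier \<Omega>"
  shows "\<gamma> (p \<bullet> \<tau>) = p \<bullet> e"
proof -
  define h where "h x = \<gamma> (x \<bullet> \<tau>) - x \<bullet> e" for x
  have r: "r > 0" and iff: "\<And>x. x \<in> ball p r \<Longrightarrow> x \<in> \<Omega> \<longleftrightarrow> h x < 0"
    using ch by (auto simp: C11_chart_def h_def)
  have "continuous_on UNIV \<gamma>"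
    using ch by (auto simp: C11_chart_def intro!: continuous_at_imp_continuous_on
        field_differentiable_imp_continuous_at)
  then have "continuous_on UNIV (\<lambda>x. \<gamma> (x \<bullet> \<tau>))"
    by (rule continuous_on_compose2) (intro continuous_intros, simp)
  then have cont: "continuous_on UNIV h"
    unfolding h_def by (intro continuous_intros)
  have "\<not> h p < 0"
  proof
    assume neg: "h p < 0"
    have "open ({x. h x < 0} \<inter> ball p r)"
      using cont by (intro open_Int open_Collect_less) auto
    moreover have "{x. h x < 0} \<inter> ball p r \<subseteq> \<Omega>" using iff by auto
    ultimately have "p \<in> interior \<Omega>" using neg r by (intro interiorI) auto
    then show False using p by (simp add: frontier_def)
  qed
  moreover have "\<not> h p > 0"
  proof
    assume pos: "h p > 0"
    have "open ({x. h x > 0} \<inter> ball p r)"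
      using cont by (intro open_Int open_Collect_less) auto
    moreover have "{x. h x > 0} \<inter> ball p r \<subseteq> - \<Omega>" using iff by force
    ultimately have "p \<in> interior (- \<Omega>)" using pos r by (intro interiorI) auto
    then show False using p by (simp add: frontier_def interior_complement)
  qed
  ultimately show ?thesis by (simp add: h_def)
qed

lemma norm_chart_normal:
  assumes "C11_chart \<Omega> p r \<tau> e \<gamma>"
  shows "norm (chart_normal p \<tau> e \<gamma>) = 1"
proof -
  let ?d = "deriv \<gamma> (p \<bullet> \<tau>)"
  have "\<tau> \<bullet> \<tau> = 1" "e \<bullet> e = 1" "\<tau> \<bullet> e = 0"
    using assms by (auto simp: C11_chart_def norm_eq_1)
  then have "(?d *\<^sub>R \<tau> - e) \<bullet> (?d *\<^sub>R \<tau> - e) = 1 + ?d\<^sup>2"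
    by (simp add: inner_diff inner_commute power2_eq_square)
  then have "norm (?d *\<^sub>R \<tau> - e) = sqrt (1 + ?d\<^sup>2)" by (simp add: norm_eq_sqrt_inner)
  moreover have "sqrt (1 + ?d\<^sup>2) > 0" by (simp add: add_pos_nonneg)
  ultimately show ?thesis by (simp add: chart_normal_def)
qed

lemma chart_normal_ray:
  assumes ch: "C11_chart \<Omega> p r \<tau> e \<gamma>" and p: "p \<in> frontier \<Omega>"
  shows "v \<bullet> chart_normal p \<tau> e \<gamma> < 0 \<Longrightarrow> \<forall>\<^sub>F t in at_right 0. p + t *\<^sub>R v \<in> \<Omega>"
    and "v \<bullet> chart_normal p \<tau> e \<gamma> > 0 \<Longrightarrow> \<forall>\<^sub>F t in at_right 0. p + t *\<^sub>R v \<notin> \<Omega>"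
proof -
  let ?d = "deriv \<gamma> (p \<bullet> \<tau>)"
  define h where "h t = \<gamma> ((p + t *\<^sub>R v) \<bullet> \<tau>) - (p + t *\<^sub>R v) \<bullet> e" for t
  define D where "D = ?d * (v \<bullet> \<tau>) - v \<bullet> e"
  have h0: "h 0 = 0" using C11_chart_frontier[OF assms] by (simp add: h_def)
  have s: "sqrt (1 + ?d\<^sup>2) > 0" by (simp add: add_pos_nonneg)
  have vn: "v \<bullet> chart_normal p \<tau> e \<gamma> = D / sqrt (1 + ?d\<^sup>2)"
    by (simp add: chart_normal_def D_def inner_diff_right divide_inverse)
  have "(\<gamma> has_real_derivative ?d) (at (p \<bullet> \<tau>))"
    using ch by (simp add: C11_chart_def DERIV_deriv_iff_field_differentiable)
  then have "((\<lambda>t. \<gamma> (p \<bullet> \<tau> + t * (v \<bullet> \<tau>))) has_real_derivative ?d * (v \<bullet> \<tau>)) (at 0)"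
    by (intro DERIV_chain2[where g = "\<lambda>t. p \<bullet> \<tau> + t * (v \<bullet> \<tau>)"]) (auto intro!: derivative_eq_intros)
  then have der: "(h has_real_derivative D) (at 0)"
    unfolding h_def D_def inner_add_left inner_scaleR_left
    by (auto intro!: derivative_eq_intros)
  have "((\<lambda>t. p + t *\<^sub>R v) \<longlongrightarrow> p + 0 *\<^sub>R v) (at_right 0)"
    by (intro tendsto_intros)
  then have "\<forall>\<^sub>F t in at_right 0. p + t *\<^sub>R v \<in> ball p r"
    using ch by (intro topological_tendstoD) (auto simp: C11_chart_def)
  then have iff: "\<forall>\<^sub>F t in at_right 0. p + t *\<^sub>R v \<in> \<Omega> \<longleftrightarrow> h t < 0"
    by eventually_elim (use ch in \<open>auto simp: C11_chart_def h_def\<close>)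
  show "\<forall>\<^sub>F t in at_right 0. p + t *\<^sub>R v \<in> \<Omega>" if "v \<bullet> chart_normal p \<tau> e \<gamma> < 0"
  proof -
    have "D < 0" using that s by (simp add: vn divide_less_0_iff)
    then obtain d where "d > 0" "\<And>t. 0 < t \<Longrightarrow> t < d \<Longrightarrow> h t < 0"
      using DERIV_neg_dec_right[OF der] h0 by auto
    then have "\<forall>\<^sub>F t in at_right 0. h t < 0" by (auto simp: eventually_at_right)
    with iff show ?thesis by eventually_elim auto
  qed
  show "\<forall>\<^sub>F t in at_right 0. p + t *\<^sub>R v \<notin> \<Omega>" if "v \<bullet> chart_normal p \<tau> e \<gamma> > 0"
  proof -
    have "D > 0" using that s by (simp add: vn zero_less_divide_iff)
    then obtain d where "d > 0" "\<And>t. 0 < t \<Longrightarrow> t < d \<Longrightarrow> h t > 0"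
      using DERIV_pos_inc_right[OF der] h0 by auto
    then have "\<forall>\<^sub>F t in at_right 0. h t > 0" by (auto simp: eventually_at_right)
    with iff show ?thesis by eventually_elim auto
  qed
qed

lemma chart_normal_unique:
  assumes ch: "C11_chart \<Omega> p r \<tau> e \<gamma>" "C11_chart \<Omega> p r' \<tau>' e' \<gamma>'" and p: "p \<in> frontier \<Omega>"
  shows "chart_normal p \<tau> e \<gamma> = chart_normal p \<tau>' e' \<gamma>'" (is "?a = ?b")
proof (rule ccontr)
  assume ne: "?a \<noteq> ?b"
  have a: "?a \<bullet> ?a = 1" and b: "?b \<bullet> ?b = 1"
    using ch[THEN norm_chart_normal] by (simp_all add: norm_eq_1)
  have "0 < (?a - ?b) \<bullet> (?a - ?b)" using ne by simp
  then have "?a \<bullet> ?b < 1" using a b by (simp add: inner_diff inner_commute)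
  then have "(?a - ?b) \<bullet> ?a > 0" "(?a - ?b) \<bullet> ?b < 0"
    using a b inner_commute[of ?a ?b] by (simp_all only: inner_diff_left)
  then have "\<forall>\<^sub>F t in at_right 0. p + t *\<^sub>R (?a - ?b) \<notin> \<Omega>"
    "\<forall>\<^sub>F t in at_right 0. p + t *\<^sub>R (?a - ?b) \<in> \<Omega>"
    using chart_normal_ray[OF ch(1) p] chart_normal_ray[OF ch(2) p] by auto
  then have "\<forall>\<^sub>F t::real in at_right 0. False" by eventually_elim auto
  then show False by simp
qed

lemma outer_unit_normal_eq:
  assumes "C11_chart \<Omega> p r \<tau> e \<gamma>" "p \<in> frontier \<Omega>"
  shows "outer_unit_normal \<Omega> p = chart_normal p \<tau> e \<gamma>"
  unfolding outer_unit_normal_def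
proof (rule the_equality)
  show "\<exists>r' \<tau>' e' \<gamma>'. C11_chart \<Omega> p r' \<tau>' e' \<gamma>' \<and> chart_normal p \<tau> e \<gamma> = chart_normal p \<tau>' e' \<gamma>'"
    using assms(1) by blast
qed (metis assms chart_normal_unique)

definition C1_on :: "(real^2) set \<Rightarrow> (real^2 \<Rightarrow> real^2) \<Rightarrow> bool" where
  "C1_on S m \<longleftrightarrow>
     (\<forall>x\<in>S. m differentiable (at x)) \<and> continuous_on S (\<lambda>x. jacobian m (at x))"

text \<open>The norm of \<open>real^2^2\<close> is the Frobenius norm, so \<open>norm (jacobian m (at x))\<close> is the Euclidean
  norm of the gradient of \<open>m\<close> at \<open>x\<close>.\<close>

text \<open>The trace operator is the continuous extension to \<open>H\<^sup>1(\<Omega>)\<close> of the restriction of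
  \<open>C\<^sup>1\<close> fields on the closed domain to the boundary, with values in \<open>L\<^sup>2(\<partial>\<Omega>)\<close>. The relation below
  is only meant for \<open>m\<close> of class \<open>C\<^sup>1\<close> in \<open>\<Omega>\<close>, whose weak gradient is the classical one.\<close>

definition has_trace ::
  "(real^2) set \<Rightarrow> (real^2 \<Rightarrow> real^2) \<Rightarrow> (real^2 \<Rightarrow> real^2) \<Rightarrow> bool" where
  "has_trace \<Omega> m g \<longleftrightarrow>
     g \<in> borel_measurable borel \<and>
     (\<exists>w :: nat \<Rightarrow> real^2 \<Rightarrow> real^2. (\<forall>n. C1_on UNIV (w n)) \<and>
        (\<lambda>n. \<integral>\<^sup>+x\<in>\<Omega>. ennreal ((norm (w n x - m x))\<^sup>2
               + (norm (jacobian (w n) (at x) - jacobian m (at x)))\<^sup>2) \<partial>lborel) \<longlonglongrightarrow> 0 \<and>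
        (\<lambda>n. \<integral>\<^sup>+x\<in>frontier \<Omega>. ennreal ((norm (w n x - g x))\<^sup>2) \<partial>hausdorff1) \<longlonglongrightarrow> 0)"

definition normal_trace_zero :: "(real^2) set \<Rightarrow> (real^2 \<Rightarrow> real^2) \<Rightarrow> bool" where
  "normal_trace_zero \<Omega> m \<longleftrightarrow>
     (\<exists>g. has_trace \<Omega> m g \<and>
        (AE x in hausdorff1. x \<in> frontier \<Omega> \<longrightarrow> g x \<bullet> outer_unit_normal \<Omega> x = 0))"

definition gl_density :: "real \<Rightarrow> (real^2 \<Rightarrow> real^2) \<Rightarrow> real^2 \<Rightarrow> real" where
  "gl_density \<epsilon> m x =
     (norm (jacobian m (at x)))\<^sup>2 + 1 / \<epsilon>\<^sup>2 * (1 - (norm (m x))\<^sup>2)\<^sup>2"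

definition gl_energy :: "real \<Rightarrow> (real^2 \<Rightarrow> real^2) \<Rightarrow> (real^2) set \<Rightarrow> ennreal" where
  "gl_energy \<epsilon> m A = (\<integral>\<^sup>+x\<in>A. ennreal (gl_density \<epsilon> m x) \<partial>lborel)"

end

theory Submission imports Defs "HOL-Complex_Analysis.Complex_Analysis" "HOL-Real_Asymp.Real_Asymp" begin

text \<open>The proof is a ball construction in the manner of Jerrard that avoids the notion of degree. The field \<open>m\<close>
  is replaced by a \<open>C\<^sup>1\<close> field \<open>w\<close> on the plane whose normal component on the boundary is small off a set
  of tiny length. On the scale \<open>\<epsilon>\<close> the values of \<open>w\<close> determine a continuous field \<open>f\<close>, which outside few balls of
  radius \<open>O(\<epsilon>)\<close> has no zeros and is almost tangential on the boundary. A ball gets label 0 if \<open>f\<close> can be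
  replaced inside it by a field without zeros that is almost tangential on the boundary, label 1 if one can
  only achieve that the field does not point outwards (or does not point inwards) there, and label 2 otherwise.
  Along a boundary circle (half circle) of a ball whose label \<open>n\<close> cannot be lowered, \<open>w\<close> turns by almost \<open>n \<pi>\<close> at least, which
  costs the energy \<open>n \<pi> / \<rho>\<close>; a circle inside the domain even costs \<open>2 \<pi> / \<rho>\<close>. The balls grow at speeds proportional to
  their labels, they are merged when they touch, and an interior ball that reaches the boundary is turned into a
  boundary ball, until their radii are comparable to \<open>r\<^sup>*\<close>. A ball of label \<open>n\<close> then contains
  almost the energy \<open>n \<pi> ln (r\<^sup>* / \<epsilon>)\<close>. The labels sum up to at least 2, since otherwise the simply
  connected domain would carry a field without zeros that points inwards on the boundary, against Brouwer's
  theorem; as the energy is less than \<open>3 \<pi> ln (1 / \<epsilon>)\<close>, the sum is 2.\<close>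

section \<open>Domains with a \<open>C\<close>(1,1) boundary\<close>

text \<open>Two obstacles shape the proof. The normal trace of \<open>m\<close> vanishes only almost
  everywhere, so circles around boundary points may end where the boundary condition fails. For
  \<open>w\<close> these points have length O(\<open>\<epsilon>\<close>), hence so has the set of
  spoilt radii, and the loss is charged to an extra term of the energy. Secondly, balls have to be
  combined across a curved boundary on which \<open>f\<close> is only almost tangential.
  Replaceability by a field without zeros passes directly from small balls to a large one, and its
  failure is exactly what forces \<open>w\<close> to turn on a circle. The bookkeeping rests on the
  concavity of the logarithm. If \<open>Lam s\<close> is the energy owed per unit of label at
  parameter \<open>s\<close>, then \<open>Lam s\<close> / \<open>s\<close> decreases, so the
  inequality energy >= size * \<open>Lam s\<close> / \<open>s\<close> survives an increase of
  \<open>s\<close>; being linear in size and energy it also survives mergers. The power of the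
  logarithm enters twice: the curvature factor is raised to the number O(|log
  \<open>\<epsilon>\<close>|) of initial balls, and the cost of a circle has a relative error
  O(\<open>rstar\<close>), which is multiplied by |log \<open>\<epsilon>\<close>|. Both effects stay
  bounded because \<open>rstar\<close> * |log \<open>\<epsilon>\<close>| does.\<close>

definition rv :: "complex \<Rightarrow> real^2" where "rv z = vector [Re z, Im z]"
definition cx :: "real^2 \<Rightarrow> complex" where "cx v = Complex (v$1) (v$2)"

lemma rv_nth [simp]: "rv z $ 1 = Re z" "rv z $ 2 = Im z" by (simp_all add: rv_def)
lemma cx_sel [simp]: "Re (cx v) = v$1" "Im (cx v) = v$2" by (simp_all add: cx_def)
lemma cx_rv [simp]: "cx (rv z) = z" by (simp add: complex_eq_iff)
lemma rv_cx [simp]: "rv (cx v) = v" by (simp add: vec_eq_iff forall_2)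
lemma inner_2: "x \<bullet> y = x$1 * y$1 + x$2 * (y$2 :: real)" for x y :: "real^2"
  by (simp add: inner_vec_def sum_2)
lemma inner_rv: "rv z \<bullet> rv w = Re (z * cnj w)" by (simp add: inner_2)
lemma inner_cx: "x \<bullet> y = Re (cx x * cnj (cx y))" by (simp add: inner_2)
lemma norm_rv [simp]: "norm (rv z) = cmod z"
  unfolding norm_eq_sqrt_inner[of "rv z"] by (simp add: inner_2 cmod_def power2_eq_square)
lemma norm_cx [simp]: "cmod (cx v) = norm v" by (metis norm_rv rv_cx)
lemma bounded_linear_rv: "bounded_linear rv"
  by (rule bounded_linear_intro[where K=1]) (auto simp: vec_eq_iff forall_2)
lemma bounded_linear_cx: "bounded_linear cx"
  by (rule bounded_linear_intro[where K=1]) (auto simp: complex_eq_iff)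
lemma cx_diff: "cx (x - y) = cx x - cx y" and cx_scaleR: "cx (r *\<^sub>R x) = r *\<^sub>R cx x"
  and cx_add: "cx (x + y) = cx x + cx y"
  by (simp_all add: complex_eq_iff)
lemma rv_diff: "rv (x - y) = rv x - rv y" and rv_scaleR: "rv (r *\<^sub>R x) = r *\<^sub>R rv x"
  and rv_add: "rv (x + y) = rv x + rv y" and rv_minus: "rv (- x) = - rv x"
  by (simp_all add: vec_eq_iff forall_2)
lemma cx_eq_0_iff [simp]: "cx x = 0 \<longleftrightarrow> x = 0" by (metis norm_cx norm_eq_zero)
lemma rv_eq_0_iff [simp]: "rv x = 0 \<longleftrightarrow> x = 0" by (metis norm_rv norm_eq_zero)
lemma continuous_on_rv [continuous_intros]: "continuous_on S f \<Longrightarrow> continuous_on S (\<lambda>x. rv (f x))"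
  by (rule bounded_linear.continuous_on[OF bounded_linear_rv])
lemma continuous_on_cx [continuous_intros]: "continuous_on S f \<Longrightarrow> continuous_on S (\<lambda>x. cx (f x))"
  by (rule bounded_linear.continuous_on[OF bounded_linear_cx])

definition circ :: "real^2 \<Rightarrow> real \<Rightarrow> real \<Rightarrow> real^2" where
  "circ c \<rho> \<theta> = c + \<rho> *\<^sub>R rv (cis \<theta>)"

lemma dist_circ: "\<rho> \<ge> 0 \<Longrightarrow> dist c (circ c \<rho> \<theta>) = \<rho>" by (simp add: circ_def dist_norm)
lemma continuous_on_circ [continuous_intros]:
  "continuous_on S f \<Longrightarrow> continuous_on S g \<Longrightarrow> continuous_on S h \<Longrightarrow> continuous_on S (\<lambda>x. circ (f x) (g x) (h x))"
  unfolding circ_def by (intro continuous_intros)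

lemma sphere_circ: assumes "dist c x = \<rho>"
  obtains \<theta> where "x = circ c \<rho> \<theta>" "a \<le> \<theta>" "\<theta> < a + 2 * pi"
proof (cases "\<rho> = 0")
  case True then show ?thesis using that[of a] assms by (simp add: circ_def)
next
  case False
  define z where "z = cx (x - c) / \<rho>"
  have r: "\<rho> > 0" using False assms by auto
  have "cmod z = 1" using assms r by (simp add: z_def norm_divide dist_norm norm_minus_commute)
  then have z: "z = cis (Arg z)" by (metis cis_Arg complex_sgn_def norm_zero scaleR_one inverse_1 zero_neq_one)
  define k where "k = \<lceil>(a - Arg z) / (2 * pi)\<rceil>"
  define t where "t = Arg z + 2 * pi * real_of_int k"
  have "cis t = z" using z by (simp add: t_def cis_mult[symmetric] cis_multiple_2pi)
  moreover have "\<rho> *\<^sub>R z = cx (x - c)" using r by (simp add: z_def scaleR_conv_of_real)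
  ultimately have "x = circ c \<rho> t" by (simp add: circ_def rv_scaleR[symmetric])
  moreover have "(a - Arg z) / (2 * pi) \<le> k" "k < (a - Arg z) / (2 * pi) + 1"
    unfolding k_def by linarith+
  then have "a \<le> t" "t < a + 2 * pi" by (auto simp: t_def field_simps)
  ultimately show ?thesis using that by blast
qed

text \<open>Concavity puts the sine above its chord on [0, pi/2], whose slope 2/pi exceeds 1/2 since
  pi < 4.\<close>

lemma abs_le_2_abs_sin:
  fixes \<theta> :: real assumes that: "\<bar>\<theta>\<bar> \<le> pi/2" shows "\<bar>\<theta>\<bar> \<le> 2 * \<bar>sin \<theta>\<bar>"
proof -
  have *: "x \<le> 2 * sin x" if "0 \<le> x" "x \<le> pi/2" for x :: real
  proof -
    have "concave_on {0..pi} sin" 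
      by (rule f''_le0_imp_concave[of _ _ cos "\<lambda>x. - sin x"]) (auto intro!: derivative_eq_intros sin_ge_zero)
    then have "sin ((1 - x / (pi/2)) * 0 + (x / (pi/2)) * (pi/2)) \<ge> (1 - x / (pi/2)) * sin 0 + (x / (pi/2)) * sin (pi/2)"
      using that pi_gt_zero by (intro concave_onD[of _ sin, simplified]) auto
    then have "sin x \<ge> x * (2 / pi)" by (simp add: mult_ac)
    moreover have "x * (2 / pi) \<ge> x * (1 / 2)"
      using that pi_less_4 by (intro mult_left_mono) (auto simp: field_simps)
    ultimately show ?thesis by simp
  qed
  show ?thesis using *[of \<theta>] *[of "-\<theta>"] that sin_ge_zero[of \<theta>] sin_ge_zero[of "-\<theta>"] by (cases "\<theta> \<ge> 0") auto
qed

text \<open>These uniform facts are what the later arguments use of the charts.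
  \<open>inside\<close> and \<open>outside\<close> place the boundary between two parabolas that
  touch it at \<open>y\<close>; \<open>cone\<close> is a uniform interior cone condition, with all
  directions allowed whose inward component is at least 1/8 of their length.\<close>

locale regular_domain =
  fixes \<Omega> :: "(real^2) set" and \<nu> :: "real^2 \<Rightarrow> real^2" and K r0 :: real
  assumes open_dom: "open \<Omega>" and bounded_dom: "bounded \<Omega>" and K: "0 < K" and r0: "0 < r0"
    and norm_normal: "\<And>y. y \<in> frontier \<Omega> \<Longrightarrow> norm (\<nu> y) = 1"
    and lipschitz_normal: "\<And>y y'. y \<in> frontier \<Omega> \<Longrightarrow> y' \<in> frontier \<Omega> \<Longrightarrow> norm (\<nu> y - \<nu> y') \<le> K * dist y y'"
    and inside: "\<And>x y. y \<in> frontier \<Omega> \<Longrightarrow> x \<in> ball y r0 \<Longrightarrow> (x - y) \<bullet> \<nu> y < - K * (dist y x)\<^sup>2 \<Longrightarrow> x \<in> \<Omega>"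
    and outside: "\<And>x y. y \<in> frontier \<Omega> \<Longrightarrow> x \<in> ball y r0 \<Longrightarrow> K * (dist y x)\<^sup>2 < (x - y) \<bullet> \<nu> y \<Longrightarrow> x \<notin> closure \<Omega>"
    and cone: "\<And>x y z. y \<in> frontier \<Omega> \<Longrightarrow> x \<in> ball y r0 \<Longrightarrow> z \<in> ball y r0 \<Longrightarrow> x \<in> closure \<Omega> \<Longrightarrow> x \<noteq> z \<Longrightarrow>
        (z - x) \<bullet> \<nu> y \<le> - (1/8) * norm (z - x) \<Longrightarrow> z \<in> \<Omega>"

lemma normalize_lipschitz:
  fixes a b :: "'a::real_normed_vector" assumes "norm a \<ge> 1" "norm b \<ge> 1"
  shows "norm (a /\<^sub>R norm a - b /\<^sub>R norm b) \<le> 2 * norm (a - b)"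
proof -
  have "a /\<^sub>R norm a - b /\<^sub>R norm b = (a - b) /\<^sub>R norm a + (inverse (norm a) - inverse (norm b)) *\<^sub>R b"
    by (simp add: algebra_simps)
  also have "norm \<dots> \<le> norm ((a - b) /\<^sub>R norm a) + norm ((inverse (norm a) - inverse (norm b)) *\<^sub>R b)"
    by (rule norm_triangle_ineq)
  also have "norm ((a - b) /\<^sub>R norm a) \<le> norm (a - b)"
    proof -
    have "inverse (norm a) \<le> 1" using assms by (simp add: inverse_le_1_iff)
    then show ?thesis using mult_right_mono[of "inverse (norm a)" 1 "norm (a - b)"] assms by simp
  qed
  also have "norm ((inverse (norm a) - inverse (norm b)) *\<^sub>R b) = \<bar>norm b - norm a\<bar> / norm a"
  proof -
    have "inverse (norm a) - inverse (norm b) = (norm b - norm a) / (norm a * norm b)"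
      using assms by (subst inverse_diff_inverse) (auto simp: divide_inverse algebra_simps)
    moreover have "norm b > 0" using assms by linarith
    ultimately show ?thesis using assms by (simp add: abs_mult)
  qed
  also have "\<dots> \<le> \<bar>norm b - norm a\<bar>" using assms by (simp add: divide_le_eq mult_le_cancel_left1)
  also have "\<dots> \<le> norm (a - b)" using norm_triangle_ineq3[of b a] by (simp add: norm_minus_commute)
  finally show ?thesis by simp
qed

lemma C11_chart_recenter:
  assumes "C11_chart \<Omega> p r \<tau> e \<gamma>" "y \<in> ball p r"
  shows "C11_chart \<Omega> y (r - dist p y) \<tau> e \<gamma>"
proof -
  have "ball y (r - dist p y) \<subseteq> ball p r" by (simp add: ball_subset_ball_iff dist_commute)
  then show ?thesis using assms unfolding C11_chart_def by auto
qed

text \<open>The local form of \<open>regular_domain\<close>; compactness of the boundary later makes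
  the constants independent of \<open>p\<close>.\<close>

definition regular_at :: "(real^2) set \<Rightarrow> (real^2 \<Rightarrow> real^2) \<Rightarrow> real^2 \<Rightarrow> real \<Rightarrow> real \<Rightarrow> bool" where
  "regular_at \<Omega> \<nu> p K \<rho> \<longleftrightarrow>  K > 0 \<and> \<rho> > 0 \<and>
    (\<forall>y y'. y \<in> frontier \<Omega> \<longrightarrow> y' \<in> frontier \<Omega> \<longrightarrow> y \<in> ball p \<rho> \<longrightarrow> y' \<in> ball p \<rho> \<longrightarrow>
      norm (\<nu> y - \<nu> y') \<le> K * dist y y') \<and>
    (\<forall>x y. y \<in> frontier \<Omega> \<longrightarrow> y \<in> ball p \<rho> \<longrightarrow> x \<in> ball y \<rho> \<longrightarrow> (x - y) \<bullet> \<nu> y < - K * (dist y x)\<^sup>2 \<longrightarrow> x \<in> \<Omega>) \<and>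
    (\<forall>x y. y \<in> frontier \<Omega> \<longrightarrow> y \<in> ball p \<rho> \<longrightarrow> x \<in> ball y \<rho> \<longrightarrow> K * (dist y x)\<^sup>2 < (x - y) \<bullet> \<nu> y \<longrightarrow> x \<notin> closure \<Omega>) \<and>
    (\<forall>x y z. y \<in> frontier \<Omega> \<longrightarrow> y \<in> ball p \<rho> \<longrightarrow> x \<in> ball y \<rho> \<longrightarrow> z \<in> ball y \<rho> \<longrightarrow> x \<in> closure \<Omega> \<longrightarrow>
      x \<noteq> z \<longrightarrow> (z - x) \<bullet> \<nu> y \<le> - (1/8) * norm (z - x) \<longrightarrow> z \<in> \<Omega>)"

text \<open>In a chart \<open>\<Omega>\<close> is the set where \<open>h\<close> is negative, and
  \<open>h\<close> vanishes on the boundary. So the position of a point is decided by an increment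
  of \<open>h\<close>, which is compared with a normal component.\<close>

lemma C11_chart_regular:
  assumes ch: "C11_chart \<Omega> p r \<tau> e \<gamma>"
  shows "\<exists>K \<rho>. regular_at \<Omega> (outer_unit_normal \<Omega>) p K \<rho>"
proof -
  have r: "r > 0" and on: "norm \<tau> = 1" "norm e = 1" "\<tau> \<bullet> e = 0"
    and diff: "\<And>s. \<gamma> field_differentiable (at s)"
    and iff: "\<And>x. x \<in> ball p r \<Longrightarrow> x \<in> \<Omega> \<longleftrightarrow> \<gamma> (x \<bullet> \<tau>) < x \<bullet> e"
    using ch by (auto simp: C11_chart_def)
  obtain L where "L-lipschitz_on UNIV (deriv \<gamma>)" using ch by (auto simp: C11_chart_def)
  then have L: "L \<ge> 0" "\<And>s t. \<bar>deriv \<gamma> s - deriv \<gamma> t\<bar> \<le> L * \<bar>s - t\<bar>"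
    by (auto simp: lipschitz_on_def dist_norm)
  \<comment> \<open>The 2 is the loss in normalising the normal, the 1 makes \<open>K\<close>
    positive. The radius below is chosen so that L * rho < 1/8, which is the slope left for
    \<open>cone\<close>.\<close>
  define K where "K = 2 * L + 1"
  define \<rho> where "\<rho> = min (r / 2) (1 / (16 * (L + 1)))"
  have \<rho>: "\<rho> > 0" "\<rho> \<le> r / 2" "L * \<rho> < 1/8"
  proof -
    show "\<rho> > 0" "\<rho> \<le> r / 2" using r L by (auto simp: \<rho>_def)
    have "L * \<rho> \<le> L * (1 / (16 * (L + 1)))" using L by (intro mult_left_mono) (auto simp: \<rho>_def)
    also have "\<dots> < 1/8" using L by (simp add: field_simps)
    finally show "L * \<rho> < 1/8" .
  qed
  define h where "h x = \<gamma> (x \<bullet> \<tau>) - x \<bullet> e" for x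
  have hiff: "x \<in> \<Omega> \<longleftrightarrow> h x < 0" if "x \<in> ball p r" for x using iff[OF that] by (simp add: h_def)
  have "continuous_on UNIV \<gamma>"
    using diff by (auto intro!: continuous_at_imp_continuous_on field_differentiable_imp_continuous_at)
  then have "continuous_on UNIV (\<lambda>x. \<gamma> (x \<bullet> \<tau>))"
    by (rule continuous_on_compose2) (intro continuous_intros, simp)
  then have conth: "continuous_on UNIV h" unfolding h_def by (intro continuous_intros)
  have hout: "x \<notin> closure \<Omega>" if "x \<in> ball p r" "h x > 0" for x
  proof -
    have "open ({x. h x > 0} \<inter> ball p r)" using conth by (intro open_Int open_Collect_less) auto
    moreover have "({x. h x > 0} \<inter> ball p r) \<inter> \<Omega> = {}" using hiff by force
    ultimately have "({x. h x > 0} \<inter> ball p r) \<inter> closure \<Omega> = {}" by (simp add: open_Int_closure_eq_empty)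
    then show ?thesis using that by auto
  qed
  have nrm: "outer_unit_normal \<Omega> y = chart_normal y \<tau> e \<gamma>" and h0: "h y = 0"
    if "y \<in> frontier \<Omega>" "y \<in> ball p \<rho>" for y
  proof -
    have "y \<in> ball p r" using that \<rho> r by auto
    from C11_chart_recenter[OF ch this] show "outer_unit_normal \<Omega> y = chart_normal y \<tau> e \<gamma>" "h y = 0"
      using outer_unit_normal_eq C11_chart_frontier that(1) by (auto simp: h_def)
  qed
  define q where "q y = sqrt (1 + (deriv \<gamma> (y \<bullet> \<tau>))\<^sup>2)" for y
  have q: "q y \<ge> 1" for y by (simp add: q_def)
  have q0: "q y \<noteq> 0" for y using q[of y] by auto
  \<comment> \<open>By the mean value theorem the gradient of \<open>h\<close> enters at a point
    whose distance from \<open>y\<close> is controlled, where it differs from its value at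
    \<open>y\<close> by at most L times that distance; \<open>q y\<close> is the length of the
    gradient at \<open>y\<close>. Starting from \<open>y\<close> itself this gives the parabolas,
    starting from other points it gives \<open>cone\<close>.\<close>
  have main: "\<bar>h z - h x - q y * ((z - x) \<bullet> chart_normal y \<tau> e \<gamma>)\<bar> \<le> L * max (dist y x) (dist y z) * norm (z - x)" for x y z
  proof -
    have "\<exists>\<xi>. \<gamma> (z \<bullet> \<tau>) - \<gamma> (x \<bullet> \<tau>) = deriv \<gamma> \<xi> * (z \<bullet> \<tau> - x \<bullet> \<tau>) \<and> \<bar>\<xi> - y \<bullet> \<tau>\<bar> \<le> max (\<bar>x \<bullet> \<tau> - y \<bullet> \<tau>\<bar>) (\<bar>z \<bullet> \<tau> - y \<bullet> \<tau>\<bar>)"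
    proof (cases "z \<bullet> \<tau> = x \<bullet> \<tau>")
      case True then show ?thesis by (intro exI[of _ "x \<bullet> \<tau>"]) auto
    next
      case False
      have mvt: "\<exists>\<xi>. a < \<xi> \<and> \<xi> < b \<and> \<gamma> b - \<gamma> a = (b - a) * deriv \<gamma> \<xi>" if "a < b" for a b
        using MVT2[OF that, of \<gamma> "deriv \<gamma>"] diff by (simp add: DERIV_deriv_iff_field_differentiable)
      show ?thesis
      proof (cases "x \<bullet> \<tau> < z \<bullet> \<tau>")
        case True
        from mvt[OF this] obtain \<xi> where "x \<bullet> \<tau> < \<xi>" "\<xi> < z \<bullet> \<tau>" "\<gamma> (z \<bullet> \<tau>) - \<gamma> (x \<bullet> \<tau>) = (z \<bullet> \<tau> - x \<bullet> \<tau>) * deriv \<gamma> \<xi>" by auto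
        then show ?thesis by (intro exI[of _ \<xi>]) (auto simp: mult.commute)
      next
        case False': False
        with False have "z \<bullet> \<tau> < x \<bullet> \<tau>" by simp
        from mvt[OF this] obtain \<xi> where "z \<bullet> \<tau> < \<xi>" "\<xi> < x \<bullet> \<tau>" "\<gamma> (x \<bullet> \<tau>) - \<gamma> (z \<bullet> \<tau>) = (x \<bullet> \<tau> - z \<bullet> \<tau>) * deriv \<gamma> \<xi>" by auto
        then show ?thesis by (intro exI[of _ \<xi>]) (auto simp: algebra_simps)
      qed
    qed
    then obtain \<xi> where \<xi>: "\<gamma> (z \<bullet> \<tau>) - \<gamma> (x \<bullet> \<tau>) = deriv \<gamma> \<xi> * (z \<bullet> \<tau> - x \<bullet> \<tau>)"
      "\<bar>\<xi> - y \<bullet> \<tau>\<bar> \<le> max (\<bar>x \<bullet> \<tau> - y \<bullet> \<tau>\<bar>) (\<bar>z \<bullet> \<tau> - y \<bullet> \<tau>\<bar>)" by blast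
    have t: "\<bar>a \<bullet> \<tau> - b \<bullet> \<tau>\<bar> \<le> norm (a - b)" for a b
      using Cauchy_Schwarz_ineq2[of "a - b" \<tau>] on by (simp add: inner_diff_left)
    have "q y * ((z - x) \<bullet> chart_normal y \<tau> e \<gamma>) = deriv \<gamma> (y \<bullet> \<tau>) * ((z - x) \<bullet> \<tau>) - (z - x) \<bullet> e"
      using q0[of y] unfolding chart_normal_def q_def[symmetric] by (simp add: inner_diff_right)
    then have "h z - h x - q y * ((z - x) \<bullet> chart_normal y \<tau> e \<gamma>) = (deriv \<gamma> \<xi> - deriv \<gamma> (y \<bullet> \<tau>)) * ((z - x) \<bullet> \<tau>)"
      using \<xi>(1) by (simp add: h_def inner_diff_left algebra_simps)
    then have "\<bar>h z - h x - q y * ((z - x) \<bullet> chart_normal y \<tau> e \<gamma>)\<bar> = \<bar>deriv \<gamma> \<xi> - deriv \<gamma> (y \<bullet> \<tau>)\<bar> * \<bar>(z - x) \<bullet> \<tau>\<bar>"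
      by (simp add: abs_mult)
    also have "\<dots> \<le> (L * max (dist y x) (dist y z)) * norm (z - x)"
    proof (intro mult_mono)
      have "\<bar>deriv \<gamma> \<xi> - deriv \<gamma> (y \<bullet> \<tau>)\<bar> \<le> L * \<bar>\<xi> - y \<bullet> \<tau>\<bar>" by (rule L)
      also have "\<dots> \<le> L * max (dist y x) (dist y z)"
        using order_trans[OF \<xi>(2) max.mono[OF t[of x y] t[of z y]]] by (intro mult_left_mono L) (simp add: dist_norm norm_minus_commute)
      finally show "\<bar>deriv \<gamma> \<xi> - deriv \<gamma> (y \<bullet> \<tau>)\<bar> \<le> L * max (dist y x) (dist y z)" .
      show "\<bar>(z - x) \<bullet> \<tau>\<bar> \<le> norm (z - x)" using t[of z x] by (simp add: inner_diff_left)
    qed (use L in \<open>auto intro: mult_nonneg_nonneg simp: le_max_iff_disj\<close>)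
    finally show ?thesis .
  qed
  have inball: "x \<in> ball p r" if "y \<in> ball p \<rho>" "x \<in> ball y \<rho>" for x y
    using that \<rho>(2) dist_triangle[of p x y] by auto
  have quad: "\<bar>h x - q y * ((x - y) \<bullet> outer_unit_normal \<Omega> y)\<bar> \<le> L * (dist y x)\<^sup>2"
      "L * (dist y x)\<^sup>2 \<le> K * (dist y x)\<^sup>2"
    if y: "y \<in> frontier \<Omega>" "y \<in> ball p \<rho>" and x: "x \<in> ball y \<rho>" for x y
    using main[of x y y] nrm[OF y] h0[OF y] L
    by (auto simp: dist_norm norm_minus_commute power2_eq_square K_def intro!: mult_right_mono)
  have "regular_at \<Omega> (outer_unit_normal \<Omega>) p K \<rho>"
    unfolding regular_at_def
  proof (intro conjI allI impI)
    show "K > 0" "\<rho> > 0" using L \<rho> by (auto simp: K_def)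
  next
    fix y y' assume y: "y \<in> frontier \<Omega>" "y' \<in> frontier \<Omega>" "y \<in> ball p \<rho>" "y' \<in> ball p \<rho>"
    define a where "a y = deriv \<gamma> (y \<bullet> \<tau>) *\<^sub>R \<tau> - e" for y
    have na: "norm (a y) = q y" for y
    proof -
      have "\<tau> \<bullet> \<tau> = 1" "e \<bullet> e = 1" using on by (auto simp: norm_eq_1)
      then have "a y \<bullet> a y = 1 + (deriv \<gamma> (y \<bullet> \<tau>))\<^sup>2"
        using on by (simp add: a_def inner_diff inner_commute power2_eq_square)
      then show ?thesis by (simp add: norm_eq_sqrt_inner q_def)
    qed
    have ca: "chart_normal y \<tau> e \<gamma> = a y /\<^sub>R norm (a y)" for y
      unfolding na by (simp add: chart_normal_def a_def q_def)
    have "norm (outer_unit_normal \<Omega> y - outer_unit_normal \<Omega> y') \<le> 2 * norm (a y - a y')"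
      unfolding nrm[OF y(1,3)] nrm[OF y(2,4)] ca by (rule normalize_lipschitz) (auto simp: na q)
    also have "a y - a y' = (deriv \<gamma> (y \<bullet> \<tau>) - deriv \<gamma> (y' \<bullet> \<tau>)) *\<^sub>R \<tau>" by (simp add: a_def algebra_simps)
    also have "norm \<dots> = \<bar>deriv \<gamma> (y \<bullet> \<tau>) - deriv \<gamma> (y' \<bullet> \<tau>)\<bar>" using on by simp
    also have "\<dots> \<le> L * \<bar>y \<bullet> \<tau> - y' \<bullet> \<tau>\<bar>" by (rule L)
    also have "\<bar>y \<bullet> \<tau> - y' \<bullet> \<tau>\<bar> \<le> dist y y'"
      using Cauchy_Schwarz_ineq2[of "y - y'" \<tau>] on by (simp add: inner_diff_left dist_norm)
    finally have *: "norm (outer_unit_normal \<Omega> y - outer_unit_normal \<Omega> y') \<le> 2 * (L * dist y y')"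
      using L by (simp add: mult_left_mono)
    have "2 * (L * dist y y') \<le> K * dist y y'" by (simp add: K_def algebra_simps)
    with * show "norm (outer_unit_normal \<Omega> y - outer_unit_normal \<Omega> y') \<le> K * dist y y'"
      by linarith
  next
    fix x y assume y: "y \<in> frontier \<Omega>" "y \<in> ball p \<rho>" and x: "x \<in> ball y \<rho>"
      and that: "(x - y) \<bullet> outer_unit_normal \<Omega> y < - K * (dist y x)\<^sup>2"
    let ?i = "(x - y) \<bullet> outer_unit_normal \<Omega> y"
    have m: "\<bar>h x - q y * ?i\<bar> \<le> L * (dist y x)\<^sup>2" and KL: "L * (dist y x)\<^sup>2 \<le> K * (dist y x)\<^sup>2"
      by (rule quad[OF y x])+
    show "x \<in> \<Omega>"
    proof -
      have "?i < 0" using that L by (smt (verit) K_def mult_nonneg_nonneg mult_minus_left zero_le_power2)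
      then have "q y * ?i \<le> ?i" using q[of y] by (simp add: mult_le_cancel_right1)
      then have "h x < 0" using m KL that by linarith
      then show ?thesis using hiff inball[OF y(2) x] by blast
    qed
  next
    fix x y assume y: "y \<in> frontier \<Omega>" "y \<in> ball p \<rho>" and x: "x \<in> ball y \<rho>"
      and that: "K * (dist y x)\<^sup>2 < (x - y) \<bullet> outer_unit_normal \<Omega> y"
    let ?i = "(x - y) \<bullet> outer_unit_normal \<Omega> y"
    have m: "\<bar>h x - q y * ?i\<bar> \<le> L * (dist y x)\<^sup>2" and KL: "L * (dist y x)\<^sup>2 \<le> K * (dist y x)\<^sup>2"
      by (rule quad[OF y x])+
    show "x \<notin> closure \<Omega>"
    proof -
      have "?i > 0" using that L by (smt (verit) K_def mult_nonneg_nonneg zero_le_power2)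
      then have "q y * ?i \<ge> ?i" using q[of y] by (simp add: mult_le_cancel_right1)
      then have "h x > 0" using m KL that by linarith
      then show ?thesis using hout inball[OF y(2) x] by blast
    qed
  next
    fix x y z assume y: "y \<in> frontier \<Omega>" "y \<in> ball p \<rho>" and x: "x \<in> ball y \<rho>" and z: "z \<in> ball y \<rho>"
      and cl: "x \<in> closure \<Omega>" and ne: "x \<noteq> z" and le: "(z - x) \<bullet> outer_unit_normal \<Omega> y \<le> - (1/8) * norm (z - x)"
    have "h x \<le> 0" using hout[OF inball[OF y(2) x]] cl by fastforce
    have "q y * ((z - x) \<bullet> outer_unit_normal \<Omega> y) \<le> (z - x) \<bullet> outer_unit_normal \<Omega> y"
    proof -
      have "(q y - 1) * ((z - x) \<bullet> outer_unit_normal \<Omega> y) \<le> 0"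
        using q[of y] order_trans[OF le, of 0] by (intro mult_nonneg_nonpos) auto
      then show ?thesis by (simp add: algebra_simps)
    qed
    moreover have "L * max (dist y x) (dist y z) * norm (z - x) \<le> L * \<rho> * norm (z - x)"
      using x z L by (intro mult_right_mono mult_left_mono) auto
    moreover have "L * \<rho> * norm (z - x) < (1/8) * norm (z - x)"
      using \<rho>(3) ne by (intro mult_strict_right_mono) auto
    ultimately have "h z < 0" using abs_ge_self[of "h z - h x - q y * ((z - x) \<bullet> chart_normal y \<tau> e \<gamma>)"] main[of z x y] le \<open>h x \<le> 0\<close>
      unfolding nrm[OF y] by linarith
    then show "z \<in> \<Omega>" using hiff inball[OF y(2) z] by blast
  qed
  then show ?thesis by blast
qed

lemma C11_boundary_regular_domain:
  assumes "open \<Omega>" "bounded \<Omega>" "C11_boundary \<Omega>"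
  obtains K r0 where "regular_domain \<Omega> (outer_unit_normal \<Omega>) K r0"
proof -
  let ?\<nu> = "outer_unit_normal \<Omega>"
  define Q where "Q = regular_at \<Omega> ?\<nu>"
  note Q_def = Q_def regular_at_def
  have "\<forall>p\<in>frontier \<Omega>. \<exists>K \<rho>. Q p K \<rho>"
  proof
    fix p assume "p \<in> frontier \<Omega>"
    then obtain r \<tau> e \<gamma> where "C11_chart \<Omega> p r \<tau> e \<gamma>" using assms(3) by (auto simp: C11_boundary_def)
    from C11_chart_regular[OF this] show "\<exists>K \<rho>. Q p K \<rho>" unfolding Q_def(1) .
  qed
  then obtain KK where "\<forall>p\<in>frontier \<Omega>. \<exists>\<rho>. Q p (KK p) \<rho>" by (rule bchoice[THEN exE])
  then obtain RR where "\<forall>p\<in>frontier \<Omega>. Q p (KK p) (RR p)" by (rule bchoice[THEN exE])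
  then have Q: "\<And>p. p \<in> frontier \<Omega> \<Longrightarrow> Q p (KK p) (RR p)" by blast
  have cp: "compact (frontier \<Omega>)" using assms(2) by (simp add: compact_frontier_bounded)
  have "p \<in> ball p (RR p / 2)" if "p \<in> frontier \<Omega>" for p
    using Q[OF that] unfolding Q_def by simp
  then have cov: "frontier \<Omega> \<subseteq> (\<Union>p\<in>frontier \<Omega>. ball p (RR p / 2))" by blast
  have "\<exists>P\<subseteq>frontier \<Omega>. finite P \<and> frontier \<Omega> \<subseteq> (\<Union>p\<in>P. ball p (RR p / 2))"
    by (rule compactE_image[OF cp _ cov]) auto
  then obtain P where P: "P \<subseteq> frontier \<Omega>" "finite P" "frontier \<Omega> \<subseteq> (\<Union>p\<in>P. ball p (RR p / 2))" by blast
  define r0 where "r0 = Min (insert 1 ((\<lambda>p. RR p / 2) ` P))"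
  \<comment> \<open>Unit normals at points that are at least \<open>r0\<close> apart differ by at
    most 2, so the bound 2 / r0 makes the Lipschitz estimate global.\<close>
  define K where "K = Max (insert (2 / r0) (KK ` P))"
  have r0: "r0 > 0" using P Q by (auto simp: r0_def Q_def)
  have rr: "r0 \<le> RR p / 2" if "p \<in> P" for p using that P unfolding r0_def by (intro Min_le) auto
  have kk: "KK p \<le> K" if "p \<in> P" for p using that P unfolding K_def by (intro Max_ge) auto
  have K2: "2 / r0 \<le> K" using P by (auto simp: K_def)
  then have K: "K > 0" using r0 by (smt (verit) divide_pos_pos)
  have kx: "KK p * (dist y x)\<^sup>2 \<le> K * (dist y x)\<^sup>2" if "p \<in> P" for p and x y :: "real^2"
    using kk[OF that] by (intro mult_right_mono) auto
  have near: "\<exists>p\<in>P. y \<in> ball p (RR p / 2)" if "y \<in> frontier \<Omega>" for y using P(3) that by blast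
  have "regular_domain \<Omega> ?\<nu> K r0"
  proof
    show "open \<Omega>" "bounded \<Omega>" "0 < K" "0 < r0" using assms K r0 by auto
  next
    fix y assume y: "y \<in> frontier \<Omega>"
    obtain r \<tau> e \<gamma> where ch: "C11_chart \<Omega> y r \<tau> e \<gamma>" using assms(3) y by (auto simp: C11_boundary_def)
    show "norm (?\<nu> y) = 1" using outer_unit_normal_eq[OF ch y] norm_chart_normal[OF ch] by simp
  next
    fix y y' assume y: "y \<in> frontier \<Omega>" "y' \<in> frontier \<Omega>"
    have n1: "norm (?\<nu> y) = 1" if "y \<in> frontier \<Omega>" for y
      using assms(3) that norm_chart_normal outer_unit_normal_eq unfolding C11_boundary_def by metis
    show "norm (?\<nu> y - ?\<nu> y') \<le> K * dist y y'"
    proof (cases "dist y y' < r0")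
      case True
      obtain p where p: "p \<in> P" "y \<in> ball p (RR p / 2)" using near y by blast
      have "y' \<in> ball p (RR p)" "y \<in> ball p (RR p)"
        using p True rr[OF p(1)] dist_triangle[of p y' y] zero_le_dist[of y y'] r0 by (auto simp: dist_commute)
      then have "norm (?\<nu> y - ?\<nu> y') \<le> KK p * dist y y'" using Q[of p] P p y unfolding Q_def by blast
      also have "\<dots> \<le> K * dist y y'" using kk[OF p(1)] by (intro mult_right_mono) auto
      finally show ?thesis .
    next
      case False
      have "norm (?\<nu> y - ?\<nu> y') \<le> 2" using norm_triangle_ineq4[of "?\<nu> y" "?\<nu> y'"] n1 y by simp
      also have "2 \<le> (2 / r0) * dist y y'" using False r0 by (simp add: field_simps)
      also have "\<dots> \<le> K * dist y y'" using K2 by (intro mult_right_mono) auto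
      finally show ?thesis .
    qed
  next
    fix x y assume y: "y \<in> frontier \<Omega>" and x: "x \<in> ball y r0" and lt: "(x - y) \<bullet> ?\<nu> y < - K * (dist y x)\<^sup>2"
    obtain p where p: "p \<in> P" "y \<in> ball p (RR p / 2)" using near y by blast
    have "y \<in> ball p (RR p)" "x \<in> ball y (RR p)" using p x rr[OF p(1)] r0 by auto
    moreover have "(x - y) \<bullet> ?\<nu> y < - KK p * (dist y x)\<^sup>2" using lt kx[OF p(1), of y x] by simp
    ultimately show "x \<in> \<Omega>" using Q[of p] P p y unfolding Q_def by blast
  next
    fix x y assume y: "y \<in> frontier \<Omega>" and x: "x \<in> ball y r0" and lt: "K * (dist y x)\<^sup>2 < (x - y) \<bullet> ?\<nu> y"
    obtain p where p: "p \<in> P" "y \<in> ball p (RR p / 2)" using near y by blast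
    have "y \<in> ball p (RR p)" "x \<in> ball y (RR p)" using p x rr[OF p(1)] r0 by auto
    moreover have "KK p * (dist y x)\<^sup>2 < (x - y) \<bullet> ?\<nu> y" using lt kx[OF p(1), of y x] by simp
    ultimately show "x \<notin> closure \<Omega>" using Q[of p] P p y unfolding Q_def by blast
  next
    fix x y z assume y: "y \<in> frontier \<Omega>" and x: "x \<in> ball y r0" and z: "z \<in> ball y r0" and cl: "x \<in> closure \<Omega>"
      and ne: "x \<noteq> z" and le: "(z - x) \<bullet> ?\<nu> y \<le> - (1/8) * norm (z - x)"
    obtain p where p: "p \<in> P" "y \<in> ball p (RR p / 2)" using near y by blast
    have "y \<in> ball p (RR p)" "x \<in> ball y (RR p)" "z \<in> ball y (RR p)" using p x z rr[OF p(1)] r0 by auto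
    then show "z \<in> \<Omega>" using Q[of p] P p y cl ne le unfolding Q_def by blast
  qed
  then show thesis by (rule that)
qed

section \<open>Circles, chords and inward steps near the boundary\<close>

context regular_domain
begin

lemma compact_frontier_dom: "compact (frontier \<Omega>)" using bounded_dom by (simp add: compact_frontier_bounded)

lemma frontier_iff: "y \<in> frontier \<Omega> \<longleftrightarrow> y \<in> closure \<Omega> \<and> y \<notin> \<Omega>"
  using open_dom by (simp add: frontier_def interior_open)

text \<open>The parabolas decide every angle with |sin| > K * rho, so a crossing can only happen in
  a short range of angles around 0. There the circle runs almost in the inward direction, and
  \<open>cone\<close> keeps it inside once it has met the closure.\<close>

lemma half_arc:
  assumes y: "y \<in> frontier \<Omega>" and v: "\<nu> y = - v" and t: "norm t = 1" "t \<bullet> v = 0"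
    and \<rho>: "0 < \<rho>" "\<rho> < r0" "K * \<rho> \<le> 1/8"
  defines "X \<theta> \<equiv> y + \<rho> *\<^sub>R (cos \<theta> *\<^sub>R t + sin \<theta> *\<^sub>R v)"
  shows "\<exists>\<theta>p. \<bar>\<theta>p\<bar> \<le> 2 * K * \<rho> \<and> X \<theta>p \<in> frontier \<Omega> \<and> (\<forall>\<theta>\<in>{\<theta>p<..pi/2}. X \<theta> \<in> \<Omega>) \<and>
     (\<forall>\<theta>\<in>{- pi/2..<\<theta>p}. X \<theta> \<notin> closure \<Omega>)"
proof -
  have nv: "norm v = 1" using norm_normal[OF y] v by (simp add: norm_minus_cancel)
  have vv: "v \<bullet> v = 1" "t \<bullet> t = 1" using nv t by (auto simp: norm_eq_1)
  have cX: "continuous_on S X" for S unfolding X_def by (intro continuous_intros)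
  have nX: "dist y (X \<theta>) = \<rho>" for \<theta>
  proof -
    have "(cos \<theta> *\<^sub>R t + sin \<theta> *\<^sub>R v) \<bullet> (cos \<theta> *\<^sub>R t + sin \<theta> *\<^sub>R v) = 1"
      using t vv by (simp add: inner_add inner_commute power2_eq_square[symmetric])
    then show ?thesis using \<rho> by (simp add: X_def dist_norm norm_eq_sqrt_inner)
  qed
  have inn: "(X \<theta> - X \<theta>') \<bullet> \<nu> y = - \<rho> * (sin \<theta> - sin \<theta>')" "(X \<theta> - y) \<bullet> \<nu> y = - \<rho> * sin \<theta>" for \<theta> \<theta>'
    using t vv by (simp_all add: X_def v algebra_simps inner_simps)
  have inb: "X \<theta> \<in> ball y r0" for \<theta> using nX \<rho> by simp
  have up: "X \<theta> \<in> \<Omega>" if "sin \<theta> > K * \<rho>" for \<theta>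
  proof (rule inside[OF y inb])
    show "(X \<theta> - y) \<bullet> \<nu> y < - K * (dist y (X \<theta>))\<^sup>2"
      unfolding inn nX using that \<rho> by (simp add: power2_eq_square)
  qed
  have dn: "X \<theta> \<notin> closure \<Omega>" if "sin \<theta> < - K * \<rho>" for \<theta>
  proof (rule outside[OF y inb])
    have "\<rho> * (K * \<rho>) < \<rho> * (- sin \<theta>)" using that \<rho> by (intro mult_strict_left_mono) auto
    then show "K * (dist y (X \<theta>))\<^sup>2 < (X \<theta> - y) \<bullet> \<nu> y"
      unfolding inn nX by (simp add: power2_eq_square algebra_simps)
  qed
  have p2: "pi / 2 \<ge> 1" using pi_gt3 by simp
  \<comment> \<open>The least angle in this set is the crossing. Everything below it is outside the
    closure by minimality.\<close>
  define S where "S = {-pi/2..pi/2} \<inter> X -` closure \<Omega>"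
  have "closed S" unfolding S_def using cX by (intro continuous_closed_preimage) auto
  moreover have ne: "pi/2 \<in> S"
    using up[of "pi/2"] \<rho> closure_subset[of \<Omega>] by (auto simp: S_def)
  moreover have bb: "bdd_below S" by (auto simp: S_def intro: bdd_belowI)
  ultimately have inS: "Inf S \<in> S" by (intro closed_contains_Inf) auto
  define p where "p = Inf S"
  have p: "p \<in> S" "\<And>\<theta>. \<theta> \<in> S \<Longrightarrow> p \<le> \<theta>" using inS bb by (auto simp: p_def cInf_lower)
  have pr: "-pi/2 \<le> p" "p \<le> pi/2" using p(1) by (auto simp: S_def)
  have s1: "sin p \<ge> - K * \<rho>" using dn[of p] p(1) by (force simp: S_def)
  have pm: "p > - pi/2"
  proof -
    have "sin p > -1" using s1 \<rho> by linarith
    then have "p \<noteq> -pi/2" by auto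
    then show ?thesis using pr by simp
  qed
  have nin: "X p \<notin> \<Omega>"
  proof
    assume "X p \<in> \<Omega>"
    have "open (X -` \<Omega>)" using cX open_dom by (simp add: open_vimage)
    then obtain d where d: "d > 0" "ball p d \<subseteq> X -` \<Omega>" using \<open>X p \<in> \<Omega>\<close> by (meson openE vimageI2)
    define q where "q = max (-pi/2) (p - d/2)"
    have "q < p" "dist p q < d" using pm d(1) by (auto simp: q_def dist_real_def max_def)
    then have "X q \<in> \<Omega>" using d(2) by auto
    then have "q \<in> S" using \<open>q < p\<close> pr closure_subset[of \<Omega>] by (auto simp: S_def) (auto simp: q_def)
    then show False using p(2)[of q] \<open>q < p\<close> by simp
  qed
  have fr: "X p \<in> frontier \<Omega>" using p(1) nin by (simp add: frontier_iff S_def)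
  have s2: "sin p \<le> K * \<rho>" using up[of p] nin by force
  note small = abs_le_2_abs_sin
  have pb: "\<bar>p\<bar> \<le> 2 * K * \<rho>" proof -
    have "\<bar>sin p\<bar> \<le> K * \<rho>" using s1 s2 by (simp add: abs_le_iff)
    moreover have "\<bar>p\<bar> \<le> 2 * \<bar>sin p\<bar>" using pr by (intro small) auto
    ultimately show ?thesis by simp
  qed
  have above: "X \<theta> \<in> \<Omega>" if "\<theta> \<in> {p<..pi/2}" for \<theta>
  proof (cases "sin \<theta> > K * \<rho>")
    case False
    have mono: "sin p \<le> sin \<theta>" using that pr by (intro sin_monotone_2pi_le) auto
    then have "\<bar>sin \<theta>\<bar> \<le> K * \<rho>" using False s1 by auto
    then have t4: "\<bar>\<theta>\<bar> \<le> 1/4" "\<bar>p\<bar> \<le> 1/4" proof -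
      have "\<bar>\<theta>\<bar> \<le> pi/2" using that pr by auto
      from small[OF this] show "\<bar>\<theta>\<bar> \<le> 1/4" using \<open>\<bar>sin \<theta>\<bar> \<le> K * \<rho>\<close> \<rho>(3) by linarith
      show "\<bar>p\<bar> \<le> 1/4" using pb \<rho>(3) by linarith
    qed
    have "p < \<theta>" using that by simp
    have "\<exists>\<xi>. p < \<xi> \<and> \<xi> < \<theta> \<and> sin \<theta> - sin p = (\<theta> - p) * cos \<xi>"
      by (rule MVT2[OF \<open>p < \<theta>\<close>]) (rule DERIV_sin)
    then obtain \<xi> where \<xi>: "p < \<xi>" "\<xi> < \<theta>" "sin \<theta> - sin p = (\<theta> - p) * cos \<xi>" by blast
    have "cos \<xi> \<ge> 1/2"
    proof -
      have "\<bar>\<xi>\<bar> \<le> pi/3" using \<xi> t4 pi_gt3 by auto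
      then have "cos (pi/3) \<le> cos \<bar>\<xi>\<bar>" by (intro cos_monotone_0_pi_le) auto
      then show ?thesis by (simp add: cos_60)
    qed
    then have sl: "sin \<theta> - sin p \<ge> (\<theta> - p) / 2" using \<xi>(3) that mult_left_mono[of "1/2" "cos \<xi>" "\<theta> - p"] by simp
    have nle: "norm (X \<theta> - X p) \<le> 2 * \<rho> * (\<theta> - p)"
    proof -
      have "X \<theta> - X p = \<rho> *\<^sub>R ((cos \<theta> - cos p) *\<^sub>R t + (sin \<theta> - sin p) *\<^sub>R v)" by (simp add: X_def algebra_simps)
      also have "norm \<dots> \<le> \<rho> * (\<bar>cos \<theta> - cos p\<bar> + \<bar>sin \<theta> - sin p\<bar>)"
        using \<rho> nv t norm_triangle_ineq[of "(cos \<theta> - cos p) *\<^sub>R t" "(sin \<theta> - sin p) *\<^sub>R v"] by simp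
      also have "\<bar>sin \<theta> - sin p\<bar> \<le> \<theta> - p"
        using \<xi> mono that by (auto simp: abs_if mult_left_le)
      also have "\<bar>cos \<theta> - cos p\<bar> \<le> \<theta> - p"
      proof -
        have "\<exists>\<zeta>. p < \<zeta> \<and> \<zeta> < \<theta> \<and> cos \<theta> - cos p = (\<theta> - p) * (- sin \<zeta>)"
          by (rule MVT2[OF \<open>p < \<theta>\<close>]) (rule DERIV_cos)
        then obtain \<zeta> where "cos \<theta> - cos p = (\<theta> - p) * (- sin \<zeta>)" by blast
        then show ?thesis using that abs_sin_le_one[of \<zeta>] by (simp add: abs_mult mult_left_le)
      qed
      finally show ?thesis using \<rho> by (simp add: algebra_simps)
    qed
    have "X p \<noteq> X \<theta>"
    proof
      assume "X p = X \<theta>"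
      then have "- \<rho> * (sin \<theta> - sin p) = 0" using inn(1)[of \<theta> p] by simp
      then show False using sl that \<rho> by auto
    qed
    \<comment> \<open>The inward component of the displacement is at least rho * (difference of
      angles) / 2 and its length at most four times as much.\<close>
    moreover have "(X \<theta> - X p) \<bullet> \<nu> y \<le> - (1/8) * norm (X \<theta> - X p)"
    proof -
      have "\<rho> * (sin \<theta> - sin p) \<ge> \<rho> * ((\<theta> - p) / 2)" using sl \<rho> by (intro mult_left_mono) auto
      moreover have "\<rho> * (\<theta> - p) \<ge> 0" using \<rho> \<open>p < \<theta>\<close> by simp
      moreover have "norm (X \<theta> - X p) \<le> 2 * (\<rho> * (\<theta> - p))" using nle by (simp only: mult.assoc)
      moreover have "(X \<theta> - X p) \<bullet> \<nu> y = - (\<rho> * (sin \<theta> - sin p))" unfolding inn by simp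
      moreover have "\<rho> * ((\<theta> - p) / 2) = \<rho> * (\<theta> - p) / 2" by simp
      ultimately show ?thesis by linarith
    qed
    ultimately show ?thesis using cone[OF y inb inb, of p \<theta>] p(1) by (simp add: S_def)
  qed (use up in auto)
  have below: "X \<theta> \<notin> closure \<Omega>" if "\<theta> \<in> {- pi/2..<p}" for \<theta>
    using p(2)[of \<theta>] that pr by (auto simp: S_def)
  show ?thesis using pb fr above below by blast
qed

text \<open>A chord of length d deviates from the boundary by O(K * d^2). Moving from a point of the
  chord by that amount along the normal at one end leads outside, the opposite move leads inside,
  and the boundary is met in between.\<close>

lemma frontier_near_segment:
  assumes y: "y1 \<in> frontier \<Omega>" "y2 \<in> frontier \<Omega>" and z0: "z0 \<in> closed_segment y1 y2"
    and small: "2 * dist y1 y2 < r0" "6 * K * dist y1 y2 \<le> 1"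
  shows "\<exists>z\<in>frontier \<Omega>. dist z z0 \<le> 6 * K * (dist y1 y2)\<^sup>2"
proof (cases "y1 = y2")
  case True then show ?thesis using z0 y by auto
next
  case False
  define d where "d = dist y1 y2"
  have d: "d > 0" using False by (simp add: d_def)
  obtain s where s: "0 \<le> s" "s \<le> 1" "z0 = (1 - s) *\<^sub>R y1 + s *\<^sub>R y2" using z0 by (auto simp: in_segment)
  have z0y: "z0 - y1 = s *\<^sub>R (y2 - y1)" using s by (simp add: algebra_simps)
  have y2i: "\<bar>(y2 - y1) \<bullet> \<nu> y1\<bar> \<le> K * d\<^sup>2"
  proof -
    have "y2 \<in> ball y1 r0" using small(1) zero_le_dist[of y1 y2] unfolding mem_ball by linarith
    then show ?thesis using inside[OF y(1), of y2] outside[OF y(1), of y2] y(2)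
      by (force simp: frontier_iff d_def abs_le_iff)
  qed
  have zi: "\<bar>(z0 - y1) \<bullet> \<nu> y1\<bar> \<le> K * d\<^sup>2"
  proof -
    have "\<bar>(z0 - y1) \<bullet> \<nu> y1\<bar> = s * \<bar>(y2 - y1) \<bullet> \<nu> y1\<bar>" using s unfolding z0y by (simp add: abs_mult)
    also have "\<dots> \<le> 1 * \<bar>(y2 - y1) \<bullet> \<nu> y1\<bar>" using s by (intro mult_right_mono) auto
    finally show ?thesis using y2i by simp
  qed
  \<comment> \<open>The point \<open>z0\<close> itself has a normal component of at most K * d^2,
    and the parabola at distance 2 * d needs 4 * K * d^2; 6 exceeds the sum 5.\<close>
  define h where "h = 6 * K * d\<^sup>2"
  have h: "0 < h" "h \<le> d" using d K small
    by (auto simp: h_def d_def[symmetric] power2_eq_square mult_le_cancel_right1 simp flip: mult.assoc)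
  have nn: "\<nu> y1 \<bullet> \<nu> y1 = 1" "norm (\<nu> y1) = 1" using norm_normal[OF y(1)] by (auto simp: norm_eq_1)
  have dz: "dist y1 (z0 + r *\<^sub>R \<nu> y1) \<le> 2 * d" if "\<bar>r\<bar> = h" for r
  proof -
    have "dist y1 (z0 + r *\<^sub>R \<nu> y1) = norm ((z0 - y1) + r *\<^sub>R \<nu> y1)"
      by (simp add: dist_norm norm_minus_commute algebra_simps)
    also have "\<dots> \<le> norm (z0 - y1) + norm (r *\<^sub>R \<nu> y1)" by (rule norm_triangle_ineq)
    also have "norm (z0 - y1) \<le> d"
      using s unfolding z0y by (simp add: d_def dist_norm norm_minus_commute mult_left_le_one_le)
    finally show ?thesis using that nn h by simp
  qed
  then have sq: "K * (dist y1 (z0 + r *\<^sub>R \<nu> y1))\<^sup>2 \<le> 4 * K * d\<^sup>2" if "\<bar>r\<bar> = h" for r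
    using power_mono[OF dz[OF that], of 2] K by (simp add: power_mult_distrib)
  have Kd: "K * d\<^sup>2 > 0" using K d by simp
  have inb: "z0 + r *\<^sub>R \<nu> y1 \<in> ball y1 r0" if "\<bar>r\<bar> = h" for r
    using dz[OF that] small by (simp add: d_def)
  have ip: "(z0 + r *\<^sub>R \<nu> y1 - y1) \<bullet> \<nu> y1 = (z0 - y1) \<bullet> \<nu> y1 + r" for r
    using nn by (simp add: inner_diff_left inner_add_left)
  have "z0 + (-h) *\<^sub>R \<nu> y1 \<in> \<Omega>"
  proof (rule inside[OF y(1) inb])
    show "(z0 + (-h) *\<^sub>R \<nu> y1 - y1) \<bullet> \<nu> y1 < - K * (dist y1 (z0 + (-h) *\<^sub>R \<nu> y1))\<^sup>2"
      unfolding ip using zi sq[of "-h"] h Kd by (simp add: h_def)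
  qed (use h in auto)
  moreover have "z0 + h *\<^sub>R \<nu> y1 \<notin> closure \<Omega>"
  proof (rule outside[OF y(1) inb])
    show "K * (dist y1 (z0 + h *\<^sub>R \<nu> y1))\<^sup>2 < (z0 + h *\<^sub>R \<nu> y1 - y1) \<bullet> \<nu> y1"
      unfolding ip using zi sq[of h] h Kd by (simp add: h_def)
  qed (use h in auto)
  ultimately have "closed_segment (z0 + (-h) *\<^sub>R \<nu> y1) (z0 + h *\<^sub>R \<nu> y1) \<inter> frontier \<Omega> \<noteq> {}"
    using closure_subset[of \<Omega>] by (intro connected_Int_frontier) (auto simp del: scaleR_minus_left)
  then obtain z where z: "z \<in> closed_segment (z0 + (-h) *\<^sub>R \<nu> y1) (z0 + h *\<^sub>R \<nu> y1)" "z \<in> frontier \<Omega>" by blast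
  have "closed_segment (z0 + (-h) *\<^sub>R \<nu> y1) (z0 + h *\<^sub>R \<nu> y1) \<subseteq> cball z0 h"
    using nn h by (intro closed_segment_subset) (auto simp: dist_norm)
  then show ?thesis using z by (auto simp: h_def d_def dist_commute intro!: bexI[of _ z])
qed

text \<open>Uniformity in the point comes from compactness: counterexamples for step lengths 1/(n+1)
  accumulate somewhere, which contradicts openness at an interior point and \<open>cone\<close> at a
  boundary point.\<close>

lemma inward_step:
  assumes V: "continuous_on (closure \<Omega>) V" and inw: "\<And>y. y \<in> frontier \<Omega> \<Longrightarrow> V y \<bullet> \<nu> y < - (1/8) * norm (V y)"
  shows "\<exists>t>0. \<forall>x\<in>closure \<Omega>. x + t *\<^sub>R V x \<in> \<Omega>"
proof (rule ccontr)
  assume neg: "\<not> ?thesis"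
  have "\<exists>x\<in>closure \<Omega>. x + (1 / real (Suc n)) *\<^sub>R V x \<notin> \<Omega>" for n
    using neg by (metis of_nat_0_less_iff zero_less_Suc zero_less_divide_1_iff)
  then obtain X where X: "\<And>n. X n \<in> closure \<Omega>" "\<And>n. X n + (1 / real (Suc n)) *\<^sub>R V (X n) \<notin> \<Omega>" by metis
  have cc: "compact (closure \<Omega>)" using bounded_dom by (simp add: compact_closure)
  then obtain x s where x: "x \<in> closure \<Omega>" "strict_mono s" "(X \<circ> s) \<longlonglongrightarrow> x"
    using X(1) unfolding compact_def by metis
  have lV: "(\<lambda>n. V (X (s n))) \<longlonglongrightarrow> V x"
    using x X(1) by (intro continuous_on_tendsto_compose[OF V]) (auto simp: o_def)
  have l1: "(\<lambda>n. 1 / real (Suc (s n))) \<longlonglongrightarrow> 0"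
    using LIMSEQ_subseq_LIMSEQ[OF LIMSEQ_Suc[OF lim_1_over_n] x(2)] by (simp add: o_def)
  have l2: "(\<lambda>n. X (s n) + (1 / real (Suc (s n))) *\<^sub>R V (X (s n))) \<longlonglongrightarrow> x + 0 *\<^sub>R V x"
    using x(3) by (intro tendsto_intros l1 lV) (simp add: o_def)
  show False
  proof (cases "x \<in> \<Omega>")
    case True
    then have "\<forall>\<^sub>F n in sequentially. X (s n) + (1 / real (Suc (s n))) *\<^sub>R V (X (s n)) \<in> \<Omega>"
      using topological_tendstoD[OF l2 open_dom] by simp
    then show False using X(2) by simp
  next
    case False
    then have fx: "x \<in> frontier \<Omega>" using x by (simp add: frontier_iff)
    have "(\<lambda>n. V (X (s n)) \<bullet> \<nu> x + (1/8) * norm (V (X (s n)))) \<longlonglongrightarrow> V x \<bullet> \<nu> x + (1/8) * norm (V x)"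
      by (intro tendsto_intros lV)
    then have e1: "\<forall>\<^sub>F n in sequentially. V (X (s n)) \<bullet> \<nu> x + (1/8) * norm (V (X (s n))) < 0"
      using inw[OF fx] by (intro order_tendstoD(2)) auto
    have e2: "\<forall>\<^sub>F n in sequentially. X (s n) \<in> ball x r0"
      using x(3) r0 by (intro topological_tendstoD) (auto simp: o_def)
    have e3: "\<forall>\<^sub>F n in sequentially. X (s n) + (1 / real (Suc (s n))) *\<^sub>R V (X (s n)) \<in> ball x r0"
      using l2 r0 by (intro topological_tendstoD) auto
    from e1 e2 e3 have "\<forall>\<^sub>F n in sequentially. False"
    proof eventually_elim
      case (elim n)
      define z where "z = X (s n) + (1 / real (Suc (s n))) *\<^sub>R V (X (s n))"
      have v: "V (X (s n)) \<noteq> 0" using elim(1) by auto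
      then have ne: "X (s n) \<noteq> z" by (simp add: z_def)
      have "(z - X (s n)) \<bullet> \<nu> x = (1 / real (Suc (s n))) * (V (X (s n)) \<bullet> \<nu> x)" by (simp add: z_def)
      also have "\<dots> \<le> (1 / real (Suc (s n))) * (- (1/8) * norm (V (X (s n))))"
        using elim(1) by (intro mult_left_mono) auto
      also have "\<dots> = - (1/8) * norm (z - X (s n))" by (simp add: z_def)
      finally have "z \<in> \<Omega>" using cone[OF fx elim(2), of z] elim(3) X(1) ne by (simp add: z_def)
      then show False using X(2) by (simp add: z_def)
    qed
    then show False by simp
  qed
qed

end

section \<open>Energy of a field along an arc\<close>

text \<open>Cauchy-Schwarz, by integrating the squared distance of the derivative from its
  mean.\<close>

lemma integral_norm_square_ge:
  fixes u u' :: "real \<Rightarrow> 'a::euclidean_space"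
  assumes "a \<le> b" and der: "\<And>t. t \<in> {a..b} \<Longrightarrow> (u has_vector_derivative u' t) (at t within {a..b})"
    and cont: "continuous_on {a..b} u'"
  shows "(norm (u b - u a))\<^sup>2 \<le> (b - a) * integral {a..b} (\<lambda>t. (norm (u' t))\<^sup>2)"
proof (cases "a = b")
  case False
  then have L: "b - a > 0" using assms by simp
  define d where "d = u b - u a"
  have i0: "(u' has_integral d) {a..b}"
    unfolding d_def by (rule fundamental_theorem_of_calculus[OF \<open>a \<le> b\<close> der])
  have i1: "((\<lambda>t. u' t \<bullet> d) has_integral d \<bullet> d) {a..b}"
    using has_integral_linear[OF i0 bounded_linear_inner_left[of d]] by (simp add: o_def)
  have i2: "((\<lambda>t. (norm (u' t))\<^sup>2) has_integral integral {a..b} (\<lambda>t. (norm (u' t))\<^sup>2)) {a..b}"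
    by (intro integrable_integral integrable_continuous_interval continuous_intros cont)
  have i3: "((\<lambda>t. (norm (u' t))\<^sup>2 - 2 / (b - a) * (u' t \<bullet> d) + (d \<bullet> d) / (b - a)\<^sup>2)
      has_integral (integral {a..b} (\<lambda>t. (norm (u' t))\<^sup>2) - 2 / (b - a) * (d \<bullet> d)
        + (b - a) * ((d \<bullet> d) / (b - a)\<^sup>2))) {a..b}"
    using has_integral_const_real[of "(d \<bullet> d) / (b - a)\<^sup>2" a b] assms(1)
    by (intro has_integral_add has_integral_diff i2 has_integral_mult_right i1) simp
  have "0 \<le> integral {a..b} (\<lambda>t. (norm (u' t))\<^sup>2) - 2 / (b - a) * (d \<bullet> d)
        + (b - a) * ((d \<bullet> d) / (b - a)\<^sup>2)"
  proof (rule has_integral_nonneg[OF i3])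
    fix t
    define k where "k = inverse (b - a)"
    have "(norm (u' t - k *\<^sub>R d))\<^sup>2 = (norm (u' t))\<^sup>2 - 2 * k * (u' t \<bullet> d) + k\<^sup>2 * (d \<bullet> d)"
      unfolding power2_norm_eq_inner
      by (simp add: inner_diff inner_commute power2_eq_square algebra_simps)
    also have "\<dots> = (norm (u' t))\<^sup>2 - 2 / (b - a) * (u' t \<bullet> d) + (d \<bullet> d) / (b - a)\<^sup>2"
      by (simp add: k_def divide_inverse power_inverse mult_ac)
    finally show "0 \<le> (norm (u' t))\<^sup>2 - 2 / (b - a) * (u' t \<bullet> d) + (d \<bullet> d) / (b - a)\<^sup>2"
      by (metis zero_le_power2)
  qed
  moreover have "(b - a) * ((d \<bullet> d) / (b - a)\<^sup>2) = (d \<bullet> d) / (b - a)"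
    using L by (simp add: power2_eq_square)
  ultimately have "(d \<bullet> d) / (b - a) \<le> integral {a..b} (\<lambda>t. (norm (u' t))\<^sup>2)" by simp
  then have "d \<bullet> d \<le> (b - a) * integral {a..b} (\<lambda>t. (norm (u' t))\<^sup>2)"
    using L by (simp add: pos_divide_le_eq mult.commute)
  then show ?thesis by (simp add: d_def power2_norm_eq_inner)
qed (use assms in auto)

text \<open>The positive part makes values of norm above 1 free: the approximating field, unlike
  \<open>m\<close>, need not take values in the unit disk. For norms up to 1 this is the potential
  of the energy.\<close>

definition well :: "real \<Rightarrow> real" where "well t = (max 0 (1 - t\<^sup>2))\<^sup>2"

lemma well_nonneg: "0 \<le> well t" by (simp add: well_def)

lemma continuous_on_well [continuous_intros]: "continuous_on S f \<Longrightarrow> continuous_on S (\<lambda>x. well (f x))"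
  unfolding well_def by (intro continuous_intros)

lemma well_ge: assumes "0 \<le> t" "t \<le> 1" shows "(1 - t)\<^sup>2 \<le> well t"
proof -
  have "t\<^sup>2 \<le> t" using assms by (simp add: power2_eq_square mult_left_le)
  then have "(1 - t)\<^sup>2 \<le> (1 - t\<^sup>2)\<^sup>2" using assms by (intro power_mono) auto
  moreover have "max 0 (1 - t\<^sup>2) = 1 - t\<^sup>2" using \<open>t\<^sup>2 \<le> t\<close> assms by simp
  ultimately show ?thesis by (simp add: well_def)
qed

text \<open>The energy density on a circle of radius rho with the angle as parameter: only the
  tangential derivative is kept, which is \<open>u'\<close> / rho, and the line element is rho times
  that of the angle.\<close>

definition arc_energy :: "real \<Rightarrow> real \<Rightarrow> (real \<Rightarrow> complex) \<Rightarrow> (real \<Rightarrow> complex) \<Rightarrow> real \<Rightarrow> real" where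
  "arc_energy \<rho> \<epsilon> u u' t = (norm (u' t))\<^sup>2 / \<rho> + \<rho> / \<epsilon>\<^sup>2 * well (norm (u t))"

lemma arc_energy_nonneg: "\<rho> > 0 \<Longrightarrow> 0 \<le> arc_energy \<rho> \<epsilon> u u' t"
  by (simp add: arc_energy_def well_nonneg)

lemma continuous_on_arc_energy:
  "\<rho> > 0 \<Longrightarrow> continuous_on S u \<Longrightarrow> continuous_on S u' \<Longrightarrow> continuous_on S (arc_energy \<rho> \<epsilon> u u')"
  unfolding arc_energy_def[abs_def] by (intro continuous_intros) auto

locale C1_arc =
  fixes u u' :: "real \<Rightarrow> complex" and a b \<rho> \<epsilon> :: real
  assumes der: "\<And>t. t \<in> {a..b} \<Longrightarrow> (u has_vector_derivative u' t) (at t within {a..b})"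
    and cont': "continuous_on {a..b} u'"
    and pos: "0 < \<rho>" "0 < \<epsilon>"
begin

lemma cont: "continuous_on {a..b} u"
  using der by (rule continuous_on_vector_derivative)

lemma int: "a \<le> c \<Longrightarrow> d \<le> b \<Longrightarrow> arc_energy \<rho> \<epsilon> u u' integrable_on {c..d}"
  by (intro integrable_continuous_interval continuous_on_arc_energy pos
      continuous_on_subset[OF cont] continuous_on_subset[OF cont']) auto

lemma int_mono: "a \<le> c \<Longrightarrow> d \<le> b \<Longrightarrow>
    integral {c..d} (arc_energy \<rho> \<epsilon> u u') \<le> integral {a..b} (arc_energy \<rho> \<epsilon> u u')"
  by (rule integral_subset_le) (auto intro!: int arc_energy_nonneg pos)

lemma oscillation:
  assumes "s \<in> {a..b}" "t \<in> {a..b}"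
  shows "(norm (u t - u s))\<^sup>2 \<le> \<rho> * \<bar>t - s\<bar> * integral {a..b} (arc_energy \<rho> \<epsilon> u u')"
proof -
  have *: "(norm (u t - u s))\<^sup>2 \<le> \<rho> * \<bar>t - s\<bar> * integral {a..b} (arc_energy \<rho> \<epsilon> u u')"
    if "s \<le> t" "s \<in> {a..b}" "t \<in> {a..b}" for s t
  proof -
    have sub: "{s..t} \<subseteq> {a..b}" using that by auto
    have c: "continuous_on {s..t} u'" using cont' sub continuous_on_subset by blast
    have *: "(norm (u t - u s))\<^sup>2 \<le> (t - s) * integral {s..t} (\<lambda>t. (norm (u' t))\<^sup>2)"
      using that(1) sub c by (intro integral_norm_square_ge has_vector_derivative_within_subset[OF der sub]) auto
    have "integral {s..t} (\<lambda>t. (norm (u' t))\<^sup>2) \<le> integral {s..t} (\<lambda>t. \<rho> * arc_energy \<rho> \<epsilon> u u' t)"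
      using pos that
      by (intro integral_le integrable_continuous_interval continuous_intros c
          continuous_on_arc_energy continuous_on_subset[OF cont sub])
        (auto simp: arc_energy_def well_nonneg field_simps)
    also have "\<dots> = \<rho> * integral {s..t} (arc_energy \<rho> \<epsilon> u u')" by simp
    also have "\<dots> \<le> \<rho> * integral {a..b} (arc_energy \<rho> \<epsilon> u u')"
      using that pos int_mono[of s t] by (intro mult_left_mono) auto
    finally have "(t - s) * integral {s..t} (\<lambda>t. (norm (u' t))\<^sup>2)
        \<le> (t - s) * (\<rho> * integral {a..b} (arc_energy \<rho> \<epsilon> u u'))"
      using that by (intro mult_left_mono) auto
    with * show ?thesis using that by (simp add: mult_ac)
  qed
  show ?thesis
    using *[of s t] *[of t s] assms by (cases "s \<le> t") (auto simp: norm_minus_commute abs_minus_commute)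
qed

text \<open>Let m be the norm of \<open>u\<close> at \<open>t\<close>. On a window of arc length
  epsilon around \<open>t\<close> the norm either stays below (1 + m)/2, and the potential pays, or
  it rises above that value, and the derivative pays; both prices are (1 - m)^2 / (4 *
  epsilon).\<close>

lemma modulus:
  assumes t: "t \<in> {a..b}" and len: "\<epsilon> / \<rho> \<le> b - a"
  shows "(max 0 (1 - norm (u t)))\<^sup>2 \<le> 4 * \<epsilon> * integral {a..b} (arc_energy \<rho> \<epsilon> u u')"
proof (cases "norm (u t) \<ge> 1")
  case True
  have "0 \<le> integral {a..b} (arc_energy \<rho> \<epsilon> u u')"
    using integral_nonneg[OF int[of a b]] pos by (auto simp: arc_energy_nonneg)
  then show ?thesis using True pos by simp
next
  case False
  define m where "m = norm (u t)"
  have m: "0 \<le> m" "m < 1" using False by (auto simp: m_def)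
  define l where "l = \<epsilon> / \<rho>"
  have l: "l > 0" using pos by (simp add: l_def)
  define c where "c = max a (t - l)"
  have c: "a \<le> c" "c \<le> t" "c + l \<le> b \<or> c = t - l" "t \<le> c + l" "t - l \<le> c"
    using t len l by (auto simp: c_def l_def)
  then have cl: "c + l \<le> b" using t by auto
  have tcl: "t \<in> {c..c+l}" using c by auto
  have sub: "{c..c+l} \<subseteq> {a..b}" using c cl by auto
  let ?I = "integral {c..c+l} (arc_energy \<rho> \<epsilon> u u')"
  interpret sub: C1_arc u u' c "c + l" \<rho> \<epsilon>
    using der cont' pos sub
    by unfold_locales (auto intro: has_vector_derivative_within_subset[OF _ sub] continuous_on_subset)
  have "(1 - m)\<^sup>2 \<le> 4 * \<epsilon> * ?I"
  proof (cases "\<forall>s\<in>{c..c+l}. norm (u s) \<le> (1 + m) / 2")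
    case True
    have "((1 - m)/2)\<^sup>2 * \<rho> / \<epsilon>\<^sup>2 \<le> arc_energy \<rho> \<epsilon> u u' s" if "s \<in> {c..c+l}" for s
    proof -
      have n: "norm (u s) \<le> (1 + m) / 2" using True that by blast
      then have "((1 - m)/2)\<^sup>2 \<le> (1 - norm (u s))\<^sup>2" using m by (intro power_mono) (auto simp: field_simps)
      also have "\<dots> \<le> well (norm (u s))" using n m by (intro well_ge) auto
      finally have "\<rho> / \<epsilon>\<^sup>2 * ((1 - m)/2)\<^sup>2 \<le> \<rho> / \<epsilon>\<^sup>2 * well (norm (u s))"
        using pos by (intro mult_left_mono) auto
      also have "\<dots> \<le> arc_energy \<rho> \<epsilon> u u' s" using pos by (simp add: arc_energy_def)
      finally show ?thesis by (simp add: mult_ac)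
    qed
    then have "integral {c..c+l} (\<lambda>s. ((1 - m)/2)\<^sup>2 * \<rho> / \<epsilon>\<^sup>2) \<le> ?I"
      using sub.int by (intro integral_le) auto
    then have "l * (((1 - m)/2)\<^sup>2 * \<rho> / \<epsilon>\<^sup>2) \<le> ?I" using l by (simp add: mult_ac)
    moreover have "l * (((1 - m)/2)\<^sup>2 * \<rho> / \<epsilon>\<^sup>2) = (1 - m)\<^sup>2 / (4 * \<epsilon>)"
      using pos by (simp add: l_def field_simps power2_eq_square)
    ultimately have "(1 - m)\<^sup>2 / (4 * \<epsilon>) \<le> ?I" by simp
    moreover have "(1 - m)\<^sup>2 = 4 * \<epsilon> * ((1 - m)\<^sup>2 / (4 * \<epsilon>))" using pos by simp
    ultimately show ?thesis using pos by (metis mult_left_mono mult_pos_pos less_imp_le zero_less_numeral)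
  next
    case False
    then obtain s where s: "s \<in> {c..c+l}" "norm (u s) > (1 + m) / 2" by auto
    have "(1 - m) / 2 \<le> norm (u s - u t)"
      using s norm_triangle_ineq2[of "u s" "u t"] by (simp add: m_def field_simps)
    then have "((1 - m) / 2)\<^sup>2 \<le> (norm (u s - u t))\<^sup>2" using m by (intro power_mono) auto
    also have "\<dots> \<le> \<rho> * \<bar>s - t\<bar> * ?I" using sub.oscillation[OF tcl s(1)] .
    also have "\<dots> \<le> \<rho> * l * ?I"
    proof (intro mult_right_mono mult_left_mono)
      show "\<bar>s - t\<bar> \<le> l" using s tcl by auto
      show "0 \<le> ?I" using integral_nonneg[OF sub.int] pos by (auto simp: arc_energy_nonneg)
    qed (use pos in auto)
    also have "\<rho> * l = \<epsilon>" using pos by (simp add: l_def)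
    finally show ?thesis by (simp add: power_divide)
  qed
  also have "\<dots> \<le> 4 * \<epsilon> * integral {a..b} (arc_energy \<rho> \<epsilon> u u')"
    using c cl pos by (intro mult_left_mono int_mono) auto
  finally show ?thesis using m by (simp add: m_def)
qed

text \<open>A logarithm of \<open>u\<close> along the arc, so its imaginary part is an angle
  function; it is correct because \<open>u\<close> times the exponential of -\<open>lift\<close> has
  derivative 0.\<close>

definition lift :: "real \<Rightarrow> complex" where
  "lift t = Ln (u a) + integral {a..t} (\<lambda>s. u' s / u s)"

lemma lift:
  assumes nz: "\<And>t. t \<in> {a..b} \<Longrightarrow> u t \<noteq> 0" and "a \<le> b"
  shows "\<And>t. t \<in> {a..b} \<Longrightarrow> (lift has_vector_derivative u' t / u t) (at t within {a..b})"
    and "\<And>t. t \<in> {a..b} \<Longrightarrow> exp (lift t) = u t"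
proof -
  have c: "continuous_on {a..b} (\<lambda>s. u' s / u s)" by (intro continuous_intros cont cont') (use nz in auto)
  show d: "(lift has_vector_derivative u' t / u t) (at t within {a..b})" if "t \<in> {a..b}" for t
    unfolding lift_def[abs_def]
    using integral_has_vector_derivative[OF c that] by (auto intro!: derivative_eq_intros)
  define q where "q t = u t * exp (- lift t)" for t
  have dq: "(q has_vector_derivative 0) (at t within {a..b})" if "t \<in> {a..b}" for t
  proof -
    have "((\<lambda>x. - lift x) has_vector_derivative - (u' t / u t)) (at t within {a..b})"
      using d[OF that] by (rule has_vector_derivative_minus)
    moreover have "(exp has_field_derivative exp (- lift t)) (at (- lift t) within (\<lambda>x. - lift x) ` {a..b})"
      by (auto intro: DERIV_exp has_field_derivative_at_within)
    ultimately have "((\<lambda>x. exp (- lift x)) has_vector_derivative - (u' t / u t) * exp (- lift t)) (at t within {a..b})"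
      using field_vector_diff_chain_within[of "\<lambda>x. - lift x" "- (u' t / u t)" t "{a..b}" exp "exp (- lift t)"]
      by (simp add: o_def)
    from has_vector_derivative_mult[OF der[OF that] this]
    show ?thesis using nz[OF that] by (simp add: q_def[abs_def] field_simps)
  qed
  have qc: "q t = q a" if "t \<in> {a..b}" for t
  proof -
    have "\<exists>c. \<forall>t\<in>{a..b}. q t = c"
      by (rule has_vector_derivative_zero_constant[OF _ dq]) (auto simp: convex_real_interval)
    then show ?thesis using that assms(2) by fastforce
  qed
  have "q a = 1" using nz[of a] assms(2) by (simp add: q_def lift_def exp_minus)
  then show "exp (lift t) = u t" if "t \<in> {a..b}" for t
    using qc[OF that] by (simp add: q_def exp_minus field_simps)
qed

end

text \<open>The left side is A * B / (A + B), the minimum over m of the quadratic m^2 * A + (1 -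
  m)^2 * B.\<close>

lemma harmonic_le:
  fixes A B m :: real assumes "A > 0" "B > 0" "0 \<le> m"
  shows "1 / (1 / A + 1 / B) \<le> m\<^sup>2 * A + (max 0 (1 - m))\<^sup>2 * B"
proof -
  have e: "1 / (1 / A + 1 / B) = A * B / (A + B)" using assms by (simp add: field_simps)
  show ?thesis
  proof (cases "m \<ge> 1")
    case True
    have "A * B / (A + B) \<le> A" using assms by (simp add: field_simps)
    also have "A \<le> m\<^sup>2 * A" using True assms by simp
    finally show ?thesis using e True by simp
  next
    case False
    have "0 \<le> (m * (A + B) - B)\<^sup>2" by simp
    then have "A * B \<le> (m\<^sup>2 * A + (1 - m)\<^sup>2 * B) * (A + B)" by (simp add: power2_eq_square algebra_simps)
    then show ?thesis using e False assms by (simp add: field_simps)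
  qed
qed

context C1_arc
begin

text \<open>Writing \<open>u = r exp (i \<phi>)\<close>, the angular part of the energy is at least \<open>(min r)\<^sup>2\<close> times that of a
  unit field with the same rotation, while the radial part pays for letting \<open>r\<close> drop to \<open>min r\<close>.\<close>

lemma rotation_cost:
  assumes nz: "\<And>t. t \<in> {a..b} \<Longrightarrow> u t \<noteq> 0" and len: "\<epsilon> / \<rho> \<le> b - a"
    and D: "D > 0" "D \<le> \<bar>Im (lift b) - Im (lift a)\<bar>"
  shows "1 / (\<rho> * (b - a) / D\<^sup>2 + 4 * \<epsilon>) \<le> integral {a..b} (arc_energy \<rho> \<epsilon> u u')"
proof -
  have ab: "a < b" using len pos by (smt (verit) divide_pos_pos)
  define r where "r t = norm (u t)" for t
  define r' where "r' t = r t * Re (u' t / u t)" for t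
  define p where "p t = Im (lift t)" for t
  define p' where "p' t = Im (u' t / u t)" for t
  have cp: "continuous_on {a..b} (\<lambda>t. u' t / u t)" by (intro continuous_intros cont cont') (use nz in auto)
  have cp': "continuous_on {a..b} p'" unfolding p'_def by (intro continuous_on_Im cp)
  have cr: "continuous_on {a..b} r" unfolding r_def by (intro continuous_intros cont)
  have cr': "continuous_on {a..b} r'" unfolding r'_def by (intro continuous_intros cr cp)
  have dl: "(lift has_vector_derivative u' t / u t) (at t within {a..b})" if "t \<in> {a..b}" for t
    using lift(1)[OF nz _ that] ab by simp
  have dp: "(p has_vector_derivative p' t) (at t within {a..b})" if "t \<in> {a..b}" for t
    unfolding p_def p'_def by (rule bounded_linear.has_vector_derivative[OF bounded_linear_Im dl[OF that]])
  have re: "r t = exp (Re (lift t))" if "t \<in> {a..b}" for t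
    using lift(2)[OF nz _ that] ab by (metis less_imp_le norm_exp_eq_Re r_def)
  have dr: "((\<lambda>t. complex_of_real (r t)) has_vector_derivative complex_of_real (r' t)) (at t within {a..b})"
    if "t \<in> {a..b}" for t
  proof -
    have "((\<lambda>t. Re (lift t)) has_vector_derivative Re (u' t / u t)) (at t within {a..b})"
      using bounded_linear.has_vector_derivative[OF bounded_linear_Re dl[OF that]] .
    then have "((\<lambda>t. Re (lift t)) has_real_derivative Re (u' t / u t)) (at t within {a..b})"
      unfolding has_real_derivative_iff_has_vector_derivative .
    then have "((\<lambda>t. exp (Re (lift t))) has_real_derivative exp (Re (lift t)) * Re (u' t / u t)) (at t within {a..b})"
      by (rule DERIV_chain'[OF _ DERIV_exp])
    then have "(r has_real_derivative r' t) (at t within {a..b})"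
      using re that unfolding r'_def by (subst has_field_derivative_cong_eventually[where g="\<lambda>t. exp (Re (lift t))"])
        (auto simp: eventually_at_filter)
    then have "(r has_vector_derivative r' t) (at t within {a..b})"
      by (simp add: has_real_derivative_iff_has_vector_derivative)
    then show ?thesis
      by (rule bounded_linear.has_vector_derivative[OF bounded_linear_of_real])
  qed
  \<comment> \<open>Applying \<open>modulus\<close> to the real field |u| charges the drop of the
    norm to the radial part of the energy alone, so the angular part is still available.\<close>
  interpret R: C1_arc "\<lambda>t. complex_of_real (r t)" "\<lambda>t. complex_of_real (r' t)" a b \<rho> \<epsilon>
    using dr pos by unfold_locales (auto intro!: continuous_intros cr')
  obtain t0 where t0: "t0 \<in> {a..b}" "\<And>t. t \<in> {a..b} \<Longrightarrow> r t0 \<le> r t"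
    using continuous_attains_inf[OF _ _ cr] ab by fastforce
  define m where "m = r t0"
  have m: "m \<ge> 0" by (simp add: m_def r_def)
  have split: "arc_energy \<rho> \<epsilon> u u' t = arc_energy \<rho> \<epsilon> (\<lambda>t. complex_of_real (r t)) (\<lambda>t. complex_of_real (r' t)) t
      + (r t)\<^sup>2 * (p' t)\<^sup>2 / \<rho>" if "t \<in> {a..b}" for t
  proof -
    have "norm (u' t) = r t * norm (u' t / u t)" using nz[OF that] by (simp add: r_def norm_divide)
    then have "(norm (u' t))\<^sup>2 = (r t)\<^sup>2 * ((Re (u' t / u t))\<^sup>2 + (Im (u' t / u t))\<^sup>2)"
      by (simp only: power_mult_distrib cmod_power2)
    moreover have "(norm (complex_of_real (r' t)))\<^sup>2 = (r t)\<^sup>2 * (Re (u' t / u t))\<^sup>2"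
      by (simp add: r'_def norm_of_real power_mult_distrib del: of_real_mult)
    ultimately show ?thesis
      by (simp add: arc_energy_def p'_def add_divide_distrib distrib_left) (simp add: r_def)
  qed
  have "(max 0 (1 - m))\<^sup>2 / (4 * \<epsilon>)
      \<le> integral {a..b} (arc_energy \<rho> \<epsilon> (\<lambda>t. complex_of_real (r t)) (\<lambda>t. complex_of_real (r' t)))"
    using R.modulus[OF t0(1) len] pos by (simp add: m_def r_def field_simps)
  moreover have "m\<^sup>2 * (D\<^sup>2 / (\<rho> * (b - a))) \<le> integral {a..b} (\<lambda>t. (r t)\<^sup>2 * (p' t)\<^sup>2 / \<rho>)"
  proof -
    have "D\<^sup>2 \<le> \<bar>p b - p a\<bar>\<^sup>2" using D by (intro power_mono) (auto simp: p_def)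
    also have "\<dots> \<le> (b - a) * integral {a..b} (\<lambda>t. (norm (p' t))\<^sup>2)"
      using integral_norm_square_ge[of a b p p'] dp cp' ab by simp
    finally have "D\<^sup>2 / (b - a) \<le> integral {a..b} (\<lambda>t. (p' t)\<^sup>2)" using ab by (simp add: field_simps)
    then have "m\<^sup>2 / \<rho> * (D\<^sup>2 / (b - a)) \<le> m\<^sup>2 / \<rho> * integral {a..b} (\<lambda>t. (p' t)\<^sup>2)"
      using pos by (intro mult_left_mono) auto
    also have "\<dots> = integral {a..b} (\<lambda>t. m\<^sup>2 / \<rho> * (p' t)\<^sup>2)" by simp
    also have "\<dots> \<le> integral {a..b} (\<lambda>t. (r t)\<^sup>2 * (p' t)\<^sup>2 / \<rho>)"
    proof (rule integral_le)
      fix t assume "t \<in> {a..b}"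
      then have "m\<^sup>2 \<le> (r t)\<^sup>2" using t0(2) m by (intro power_mono) (auto simp: m_def)
      then have "m\<^sup>2 * ((p' t)\<^sup>2 / \<rho>) \<le> (r t)\<^sup>2 * ((p' t)\<^sup>2 / \<rho>)" using pos by (intro mult_right_mono) auto
      then show "m\<^sup>2 / \<rho> * (p' t)\<^sup>2 \<le> (r t)\<^sup>2 * (p' t)\<^sup>2 / \<rho>" by simp
    qed (intro integrable_continuous_interval continuous_intros cp' cr; use pos in simp)+
    finally show ?thesis by (simp add: field_simps)
  qed
  moreover have "integral {a..b} (arc_energy \<rho> \<epsilon> u u')
      = integral {a..b} (arc_energy \<rho> \<epsilon> (\<lambda>t. complex_of_real (r t)) (\<lambda>t. complex_of_real (r' t)))
        + integral {a..b} (\<lambda>t. (r t)\<^sup>2 * (p' t)\<^sup>2 / \<rho>)"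
  proof -
    have "integral {a..b} (arc_energy \<rho> \<epsilon> u u')
      = integral {a..b} (\<lambda>t. arc_energy \<rho> \<epsilon> (\<lambda>t. complex_of_real (r t)) (\<lambda>t. complex_of_real (r' t)) t
        + (r t)\<^sup>2 * (p' t)\<^sup>2 / \<rho>)"
      by (rule integral_cong) (rule split)
    also have "\<dots> = integral {a..b} (arc_energy \<rho> \<epsilon> (\<lambda>t. complex_of_real (r t)) (\<lambda>t. complex_of_real (r' t)))
        + integral {a..b} (\<lambda>t. (r t)\<^sup>2 * (p' t)\<^sup>2 / \<rho>)"
      by (intro integral_add R.int integrable_continuous_interval continuous_intros cp' cr) (use pos in auto)
    finally show ?thesis .
  qed
  moreover have "1 / (1 / (D\<^sup>2 / (\<rho> * (b - a))) + 1 / (1 / (4 * \<epsilon>)))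
      \<le> m\<^sup>2 * (D\<^sup>2 / (\<rho> * (b - a))) + (max 0 (1 - m))\<^sup>2 * (1 / (4 * \<epsilon>))"
    using D ab pos m by (intro harmonic_le) auto
  ultimately show ?thesis by (simp add: mult.commute)
qed

end

section \<open>Fields without zeros on a ball\<close>

text \<open>Since \<open>T\<close> is compact, \<open>X\<close> is a closed map onto its image, that
  is, a quotient map. This turns functions of the angle into functions on a circle or an
  arc.\<close>

lemma continuous_on_factor:
  fixes X :: "'a::metric_space \<Rightarrow> 'b::metric_space" and \<phi> :: "'a \<Rightarrow> 'c::metric_space"
  assumes T: "compact T" and X: "continuous_on T X" and \<phi>: "continuous_on T \<phi>"
    and g: "\<And>t. t \<in> T \<Longrightarrow> g (X t) = \<phi> t"
  shows "continuous_on (X ` T) g"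
proof -
  have "closed (X ` T \<inter> g -` B)" if "closed B" for B
  proof -
    have "X ` T \<inter> g -` B = X ` (T \<inter> \<phi> -` B)" using g by auto
    moreover have "compact (T \<inter> \<phi> -` B)"
    proof -
      have "closed (T \<inter> \<phi> -` B)"
        using continuous_closed_preimage[OF \<phi> compact_imp_closed[OF T] that] by (simp add: Int_commute)
      then show ?thesis using T by (metis compact_Int_closed Int_assoc Int_absorb inf_commute)
    qed
    ultimately show ?thesis
      using X by (metis compact_continuous_image compact_imp_closed continuous_on_subset inf_le1)
  qed
  then show ?thesis unfolding continuous_on_closed_vimage[OF compact_imp_closed[OF compact_continuous_image[OF X T]]]
    by (simp add: Int_commute)
qed

context regular_domain
begin

text \<open>The sign \<open>s\<close> says on which side of the tangent the field \<open>F\<close> may lie far away; for \<open>n = 0\<close> there is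
  no such side. A ball that does not meet the frontier has \<open>cert f 1\<close> only if it has \<open>cert f 0\<close>.\<close>

definition filling :: "(real^2 \<Rightarrow> real^2) \<Rightarrow> nat \<Rightarrow> real^2 \<Rightarrow> real \<Rightarrow> (real^2 \<Rightarrow> real^2) \<Rightarrow> real \<Rightarrow> bool" where
  "filling f n c \<rho> F s \<longleftrightarrow> (s = 1 \<or> s = -1) \<and>
     continuous_on (cball c \<rho> \<inter> closure \<Omega>) F \<and>
     (\<forall>x\<in>cball c \<rho> \<inter> closure \<Omega>. F x \<noteq> 0) \<and> (\<forall>x\<in>sphere c \<rho> \<inter> closure \<Omega>. F x = f x) \<and>
     (\<forall>x\<in>cball c \<rho> \<inter> frontier \<Omega>. s * (F x \<bullet> \<nu> x) \<le> (1/2) * norm (F x) \<and>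
        (n = 0 \<longrightarrow> \<bar>F x \<bullet> \<nu> x\<bar> \<le> (1/2) * norm (F x)))"

definition cert :: "(real^2 \<Rightarrow> real^2) \<Rightarrow> nat \<Rightarrow> real^2 \<Rightarrow> real \<Rightarrow> bool" where
  "cert f n c \<rho> \<longleftrightarrow> 2 \<le> n \<or> (\<exists>F s. filling f n c \<rho> F s)"

lemma filling_mono: "filling f n c \<rho> F s \<Longrightarrow> n \<le> n' \<Longrightarrow> filling f n' c \<rho> F s"
  unfolding filling_def by simp

lemma cert_mono: "cert f n c \<rho> \<Longrightarrow> n \<le> n' \<Longrightarrow> cert f n' c \<rho>"
  unfolding cert_def using filling_mono order_trans by blast

lemma cert_2: "2 \<le> n \<Longrightarrow> cert f n c \<rho>" by (simp add: cert_def)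

lemma frontier_subset_closure: "frontier \<Omega> \<subseteq> closure \<Omega>" by (simp add: frontier_def)

text \<open>The fillings of the small balls agree with \<open>f\<close> on their spheres, so
  together with \<open>f\<close> they form one continuous field. If the labels sum up to at most 1,
  at most one small ball imposes a side of the tangent, and its sign serves for the whole
  ball.\<close>

lemma cert_glue:
  fixes ctr :: "'l \<Rightarrow> real^2" and rad :: "'l \<Rightarrow> real" and lab :: "'l \<Rightarrow> nat"
  assumes L: "finite L" and f: "continuous_on (closure \<Omega>) f"
    and nz: "\<And>x. x \<in> cball c \<rho> \<Longrightarrow> x \<in> closure \<Omega> \<Longrightarrow> (\<And>l. l \<in> L \<Longrightarrow> x \<notin> ball (ctr l) (rad l)) \<Longrightarrow> f x \<noteq> 0"
    and tg: "\<And>x. x \<in> cball c \<rho> \<Longrightarrow> x \<in> frontier \<Omega> \<Longrightarrow> (\<And>l. l \<in> L \<Longrightarrow> x \<notin> ball (ctr l) (rad l)) \<Longrightarrow>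
        \<bar>f x \<bullet> \<nu> x\<bar> \<le> (1/2) * norm (f x)"
    and sub: "\<And>l. l \<in> L \<Longrightarrow> cball (ctr l) (rad l) \<subseteq> ball c \<rho>"
    and dis: "\<And>l l'. l \<in> L \<Longrightarrow> l' \<in> L \<Longrightarrow> l \<noteq> l' \<Longrightarrow> cball (ctr l) (rad l) \<inter> cball (ctr l') (rad l') = {}"
    and cert: "\<And>l. l \<in> L \<Longrightarrow> cert f (lab l) (ctr l) (rad l)"
    and sum: "(\<Sum>l\<in>L. lab l) \<le> n"
  shows "cert f n c \<rho>"
proof (cases "2 \<le> n")
  case False
  have lab: "lab l \<le> n" if "l \<in> L" for l using member_le_sum[OF that, of lab] sum L by force
  then have "\<forall>l\<in>L. \<exists>F s. filling f (lab l) (ctr l) (rad l) F s"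
    using cert False unfolding cert_def by (meson order_trans)
  then obtain G where "\<forall>l\<in>L. \<exists>s. filling f (lab l) (ctr l) (rad l) (G l) s" by (rule bchoice[THEN exE])
  then obtain S where GS': "\<forall>l\<in>L. filling f (lab l) (ctr l) (rad l) (G l) (S l)" by (rule bchoice[THEN exE])
  note GS = GS'[unfolded filling_def]
  define F where "F x = (if \<exists>l\<in>L. x \<in> cball (ctr l) (rad l) then G (SOME l. l \<in> L \<and> x \<in> cball (ctr l) (rad l)) x else f x)" for x
  have FG: "F x = G l x" if "l \<in> L" "x \<in> cball (ctr l) (rad l)" for x l
  proof -
    have "(SOME l. l \<in> L \<and> x \<in> cball (ctr l) (rad l)) = l"
      by (rule some_equality) (use that dis in blast)+
    then show ?thesis using that by (auto simp: F_def)
  qed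
  have Ff: "F x = f x" if x: "x \<in> closure \<Omega>" "\<And>l. l \<in> L \<Longrightarrow> x \<notin> ball (ctr l) (rad l)" for x
  proof (cases "\<exists>l\<in>L. x \<in> cball (ctr l) (rad l)")
    case True
    then obtain l where l: "l \<in> L" "x \<in> cball (ctr l) (rad l)" by blast
    then have "x \<in> sphere (ctr l) (rad l)" using x(2)[OF l(1)] by auto
    then show ?thesis using FG[OF l] GS l x(1) by auto
  qed (simp add: F_def)
  define U0 where "U0 = (cball c \<rho> \<inter> closure \<Omega>) - (\<Union>l\<in>L. ball (ctr l) (rad l))"
  have D: "cball c \<rho> \<inter> closure \<Omega> = U0 \<union> (\<Union>l\<in>L. cball (ctr l) (rad l) \<inter> closure \<Omega>)"
  proof -
    have "x \<in> cball c \<rho>" if "l \<in> L" "x \<in> cball (ctr l) (rad l)" for x l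
      using sub[OF that(1)] that(2) ball_subset_cball by blast
    then show ?thesis using ball_subset_cball unfolding U0_def by fast
  qed
  have "continuous_on (U0 \<union> (\<Union>l\<in>L. cball (ctr l) (rad l) \<inter> closure \<Omega>)) F"
  proof (rule continuous_on_closed_Un)
    show "closed U0" unfolding U0_def by (intro closed_Diff closed_Int open_UN) auto
    show "closed (\<Union>l\<in>L. cball (ctr l) (rad l) \<inter> closure \<Omega>)" using L by (intro closed_UN) auto
    have "continuous_on U0 f" using f by (rule continuous_on_subset) (auto simp: U0_def)
    then show "continuous_on U0 F"
      by (rule continuous_on_cong[THEN iffD1, rotated -1]) (auto simp: U0_def intro!: Ff[symmetric])
    show "continuous_on (\<Union>l\<in>L. cball (ctr l) (rad l) \<inter> closure \<Omega>) F"
    proof (rule continuous_on_closed_Union[OF L])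
      fix l assume l: "l \<in> L"
      then have "continuous_on (cball (ctr l) (rad l) \<inter> closure \<Omega>) (G l)" using GS by blast
      then show "continuous_on (cball (ctr l) (rad l) \<inter> closure \<Omega>) F"
        by (rule continuous_on_cong[THEN iffD1, rotated -1]) (use FG[OF l] in auto)
    qed auto
  qed
  then have contF: "continuous_on (cball c \<rho> \<inter> closure \<Omega>) F" by (simp add: D)
  have nzF: "F x \<noteq> 0" if x: "x \<in> cball c \<rho> \<inter> closure \<Omega>" for x
  proof (cases "\<exists>l\<in>L. x \<in> ball (ctr l) (rad l)")
    case True
    then obtain l where "l \<in> L" "x \<in> cball (ctr l) (rad l)" by force
    then show ?thesis using FG GS x by auto
  next
    case False
    then show ?thesis using nz[of x] Ff[of x] x by auto
  qed
  have sp: "F x = f x" if "x \<in> sphere c \<rho> \<inter> closure \<Omega>" for x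
    using that sub ball_subset_cball[of "ctr _" "rad _"] by (intro Ff) (fastforce simp: subset_iff)+
  \<comment> \<open>All points that do not belong to the one ball with a nonzero label satisfy the
    two-sided bound, which fits either sign.\<close>
  have "\<exists>s. (s = 1 \<or> s = -1) \<and> (\<forall>l\<in>L. lab l \<noteq> 0 \<longrightarrow> S l = s) \<and> (n = 0 \<longrightarrow> (\<forall>l\<in>L. lab l = 0))"
  proof (cases "\<exists>l\<in>L. lab l \<noteq> 0")
    case True
    then obtain l where l: "l \<in> L" "lab l \<noteq> 0" by blast
    have "lab l' = 0" if "l' \<in> L" "l' \<noteq> l" for l'
    proof -
      have "lab l + lab l' = (\<Sum>l\<in>{l,l'}. lab l)" using that by simp
      also have "\<dots> \<le> (\<Sum>l\<in>L. lab l)" using that l L by (intro sum_mono2) auto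
      finally show ?thesis using l sum False by simp
    qed
    moreover have "S l = 1 \<or> S l = -1" using GS l(1) by blast
    moreover have "n \<noteq> 0" using l lab[OF l(1)] by simp
    ultimately show ?thesis using l by (intro exI[of _ "S l"]) metis
  qed auto
  then obtain s where s: "s = 1 \<or> s = (-1::real)" "\<And>l. l \<in> L \<Longrightarrow> lab l \<noteq> 0 \<Longrightarrow> S l = s"
    "\<And>l. n = 0 \<Longrightarrow> l \<in> L \<Longrightarrow> lab l = 0" by blast
  have ab: "s * r \<le> q" if "\<bar>r\<bar> \<le> q" for r q :: real using that s(1) by auto
  have "s * (F x \<bullet> \<nu> x) \<le> (1/2) * norm (F x) \<and> (n = 0 \<longrightarrow> \<bar>F x \<bullet> \<nu> x\<bar> \<le> (1/2) * norm (F x))"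
    if x: "x \<in> cball c \<rho> \<inter> frontier \<Omega>" for x
  proof (cases "\<exists>l\<in>L. x \<in> ball (ctr l) (rad l)")
    case True
    then obtain l where l: "l \<in> L" "x \<in> cball (ctr l) (rad l)" by force
    then have *: "S l * (G l x \<bullet> \<nu> x) \<le> (1/2) * norm (G l x)" "lab l = 0 \<Longrightarrow> \<bar>G l x \<bullet> \<nu> x\<bar> \<le> (1/2) * norm (G l x)"
      using GS x by blast+
    show ?thesis
    proof (cases "lab l = 0")
      case True
      then show ?thesis unfolding FG[OF l] using *(2) ab by blast
    next
      case False
      then show ?thesis using * FG[OF l] s l by auto
    qed
  next
    case False
    then have "F x = f x" using Ff[of x] x frontier_subset_closure by blast
    moreover have "\<bar>f x \<bullet> \<nu> x\<bar> \<le> (1/2) * norm (f x)" using tg[of x] x False by blast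
    ultimately show ?thesis using ab by metis
  qed
  then have "filling f n c \<rho> F s" unfolding filling_def using contF nzF sp s(1) by blast
  then show ?thesis unfolding cert_def by blast
qed (simp add: cert_2)

lemma normal_extension:
  obtains N :: "real^2 \<Rightarrow> real^2" where "continuous_on UNIV N" "\<And>x. norm (N x) \<le> 1" "\<And>y. y \<in> frontier \<Omega> \<Longrightarrow> N y = \<nu> y"
proof -
  have lip: "K-lipschitz_on (frontier \<Omega>) \<nu>"
    using lipschitz_normal K by (auto simp: lipschitz_on_def dist_norm)
  have "continuous_on (frontier \<Omega>) \<nu>" by (rule lipschitz_on_continuous_on[OF lip])
  then obtain N where "continuous_on UNIV N" "N ` UNIV \<subseteq> cball 0 1" "\<And>x. x \<in> frontier \<Omega> \<Longrightarrow> N x = \<nu> x"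
    by (rule Dugundji[of "cball (0::real^2) 1" UNIV "frontier \<Omega>" \<nu>, rotated 3]) (auto simp: norm_normal)
  then show thesis by (intro that[of N]) (auto simp: image_subset_iff)
qed

text \<open>A small step along \<open>V\<close> maps the closure into \<open>\<Omega>\<close>.
  Carried over to the open unit disk by the Riemann mapping theorem, its image is compact and so
  lies in a smaller closed disk, which is mapped to itself; Brouwer's fixed point is a zero of
  \<open>V\<close>.\<close>

lemma no_inward_field:
  assumes "simply_connected \<Omega>" "\<Omega> \<noteq> {}"
    and V: "continuous_on (closure \<Omega>) V" and inw: "\<And>y. y \<in> frontier \<Omega> \<Longrightarrow> V y \<bullet> \<nu> y < - (1/8) * norm (V y)"
    and nz: "\<And>x. x \<in> \<Omega> \<Longrightarrow> V x \<noteq> 0"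
  shows False
proof -
  obtain t where t: "t > 0" "\<And>x. x \<in> closure \<Omega> \<Longrightarrow> x + t *\<^sub>R V x \<in> \<Omega>" using inward_step[OF V inw] by blast
  define g where "g x = x + t *\<^sub>R V x" for x
  have contg: "continuous_on (closure \<Omega>) g" unfolding g_def by (intro continuous_intros V)
  define S where "S = cx ` \<Omega>"
  have hom: "homeomorphism \<Omega> S cx rv"
    by (auto simp: homeomorphism_def S_def image_image intro!: continuous_intros continuous_on_rv continuous_on_cx)
  have oS: "open S"
  proof -
    have "S = rv -` \<Omega>" by (auto simp: S_def) (metis cx_rv image_eqI)
    then show ?thesis using open_dom by (auto intro!: open_vimage continuous_intros)
  qed
  have "simply_connected S"
    using hom assms(1) homeomorphic_simply_connected_eq homeomorphic_def by blast
  then have "S homeomorphic ball (0::complex) 1"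
    using simply_connected_eq_homeomorphic_to_disc[OF oS] assms(2) by (auto simp: S_def)
  then obtain h k where hk: "homeomorphism S (ball (0::complex) 1) h k" by (auto simp: homeomorphic_def)
  have ch: "continuous_on S h" and ck: "continuous_on (ball 0 1) k" and hkz: "\<And>z. z \<in> ball 0 1 \<Longrightarrow> h (k z) = z"
    and khz: "\<And>x. x \<in> S \<Longrightarrow> k (h x) = x" and kim: "k ` ball 0 1 = S" and him: "h ` S = ball 0 1"
    using hk by (auto simp: homeomorphism_def)
  define Q where "Q = h ` cx ` g ` closure \<Omega>"
  have gS: "cx ` g ` closure \<Omega> \<subseteq> S" using t(2) by (auto simp: S_def g_def)
  have cQ: "compact Q" unfolding Q_def
    using bounded_dom contg ch gS
    by (intro compact_continuous_image[OF continuous_on_subset[OF ch gS]] compact_continuous_image[OF continuous_on_cx[OF continuous_on_id]]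
       compact_continuous_image[OF contg]) (simp add: compact_closure)
  have Qb: "Q \<subseteq> ball 0 1" using gS him by (auto simp: Q_def)
  have "Q \<noteq> {}" using assms(2) by (auto simp: Q_def)
  then obtain q where q: "q \<in> Q" "\<And>z. z \<in> Q \<Longrightarrow> norm z \<le> norm q"
    using continuous_attains_sup[OF cQ, of norm] by (auto intro: continuous_intros)
  define r where "r = norm q"
  have r: "r < 1" "0 \<le> r" using q(1) Qb by (auto simp: r_def)
  define p where "p z = h (cx (g (rv (k z))))" for z
  have sub: "cball 0 r \<subseteq> ball (0::complex) 1" using r by auto
  have kin: "rv (k z) \<in> \<Omega>" if "z \<in> ball 0 1" for z
    using kim that by (force simp: S_def)
  have "continuous_on (cball 0 r) p"
    unfolding p_def
  proof (rule continuous_on_compose2[OF ch])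
    have "continuous_on (cball 0 r) (\<lambda>z. rv (k z))"
      by (intro continuous_on_rv continuous_on_subset[OF ck sub])
    then have "continuous_on (cball 0 r) (\<lambda>z. g (rv (k z)))"
      by (rule continuous_on_compose2[OF contg]) (use kin sub closure_subset in blast)
    then show "continuous_on (cball 0 r) (\<lambda>z. cx (g (rv (k z))))" by (rule continuous_on_cx)
    show "(\<lambda>z. cx (g (rv (k z)))) ` cball 0 r \<subseteq> S" using gS kin sub closure_subset by blast
  qed
  moreover have "p \<in> cball 0 r \<rightarrow> cball 0 r"
  proof
    fix z :: complex assume "z \<in> cball 0 r"
    then have "p z \<in> Q" unfolding Q_def p_def using kin sub closure_subset by blast
    then show "p z \<in> cball 0 r" using q(2) by (simp add: r_def)
  qed
  ultimately obtain z where z: "z \<in> cball 0 r" "p z = z"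
    using brouwer[of "cball (0::complex) r" p] r by auto
  define x where "x = rv (k z)"
  have zb: "z \<in> ball 0 1" using z sub by blast
  have x: "x \<in> \<Omega>" using kin zb by (simp add: x_def)
  have "cx (g x) \<in> S" using gS x closure_subset by blast
  then have "k (p z) = cx (g x)" using khz by (simp add: p_def x_def)
  then have "cx (g x) = cx x" using z by (simp add: x_def)
  then have "g x = x" by (metis rv_cx)
  then show False using nz[OF x] t(1) by (simp add: g_def)
qed

text \<open>On a ball that contains the whole closure the sphere imposes nothing, so a certificate
  is a field on all of \<open>\<Omega>\<close> that, up to sign, hardly points outwards. It can be
  tilted to point inwards.\<close>

lemma no_global_cert:
  assumes "simply_connected \<Omega>" "\<Omega> \<noteq> {}" and sub: "closure \<Omega> \<subseteq> ball c \<rho>" and n: "n \<le> 1"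
  shows "\<not> cert f n c \<rho>"
proof
  assume "cert f n c \<rho>"
  then obtain F s where s: "s = 1 \<or> s = (-1::real)" and F: "continuous_on (closure \<Omega>) F"
    and nz: "\<And>x. x \<in> closure \<Omega> \<Longrightarrow> F x \<noteq> 0" and tg: "\<And>x. x \<in> frontier \<Omega> \<Longrightarrow> s * (F x \<bullet> \<nu> x) \<le> (1/2) * norm (F x)"
  proof -
    have "cball c \<rho> \<inter> closure \<Omega> = closure \<Omega>" "cball c \<rho> \<inter> frontier \<Omega> = frontier \<Omega>"
      using sub ball_subset_cball frontier_subset_closure by blast+
    moreover have "\<not> 2 \<le> n" using n by simp
    ultimately show ?thesis using \<open>cert f n c \<rho>\<close> that unfolding cert_def filling_def by metis
  qed
  obtain N where N: "continuous_on UNIV N" "\<And>x. norm (N x) \<le> 1" "\<And>y. y \<in> frontier \<Omega> \<Longrightarrow> N y = \<nu> y"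
    using normal_extension by blast
  \<comment> \<open>The weight 3/4 lies below 1, which keeps \<open>V\<close> free of zeros, and
    beats the tolerance 1/2: the normal component becomes at most -1/4 of |F|, while |V| is at most
    7/4 of |F|, and 1/4 > 7/32.\<close>
  define V where "V x = s *\<^sub>R F x - (3/4 * norm (F x)) *\<^sub>R N x" for x
  have ns: "norm (s *\<^sub>R F x) = norm (F x)" for x using s by auto
  have nN: "norm ((3/4 * norm (F x)) *\<^sub>R N x) \<le> 3/4 * norm (F x)" for x
    using mult_left_mono[OF N(2)[of x], of "3/4 * norm (F x)"] by simp
  show False
  proof (rule no_inward_field[OF assms(1,2)])
    show "continuous_on (closure \<Omega>) V"
      unfolding V_def by (intro continuous_intros F continuous_on_subset[OF N(1)]) auto
    show "V x \<noteq> 0" if "x \<in> \<Omega>" for x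
    proof -
      have "norm (F x) > 0" using nz that closure_subset by auto
      moreover have "norm (V x) \<ge> norm (F x) - 3/4 * norm (F x)"
        using norm_triangle_ineq2[of "s *\<^sub>R F x" "(3/4 * norm (F x)) *\<^sub>R N x"] nN[of x] ns[of x] unfolding V_def by linarith
      ultimately show ?thesis by auto
    qed
    show "V y \<bullet> \<nu> y < - (1/8) * norm (V y)" if y: "y \<in> frontier \<Omega>" for y
    proof -
      have "norm (F y) > 0" using nz y frontier_subset_closure by auto
      have "\<nu> y \<bullet> \<nu> y = 1" using norm_normal[OF y] by (simp add: norm_eq_1)
      then have "V y \<bullet> \<nu> y = s * (F y \<bullet> \<nu> y) - 3/4 * norm (F y)"
        by (simp add: V_def inner_diff_left N(3)[OF y])
      also have "\<dots> \<le> - (1/4) * norm (F y)" using tg[OF y] by simp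
      finally have "V y \<bullet> \<nu> y \<le> - (1/4) * norm (F y)" .
      moreover have "norm (V y) \<le> 7/4 * norm (F y)"
        using norm_triangle_ineq4[of "s *\<^sub>R F y" "(3/4 * norm (F y)) *\<^sub>R N y"] nN[of y] ns[of y] unfolding V_def by linarith
      ultimately show ?thesis using \<open>norm (F y) > 0\<close> by linarith
    qed
  qed
qed

text \<open>A field written as modulus times \<open>cis\<close> of an angle cannot vanish, so it
  suffices to extend the logarithm of the modulus and the angle, which Tietze's theorem does. The
  angle is prescribed on the circle, by \<open>\<phi>\<close>, and on the boundary of the domain, by
  \<open>g0\<close>; the extension inside is arbitrary.\<close>

lemma cert_fill:
  assumes n: "n \<le> 1" and f: "continuous_on (closure \<Omega>) f" and ab: "a \<le> b"
    and C: "sphere c \<rho> \<inter> closure \<Omega> = circ c \<rho> ` {a..b}"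
    and phi: "continuous_on {a..b} \<phi>" and nz: "\<And>x. x \<in> sphere c \<rho> \<inter> closure \<Omega> \<Longrightarrow> f x \<noteq> 0"
    and arg: "\<And>\<theta>. \<theta> \<in> {a..b} \<Longrightarrow> cx (f (circ c \<rho> \<theta>)) = norm (f (circ c \<rho> \<theta>)) * cis (\<phi> \<theta>)"
    and cons: "\<And>\<theta> \<theta>'. \<theta> \<in> {a..b} \<Longrightarrow> \<theta>' \<in> {a..b} \<Longrightarrow> circ c \<rho> \<theta> = circ c \<rho> \<theta>' \<Longrightarrow> \<phi> \<theta> = \<phi> \<theta>'"
    and g0: "continuous_on (cball c \<rho> \<inter> frontier \<Omega>) g0"
    and cons0: "\<And>\<theta>. \<theta> \<in> {a..b} \<Longrightarrow> circ c \<rho> \<theta> \<in> frontier \<Omega> \<Longrightarrow> g0 (circ c \<rho> \<theta>) = \<phi> \<theta>"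
    and s: "s = 1 \<or> s = (-1::real)"
    and bd: "\<And>x. x \<in> cball c \<rho> \<inter> frontier \<Omega> \<Longrightarrow> s * Re (cis (g0 x) * cnj (cx (\<nu> x))) \<le> 1/2"
    and bd0: "\<And>x. n = 0 \<Longrightarrow> x \<in> cball c \<rho> \<inter> frontier \<Omega> \<Longrightarrow> \<bar>Re (cis (g0 x) * cnj (cx (\<nu> x)))\<bar> \<le> 1/2"
  shows "cert f n c \<rho>"
proof -
  let ?C = "sphere c \<rho> \<inter> closure \<Omega>" and ?B = "cball c \<rho> \<inter> frontier \<Omega>"
  define g1 where "g1 x = (if x \<in> ?C then \<phi> (SOME \<theta>. \<theta> \<in> {a..b} \<and> circ c \<rho> \<theta> = x) else g0 x)" for x
  have g1: "g1 (circ c \<rho> \<theta>) = \<phi> \<theta>" if "\<theta> \<in> {a..b}" for \<theta>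
  proof -
    have "circ c \<rho> \<theta> \<in> ?C" using C that by blast
    moreover have "(SOME \<theta>'. \<theta>' \<in> {a..b} \<and> circ c \<rho> \<theta>' = circ c \<rho> \<theta>) \<in> {a..b} \<and>
       circ c \<rho> (SOME \<theta>'. \<theta>' \<in> {a..b} \<and> circ c \<rho> \<theta>' = circ c \<rho> \<theta>) = circ c \<rho> \<theta>"
      by (rule someI_ex) (use that in blast)
    ultimately show ?thesis using cons[of "SOME \<theta>'. \<theta>' \<in> {a..b} \<and> circ c \<rho> \<theta>' = circ c \<rho> \<theta>" \<theta>] that
      unfolding g1_def by presburger
  qed
  have g10: "g1 x = g0 x" if x: "x \<in> ?B" for x
  proof (cases "x \<in> ?C")
    case True
    then obtain \<theta> where "\<theta> \<in> {a..b}" "x = circ c \<rho> \<theta>" using C by blast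
    then show ?thesis using g1 cons0 x by auto
  qed (auto simp: g1_def)
  have "continuous_on ?C g1"
    unfolding C by (rule continuous_on_factor[OF _ _ phi]) (auto intro!: continuous_intros g1)
  moreover have "continuous_on ?B g1"
    using g0 by (rule continuous_on_cong[THEN iffD1, rotated -1]) (use g10 in auto)
  ultimately have "continuous_on (?C \<union> ?B) g1"
    by (intro continuous_on_closed_Un) auto
  then obtain g where g: "continuous_on UNIV g" "\<And>x. x \<in> ?C \<union> ?B \<Longrightarrow> g x = g1 x"
    by (rule Tietze_unbounded[where U=UNIV]) (auto intro!: closed_Un)
  have "continuous_on ?C (\<lambda>x. ln (norm (f x)))"
    by (intro continuous_intros continuous_on_subset[OF f]) (use nz in auto)
  then obtain l where l: "continuous_on UNIV l" "\<And>x. x \<in> ?C \<Longrightarrow> l x = ln (norm (f x))"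
    by (rule Tietze_unbounded[where U=UNIV]) auto
  define F where "F x = rv (exp (l x) * cis (g x))" for x
  have nF: "norm (F x) = exp (l x)" for x by (simp add: F_def norm_mult)
  have "continuous_on UNIV F" unfolding F_def by (intro continuous_intros l g)
  then have "continuous_on (cball c \<rho> \<inter> closure \<Omega>) F" by (rule continuous_on_subset) simp
  moreover have "F x \<noteq> 0" for x using nF[of x] by (metis exp_not_eq_zero norm_zero)
  moreover have "F x = f x" if x: "x \<in> ?C" for x
  proof -
    obtain \<theta> where t: "\<theta> \<in> {a..b}" "x = circ c \<rho> \<theta>" using C x by blast
    have "cx (F x) = cx (f x)"
      using arg[OF t(1)] g(2)[of x] l(2)[OF x] x nz[OF x] g1[OF t(1)] t(2) by (simp add: F_def)
    then show ?thesis by (metis rv_cx)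
  qed
  moreover have "F x \<bullet> \<nu> x = norm (F x) * Re (cis (g0 x) * cnj (cx (\<nu> x)))" if x: "x \<in> ?B" for x
    unfolding nF using g(2)[of x] g10[OF x] x by (simp add: F_def inner_cx mult.assoc)
  then have "s * (F x \<bullet> \<nu> x) \<le> (1/2) * norm (F x) \<and> (n = 0 \<longrightarrow> \<bar>F x \<bullet> \<nu> x\<bar> \<le> (1/2) * norm (F x))"
    if x: "x \<in> ?B" for x
    using mult_left_mono[OF bd[OF x], of "norm (F x)"] mult_left_mono[OF bd0[OF _ x], of "norm (F x)"] x
    by (auto simp: abs_mult mult_ac)
  ultimately have "filling f n c \<rho> F s" unfolding filling_def using s by blast
  then show ?thesis unfolding cert_def by blast
qed

text \<open>The angle between \<open>w\<close> and \<open>f\<close> stays in \<open>(-\<pi>/2, \<pi>/2)\<close>, so an angle function of \<open>w\<close> along an arc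
  yields one of \<open>f\<close>.\<close>

lemma compare_angle:
  assumes f: "continuous_on T (\<lambda>t. f t :: real^2)" and w: "continuous_on T (\<lambda>t. w t :: real^2)"
    and arg: "\<And>t. t \<in> T \<Longrightarrow> cx (w t) = norm (w t) * cis (\<theta> t)" and \<theta>: "continuous_on T \<theta>"
    and near: "\<And>t. t \<in> T \<Longrightarrow> 99/100 * (norm (f t) * norm (w t)) \<le> f t \<bullet> w t"
    and nz: "\<And>t. t \<in> T \<Longrightarrow> f t \<noteq> 0" "\<And>t. t \<in> T \<Longrightarrow> w t \<noteq> 0"
  obtains \<delta> where "continuous_on T \<delta>" "\<And>t. t \<in> T \<Longrightarrow> \<bar>\<delta> t\<bar> \<le> 3/10"
    "\<And>t. t \<in> T \<Longrightarrow> cx (f t) = norm (f t) * cis (\<theta> t + \<delta> t)"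
    "\<And>t. t \<in> T \<Longrightarrow> \<delta> t = Arg (cx (f t) * cnj (cx (w t)))"
proof
  define z where "z t = cx (f t) * cnj (cx (w t))" for t
  define \<delta> where "\<delta> t = Arg (z t)" for t
  have nz': "norm (z t) = norm (f t) * norm (w t)" for t by (simp add: z_def norm_mult)
  have rez: "Re (z t) = f t \<bullet> w t" for t by (simp add: z_def inner_cx)
  have pos: "Re (z t) > 0" "norm (z t) > 0" "99/100 * norm (z t) \<le> Re (z t)" if "t \<in> T" for t
  proof -
    show n: "norm (z t) > 0" using nz[OF that] by (simp add: nz')
    show "99/100 * norm (z t) \<le> Re (z t)" using near[OF that] by (simp add: nz' rez)
    with n show "Re (z t) > 0" by linarith
  qed
  have cz: "continuous_on T z" unfolding z_def by (intro continuous_intros f w)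
  have "continuous_on T (\<lambda>t. Im (Ln (z t)))"
    by (intro continuous_intros cz) (use pos(1) in \<open>force simp: complex_nonpos_Reals_iff\<close>)
  moreover have "Im (Ln (z t)) = \<delta> t" if "t \<in> T" for t
    using pos(2)[OF that] by (simp add: \<delta>_def Arg_def)
  ultimately show "continuous_on T \<delta>"
    by (metis (mono_tags, lifting) continuous_on_cong)
  show "\<delta> t = Arg (cx (f t) * cnj (cx (w t)))" for t by (simp add: \<delta>_def z_def)
  show "\<bar>\<delta> t\<bar> \<le> 3/10" if t: "t \<in> T" for t
  proof -
    have z: "z t = norm (z t) * cis (\<delta> t)"
      using pos(2)[OF t] by (simp add: \<delta>_def cis_Arg complex_sgn_def scaleR_conv_of_real field_simps)
    then have "Re (z t) = norm (z t) * cos (\<delta> t)" by (metis Re_complex_of_real cis.simps(1) complex_scaleR scaleR_conv_of_real complex.sel(1) complex_surj)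
    then have c: "cos (\<delta> t) \<ge> 99/100" using pos[OF t] by (simp add: mult.commute)
    have d2: "\<bar>\<delta> t\<bar> < pi / 2"
      unfolding \<delta>_def using pos(1)[OF t] Arg_Re_pos[of "z t"] by blast
    show ?thesis
    proof (rule ccontr)
      assume "\<not> ?thesis"
      then have "cos \<bar>\<delta> t\<bar> < cos (3/10)" using d2 pi_less_4 by (intro cos_monotone_0_pi) auto
      \<comment> \<open>From cos t = 1 - 2 * sin(t/2)^2 and sin(3/20) >= 3/40.\<close>
      moreover have "cos (3/10) \<le> (99/100::real)"
      proof -
        have "3/40 \<le> \<bar>sin (3/20::real)\<bar>" using abs_le_2_abs_sin[of "3/20"] pi_gt3 by simp
        then have "(3/40)\<^sup>2 \<le> (sin (3/20::real))\<^sup>2" by (metis abs_le_square_iff abs_numeral abs_divide)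
        then show ?thesis using cos_double_sin[of "3/20::real"] by (simp add: power2_eq_square)
      qed
      ultimately show False using c by simp
    qed
  qed
  show "cx (f t) = norm (f t) * cis (\<theta> t + \<delta> t)" if t: "t \<in> T" for t
  proof -
    have "z t = norm (z t) * cis (\<delta> t)"
      using pos(2)[OF t] by (simp add: \<delta>_def cis_Arg complex_sgn_def scaleR_conv_of_real field_simps)
    then have "z t = norm (f t) * norm (w t) * cis (\<delta> t)" unfolding nz' by simp
    moreover have "cx (f t) * (norm (w t))\<^sup>2 = z t * cx (w t)"
      by (simp add: z_def complex_norm_square[symmetric] mult.assoc mult.commute[of "cnj _"] flip: norm_cx)
    ultimately have "cx (f t) * (norm (w t))\<^sup>2 = norm (f t) * cis (\<theta> t + \<delta> t) * (norm (w t))\<^sup>2"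
      by (subst (asm) arg[OF t]) (simp add: cis_mult[symmetric] power2_eq_square mult_ac)
    then show ?thesis using nz(2)[OF t] by simp
  qed
qed

end

lemma circ_eq_iff:
  assumes "\<rho> > 0" shows "circ c \<rho> \<theta> = circ c \<rho> \<theta>' \<longleftrightarrow> (\<exists>n::int. \<theta> = \<theta>' + 2 * pi * n)"
proof -
  have "circ c \<rho> \<theta> = circ c \<rho> \<theta>' \<longleftrightarrow> cis \<theta> = cis \<theta>'"
  proof
    assume "circ c \<rho> \<theta> = circ c \<rho> \<theta>'"
    then have "rv (cis \<theta>) = rv (cis \<theta>')" using assms by (simp add: circ_def)
    then have "cx (rv (cis \<theta>)) = cx (rv (cis \<theta>'))" by (rule arg_cong)
    then show "cis \<theta> = cis \<theta>'" by simp
  qed (simp add: circ_def)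
  also have "\<dots> \<longleftrightarrow> sin \<theta> = sin \<theta>' \<and> cos \<theta> = cos \<theta>'" by (auto simp: complex_eq_iff)
  also have "\<dots> \<longleftrightarrow> (\<exists>n::int. \<theta> = \<theta>' + 2 * pi * n)" by (rule sin_cos_eq_iff)
  finally show ?thesis .
qed

lemma inj_circ:
  assumes "\<rho> > 0" "\<bar>\<theta> - \<theta>'\<bar> < 2 * pi" "circ c \<rho> \<theta> = circ c \<rho> \<theta>'" shows "\<theta> = \<theta>'"
proof -
  obtain n :: int where n: "\<theta> = \<theta>' + 2 * pi * n" using circ_eq_iff[OF assms(1)] assms(3) by blast
  then have "2 * pi * \<bar>real_of_int n\<bar> < 2 * pi" using assms(2) by (simp add: abs_mult)
  then have "\<bar>real_of_int n\<bar> < 1" by simp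
  then have "n = 0" by linarith
  then show ?thesis using n by simp
qed

lemma near_multiple_pi:
  fixes t :: real assumes "\<bar>sin t\<bar> \<le> \<sigma>"
  obtains k :: int where "\<bar>t - pi * k\<bar> \<le> 2 * \<sigma>"
proof
  define k where "k = round (t / pi)"
  have "\<bar>t / pi - k\<bar> \<le> 1/2" unfolding k_def using of_int_round_abs_le[of "t / pi"] by (simp add: abs_minus_commute)
  then have "pi * \<bar>t / pi - k\<bar> \<le> pi * (1/2)" by (intro mult_left_mono) auto
  moreover have "pi * \<bar>t / pi - k\<bar> = \<bar>t - pi * k\<bar>"
    by (simp add: abs_mult_pos' right_diff_distrib)
  ultimately have "\<bar>t - pi * k\<bar> \<le> pi / 2" by simp
  from abs_le_2_abs_sin[OF this] have "\<bar>t - pi * k\<bar> \<le> 2 * \<bar>sin (t - pi * k)\<bar>" .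
  also have "\<bar>sin (t - pi * k)\<bar> = \<bar>sin t\<bar>"
  proof -
    have z: "sin (pi * real_of_int k) = 0" using sin_npi_int[of k] by (simp add: mult.commute)
    then have "(cos (pi * real_of_int k))\<^sup>2 = 1" using sin_cos_squared_add[of "pi * real_of_int k"] by simp
    then have "\<bar>cos (pi * real_of_int k)\<bar> = 1" by (auto simp: power2_eq_1_iff)
    then show ?thesis by (simp add: sin_diff z abs_mult)
  qed
  finally show "\<bar>t - pi * k\<bar> \<le> 2 * \<sigma>" using assms by simp
qed

section \<open>Rotation along a circle that bounds no filling\<close>

context regular_domain
begin

text \<open>With this \<open>\<omega>\<close> the tangent is \<open>cis \<omega>\<close> and the
  inward normal its quarter turn, so the circle runs inside the domain between the angles close to
  \<open>\<omega>\<close> and \<open>\<omega>\<close> + pi. The two ends come from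
  \<open>half_arc\<close> for the tangent and for its negative.\<close>

lemma sphere_Int_closure_arc:
  assumes y: "y \<in> frontier \<Omega>" and \<rho>: "0 < \<rho>" "\<rho> < r0" "K * \<rho> \<le> 1/8" and \<omega>: "cx (\<nu> y) = - \<i> * cis \<omega>"
  obtains a b where "\<bar>a - \<omega>\<bar> \<le> 2 * K * \<rho>" "\<bar>b - (\<omega> + pi)\<bar> \<le> 2 * K * \<rho>"
    "circ y \<rho> a \<in> frontier \<Omega>" "circ y \<rho> b \<in> frontier \<Omega>" "\<And>\<theta>. a < \<theta> \<Longrightarrow> \<theta> < b \<Longrightarrow> circ y \<rho> \<theta> \<in> \<Omega>"
    "sphere y \<rho> \<inter> closure \<Omega> = circ y \<rho> ` {a..b}"
proof -
  define t where "t = rv (cis \<omega>)"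
  define v where "v = rv (\<i> * cis \<omega>)"
  have v: "\<nu> y = - v" using \<omega> by (metis minus_mult_left rv_cx rv_minus v_def)
  have t: "norm t = 1" "t \<bullet> v = 0" "norm (- t) = 1" "- t \<bullet> v = 0"
    by (simp_all add: t_def v_def inner_rv complex_mult_cnj flip: mult.assoc)
  have e1: "circ y \<rho> (\<omega> + \<theta>) = y + \<rho> *\<^sub>R (cos \<theta> *\<^sub>R t + sin \<theta> *\<^sub>R v)" for \<theta>
    by (simp add: circ_def t_def v_def vec_eq_iff forall_2 cos_add sin_add)
  have e2: "circ y \<rho> (\<omega> + (pi - \<theta>)) = y + \<rho> *\<^sub>R (cos \<theta> *\<^sub>R (- t) + sin \<theta> *\<^sub>R v)" for \<theta>
    unfolding e1 by simp
  obtain p where p: "\<bar>p\<bar> \<le> 2 * K * \<rho>" "circ y \<rho> (\<omega> + p) \<in> frontier \<Omega>"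
    "\<And>\<theta>. p < \<theta> \<Longrightarrow> \<theta> \<le> pi/2 \<Longrightarrow> circ y \<rho> (\<omega> + \<theta>) \<in> \<Omega>"
    "\<And>\<theta>. - pi/2 \<le> \<theta> \<Longrightarrow> \<theta> < p \<Longrightarrow> circ y \<rho> (\<omega> + \<theta>) \<notin> closure \<Omega>"
    using half_arc[OF y v t(1,2) \<rho>] unfolding e1 by auto
  obtain q where q: "\<bar>q\<bar> \<le> 2 * K * \<rho>" "circ y \<rho> (\<omega> + (pi - q)) \<in> frontier \<Omega>"
    "\<And>\<theta>. q < \<theta> \<Longrightarrow> \<theta> \<le> pi/2 \<Longrightarrow> circ y \<rho> (\<omega> + (pi - \<theta>)) \<in> \<Omega>"
    "\<And>\<theta>. - pi/2 \<le> \<theta> \<Longrightarrow> \<theta> < q \<Longrightarrow> circ y \<rho> (\<omega> + (pi - \<theta>)) \<notin> closure \<Omega>"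
    using half_arc[OF y v t(3,4) \<rho>] unfolding e2 by auto
  define a b where "a = \<omega> + p" and "b = \<omega> + (pi - q)"
  have pq: "\<bar>p\<bar> \<le> 1/4" "\<bar>q\<bar> \<le> 1/4" using p(1) q(1) \<rho>(3) by auto
  have p3: "pi > 3" by (rule pi_gt3)
  have inside: "circ y \<rho> \<theta> \<in> \<Omega>" if "a < \<theta>" "\<theta> < b" for \<theta>
  proof (cases "\<theta> \<le> \<omega> + pi/2")
    case True then show ?thesis using p(3)[of "\<theta> - \<omega>"] that by (simp add: a_def)
  next
    case False then show ?thesis using q(3)[of "\<omega> + pi - \<theta>"] that by (simp add: b_def)
  qed
  have "sphere y \<rho> \<inter> closure \<Omega> = circ y \<rho> ` {a..b}"
  proof (intro equalityI subsetI)
    fix x assume x: "x \<in> sphere y \<rho> \<inter> closure \<Omega>"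
    then obtain \<theta> where \<theta>: "x = circ y \<rho> \<theta>" "\<omega> - pi/2 \<le> \<theta>" "\<theta> < \<omega> - pi/2 + 2 * pi"
      using sphere_circ[of y x \<rho> "\<omega> - pi/2"] by auto
    have "a \<le> \<theta> \<and> \<theta> \<le> b"
    proof (cases "\<theta> \<le> \<omega> + pi/2")
      case True
      then have "\<theta> - \<omega> \<ge> p" using p(4)[of "\<theta> - \<omega>"] x \<theta> by force
      then show ?thesis using True pq p3 unfolding a_def b_def by linarith
    next
      case False
      then have "\<omega> + pi - \<theta> \<ge> q" using q(4)[of "\<omega> + pi - \<theta>"] x \<theta> by force
      then show ?thesis using False pq p3 unfolding a_def b_def by linarith
    qed
    then show "x \<in> circ y \<rho> ` {a..b}" using \<theta> by auto
  next
    fix x assume "x \<in> circ y \<rho> ` {a..b}"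
    then obtain \<theta> where \<theta>: "x = circ y \<rho> \<theta>" "a \<le> \<theta>" "\<theta> \<le> b" by auto
    have "x \<in> closure \<Omega>"
      using inside[of \<theta>] \<theta> p(2) q(2) closure_subset[of \<Omega>] frontier_subset_closure
      by (cases "\<theta> = a \<or> \<theta> = b") (auto simp: a_def b_def)
    then show "x \<in> sphere y \<rho> \<inter> closure \<Omega>" using \<theta> \<rho> dist_circ[of \<rho> y \<theta>] by simp
  qed
  moreover have "\<bar>a - \<omega>\<bar> \<le> 2 * K * \<rho>" "\<bar>b - (\<omega> + pi)\<bar> \<le> 2 * K * \<rho>" using p q by (auto simp: a_def b_def)
  ultimately show thesis using p(2) q(2) inside by (intro that[of a b]) (simp_all add: a_def b_def)
qed

text \<open>The total rotation of \<open>w\<close> is a multiple of 2 * pi. If it is less than 2 *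
  pi it vanishes, the angle of \<open>f\<close> is then a function on the circle, and
  \<open>cert_fill\<close> applies; the ball does not meet the boundary, so no condition arises
  there.\<close>

lemma interior_rotation:
  assumes f: "continuous_on (closure \<Omega>) f" and w: "continuous_on UNIV w" and \<rho>: "0 < \<rho>" and sub: "cball c \<rho> \<subseteq> \<Omega>"
    and \<phi>: "continuous_on {0..2*pi} \<phi>"
    and arg: "\<And>t. t \<in> {0..2*pi} \<Longrightarrow> cx (w (circ c \<rho> t)) = norm (w (circ c \<rho> t)) * cis (\<phi> t)"
    and near: "\<And>x. x \<in> sphere c \<rho> \<Longrightarrow> 99/100 * (norm (f x) * norm (w x)) \<le> f x \<bullet> w x"
    and nz: "\<And>x. x \<in> sphere c \<rho> \<Longrightarrow> f x \<noteq> 0" "\<And>x. x \<in> sphere c \<rho> \<Longrightarrow> w x \<noteq> 0"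
    and n: "n \<le> 1" and ncert: "\<not> cert f n c \<rho>"
  shows "2 * pi \<le> \<bar>\<phi> (2 * pi) - \<phi> 0\<bar>"
proof (rule ccontr)
  assume lt: "\<not> ?thesis"
  have sph: "circ c \<rho> t \<in> sphere c \<rho>" for t using dist_circ[of \<rho> c t] \<rho> by simp
  have sphO: "sphere c \<rho> \<subseteq> \<Omega>" using sub sphere_cball by blast
  have clO: "circ c \<rho> t \<in> closure \<Omega>" for t using sph sphO closure_subset by blast
  have circ2: "circ c \<rho> (2 * pi) = circ c \<rho> 0" by (simp add: circ_def)
  have fr: "cball c \<rho> \<inter> frontier \<Omega> = {}" using sub frontier_iff by blast
  obtain \<delta> where \<delta>: "continuous_on {0..2*pi} \<delta>"
    "\<And>t. t \<in> {0..2*pi} \<Longrightarrow> cx (f (circ c \<rho> t)) = norm (f (circ c \<rho> t)) * cis (\<phi> t + \<delta> t)"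
    "\<And>t. t \<in> {0..2*pi} \<Longrightarrow> \<delta> t = Arg (cx (f (circ c \<rho> t)) * cnj (cx (w (circ c \<rho> t))))"
  proof -
    have c1: "continuous_on {0..2*pi} (\<lambda>t. f (circ c \<rho> t))"
      by (rule continuous_on_compose2[OF f]) (use clO in \<open>auto intro!: continuous_intros\<close>)
    have c2: "continuous_on {0..2*pi} (\<lambda>t. w (circ c \<rho> t))"
      by (rule continuous_on_compose2[OF w]) (auto intro!: continuous_intros)
    show thesis
      by (rule compare_angle[OF c1 c2 arg \<phi> near[OF sph] nz(1)[OF sph] nz(2)[OF sph]]) (assumption | rule that | blast)+
  qed
  have "cis (\<phi> (2 * pi)) = cis (\<phi> 0)"
    using arg[of 0] arg[of "2*pi"] nz(2)[OF sph[of 0]] circ2 by simp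
  then have "sin (\<phi> (2*pi)) = sin (\<phi> 0) \<and> cos (\<phi> (2*pi)) = cos (\<phi> 0)" by (simp add: complex_eq_iff)
  then obtain k :: int where k: "\<phi> (2*pi) = \<phi> 0 + 2 * pi * k" using sin_cos_eq_iff by blast
  then have "2 * pi * \<bar>real_of_int k\<bar> < 2 * pi" using lt by (simp add: abs_mult)
  then have "\<bar>real_of_int k\<bar> < 1" by simp
  then have "k = 0" by linarith
  then have eq: "\<phi> (2*pi) = \<phi> 0" "\<delta> (2*pi) = \<delta> 0" using k \<delta>(3)[of 0] \<delta>(3)[of "2*pi"] circ2 by auto
  have "cert f n c \<rho>"
  proof (rule cert_fill[OF n f, where a=0 and b="2*pi" and \<phi>="\<lambda>t. \<phi> t + \<delta> t" and s=1 and ?g0.0="\<lambda>_. 0"])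
    show "sphere c \<rho> \<inter> closure \<Omega> = circ c \<rho> ` {0..2*pi}"
    proof (intro equalityI subsetI)
      fix x assume "x \<in> sphere c \<rho> \<inter> closure \<Omega>"
      then show "x \<in> circ c \<rho> ` {0..2*pi}" using sphere_circ[of c x \<rho> 0] by force
    next
      fix x assume "x \<in> circ c \<rho> ` {0..2*pi}"
      then show "x \<in> sphere c \<rho> \<inter> closure \<Omega>" using sph clO by blast
    qed
    show "\<phi> \<theta> + \<delta> \<theta> = \<phi> \<theta>' + \<delta> \<theta>'" if t: "\<theta> \<in> {0..2*pi}" "\<theta>' \<in> {0..2*pi}" "circ c \<rho> \<theta> = circ c \<rho> \<theta>'" for \<theta> \<theta>'
    proof (cases "\<bar>\<theta> - \<theta>'\<bar> < 2 * pi")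
      case True then show ?thesis using inj_circ[OF \<rho> True t(3)] by simp
    next
      case False
      then have "(\<theta> = 0 \<and> \<theta>' = 2*pi) \<or> (\<theta> = 2*pi \<and> \<theta>' = 0)" using t by auto
      then show ?thesis using eq by auto
    qed
    show "(0::real) \<le> 2 * pi" "(1::real) = 1 \<or> (1::real) = -1" by auto
    show "continuous_on {0..2*pi} (\<lambda>t. \<phi> t + \<delta> t)" by (rule continuous_on_add[OF \<phi> \<delta>(1)])
    show "f x \<noteq> 0" if "x \<in> sphere c \<rho> \<inter> closure \<Omega>" for x using nz(1) that by blast
    show "cx (f (circ c \<rho> \<theta>)) = norm (f (circ c \<rho> \<theta>)) * cis (\<phi> \<theta> + \<delta> \<theta>)" if "\<theta> \<in> {0..2*pi}" for \<theta>
      by (rule \<delta>(2)[OF that])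
    show "0 = \<phi> \<theta> + \<delta> \<theta>" if "\<theta> \<in> {0..2*pi}" "circ c \<rho> \<theta> \<in> frontier \<Omega>" for \<theta>
      using fr that(2) sph[of \<theta>] sphere_cball[of c \<rho>] by blast
  qed (use fr in simp_all)
  then show False using ncert by simp
qed

text \<open>At both ends of the arc \<open>w\<close> is almost tangential, so its angle relative to
  \<open>\<omega>\<close> is close to a multiple of pi. If the rotation is too small, these
  multiples differ by at most \<open>n\<close> half turns. Then the angles at the ends can be joined
  along the boundary, without leaving the tangent for \<open>n\<close> = 0 and through one side of
  it for \<open>n\<close> = 1, which is a certificate.\<close>

lemma boundary_rotation:
  assumes f: "continuous_on (closure \<Omega>) f" and w: "continuous_on UNIV w" and y: "y \<in> frontier \<Omega>"
    and \<rho>: "0 < \<rho>" "K * \<rho> \<le> 1/100" and \<omega>: "cx (\<nu> y) = - \<i> * cis \<omega>"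
    and ab: "a < b" "b < a + 2 * pi" and ends: "circ y \<rho> a \<in> frontier \<Omega>" "circ y \<rho> b \<in> frontier \<Omega>"
    and ins: "\<And>\<theta>. a < \<theta> \<Longrightarrow> \<theta> < b \<Longrightarrow> circ y \<rho> \<theta> \<in> \<Omega>"
    and C: "sphere y \<rho> \<inter> closure \<Omega> = circ y \<rho> ` {a..b}"
    and \<phi>: "continuous_on {a..b} \<phi>"
    and arg: "\<And>t. t \<in> {a..b} \<Longrightarrow> cx (w (circ y \<rho> t)) = norm (w (circ y \<rho> t)) * cis (\<phi> t)"
    and near: "\<And>x. x \<in> sphere y \<rho> \<inter> closure \<Omega> \<Longrightarrow> 99/100 * (norm (f x) * norm (w x)) \<le> f x \<bullet> w x"
    and nz: "\<And>x. x \<in> sphere y \<rho> \<inter> closure \<Omega> \<Longrightarrow> f x \<noteq> 0" "\<And>x. x \<in> sphere y \<rho> \<inter> closure \<Omega> \<Longrightarrow> w x \<noteq> 0"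
    and tan: "\<And>x. x \<in> sphere y \<rho> \<inter> frontier \<Omega> \<Longrightarrow> \<bar>w x \<bullet> \<nu> x\<bar> \<le> \<beta> * norm (w x)" and \<beta>: "\<beta> + K * \<rho> \<le> 1/100"
    and n: "n \<le> 1" and ncert: "\<not> cert f n y \<rho>"
  shows "(real n + 1) * pi - 4 * (\<beta> + K * \<rho>) \<le> \<bar>\<phi> b - \<phi> a\<bar>"
proof (rule ccontr)
  assume lt: "\<not> ?thesis"
  let ?X = "circ y \<rho>"
  define \<sigma> where "\<sigma> = \<beta> + K * \<rho>"
  have cm: "Re (cis t * cnj (cx (\<nu> y))) = - sin (t - \<omega>)" for t
    by (simp add: \<omega> sin_diff)
  have nclose: "\<bar>Re (cis t * cnj (cx (\<nu> x))) + sin (t - \<omega>)\<bar> \<le> K * \<rho>" if x: "x \<in> cball y \<rho> \<inter> frontier \<Omega>" for x t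
  proof -
    have "Re (cis t * cnj (cx (\<nu> x))) + sin (t - \<omega>) = Re (cis t * cnj (cx (\<nu> x - \<nu> y)))"
      using cm[of t] by (simp add: cx_diff algebra_simps)
    then have "\<bar>Re (cis t * cnj (cx (\<nu> x))) + sin (t - \<omega>)\<bar> \<le> norm (cis t * cnj (cx (\<nu> x - \<nu> y)))"
      using abs_Re_le_cmod by metis
    also have "\<dots> = norm (\<nu> x - \<nu> y)" by (simp add: norm_mult)
    also have "\<dots> \<le> K * dist x y" using x y by (intro lipschitz_normal) auto
    also have "\<dots> \<le> K * \<rho>" using x K by (intro mult_left_mono) (auto simp: dist_commute)
    finally show ?thesis .
  qed
  have sph: "?X t \<in> sphere y \<rho>" for t using dist_circ[of \<rho> y t] \<rho> by simp
  have inC: "?X t \<in> sphere y \<rho> \<inter> closure \<Omega>" if "t \<in> {a..b}" for t using C that by blast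
  have end_k: "\<exists>k::int. \<bar>\<phi> t - \<omega> - pi * k\<bar> \<le> 2 * \<sigma>" if t: "t = a \<or> t = b" for t
  proof -
    have ti: "t \<in> {a..b}" and fr: "?X t \<in> frontier \<Omega>" using t ab ends by auto
    have "\<bar>w (?X t) \<bullet> \<nu> (?X t)\<bar> = norm (w (?X t)) * \<bar>Re (cis (\<phi> t) * cnj (cx (\<nu> (?X t))))\<bar>"
      unfolding inner_cx arg[OF ti] by (simp add: mult.assoc abs_mult)
    then have "norm (w (?X t)) * \<bar>Re (cis (\<phi> t) * cnj (cx (\<nu> (?X t))))\<bar> \<le> norm (w (?X t)) * \<beta>"
      using tan[of "?X t"] fr sph by (simp add: mult.commute)
    then have "\<bar>Re (cis (\<phi> t) * cnj (cx (\<nu> (?X t))))\<bar> \<le> \<beta>" using nz(2)[OF inC[OF ti]] by simp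
    moreover have "?X t \<in> cball y \<rho> \<inter> frontier \<Omega>" using fr sph[of t] by simp
    ultimately have "\<bar>sin (\<phi> t - \<omega>)\<bar> \<le> \<sigma>" using nclose[of "?X t" "\<phi> t"] unfolding \<sigma>_def by linarith
    then show ?thesis using near_multiple_pi by metis
  qed
  obtain k1 k2 :: int where k1: "\<bar>\<phi> a - \<omega> - pi * k1\<bar> \<le> 2 * \<sigma>" and k2: "\<bar>\<phi> b - \<omega> - pi * k2\<bar> \<le> 2 * \<sigma>" using end_k by blast
  define k where "k = k2 - k1"
  have kb: "\<bar>k\<bar> \<le> int n"
  proof -
    have "pi * \<bar>real_of_int k\<bar> = \<bar>pi * real_of_int k2 - pi * real_of_int k1\<bar>"
      by (simp add: k_def abs_mult right_diff_distrib[symmetric])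
    also have "\<dots> < (real n + 1) * pi" using k1 k2 lt unfolding \<sigma>_def by linarith
    finally have "pi * \<bar>real_of_int k\<bar> < pi * (real n + 1)" by (simp add: mult.commute)
    then have "\<bar>real_of_int k\<bar> < real n + 1" by (metis mult_less_cancel_left_pos pi_gt_zero)
    then show ?thesis by linarith
  qed
  obtain \<delta> where \<delta>: "continuous_on {a..b} \<delta>" "\<And>t. t \<in> {a..b} \<Longrightarrow> \<bar>\<delta> t\<bar> \<le> 3/10"
    "\<And>t. t \<in> {a..b} \<Longrightarrow> cx (f (?X t)) = norm (f (?X t)) * cis (\<phi> t + \<delta> t)"
  proof -
    have c1: "continuous_on {a..b} (\<lambda>t. f (?X t))"
      by (rule continuous_on_compose2[OF f]) (use inC in \<open>auto intro!: continuous_intros\<close>)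
    have c2: "continuous_on {a..b} (\<lambda>t. w (?X t))"
      by (rule continuous_on_compose2[OF w]) (auto intro!: continuous_intros)
    show thesis
      by (rule compare_angle[OF c1 c2 arg \<phi> near[OF inC] nz(1)[OF inC] nz(2)[OF inC]]) (assumption | rule that | blast)+
  qed
  define A where "A = \<phi> a + \<delta> a" define B where "B = \<phi> b + \<delta> b"
  have \<sigma>: "\<sigma> \<le> 1/100" using \<beta> by (simp add: \<sigma>_def)
  have A: "\<bar>A - \<omega> - pi * k1\<bar> \<le> 32/100" 
  proof -
    have "\<bar>\<delta> a\<bar> \<le> 3/10" using \<delta>(2)[of a] ab by simp
    then show ?thesis using k1 \<sigma> unfolding A_def by linarith
  qed
  have B: "\<bar>B - \<omega> - pi * k1 - pi * k\<bar> \<le> 32/100"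
  proof -
    have "\<bar>\<delta> b\<bar> \<le> 3/10" using \<delta>(2)[of b] ab by simp
    moreover have "pi * real_of_int k2 = pi * real_of_int k1 + pi * real_of_int k" by (simp add: k_def algebra_simps)
    ultimately show ?thesis using k2 \<sigma> unfolding B_def by linarith
  qed
  define p q where "p = ?X a" and "q = ?X b"
  have pq: "p \<noteq> q" using inj_circ[OF \<rho>(1), of a b y] ab by (auto simp: p_def q_def)
  \<comment> \<open>A continuous function on the plane with values 0 and 1 at the two ends. It
    interpolates the angle on the boundary without a parametrisation of the piece of boundary in the
    ball.\<close>
  define u where "u x = dist x p / (dist x p + dist x q)" for x
  have den: "dist x p + dist x q > 0" for x using pq
    by (metis add_nonneg_eq_0_iff dist_eq_0_iff order_less_le zero_le_dist add_nonneg_nonneg)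
  have u: "0 \<le> u x" "u x \<le> 1" for x using den[of x] by (auto simp: u_def divide_le_eq)
  have up: "u p = 0" "u q = 1" using pq by (auto simp: u_def)
  have cu: "continuous_on S u" for S unfolding u_def
    by (intro continuous_intros) (use den in \<open>auto simp: less_le\<close>)
  define g0 where "g0 x = A + (B - A) * u x" for x
  define e where "e = cos (pi * k1)"
  have e: "e = 1 \<or> e = -1" using sin_npi_int[of k1] sin_cos_squared_add[of "pi * real_of_int k1"]
    by (simp add: e_def mult.commute power2_eq_1_iff)
  have sk1: "sin (pi * real_of_int k1) = 0" using sin_npi_int[of k1] by (simp add: mult.commute)
  define \<tau> where "\<tau> x = g0 x - \<omega> - pi * k1" for x
  have sing: "sin (g0 x - \<omega>) = e * sin (\<tau> x)" for x
  proof -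
    have "g0 x - \<omega> = \<tau> x + pi * k1" by (simp add: \<tau>_def)
    then show ?thesis by (simp only: sin_add sk1 e_def) simp
  qed
  have lo: "min (A - \<omega> - pi * k1) (B - \<omega> - pi * k1) \<le> \<tau> x \<and> \<tau> x \<le> max (A - \<omega> - pi * k1) (B - \<omega> - pi * k1)" for x
  proof (cases "A \<le> B")
    case True
    then have "0 \<le> (B - A) * u x" "(B - A) * u x \<le> (B - A) * 1" using u[of x] by (auto simp: mult_left_le)
    then show ?thesis by (simp add: \<tau>_def g0_def)
  next
    case False
    then have "0 \<le> (A - B) * u x" "(A - B) * u x \<le> (A - B) * 1" using u[of x] by (auto simp: mult_left_le)
    then show ?thesis using False by (simp add: \<tau>_def g0_def algebra_simps)
  qed
  have sinb: "\<bar>sin t\<bar> \<le> \<bar>t\<bar>" for t :: real by (rule abs_sin_x_le_abs_x)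
  \<comment> \<open>During a half turn the sine keeps its sign up to the errors at the ends. These
    are at most 3/10 from the angle between \<open>f\<close> and \<open>w\<close> plus 2/100 from
    the tangency of \<open>w\<close>.\<close>
  have sinlow: "sin t \<ge> - (32/100)" if "- (32/100) \<le> t" "t \<le> pi + 32/100" for t :: real
  proof -
    consider "t < 0" | "0 \<le> t" "t \<le> pi" | "t > pi" by linarith
    then show ?thesis
    proof cases
      case 1 then show ?thesis using sinb[of t] that by linarith
    next
      case 2 then show ?thesis using sin_ge_zero[of t] by linarith
    next
      case 3
      have "sin t = - sin (t - pi)" by simp
      then show ?thesis using sinb[of "t - pi"] that 3 by linarith
    qed
  qed
  \<comment> \<open>The parity of the starting multiple and the direction of the half turn decide
    which side of the tangent is passed.\<close>
  define s where "s = (if k = -1 then - e else e)"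
  have s: "s = 1 \<or> s = -1" using e by (auto simp: s_def)
  have "n = 0 \<Longrightarrow> k = 0" "k = 0 \<or> k = 1 \<or> k = -1" using kb n by auto
  have main: "s * - sin (g0 x - \<omega>) \<le> 32/100" "k = 0 \<Longrightarrow> \<bar>sin (g0 x - \<omega>)\<bar> \<le> 32/100" for x
  proof -
    show z: "\<bar>sin (g0 x - \<omega>)\<bar> \<le> 32/100" if "k = 0"
    proof -
      have "\<bar>\<tau> x\<bar> \<le> 32/100" 
      proof -
        have B': "\<bar>B - \<omega> - pi * k1\<bar> \<le> 32/100" using B that by simp
        show ?thesis using lo[of x] A B' by linarith
      qed
      then show ?thesis using sinb[of "\<tau> x"] e by (auto simp: sing abs_mult)
    qed
    consider "k = 0" | "k = 1" | "k = -1" using \<open>k = 0 \<or> k = 1 \<or> k = -1\<close> by blast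
    then show "s * - sin (g0 x - \<omega>) \<le> 32/100"
    proof cases
      case 1 then show ?thesis using z s by (auto simp: abs_le_iff)
    next
      case 2
      have B': "\<bar>B - \<omega> - pi * k1 - pi\<bar> \<le> 32/100" using B 2 by simp
      have "sin (\<tau> x) \<ge> - (32/100)"
        by (rule sinlow) (use lo[of x] A B' pi_gt3 in linarith)+
      moreover have "s * - sin (g0 x - \<omega>) = - sin (\<tau> x)" using 2 e by (auto simp: s_def sing)
      ultimately show ?thesis by simp
    next
      case 3
      have B': "\<bar>B - \<omega> - pi * k1 + pi\<bar> \<le> 32/100" using B 3 by simp
      have "sin (- \<tau> x) \<ge> - (32/100)"
        by (rule sinlow) (use lo[of x] A B' pi_gt3 in linarith)+
      moreover have "s * - sin (g0 x - \<omega>) = sin (\<tau> x)" using 3 e by (auto simp: s_def sing)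
      ultimately show ?thesis by simp
    qed
  qed
  have "cert f n y \<rho>"
  proof (rule cert_fill[OF n f _ C, where \<phi>="\<lambda>t. \<phi> t + \<delta> t" and s=s and ?g0.0=g0])
    show "\<phi> \<theta> + \<delta> \<theta> = \<phi> \<theta>' + \<delta> \<theta>'" if t: "\<theta> \<in> {a..b}" "\<theta>' \<in> {a..b}" "?X \<theta> = ?X \<theta>'" for \<theta> \<theta>'
      using inj_circ[OF \<rho>(1) _ t(3)] t ab by (simp add: abs_less_iff)
    show "g0 (?X \<theta>) = \<phi> \<theta> + \<delta> \<theta>" if t: "\<theta> \<in> {a..b}" "?X \<theta> \<in> frontier \<Omega>" for \<theta>
    proof -
      have "\<theta> = a \<or> \<theta> = b" using ins[of \<theta>] t by (force simp: frontier_iff)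
      then show ?thesis using up by (auto simp: g0_def A_def B_def p_def q_def)
    qed
    show "continuous_on (cball y \<rho> \<inter> frontier \<Omega>) g0" unfolding g0_def by (intro continuous_intros cu)
    fix x assume x: "x \<in> cball y \<rho> \<inter> frontier \<Omega>"
    have "s * (Re (cis (g0 x) * cnj (cx (\<nu> x))) + sin (g0 x - \<omega>)) \<le> K * \<rho>"
      using nclose[OF x, of "g0 x"] s by auto
    then show "s * Re (cis (g0 x) * cnj (cx (\<nu> x))) \<le> 1/2" using main(1)[of x] \<rho>(2) by (simp add: distrib_left del: mult_minus_left)
    show "\<bar>Re (cis (g0 x) * cnj (cx (\<nu> x)))\<bar> \<le> 1/2" if "n = 0"
      using nclose[OF x, of "g0 x"] main(2)[of x] \<open>n = 0 \<Longrightarrow> k = 0\<close> that \<rho>(2) by linarith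
  next
    show "a \<le> b" using ab by simp
    show "s = 1 \<or> s = -1" by (rule s)
    show "continuous_on {a..b} (\<lambda>t. \<phi> t + \<delta> t)" by (rule continuous_on_add[OF \<phi> \<delta>(1)])
    show "f x \<noteq> 0" if "x \<in> sphere y \<rho> \<inter> closure \<Omega>" for x by (rule nz(1)[OF that])
    show "cx (f (?X \<theta>)) = norm (f (?X \<theta>)) * cis (\<phi> \<theta> + \<delta> \<theta>)" if "\<theta> \<in> {a..b}" for \<theta>
      by (rule \<delta>(3)[OF that])
  qed
  then show False using ncert by simp
qed

lemma cball_inside:
  assumes "x \<in> cball c r" "x \<in> closure \<Omega>" "cball c r \<inter> frontier \<Omega> = {}" shows "cball c r \<subseteq> \<Omega>"
proof (rule ccontr)
  assume "\<not> ?thesis"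
  then have "cball c r - \<Omega> \<noteq> {}" by blast
  moreover have "cball c r \<inter> \<Omega> \<noteq> {}" using assms frontier_iff by blast
  ultimately have "cball c r \<inter> frontier \<Omega> \<noteq> {}" by (intro connected_Int_frontier) auto
  then show False using assms by simp
qed

end

section \<open>Polar coordinates\<close>

lemma distr_vector2: "distr (lborel \<Otimes>\<^sub>M lborel) borel (\<lambda>(a::real, b::real). vector [a, b] :: real^2) = lborel"
proof (rule lborel_eqI[symmetric])
  have meas: "(\<lambda>(a::real, b::real). vector [a, b] :: real^2) \<in> borel_measurable (lborel \<Otimes>\<^sub>M lborel)"
  proof -
    have "continuous_on UNIV (\<lambda>z::real\<times>real. vector [fst z, snd z] :: real^2)"
      by (subst continuous_on_componentwise) (auto simp: Basis_vec_def inner_axis forall_2 UNIV_2 axis_eq_axis intro!: continuous_intros)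
    then have "(\<lambda>z::real\<times>real. vector [fst z, snd z] :: real^2) \<in> borel_measurable borel"
      by (rule borel_measurable_continuous_onI)
    then show ?thesis by (simp add: lborel_prod split_def)
  qed
  fix l u :: "real^2" assume le: "\<And>b. b \<in> Basis \<Longrightarrow> l \<bullet> b \<le> u \<bullet> b"
  have "l$1 \<le> u$1" "l$2 \<le> u$2"
    using le[of "axis 1 1"] le[of "axis 2 1"] by (auto simp: inner_axis)
  have "emeasure (distr (lborel \<Otimes>\<^sub>M lborel) borel (\<lambda>(a::real, b::real). vector [a, b] :: real^2)) (box l u)
     = emeasure (lborel \<Otimes>\<^sub>M lborel) ({l$1<..<u$1} \<times> {l$2<..<u$2})"
    by (subst emeasure_distr[OF meas]) (auto intro!: arg_cong2[where f=emeasure] simp: space_pair_measure mem_box_cart forall_2)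
  also have "\<dots> = ennreal (u$1 - l$1) * ennreal (u$2 - l$2)"
    using \<open>l$1 \<le> u$1\<close> \<open>l$2 \<le> u$2\<close> by (subst lborel.emeasure_pair_measure_Times) auto
  also have "\<dots> = (\<Prod>b\<in>Basis. (u - l) \<bullet> b)"
  proof -
    have "(Basis :: (real^2) set) = {axis 1 1, axis 2 1}" by (auto simp: Basis_vec_def UNIV_2)
    moreover have "axis 1 1 \<noteq> (axis 2 1 :: real^2)" by (simp add: axis_eq_axis)
    ultimately have "(\<Prod>b\<in>Basis. (u - l) \<bullet> b) = (u$1 - l$1) * (u$2 - l$2)"
    proof -
      assume "(Basis :: (real^2) set) = {axis 1 1, axis 2 1}" "axis 1 1 \<noteq> (axis 2 1 :: real^2)"
      then have "(\<Prod>b\<in>Basis. (u - l) \<bullet> b) = ((u - l) \<bullet> axis 1 1) * ((u - l) \<bullet> axis 2 1)"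
        unfolding \<open>Basis = {axis 1 1, axis 2 1}\<close> using \<open>axis 1 1 \<noteq> (axis 2 1 :: real^2)\<close>
        by (subst prod.insert) auto
      then show ?thesis by (simp add: inner_axis)
    qed
    then show ?thesis using \<open>l$1 \<le> u$1\<close> \<open>l$2 \<le> u$2\<close> by (simp only: ennreal_mult diff_ge_0_iff_ge)
  qed
  finally show "emeasure (distr (lborel \<Otimes>\<^sub>M lborel) borel (\<lambda>(a::real, b::real). vector [a, b] :: real^2)) (box l u)
      = (\<Prod>b\<in>Basis. (u - l) \<bullet> b)" .
qed simp

lemma nn_integral_vector2:
  assumes "f \<in> borel_measurable borel"
  shows "(\<integral>\<^sup>+x. f x \<partial>lborel) = (\<integral>\<^sup>+a. (\<integral>\<^sup>+b. f (vector [a, b] :: real^2) \<partial>lborel) \<partial>lborel)"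
proof -
  have meas: "(\<lambda>(a::real, b::real). vector [a, b] :: real^2) \<in> borel_measurable (lborel \<Otimes>\<^sub>M lborel)"
  proof -
    have "continuous_on UNIV (\<lambda>z::real\<times>real. vector [fst z, snd z] :: real^2)"
      by (subst continuous_on_componentwise) (auto simp: Basis_vec_def inner_axis forall_2 UNIV_2 axis_eq_axis intro!: continuous_intros)
    then have "(\<lambda>z::real\<times>real. vector [fst z, snd z] :: real^2) \<in> borel_measurable borel"
      by (rule borel_measurable_continuous_onI)
    then show ?thesis by (simp add: lborel_prod split_def)
  qed
  have "(\<integral>\<^sup>+x. f x \<partial>lborel) = (\<integral>\<^sup>+x. f x \<partial>distr (lborel \<Otimes>\<^sub>M lborel) borel (\<lambda>(a::real, b::real). vector [a, b] :: real^2))"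
    by (simp only: distr_vector2)
  also have "\<dots> = (\<integral>\<^sup>+z. f (case z of (a, b) \<Rightarrow> vector [a, b]) \<partial>(lborel \<Otimes>\<^sub>M lborel))"
    by (rule nn_integral_distr[OF meas]) (use assms in simp)
  also have "\<dots> = (\<integral>\<^sup>+a. (\<integral>\<^sup>+b. f (vector [a, b] :: real^2) \<partial>lborel) \<partial>lborel)"
    using measurable_compose[OF meas assms]
    by (subst lborel.nn_integral_fst[symmetric]) (auto simp: split_def)
  finally show ?thesis .
qed

text \<open>Only this inequality is needed, so one ray may be left out: on the remaining open set of
  parameters the polar map is injective, and its image is contained in the annulus. The bound
  \<open>B\<close> provides integrability.\<close>

lemma polar_le:
  fixes f :: "real^2 \<Rightarrow> real"
  assumes f: "f \<in> borel_measurable borel" "\<And>x. 0 \<le> f x" and B: "\<And>x. x \<in> ball c r1 \<Longrightarrow> f x \<le> B" and r: "0 \<le> r0"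
  shows "(\<integral>\<^sup>+\<rho>\<in>{r0<..<r1}. (\<integral>\<^sup>+\<theta>\<in>{\<alpha><..<\<alpha> + 2 * pi}. ennreal (\<rho> * f (circ c \<rho> \<theta>)) \<partial>lborel) \<partial>lborel)
    \<le> (\<integral>\<^sup>+x\<in>{x. r0 < dist c x \<and> dist c x < r1}. ennreal (f x) \<partial>lborel)"
proof -
  define A where "A = {x. r0 < dist c x \<and> dist c x < r1}"
  define S where "S = {v::real^2. r0 < v$1 \<and> v$1 < r1 \<and> \<alpha> < v$2 \<and> v$2 < \<alpha> + 2 * pi}"
  define G where "G v = circ c (v$1) (v$2)" for v :: "real^2"
  define G' where "G' v h = h$1 *\<^sub>R rv (cis (v$2)) + (v$1 * h$2) *\<^sub>R rv (\<i> * cis (v$2))" for v h :: "real^2"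
  have oA: "open A" unfolding A_def by (intro open_Collect_conj open_Collect_less continuous_intros)
  have oS: "open S" unfolding S_def by (intro open_Collect_conj open_Collect_less continuous_intros)
  have der: "(G has_derivative G' v) (at v within S)" for v
  proof -
    have b: "bounded_linear (\<lambda>h::real^2. h$i)" for i by (rule bounded_linear_vec_nth)
    have d1: "((\<lambda>v::real^2. v$i) has_derivative (\<lambda>h. h$i)) (at v within S)" for i
      by (rule bounded_linear_imp_has_derivative[OF b])
    have dc: "(cis has_vector_derivative (\<i> * cis t)) (at t within T)" for t T
      unfolding cis_conv_exp
      by (rule has_vector_derivative_real_field[of "\<lambda>z. exp (\<i> * z)"])
         (auto intro!: derivative_eq_intros)
    then have "((\<lambda>t. rv (cis t)) has_vector_derivative rv (\<i> * cis t)) (at t within T)" for t T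
      by (rule bounded_linear.has_vector_derivative[OF bounded_linear_rv])
    then have d2: "((\<lambda>t. rv (cis t)) has_derivative (\<lambda>h. h *\<^sub>R rv (\<i> * cis t))) (at t within T)" for t T
      by (simp add: has_vector_derivative_def)
    have d3: "((\<lambda>v::real^2. rv (cis (v$2))) has_derivative (\<lambda>h. (h$2) *\<^sub>R rv (\<i> * cis (v$2)))) (at v within S)"
      using has_derivative_compose[OF d1[of 2] d2] by simp
    show ?thesis unfolding G_def[abs_def] G'_def[abs_def] circ_def
      by (rule derivative_eq_intros d1 d3 refl | simp)+ (auto simp: fun_eq_iff)
  qed
  have det: "det (matrix (G' v)) = v$1" for v
  proof -
    have m: "matrix (G' v) $ 1 $ 1 = cos (v$2)" "matrix (G' v) $ 1 $ 2 = - v$1 * sin (v$2)"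
      "matrix (G' v) $ 2 $ 1 = sin (v$2)" "matrix (G' v) $ 2 $ 2 = v$1 * cos (v$2)"
      by (auto simp: matrix_def G'_def axis_def)
    have "det (matrix (G' v)) = v$1 * ((sin (v$2))\<^sup>2 + (cos (v$2))\<^sup>2)"
      unfolding det_2 m by (simp add: power2_eq_square distrib_left mult_ac)
    then show ?thesis by (simp only: sin_cos_squared_add mult_1_right)
  qed
  have pos: "(0::real) < v$1" if "v \<in> S" for v :: "real^2" using that r by (auto simp: S_def)
  have inj: "inj_on G S"
  proof
    fix v w assume v: "v \<in> S" "w \<in> S" "G v = G w"
    have 1: "v$1 = w$1" using v(3) dist_circ[of "v$1" c "v$2"] dist_circ[of "w$1" c "w$2"] pos[OF v(1)] pos[OF v(2)] by (simp add: G_def)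
    then have "rv (cis (v$2)) = rv (cis (w$2))" using v(3) pos[OF v(2)] by (simp add: G_def circ_def)
    then have "cx (rv (cis (v$2))) = cx (rv (cis (w$2)))" by (rule arg_cong)
    then have "cis (v$2) = cis (w$2)" by simp
    then have "sin (v$2) = sin (w$2) \<and> cos (v$2) = cos (w$2)" by (simp add: complex_eq_iff)
    then obtain n :: int where n: "v$2 = w$2 + 2 * pi * n" using sin_cos_eq_iff by blast
    moreover have "\<bar>v$2 - w$2\<bar> < 2 * pi" using v by (auto simp: S_def)
    ultimately have "2 * pi * \<bar>real_of_int n\<bar> < 2 * pi" by (simp add: abs_mult)
    then have "\<bar>real_of_int n\<bar> < 1" by simp
    then have "n = 0" by linarith
    then show "v = w" using n 1 by (simp add: vec_eq_iff forall_2)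
  qed
  have GA: "G ` S \<subseteq> A" using dist_circ r by (auto simp: G_def S_def A_def)
  have Sm: "S \<in> sets lebesgue" using oS by auto
  have lmA: "A \<in> lmeasurable" "bounded A"
  proof -
    show "bounded A" by (rule bounded_subset[of "ball c r1"]) (auto simp: A_def)
    then show "A \<in> lmeasurable" using oA by (simp add: bounded_set_imp_lmeasurable)
  qed
  have GSm: "G ` S \<in> sets lebesgue"
  proof -
    have "continuous_on S G" unfolding G_def by (intro continuous_intros)
    then have "open (G ` S)" by (rule invariance_of_domain[OF _ oS inj])
    then show ?thesis by auto
  qed
  have fA: "f absolutely_integrable_on A"
  proof (rule measurable_bounded_by_integrable_imp_absolutely_integrable)
    show "f \<in> borel_measurable (lebesgue_on A)"
      using f(1) by (simp add: measurable_completion measurable_restrict_space1)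
    show "A \<in> sets lebesgue" using oA by auto
    show "(\<lambda>_. B) integrable_on A" using lmA by (simp add: integrable_on_const)
    show "norm (f x) \<le> B" if "x \<in> A" for x using f(2)[of x] B[of x] that by (simp add: A_def)
  qed
  have fG: "f absolutely_integrable_on G ` S"
    by (rule set_integrable_subset[OF fA]) (use GSm GA in auto)
  define F1 where "F1 x = (vec (f x) :: real^1)" for x
  have b1: "(Basis :: (real^1) set) = {axis 1 1}" by (auto simp: Basis_vec_def)
  have F1: "F1 absolutely_integrable_on G ` S"
    unfolding absolutely_integrable_componentwise_iff[where f=F1] b1 using fG by (simp add: F1_def inner_axis)
  from has_absolute_integral_change_of_variables[OF Sm der inj, of F1]
  have chg: "(\<lambda>x. \<bar>det (matrix (G' x))\<bar> *\<^sub>R F1 (G x)) absolutely_integrable_on S"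
    "integral S (\<lambda>x. \<bar>det (matrix (G' x))\<bar> *\<^sub>R F1 (G x)) = integral (G ` S) F1"
    using F1 by blast+
  have comp1: "integral T (\<lambda>x. h x :: real^1) $ 1 = integral T (\<lambda>x. h x $ 1)" if "h integrable_on T" for T and h :: "real^2 \<Rightarrow> real^1"
    using integral_component_eq_cart[OF that, of 1] by simp
  have i1: "(\<lambda>x. \<bar>x$1\<bar> * f (G x)) absolutely_integrable_on S"
    using chg(1) unfolding absolutely_integrable_componentwise_iff[where f="\<lambda>x. \<bar>det (matrix (G' x))\<bar> *\<^sub>R F1 (G x)"] b1
    by (simp add: det F1_def inner_axis)
  have i2: "integral S (\<lambda>x. \<bar>x$1\<bar> * f (G x)) = integral (G ` S) f"
  proof -
    have "integral S (\<lambda>x. \<bar>det (matrix (G' x))\<bar> *\<^sub>R F1 (G x)) $ 1 = integral (G ` S) F1 $ 1" using chg(2) by simp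
    then show ?thesis
      using comp1[OF absolutely_integrable_on_def[THEN iffD1, THEN conjunct1, OF chg(1)]]
         comp1[OF absolutely_integrable_on_def[THEN iffD1, THEN conjunct1, OF F1]]
      by (simp add: det F1_def)
  qed
  have mG: "(\<lambda>x. f (G x)) \<in> borel_measurable borel"
  proof -
    have "G \<in> borel_measurable borel" unfolding G_def by (intro borel_measurable_continuous_onI continuous_intros)
    then show ?thesis using f(1) by (rule measurable_compose)
  qed
  have "(\<integral>\<^sup>+x. ennreal (\<bar>x$1\<bar> * f (G x)) * indicator S x \<partial>lborel) = ennreal (integral S (\<lambda>x. \<bar>x$1\<bar> * f (G x)))"
    using i1 f(2) by (intro nn_integral_has_integral_lebesgue') (auto simp: absolutely_integrable_on_def integrable_integral)
  also have "\<dots> \<le> ennreal (integral A f)"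
    unfolding i2 using f fA fG GA by (intro ennreal_leI integral_subset_le) (auto simp: absolutely_integrable_on_def)
  also have "\<dots> = (\<integral>\<^sup>+x\<in>A. ennreal (f x) \<partial>lborel)"
    using fA f(2) by (intro nn_integral_has_integral_lebesgue'[symmetric]) (auto simp: absolutely_integrable_on_def integrable_integral)
  finally have le: "(\<integral>\<^sup>+x. ennreal (\<bar>x$1\<bar> * f (G x)) * indicator S x \<partial>lborel) \<le> (\<integral>\<^sup>+x\<in>A. ennreal (f x) \<partial>lborel)" .
  have m1: "(\<lambda>x::real^2. \<bar>x$1\<bar>) \<in> borel_measurable borel"
    by (intro borel_measurable_continuous_onI continuous_intros)
  have "(\<lambda>x. ennreal (\<bar>x$1\<bar> * f (G x)) * indicator S x) \<in> borel_measurable borel"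
    by (rule borel_measurable_times_ennreal[OF measurable_compose[OF borel_measurable_times[OF m1 mG] measurable_ennreal]])
       (use oS in simp)
  then have "(\<integral>\<^sup>+x. ennreal (\<bar>x$1\<bar> * f (G x)) * indicator S x \<partial>lborel)
     = (\<integral>\<^sup>+a. (\<integral>\<^sup>+b. ennreal (\<bar>a\<bar> * f (circ c a b)) * indicator S (vector [a, b] :: real^2) \<partial>lborel) \<partial>lborel)"
    by (subst nn_integral_vector2) (simp_all add: G_def)
  also have "\<dots> = (\<integral>\<^sup>+\<rho>\<in>{r0<..<r1}. (\<integral>\<^sup>+\<theta>\<in>{\<alpha><..<\<alpha> + 2 * pi}. ennreal (\<rho> * f (circ c \<rho> \<theta>)) \<partial>lborel) \<partial>lborel)"
    using r by (intro nn_integral_cong) (auto simp: S_def indicator_def intro!: nn_integral_cong)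
  finally show ?thesis using le by (simp add: A_def)
qed

section \<open>Approximation by smooth fields\<close>

definition gl_dens :: "real \<Rightarrow> (real^2 \<Rightarrow> real^2) \<Rightarrow> real^2 \<Rightarrow> real" where
  "gl_dens \<epsilon> w x = (norm (jacobian w (at x)))\<^sup>2 + 1 / \<epsilon>\<^sup>2 * well (norm (w x))"

lemma gl_dens_nonneg: "0 \<le> gl_dens \<epsilon> w x" by (simp add: gl_dens_def well_nonneg)

lemma continuous_on_gl_dens:
  assumes "C1_on UNIV w" shows "continuous_on UNIV w" "continuous_on UNIV (gl_dens \<epsilon> w)"
proof -
  show w: "continuous_on UNIV w"
    using assms by (auto simp: C1_on_def intro!: continuous_at_imp_continuous_on differentiable_imp_continuous_within)
  show "continuous_on UNIV (gl_dens \<epsilon> w)"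
    using assms unfolding gl_dens_def[abs_def] C1_on_def by (intro continuous_intros w) auto
qed

text \<open>Truncating |v| at 1 changes neither side for the worse; on [0, 1] the potential is
  Lipschitz with constant 4, and 4 * x <= 4 * k + x^2 / k.\<close>

lemma well_perturb:
  fixes v m :: "'a::real_normed_vector" assumes m: "norm m \<le> 1" and k: "k > 0"
  shows "well (norm v) \<le> (1 - (norm m)\<^sup>2)\<^sup>2 + 4 * k + (norm (v - m))\<^sup>2 / k"
proof -
  define s where "s = min 1 (norm v)"
  have s: "0 \<le> s" "s \<le> 1" by (auto simp: s_def)
  have "max 0 (1 - (norm v)\<^sup>2) = 1 - s\<^sup>2"
    by (cases "norm v \<le> 1") (auto simp: s_def max_def power_le_one abs_square_le_1 one_le_power)
  then have w: "well (norm v) = (1 - s\<^sup>2)\<^sup>2" by (simp add: well_def)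
  define t where "t = norm m"
  have t: "0 \<le> t" "t \<le> 1" using m by (auto simp: t_def)
  have st: "\<bar>s - t\<bar> \<le> norm (v - m)"
    using norm_triangle_ineq3[of v m] t by (auto simp: s_def t_def)
  have "(1 - s\<^sup>2)\<^sup>2 - (1 - t\<^sup>2)\<^sup>2 = (t - s) * ((t + s) * ((1 - s\<^sup>2) + (1 - t\<^sup>2)))"
    by (simp add: power2_eq_square algebra_simps)
  also have "\<dots> \<le> \<bar>t - s\<bar> * \<bar>(t + s) * ((1 - s\<^sup>2) + (1 - t\<^sup>2))\<bar>" by (metis abs_ge_self abs_mult)
  also have "\<dots> \<le> \<bar>t - s\<bar> * (2 * 2)"
  proof (rule mult_left_mono)
    have "s\<^sup>2 \<le> 1" "t\<^sup>2 \<le> 1" using s t by (auto intro: power_le_one)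
    then show "\<bar>(t + s) * ((1 - s\<^sup>2) + (1 - t\<^sup>2))\<bar> \<le> 2 * 2"
      unfolding abs_mult using s t by (intro mult_mono) auto
  qed simp
  also have "\<dots> \<le> 4 * norm (v - m)" using st by (simp add: abs_minus_commute)
  also have "\<dots> \<le> 4 * k + (norm (v - m))\<^sup>2 / k"
  proof -
    have "0 \<le> (norm (v - m) - 2 * k)\<^sup>2" by simp
    then have "4 * k * norm (v - m) \<le> 4 * k * k + (norm (v - m))\<^sup>2" by (simp add: power2_eq_square algebra_simps)
    then show ?thesis using k by (simp add: field_simps)
  qed
  finally show ?thesis using w by (simp add: t_def)
qed

lemma norm_square_perturb:
  fixes a b :: "'a::real_inner" assumes k: "k > 0"
  shows "(norm a)\<^sup>2 \<le> (norm b)\<^sup>2 + k * (norm b)\<^sup>2 + (1 + 1 / k) * (norm (a - b))\<^sup>2"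
proof -
  have "norm a \<le> norm b + norm (a - b)" using norm_triangle_ineq[of b "a - b"] by simp
  then have "(norm a)\<^sup>2 \<le> (norm b + norm (a - b))\<^sup>2" by (intro power_mono) auto
  also have "\<dots> = (norm b)\<^sup>2 + 2 * norm b * norm (a - b) + (norm (a - b))\<^sup>2" by (simp add: power2_sum)
  also have "2 * norm b * norm (a - b) \<le> k * (norm b)\<^sup>2 + (norm (a - b))\<^sup>2 / k"
  proof -
    have "0 \<le> (k * norm b - norm (a - b))\<^sup>2" by simp
    then have "2 * k * norm b * norm (a - b) \<le> k * k * (norm b)\<^sup>2 + (norm (a - b))\<^sup>2"
      by (simp add: power2_eq_square algebra_simps)
    then show ?thesis using k by (simp add: field_simps power2_eq_square)
  qed
  finally show ?thesis by (simp add: algebra_simps)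
qed

text \<open>A late member of the sequence that defines the trace serves as \<open>w\<close>. The
  energy error is made absolute by Young's inequality, and where the trace is tangential, a large
  normal component of \<open>w\<close> means a large distance from the trace, which Markov's
  inequality makes rare.\<close>

lemma C1_approximation:
  assumes dom: "open \<Omega>" "bounded \<Omega>" and eps: "0 < \<epsilon>"
    and m: "C1_on \<Omega> m" "m ` \<Omega> \<subseteq> cball 0 1" and tr: "normal_trace_zero \<Omega> m"
    and fin: "gl_energy \<epsilon> m \<Omega> < \<infinity>" and a: "0 < a" and \<sigma>: "0 < \<sigma>"
    and \<nu>: "\<And>y. y \<in> frontier \<Omega> \<Longrightarrow> norm (outer_unit_normal \<Omega> y) = 1"
  obtains w where "C1_on UNIV w"
    "\<And>A. A \<in> sets borel \<Longrightarrow> A \<subseteq> \<Omega> \<Longrightarrow> (\<integral>\<^sup>+x\<in>A. ennreal (gl_dens \<epsilon> w x) \<partial>lborel) \<le> gl_energy \<epsilon> m A + 1"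
    "hausdorff1_outer {y \<in> frontier \<Omega>. a \<le> \<bar>w y \<bullet> outer_unit_normal \<Omega> y\<bar>} \<le> ennreal \<sigma>"
proof -
  let ?\<nu> = "outer_unit_normal \<Omega>"
  obtain g where g: "has_trace \<Omega> m g" "AE x in hausdorff1. x \<in> frontier \<Omega> \<longrightarrow> g x \<bullet> ?\<nu> x = 0"
    using tr by (auto simp: normal_trace_zero_def)
  then obtain w where gm: "g \<in> borel_measurable borel" and w: "\<And>n. C1_on UNIV (w n)"
    and lim1: "(\<lambda>n. \<integral>\<^sup>+x\<in>\<Omega>. ennreal ((norm (w n x - m x))\<^sup>2
               + (norm (jacobian (w n) (at x) - jacobian m (at x)))\<^sup>2) \<partial>lborel) \<longlonglongrightarrow> 0"
    and lim2: "(\<lambda>n. \<integral>\<^sup>+x\<in>frontier \<Omega>. ennreal ((norm (w n x - g x))\<^sup>2) \<partial>hausdorff1) \<longlonglongrightarrow> 0"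
    unfolding has_trace_def by blast
  define E where "E = enn2real (gl_energy \<epsilon> m \<Omega>)"
  have E: "gl_energy \<epsilon> m \<Omega> = ennreal E" "0 \<le> E" using fin by (auto simp: E_def)
  define V where "V = measure lborel \<Omega>"
  have V: "emeasure lborel \<Omega> = ennreal V" "0 \<le> V"
    using emeasure_bounded_finite[OF dom(2)] by (auto simp: V_def emeasure_eq_ennreal_measure)
  \<comment> \<open>The relative error of the gradient, the additive error of the potential and the
    error from the distance in H^1 are each made at most 1/4; \<open>k\<close>, \<open>k'\<close>
    and the tolerance 1 / (4 * M) for the sequence are chosen accordingly.\<close>
  define k where "k = 1 / (4 * (E + 1))"
  define k' where "k' = \<epsilon>\<^sup>2 / (16 * (V + 1))"
  have k: "k > 0" "k' > 0" using E V eps by (auto simp: k_def k'_def)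
  define M where "M = 1 + 1 / k + 1 / (\<epsilon>\<^sup>2 * k')"
  have M: "M > 0" using k eps by (auto simp: M_def intro!: add_pos_pos)
  have "\<forall>\<^sub>F n in sequentially. (\<integral>\<^sup>+x\<in>\<Omega>. ennreal ((norm (w n x - m x))\<^sup>2
               + (norm (jacobian (w n) (at x) - jacobian m (at x)))\<^sup>2) \<partial>lborel) < ennreal (1 / (4 * M))"
    using M by (intro order_tendstoD(2)[OF lim1]) simp
  moreover have "\<forall>\<^sub>F n in sequentially. (\<integral>\<^sup>+x\<in>frontier \<Omega>. ennreal ((norm (w n x - g x))\<^sup>2) \<partial>hausdorff1) < ennreal (a\<^sup>2 * \<sigma>)"
    using a \<sigma> by (intro order_tendstoD(2)[OF lim2]) simp
  ultimately have "\<forall>\<^sub>F n in sequentially. (\<integral>\<^sup>+x\<in>\<Omega>. ennreal ((norm (w n x - m x))\<^sup>2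
               + (norm (jacobian (w n) (at x) - jacobian m (at x)))\<^sup>2) \<partial>lborel) < ennreal (1 / (4 * M)) \<and>
      (\<integral>\<^sup>+x\<in>frontier \<Omega>. ennreal ((norm (w n x - g x))\<^sup>2) \<partial>hausdorff1) < ennreal (a\<^sup>2 * \<sigma>)"
    by (rule eventually_conj)
  then obtain n where n: "(\<integral>\<^sup>+x\<in>\<Omega>. ennreal ((norm (w n x - m x))\<^sup>2
               + (norm (jacobian (w n) (at x) - jacobian m (at x)))\<^sup>2) \<partial>lborel) < ennreal (1 / (4 * M))"
      "(\<integral>\<^sup>+x\<in>frontier \<Omega>. ennreal ((norm (w n x - g x))\<^sup>2) \<partial>hausdorff1) < ennreal (a\<^sup>2 * \<sigma>)"
    by (auto simp: eventually_sequentially)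
  define W where "W = w n"
  have W: "C1_on UNIV W" using w by (simp add: W_def)
  define D where "D x = (norm (W x - m x))\<^sup>2 + (norm (jacobian W (at x) - jacobian m (at x)))\<^sup>2" for x
  have mc: "continuous_on \<Omega> m"
    using m(1) by (auto simp: C1_on_def intro!: continuous_at_imp_continuous_on differentiable_imp_continuous_within)
  have Jm: "continuous_on \<Omega> (\<lambda>x. jacobian m (at x))" using m(1) by (simp add: C1_on_def)
  have Wc: "continuous_on UNIV W" by (rule continuous_on_gl_dens[OF W])
  have JW: "continuous_on UNIV (\<lambda>x. jacobian W (at x))" using W by (simp add: C1_on_def)
  have ms: "(\<lambda>x. ennreal (h x) * indicator \<Omega> x) \<in> borel_measurable lborel" if "continuous_on \<Omega> h" for h :: "real^2 \<Rightarrow> real"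
  proof -
    have "(\<lambda>x. indicator \<Omega> x *\<^sub>R h x) \<in> borel_measurable borel"
      using dom that by (intro borel_measurable_continuous_on_indicator) auto
    then have "(\<lambda>x. ennreal (indicator \<Omega> x *\<^sub>R h x)) \<in> borel_measurable borel" by simp
    moreover have "(\<lambda>x. ennreal (indicator \<Omega> x *\<^sub>R h x)) = (\<lambda>x. ennreal (h x) * indicator \<Omega> x)"
      by (auto simp: indicator_def)
    ultimately show ?thesis by simp
  qed
  have cm: "continuous_on \<Omega> (gl_density \<epsilon> m)" unfolding gl_density_def[abs_def] by (intro continuous_intros mc Jm)
  have cD: "continuous_on \<Omega> D" unfolding D_def
    by (intro continuous_intros mc Jm continuous_on_subset[OF Wc] continuous_on_subset[OF JW]) auto
  have gn: "0 \<le> gl_density \<epsilon> m x" for x by (simp add: gl_density_def)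
  have Dn: "0 \<le> D x" for x by (simp add: D_def)
  have pw: "gl_dens \<epsilon> W x \<le> gl_density \<epsilon> m x + (k * gl_density \<epsilon> m x + (4 * k' / \<epsilon>\<^sup>2 + M * D x))" if x: "x \<in> \<Omega>" for x
  proof -
    have "well (norm (W x)) \<le> (1 - (norm (m x))\<^sup>2)\<^sup>2 + 4 * k' + (norm (W x - m x))\<^sup>2 / k'"
      using m(2) x k by (intro well_perturb) auto
    then have "1 / \<epsilon>\<^sup>2 * well (norm (W x)) \<le> 1 / \<epsilon>\<^sup>2 * ((1 - (norm (m x))\<^sup>2)\<^sup>2 + 4 * k' + (norm (W x - m x))\<^sup>2 / k')"
      by (intro mult_left_mono) auto
    then have 1: "1 / \<epsilon>\<^sup>2 * well (norm (W x)) \<le> 1 / \<epsilon>\<^sup>2 * (1 - (norm (m x))\<^sup>2)\<^sup>2 + 4 * k' / \<epsilon>\<^sup>2 + 1 / (\<epsilon>\<^sup>2 * k') * (norm (W x - m x))\<^sup>2"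
      by (simp add: distrib_left mult_ac)
    have 2: "(norm (jacobian W (at x)))\<^sup>2 \<le> (norm (jacobian m (at x)))\<^sup>2 + k * (norm (jacobian m (at x)))\<^sup>2
        + (1 + 1 / k) * (norm (jacobian W (at x) - jacobian m (at x)))\<^sup>2" by (rule norm_square_perturb[OF k(1)])
    have 3: "k * (norm (jacobian m (at x)))\<^sup>2 \<le> k * gl_density \<epsilon> m x"
      using k by (intro mult_left_mono) (auto simp: gl_density_def)
    have "1 / (\<epsilon>\<^sup>2 * k') \<le> M" "1 + 1 / k \<le> M" using k eps by (auto simp: M_def intro!: add_nonneg_nonneg)
    then have 4: "1 / (\<epsilon>\<^sup>2 * k') * (norm (W x - m x))\<^sup>2 \<le> M * (norm (W x - m x))\<^sup>2"
      "(1 + 1 / k) * (norm (jacobian W (at x) - jacobian m (at x)))\<^sup>2 \<le> M * (norm (jacobian W (at x) - jacobian m (at x)))\<^sup>2"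
      by (auto simp only: intro: mult_right_mono zero_le_power2)
    show ?thesis using 1 2 3 4 unfolding gl_dens_def gl_density_def D_def by (simp add: distrib_left)
  qed
  have energy: "(\<integral>\<^sup>+x\<in>A. ennreal (gl_dens \<epsilon> W x) \<partial>lborel) \<le> gl_energy \<epsilon> m A + 1" if A: "A \<in> sets borel" "A \<subseteq> \<Omega>" for A
  proof -
    have i: "indicator A x = (indicator A x * indicator \<Omega> x :: ennreal)" for x using A(2) by (auto simp: indicator_def)
    have ms': "(\<lambda>x. ennreal (h x) * indicator A x) \<in> borel_measurable lborel" if "continuous_on \<Omega> h" for h :: "real^2 \<Rightarrow> real"
    proof -
      have "(\<lambda>x. (ennreal (h x) * indicator \<Omega> x) * indicator A x) \<in> borel_measurable lborel"
        by (rule borel_measurable_times_ennreal[OF ms[OF that]]) (use A(1) in simp)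
      moreover have "(ennreal (h x) * indicator \<Omega> x) * indicator A x = ennreal (h x) * indicator A x" for x
        using A(2) by (auto simp: indicator_def)
      ultimately show ?thesis by simp
    qed
    have "(\<integral>\<^sup>+x\<in>A. ennreal (gl_dens \<epsilon> W x) \<partial>lborel)
      \<le> (\<integral>\<^sup>+x. ennreal (gl_density \<epsilon> m x) * indicator A x + ennreal (k * gl_density \<epsilon> m x + (4 * k' / \<epsilon>\<^sup>2 + M * D x)) * indicator \<Omega> x \<partial>lborel)"
    proof (rule nn_integral_mono)
      fix x
      show "ennreal (gl_dens \<epsilon> W x) * indicator A x
          \<le> ennreal (gl_density \<epsilon> m x) * indicator A x + ennreal (k * gl_density \<epsilon> m x + (4 * k' / \<epsilon>\<^sup>2 + M * D x)) * indicator \<Omega> x"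
      proof (cases "x \<in> A")
        case True
        then have "x \<in> \<Omega>" using A by auto
        have "ennreal (gl_dens \<epsilon> W x) \<le> ennreal (gl_density \<epsilon> m x + (k * gl_density \<epsilon> m x + (4 * k' / \<epsilon>\<^sup>2 + M * D x)))"
          by (rule ennreal_leI[OF pw[OF \<open>x \<in> \<Omega>\<close>]])
        also have "\<dots> = ennreal (gl_density \<epsilon> m x) + ennreal (k * gl_density \<epsilon> m x + (4 * k' / \<epsilon>\<^sup>2 + M * D x))"
          using gn[of x] Dn[of x] k M by (intro ennreal_plus) auto
        finally show ?thesis using True \<open>x \<in> \<Omega>\<close> by simp
      qed simp
    qed
    also have "\<dots> = (\<integral>\<^sup>+x. ennreal (gl_density \<epsilon> m x) * indicator A x \<partial>lborel)
        + (\<integral>\<^sup>+x. ennreal (k * gl_density \<epsilon> m x + (4 * k' / \<epsilon>\<^sup>2 + M * D x)) * indicator \<Omega> x \<partial>lborel)"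
      by (intro nn_integral_add ms' ms cm continuous_intros cD)
    also have "(\<integral>\<^sup>+x. ennreal (k * gl_density \<epsilon> m x + (4 * k' / \<epsilon>\<^sup>2 + M * D x)) * indicator \<Omega> x \<partial>lborel)
        = (\<integral>\<^sup>+x. ennreal k * (ennreal (gl_density \<epsilon> m x) * indicator \<Omega> x)
            + (ennreal (4 * k' / \<epsilon>\<^sup>2) * indicator \<Omega> x + ennreal M * (ennreal (D x) * indicator \<Omega> x)) \<partial>lborel)"
      using gn Dn k M by (intro nn_integral_cong) (auto simp: indicator_def ennreal_plus ennreal_mult)
    also have "\<dots> = ennreal k * (\<integral>\<^sup>+x. ennreal (gl_density \<epsilon> m x) * indicator \<Omega> x \<partial>lborel)
            + (ennreal (4 * k' / \<epsilon>\<^sup>2) * emeasure lborel \<Omega> + ennreal M * (\<integral>\<^sup>+x. ennreal (D x) * indicator \<Omega> x \<partial>lborel))"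
    proof -
      have "\<Omega> \<in> sets lborel" using dom by simp
      then have mi: "(\<lambda>x. indicator \<Omega> x :: ennreal) \<in> borel_measurable lborel" by simp
      show ?thesis
        using ms[OF cm] ms[OF cD] mi \<open>\<Omega> \<in> sets lborel\<close>
        by (simp add: nn_integral_add nn_integral_cmult borel_measurable_times_ennreal borel_measurable_add)
    qed
    also have "\<dots> \<le> ennreal k * ennreal E + (ennreal (4 * k' / \<epsilon>\<^sup>2) * ennreal V + ennreal M * ennreal (1 / (4 * M)))"
      using n(1) E(1) V(1) unfolding gl_energy_def
      by (intro add_mono mult_left_mono) (auto simp: D_def W_def less_imp_le)
    also have "\<dots> = ennreal (k * E + (4 * k' / \<epsilon>\<^sup>2 * V + M * (1 / (4 * M))))"
    proof -
      have "ennreal k * ennreal E = ennreal (k * E)" "ennreal (4 * k' / \<epsilon>\<^sup>2) * ennreal V = ennreal (4 * k' / \<epsilon>\<^sup>2 * V)"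
        "ennreal M * ennreal (1 / (4 * M)) = ennreal (M * (1 / (4 * M)))"
        using k E V M by (auto simp only: intro!: ennreal_mult[symmetric]) auto
      moreover have "0 \<le> k * E" "0 \<le> 4 * k' / \<epsilon>\<^sup>2 * V" "0 \<le> M * (1 / (4 * M))" using k E V M by auto
      ultimately show ?thesis by (simp only: ennreal_plus[symmetric] add_nonneg_nonneg)
    qed
    also have "\<dots> \<le> ennreal 1"
    proof (rule ennreal_leI)
      have "k * E \<le> 1/4" using E by (simp add: k_def field_simps)
      moreover have "4 * k' / \<epsilon>\<^sup>2 * V = V / (4 * (V + 1))"
      proof -
        have "4 * (e / (16 * W)) / e * V = V / (4 * W)" if "e \<noteq> 0" "W \<noteq> 0" for e W :: real
          using that by (simp add: divide_simps)
        from this[of "\<epsilon>\<^sup>2" "V + 1"] show ?thesis using eps V(2) unfolding k'_def by simp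
      qed
      moreover have "V / (4 * (V + 1)) \<le> 1/4" using V(2) by (simp add: field_simps)
      moreover have "M * (1 / (4 * M)) = 1/4" using M by simp
      ultimately show "k * E + (4 * k' / \<epsilon>\<^sup>2 * V + M * (1 / (4 * M))) \<le> 1" by linarith
    qed
    finally show ?thesis unfolding gl_energy_def by (simp add: add_left_mono)
  qed
  have "hausdorff1_outer {y \<in> frontier \<Omega>. a \<le> \<bar>W y \<bullet> ?\<nu> y\<bar>} \<le> ennreal \<sigma>"
  proof -
    obtain N0 where N0: "{x \<in> space hausdorff1. \<not> (x \<in> frontier \<Omega> \<longrightarrow> g x \<bullet> ?\<nu> x = 0)} \<subseteq> N0"
      "N0 \<in> sets hausdorff1" "emeasure hausdorff1 N0 = 0"
      by (rule AE_E[OF g(2)]) blast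
    have Wm: "W \<in> borel_measurable borel" using Wc by (rule borel_measurable_continuous_onI)
    have hm: "(\<lambda>x. ennreal ((norm (W x - g x))\<^sup>2) * indicator (frontier \<Omega>) x) \<in> borel_measurable hausdorff1"
      using Wm gm by (intro borel_measurable_times_ennreal) (auto simp: measurable_cong_sets[OF sets_hausdorff1 refl] intro!: borel_measurable_indicator)
    define P where "P = {x \<in> space hausdorff1. 1 \<le> ennreal (1 / a\<^sup>2) * (ennreal ((norm (W x - g x))\<^sup>2) * indicator (frontier \<Omega>) x)}"
    have Pm: "P \<in> sets hausdorff1" unfolding P_def using hm by measurable
    have "emeasure hausdorff1 P \<le> ennreal (1 / a\<^sup>2) * (\<integral>\<^sup>+x\<in>frontier \<Omega>. ennreal ((norm (W x - g x))\<^sup>2) \<partial>hausdorff1)"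
    proof -
      have "emeasure hausdorff1 ({x\<in>space hausdorff1. 1 \<le> ennreal (1 / a\<^sup>2) * (ennreal ((norm (W x - g x))\<^sup>2) * indicator (frontier \<Omega>) x)} \<inter> UNIV)
        \<le> ennreal (1 / a\<^sup>2) * (\<integral>\<^sup>+x. (ennreal ((norm (W x - g x))\<^sup>2) * indicator (frontier \<Omega>) x) * indicator UNIV x \<partial>hausdorff1)"
        using nn_integral_Markov_inequality[of "\<lambda>x. ennreal ((norm (W x - g x))\<^sup>2) * indicator (frontier \<Omega>) x" "UNIV" hausdorff1 "ennreal (1 / a\<^sup>2)"] hm
        by (simp add: Collect_conj_eq)
      then show ?thesis by (simp add: P_def)
    qed
    also have "\<dots> \<le> ennreal (1 / a\<^sup>2) * ennreal (a\<^sup>2 * \<sigma>)"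
      using n(2) by (intro mult_left_mono) (auto simp: W_def less_imp_le)
    also have "\<dots> = ennreal \<sigma>" using a \<sigma> by (simp add: ennreal_mult[symmetric])
    finally have P: "hausdorff1_outer P \<le> ennreal \<sigma>" using Pm emeasure_hausdorff1[of P] by simp
    have sub: "{y \<in> frontier \<Omega>. a \<le> \<bar>W y \<bullet> ?\<nu> y\<bar>} \<subseteq> P \<union> N0"
    proof
      fix y assume y: "y \<in> {y \<in> frontier \<Omega>. a \<le> \<bar>W y \<bullet> ?\<nu> y\<bar>}"
      show "y \<in> P \<union> N0"
      proof (cases "g y \<bullet> ?\<nu> y = 0")
        case True
        have "\<bar>W y \<bullet> ?\<nu> y\<bar> = \<bar>(W y - g y) \<bullet> ?\<nu> y\<bar>" using True by (simp add: inner_diff_left)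
        also have "\<dots> \<le> norm (W y - g y)" using Cauchy_Schwarz_ineq2[of "W y - g y" "?\<nu> y"] \<nu> y by simp
        finally have "a \<le> norm (W y - g y)" using y by simp
        then have "a\<^sup>2 \<le> (norm (W y - g y))\<^sup>2" using a by (intro power_mono) auto
        then have "1 \<le> 1 / a\<^sup>2 * (norm (W y - g y))\<^sup>2" using a by (simp add: field_simps)
        then have "ennreal 1 \<le> ennreal (1 / a\<^sup>2 * (norm (W y - g y))\<^sup>2)" by (rule ennreal_leI)
        moreover have "ennreal (1 / a\<^sup>2 * (norm (W y - g y))\<^sup>2) = ennreal (1 / a\<^sup>2) * ennreal ((norm (W y - g y))\<^sup>2)"
          by (rule ennreal_mult) auto
        ultimately have "1 \<le> ennreal (1 / a\<^sup>2) * ennreal ((norm (W y - g y))\<^sup>2)" by (simp only: ennreal_1)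
        then show ?thesis using y by (simp add: P_def)
      next
        case False
        then show ?thesis using N0(1) y by auto
      qed
    qed
    have "hausdorff1_outer {y \<in> frontier \<Omega>. a \<le> \<bar>W y \<bullet> ?\<nu> y\<bar>} \<le> hausdorff1_outer P + hausdorff1_outer N0"
      using hausdorff1_outer_mono[OF sub] hausdorff1_outer_subadd[of P N0] by (rule order_trans)
    also have "hausdorff1_outer N0 = 0" using N0 emeasure_hausdorff1[of N0] by simp
    finally show ?thesis using P by simp
  qed
  then show thesis using that W energy by blast
qed

text \<open>The distance from \<open>c\<close> is 1-Lipschitz, so a covering set of diameter d is
  mapped into an interval of length at most d. This bounds the measure of the radii of circles that
  meet an exceptional set.\<close>

lemma lebesgue_dist_image_le_hausdorff1:
  assumes cN: "compact N" and h: "hausdorff1_outer (N \<inter> B) \<le> h"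
    and T: "T = {\<rho>. \<exists>y\<in>N \<inter> B. dist c y = \<rho>}" "T \<in> sets borel"
  shows "emeasure lborel T \<le> h"
proof -
  have "emeasure lborel T \<le> (\<Sum>i. ennreal (diameter (U i)))"
    if U: "N \<inter> B \<subseteq> (\<Union>i. U i)" "\<And>i. bounded (U i)" for U :: "nat \<Rightarrow> 'a set"
  proof -
    have "\<exists>l u. {\<rho>. \<exists>y\<in>U i. dist c y = \<rho>} \<subseteq> {l..u} \<and> l \<le> u \<and> u - l \<le> diameter (U i)" for i
    proof (cases "U i = {}")
      case True then show ?thesis by (intro exI[of _ 0]) auto
    next
      case False
      let ?D = "dist c ` U i"
      have bd: "bdd_below ?D" "?D \<noteq> {}" using False by (auto intro: bdd_belowI[of _ 0])
      have le: "x \<le> x' + diameter (U i)" if x: "x \<in> ?D" "x' \<in> ?D" for x x'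
      proof -
        obtain y y' where y: "y \<in> U i" "y' \<in> U i" "x = dist c y" "x' = dist c y'" using x by blast
        have "dist y' y \<le> diameter (U i)" using y U(2) diameter_bounded_bound by blast
        then show ?thesis using dist_triangle[of c y y'] y by linarith
      qed
      have "x \<le> Inf ?D + diameter (U i)" if "x \<in> ?D" for x
      proof -
        have "x - diameter (U i) \<le> Inf ?D" using le[OF that] bd by (intro cInf_greatest) (auto simp: algebra_simps)
        then show ?thesis by simp
      qed
      moreover have "Inf ?D \<le> x" if "x \<in> ?D" for x using bd that by (intro cInf_lower) auto
      ultimately show ?thesis
        using diameter_ge_0[OF U(2)[of i]] by (intro exI[of _ "Inf ?D"] exI[of _ "Inf ?D + diameter (U i)"]) auto
    qed
    then have "\<forall>i. \<exists>l u. {\<rho>. \<exists>y\<in>U i. dist c y = \<rho>} \<subseteq> {l..u} \<and> l \<le> u \<and> u - l \<le> diameter (U i)" by blast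
    then obtain l where "\<forall>i. \<exists>u. {\<rho>. \<exists>y\<in>U i. dist c y = \<rho>} \<subseteq> {l i..u} \<and> l i \<le> u \<and> u - l i \<le> diameter (U i)"
      by (rule choice[THEN exE])
    then obtain u where "\<forall>i. {\<rho>. \<exists>y\<in>U i. dist c y = \<rho>} \<subseteq> {l i..u i} \<and> l i \<le> u i \<and> u i - l i \<le> diameter (U i)"
      by (rule choice[THEN exE])
    then have lu: "\<And>i. {\<rho>. \<exists>y\<in>U i. dist c y = \<rho>} \<subseteq> {l i..u i}" "\<And>i. l i \<le> u i" "\<And>i. u i - l i \<le> diameter (U i)"
      by blast+
    have "T \<subseteq> (\<Union>i. {l i..u i})" using U(1) lu(1) unfolding T by blast
    then have "emeasure lborel T \<le> emeasure lborel (\<Union>i. {l i..u i})" by (intro emeasure_mono) auto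
    also have "\<dots> \<le> (\<Sum>i. emeasure lborel {l i..u i})" by (intro emeasure_subadditive_countably) auto
    also have "\<dots> \<le> (\<Sum>i. ennreal (diameter (U i)))"
      using lu(2,3) by (intro suminf_le) (auto intro!: ennreal_leI)
    finally show ?thesis .
  qed
  then have "emeasure lborel T \<le> hausdorff1_delta 1 (N \<inter> B)"
    unfolding hausdorff1_delta_def by (intro INF_greatest) auto
  also have "\<dots> \<le> hausdorff1_outer (N \<inter> B)" unfolding hausdorff1_outer_def by (rule SUP_upper) simp
  finally show ?thesis using h by simp
qed

section \<open>The ball construction\<close>

text \<open>Concavity of the logarithm between 1 and 1 + k * y: the quotient ln (1 + k * s) / s
  decreases in s.\<close>

lemma ln_one_plus_over_antimono:
  fixes x y k :: real assumes "0 < k" "0 < x" "x \<le> y" shows "x * ln (1 + k * y) \<le> y * ln (1 + k * x)"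
proof -
  have "concave_on {0<..} (ln :: real \<Rightarrow> real)"
    by (rule f''_le0_imp_concave[where f'="\<lambda>x. 1 / x" and f''="\<lambda>x. - 1 / x\<^sup>2"])
       (auto intro!: derivative_eq_intros simp: divide_simps power2_eq_square)
  then have "ln ((1 - x / y) * 1 + (x / y) * (1 + k * y)) \<ge> (1 - x / y) * ln 1 + (x / y) * ln (1 + k * y)"
    using assms concave_onD[of "{0<..}" ln "x / y" 1 "1 + k * y"] by (simp add: add_pos_nonneg)
  moreover have "(1 - x / y) * 1 + (x / y) * (1 + k * y) = 1 + k * x" using assms by (simp add: field_simps)
  ultimately have "(1 - x / y) * ln 1 + (x / y) * ln (1 + k * y) \<le> ln (1 + k * x)" by (simp only:)
  then have "(x / y) * ln (1 + k * y) \<le> ln (1 + k * x)" by simp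
  then show ?thesis using assms by (simp add: field_simps)
qed

text \<open>The size \<open>siz\<close> is additive under mergers and grows with speed
  \<open>lab\<close>; the radius is derived from it. The number \<open>cnt\<close> of initial balls
  fixes the power of the curvature factor, and \<open>reg\<close> is the set on which the energy of
  the item has been collected.\<close>

record item =
  ctr :: "real^2"
  bdr :: bool
  siz :: real
  cnt :: nat
  lab :: nat
  reg :: "(real^2) set"

text \<open>Here \<open>\<mu>\<close> is the energy and \<open>Z\<close> the set where \<open>f\<close> is not under control. When balls are merged into a boundary
  ball, its centre has to be moved to the curved boundary. This is paid for by the factor \<open>Fc\<close> in the
  radius, once for each of the at most \<open>N0\<close> initial balls that an item consists of. Since the cost of a circle
  of radius \<open>\<rho>\<close> is only available if it keeps the distance \<open>gap\<close> from the frontier, the energy of an item is collected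
  on circles of radius less than \<open>rad i - gap\<close>, and its label is certified on those between \<open>rad i - gap\<close> and \<open>rad i\<close>.\<close>

locale ball_construction = regular_domain +
  fixes f :: "real^2 \<Rightarrow> real^2" and Z :: "(real^2) set" and \<mu> :: "(real^2) set \<Rightarrow> real"
    and gap Fc c1 \<kappa> s1 Rcap \<mu>tot rmin :: real and N0 :: nat
  assumes f: "continuous_on (closure \<Omega>) f"
    and nz: "\<And>x. x \<in> closure \<Omega> \<Longrightarrow> x \<notin> Z \<Longrightarrow> f x \<noteq> 0"
    and tg: "\<And>x. x \<in> frontier \<Omega> \<Longrightarrow> x \<notin> Z \<Longrightarrow> \<bar>f x \<bullet> \<nu> x\<bar> \<le> (1/2) * norm (f x)"
    and mu_nonneg: "\<And>A. 0 \<le> \<mu> A"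
    and mu_mono: "\<And>A B. A \<in> sets borel \<Longrightarrow> B \<in> sets borel \<Longrightarrow> A \<subseteq> B \<Longrightarrow> \<mu> A \<le> \<mu> B"
    and mu_add: "\<And>A B. A \<in> sets borel \<Longrightarrow> B \<in> sets borel \<Longrightarrow> A \<inter> B = {} \<Longrightarrow> \<mu> A + \<mu> B \<le> \<mu> (A \<union> B)"
    and mu_tot: "\<mu> UNIV \<le> \<mu>tot"
    and pos: "0 < gap" "0 < c1" "0 < \<kappa>" "0 < s1" "0 \<le> rmin"
    and Fc: "1 \<le> Fc" "Fc ^ N0 \<le> 2" "24 * K * Rcap \<le> Fc - 1"
    and Rcap: "s1 * \<mu>tot \<le> Rcap * (c1 * ln (1 + \<kappa> * s1))" "2 * s1 \<le> Rcap" "8 * Rcap < r0" "24 * K * Rcap \<le> 1"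
    and cost_int: "\<And>c \<rho>0 \<rho>1. rmin \<le> \<rho>0 \<Longrightarrow> \<rho>0 < \<rho>1 \<Longrightarrow> \<rho>1 \<le> 2 * Rcap \<Longrightarrow> ball c (\<rho>1 + gap) \<subseteq> \<Omega> \<Longrightarrow>
      (\<And>\<rho>. \<rho>0 < \<rho> \<Longrightarrow> \<rho> < \<rho>1 \<Longrightarrow> sphere c \<rho> \<inter> Z \<inter> closure \<Omega> = {} \<and> \<not> cert f 0 c \<rho>) \<Longrightarrow>
      2 * (c1 * ln (1 + \<kappa> * \<rho>1) - c1 * ln (1 + \<kappa> * \<rho>0)) \<le> \<mu> {x. \<rho>0 < dist c x \<and> dist c x < \<rho>1}"
    and cost_bd: "\<And>c \<rho>0 \<rho>1 n. rmin \<le> \<rho>0 \<Longrightarrow> \<rho>0 < \<rho>1 \<Longrightarrow> \<rho>1 \<le> 2 * Rcap \<Longrightarrow> c \<in> frontier \<Omega> \<Longrightarrow> n \<le> 1 \<Longrightarrow>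
      (\<And>\<rho>. \<rho>0 < \<rho> \<Longrightarrow> \<rho> < \<rho>1 \<Longrightarrow> sphere c \<rho> \<inter> Z \<inter> closure \<Omega> = {} \<and> \<not> cert f n c \<rho>) \<Longrightarrow>
      (real n + 1) * (c1 * ln (1 + \<kappa> * \<rho>1) - c1 * ln (1 + \<kappa> * \<rho>0)) \<le> \<mu> {x. \<rho>0 < dist c x \<and> dist c x < \<rho>1}"
begin

text \<open>The energy owed by one unit of label at parameter \<open>s\<close>; it models the cost
  of all half circles up to radius \<open>s\<close> around a boundary point.\<close>

definition Lam :: "real \<Rightarrow> real" where "Lam s = c1 * ln (1 + \<kappa> * s)"

definition wt :: "bool \<Rightarrow> real" where "wt b = (if b then 1 else 1/2)"

definition rad :: "item \<Rightarrow> real" where "rad i = Fc ^ cnt i * siz i * wt (bdr i)"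

lemma Lam_pos: "0 < s \<Longrightarrow> 0 < Lam s" using pos by (auto simp: Lam_def intro!: mult_pos_pos ln_gt_zero)

lemma Lam_ratio: "0 < s \<Longrightarrow> s \<le> t \<Longrightarrow> s * Lam t \<le> t * Lam s"
  using ln_one_plus_over_antimono[of \<kappa> s t] pos mult_left_mono[of "s * ln (1 + \<kappa> * t)" "t * ln (1 + \<kappa> * s)" c1]
  by (simp add: Lam_def mult_ac)

text \<open>The quotient of 1 + kappa * r at the ends of an interval of radii only increases when r
  is replaced by phi * r - gap. A dilation reduces the influence of the summand 1, and the
  subtraction reduces the smaller radius relatively more.\<close>

lemma Lam_scaled_increment:
  assumes "1 \<le> \<phi>" "0 < s" "s \<le> t" "gap \<le> \<phi> * s"
  shows "Lam t - Lam s \<le> Lam (\<phi> * t - gap) - Lam (\<phi> * s - gap)"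
proof -
  have p: "0 \<le> \<kappa> * (\<phi> * s - gap)" "0 \<le> \<kappa> * (\<phi> * t - gap)" "0 \<le> \<kappa> * s" "0 \<le> \<kappa> * t"
  proof -
    have "\<phi> * s \<le> \<phi> * t" using assms by (intro mult_left_mono) auto
    then have "gap \<le> \<phi> * t" using assms(4) by simp
    then show "0 \<le> \<kappa> * (\<phi> * s - gap)" "0 \<le> \<kappa> * (\<phi> * t - gap)" "0 \<le> \<kappa> * s" "0 \<le> \<kappa> * t"
      using assms pos by (auto intro!: mult_nonneg_nonneg)
  qed
  have "(1 + \<kappa> * (\<phi> * t - gap)) * (1 + \<kappa> * s) - (1 + \<kappa> * t) * (1 + \<kappa> * (\<phi> * s - gap))
      = \<kappa> * (t - s) * (\<phi> - 1) + \<kappa> * \<kappa> * gap * (t - s)"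
    by (simp add: algebra_simps)
  also have "\<dots> \<ge> 0" using assms pos by (intro add_nonneg_nonneg mult_nonneg_nonneg) auto
  finally have "(1 + \<kappa> * t) * (1 + \<kappa> * (\<phi> * s - gap)) \<le> (1 + \<kappa> * (\<phi> * t - gap)) * (1 + \<kappa> * s)" by simp
  then have "ln ((1 + \<kappa> * t) * (1 + \<kappa> * (\<phi> * s - gap))) \<le> ln ((1 + \<kappa> * (\<phi> * t - gap)) * (1 + \<kappa> * s))"
    using p by (intro ln_mono) (auto intro!: mult_pos_pos)
  then have "ln (1 + \<kappa> * t) + ln (1 + \<kappa> * (\<phi> * s - gap)) \<le> ln (1 + \<kappa> * (\<phi> * t - gap)) + ln (1 + \<kappa> * s)"
    using p by (simp add: ln_mult)
  then have "c1 * (ln (1 + \<kappa> * t) + ln (1 + \<kappa> * (\<phi> * s - gap))) \<le> c1 * (ln (1 + \<kappa> * (\<phi> * t - gap)) + ln (1 + \<kappa> * s))"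
    using pos by (intro mult_left_mono) auto
  then show ?thesis by (simp add: Lam_def distrib_left)
qed

lemma mu_sum:
  assumes "finite I" "\<And>i. i \<in> I \<Longrightarrow> A i \<in> sets borel" "\<And>i j. i \<in> I \<Longrightarrow> j \<in> I \<Longrightarrow> i \<noteq> j \<Longrightarrow> A i \<inter> A j = {}"
  shows "(\<Sum>i\<in>I. \<mu> (A i)) \<le> \<mu> (\<Union>i\<in>I. A i)"
  using assms
proof (induction I rule: finite_induct)
  case empty then show ?case by (simp add: mu_nonneg)
next
  case (insert i I)
  have "\<mu> (A i) + (\<Sum>i\<in>I. \<mu> (A i)) \<le> \<mu> (A i) + \<mu> (\<Union>i\<in>I. A i)" using insert by (intro add_left_mono) auto
  also have "\<dots> \<le> \<mu> (A i \<union> (\<Union>i\<in>I. A i))"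
  proof (rule mu_add)
    show "A i \<inter> (\<Union>i\<in>I. A i) = {}" using insert.hyps insert.prems(2) by blast
    show "(\<Union>i\<in>I. A i) \<in> sets borel" using insert by (intro sets.finite_UN) auto
  qed (use insert in auto)
  finally show ?case using insert by simp
qed

text \<open>The clause \<open>siz i * Lam s \<le> s * \<mu> (reg i)\<close> is the energy bound;
  combined with \<open>s * lab i \<le> siz i\<close> it yields
  \<open>lab i * Lam s \<le> \<mu> (reg i)\<close>. Both hold for a merged item because sizes,
  labels and energies add up. Separation is asked only of labels below 2, since only these are ever
  glued; this admits overlapping initial balls.\<close>

definition pre :: "real \<Rightarrow> item set \<Rightarrow> bool" where
  "pre s S \<longleftrightarrow> finite S \<and> (\<Sum>i\<in>S. cnt i) \<le> N0 \<and>
     (\<forall>i\<in>S. (bdr i \<longrightarrow> ctr i \<in> frontier \<Omega>) \<and> ctr i \<in> closure \<Omega> \<and> 1 \<le> cnt i \<and> lab i \<le> 2 \<and> 2 * (rmin + gap) \<le> siz i \<and> s * lab i \<le> siz i \<and> 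
        siz i * Lam s \<le> s * \<mu> (reg i) \<and> reg i \<in> sets borel \<and> reg i \<subseteq> cball (ctr i) (rad i - gap) \<and>
        (\<forall>\<rho>. rad i - gap < \<rho> \<longrightarrow> \<rho> < rad i \<longrightarrow> cert f (lab i) (ctr i) \<rho>)) \<and>
     (\<forall>i\<in>S. \<forall>j\<in>S. i \<noteq> j \<longrightarrow> reg i \<inter> reg j = {} \<and> (lab i < 2 \<longrightarrow> lab j < 2 \<longrightarrow> rad i + rad j \<le> dist (ctr i) (ctr j))) \<and>
     Z \<inter> closure \<Omega> \<subseteq> (\<Union>i\<in>S. cball (ctr i) (rad i - gap))"

definition separated :: "item set \<Rightarrow> bool" where
  "separated S \<longleftrightarrow> (\<forall>i\<in>S. \<forall>j\<in>S. i \<noteq> j \<longrightarrow> rad i + rad j < dist (ctr i) (ctr j)) \<and>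
     (\<forall>i\<in>S. \<not> bdr i \<longrightarrow> cball (ctr i) (rad i) \<subseteq> \<Omega>)"

text \<open>It decreases at every event: a merger removes a ball, a contact with the frontier turns
  2 into 1, and a drop of a label removes 1.\<close>

definition weight :: "item set \<Rightarrow> nat" where
  "weight S = (\<Sum>i\<in>S. (if bdr i then 1 else 2) + lab i)"

lemma rad_pos: "siz i > 0 \<Longrightarrow> rad i > 0" using Fc(1) by (simp add: rad_def wt_def zero_less_power)

lemma pow_ge_1: "1 \<le> Fc ^ n" using Fc(1) by simp

lemma pow_mono: "m \<le> n \<Longrightarrow> Fc ^ m \<le> Fc ^ n" using Fc(1) by (rule power_increasing[rotated])

lemma rad_lower: assumes "2 * (rmin + gap) \<le> siz i" shows "rmin + gap \<le> rad i"
proof -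
  have s: "siz i \<ge> 0" using assms pos by simp
  have "rmin + gap \<le> siz i * (1/2)" using assms by simp
  also have "\<dots> \<le> siz i * wt (bdr i)" using s by (intro mult_left_mono) (auto simp: wt_def)
  also have "\<dots> \<le> Fc ^ cnt i * (siz i * wt (bdr i))"
    using mult_right_mono[OF pow_ge_1, of "siz i * wt (bdr i)" "cnt i"] s by (simp add: wt_def)
  finally show ?thesis by (simp add: rad_def mult.assoc)
qed

text \<open>Summing the energy bounds over the disjoint regions gives total size <= s * energy /
  \<open>Lam s\<close>. This increases with \<open>s\<close>, and at \<open>s1\<close> it is at most
  \<open>Rcap\<close> by assumption.\<close>

lemma pre_total:
  assumes p: "pre s S" and s: "0 < s" "s \<le> s1"
  shows "(\<Sum>i\<in>S. siz i) \<le> Rcap"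
proof -
  have fin: "finite S" using p by (simp add: pre_def)
  have "Lam s * (\<Sum>i\<in>S. siz i) = (\<Sum>i\<in>S. siz i * Lam s)" by (simp add: sum_distrib_left sum_distrib_right mult.commute)
  also have "\<dots> \<le> (\<Sum>i\<in>S. s * \<mu> (reg i))" using p by (intro sum_mono) (auto simp: pre_def)
  also have "\<dots> = s * (\<Sum>i\<in>S. \<mu> (reg i))" by (simp add: sum_distrib_left)
  also have "(\<Sum>i\<in>S. \<mu> (reg i)) \<le> \<mu> (\<Union>i\<in>S. reg i)" using p by (intro mu_sum) (auto simp: pre_def)
  also have "\<mu> (\<Union>i\<in>S. reg i) \<le> \<mu> UNIV"
    using p by (intro mu_mono sets.finite_UN) (auto simp: pre_def)
  also have "\<dots> \<le> \<mu>tot" by (rule mu_tot)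
  finally have 1: "Lam s * (\<Sum>i\<in>S. siz i) \<le> s * \<mu>tot" using s by (simp add: mult_left_mono)
  have "s1 * (Lam s * (\<Sum>i\<in>S. siz i)) \<le> s1 * (s * \<mu>tot)" using 1 pos by (intro mult_left_mono) auto
  also have "\<dots> = s * (s1 * \<mu>tot)" by simp
  also have "\<dots> \<le> s * (Rcap * Lam s1)" using Rcap(1) s by (intro mult_left_mono) (auto simp: Lam_def)
  also have "\<dots> = Rcap * (s * Lam s1)" by simp
  also have "\<dots> \<le> Rcap * (s1 * Lam s)" using Lam_ratio[OF s] Rcap(2) pos by (intro mult_left_mono) auto
  finally have "(s1 * Lam s) * (\<Sum>i\<in>S. siz i) \<le> (s1 * Lam s) * Rcap" by (simp add: mult_ac)
  then show ?thesis using pos Lam_pos[OF s(1)] by simp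
qed

text \<open>A cluster \<open>(c, b, T)\<close> is a ball with centre \<open>c\<close>, on the boundary if \<open>b\<close>, which contains the balls of the items
  in \<open>T\<close>; its size is the sum of their sizes. A boundary ball of radius \<open>r\<close> has size \<open>r\<close> and an interior ball
  has size \<open>2 r\<close> (it counts together with its mirror image), so that an interior ball which touches the
  boundary can be replaced by a boundary ball without changing its size.\<close>

definition csiz :: "item set \<Rightarrow> real" where "csiz T = (\<Sum>i\<in>T. siz i)"
definition ccnt :: "item set \<Rightarrow> nat" where "ccnt T = (\<Sum>i\<in>T. cnt i)"
definition crad :: "bool \<Rightarrow> item set \<Rightarrow> real" where "crad b T = Fc ^ ccnt T * csiz T * wt b"

definition clusters :: "item set \<Rightarrow> ((real^2) \<times> bool \<times> item set) set \<Rightarrow> bool" where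
  "clusters S C \<longleftrightarrow> finite C \<and> (\<Union>(c,b,T)\<in>C. T) = S \<and>
    (\<forall>(c,b,T)\<in>C. T \<noteq> {} \<and> (b \<longrightarrow> c \<in> frontier \<Omega>) \<and> (\<forall>i\<in>T. dist c (ctr i) + rad i \<le> crad b T)) \<and>
    (\<forall>(c,b,T)\<in>C. \<forall>(c',b',T')\<in>C. (c,b,T) \<noteq> (c',b',T') \<longrightarrow> T \<inter> T' = {})"

definition cweight :: "((real^2) \<times> bool \<times> item set) set \<Rightarrow> nat" where
  "cweight C = (\<Sum>(c,b,T)\<in>C. if b then 1 else 2)"

definition cseparated :: "((real^2) \<times> bool \<times> item set) set \<Rightarrow> bool" where
  "cseparated C \<longleftrightarrow> (\<forall>(c,b,T)\<in>C. \<forall>(c',b',T')\<in>C. (c,b,T) \<noteq> (c',b',T') \<longrightarrow> crad b T + crad b' T' < dist c c') \<and>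
    (\<forall>(c,b,T)\<in>C. \<not> b \<longrightarrow> cball c (crad b T) \<inter> frontier \<Omega> = {})"

lemma clusters_I:
  assumes "finite C" "(\<Union>(c,b,T)\<in>C. T) = S"
    and "\<And>c b T. (c,b,T) \<in> C \<Longrightarrow> T \<noteq> {}" "\<And>c T. (c,True,T) \<in> C \<Longrightarrow> c \<in> frontier \<Omega>"
    and "\<And>c b T i. (c,b,T) \<in> C \<Longrightarrow> i \<in> T \<Longrightarrow> dist c (ctr i) + rad i \<le> crad b T"
    and "\<And>c b T c' b' T'. (c,b,T) \<in> C \<Longrightarrow> (c',b',T') \<in> C \<Longrightarrow> (c,b,T) \<noteq> (c',b',T') \<Longrightarrow> T \<inter> T' = {}"
  shows "clusters S C"
proof -
  have "T \<noteq> {} \<and> (b \<longrightarrow> c \<in> frontier \<Omega>) \<and> (\<forall>i\<in>T. dist c (ctr i) + rad i \<le> crad b T)" if "(c,b,T) \<in> C" for c b T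
    using assms(3,5)[OF that] assms(4)[of c T] that by (cases b) auto
  then show ?thesis using assms(1,2,6) unfolding clusters_def case_prod_unfold by fastforce
qed

text \<open>Of two touching balls with one on the boundary, the boundary centre is kept: the other
  ball has half its size as radius, so it reaches no further than the sum of the sizes. Otherwise
  the centre divides the segment in the inverse ratio of the sizes, and for two boundary balls it is
  then moved to the boundary.\<close>

lemma merge_two:
  assumes siz: "0 \<le> R" "0 \<le> R'" "R + R' \<le> Rcap" and cnt: "1 \<le> n" "1 \<le> n'" "n + n' \<le> N0"
    and fr: "b \<Longrightarrow> c \<in> frontier \<Omega>" "b' \<Longrightarrow> c' \<in> frontier \<Omega>"
    and touch: "dist c c' \<le> Fc ^ n * R * wt b + Fc ^ n' * R' * wt b'"
  obtains c'' b'' where "b'' \<Longrightarrow> c'' \<in> frontier \<Omega>" "b'' \<longleftrightarrow> b \<or> b'"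
    "dist c'' c + Fc ^ n * R * wt b \<le> Fc ^ (n + n') * (R + R') * wt b''"
    "dist c'' c' + Fc ^ n' * R' * wt b' \<le> Fc ^ (n + n') * (R + R') * wt b''"
proof -
  define q where "q = Fc ^ n * R"
  define q' where "q' = Fc ^ n' * R'"
  have q: "0 \<le> q" "0 \<le> q'" using siz Fc(1) by (auto simp: q_def q'_def)
  have le: "q + q' \<le> Fc ^ (n + n') * (R + R')"
  proof -
    have "q \<le> Fc ^ (n + n') * R" "q' \<le> Fc ^ (n + n') * R'"
      unfolding q_def q'_def using siz by (auto intro!: mult_right_mono pow_mono)
    then show ?thesis by (simp add: distrib_left)
  qed
  \<comment> \<open>Each item contains at least one initial ball, so the exponent of the merged item
    exceeds both old ones. This spare factor \<open>Fc\<close> pays for moving the centre.\<close>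
  have le2: "Fc * (q + q') \<le> Fc ^ (n + n') * (R + R')"
  proof -
    have "Fc * Fc ^ n \<le> Fc ^ (n + n')" "Fc * Fc ^ n' \<le> Fc ^ (n + n')"
      using cnt pow_mono[of "Suc n" "n + n'"] pow_mono[of "Suc n'" "n + n'"] by auto
    then have "Fc * Fc ^ n * R \<le> Fc ^ (n + n') * R" "Fc * Fc ^ n' * R' \<le> Fc ^ (n + n') * R'"
      using siz by (auto intro!: mult_right_mono)
    then show ?thesis by (simp add: q_def q'_def distrib_left mult.assoc)
  qed
  show thesis
  proof (cases "b \<and> b'")
    case True
    then have b: "b" "b'" and y: "c \<in> frontier \<Omega>" "c' \<in> frontier \<Omega>" using fr by auto
    define d where "d = dist c c'"
    have d: "d \<le> q + q'" using touch b by (simp add: d_def q_def q'_def wt_def)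
    have qb: "q + q' \<le> 2 * Rcap"
    proof -
      have "Fc ^ (n + n') \<le> 2" using pow_mono[OF cnt(3)] Fc(2) by simp
      then have "Fc ^ (n + n') * (R + R') \<le> 2 * Rcap" using siz Fc(1) by (intro mult_mono) auto
      then show ?thesis using le by simp
    qed
    \<comment> \<open>This weight makes the distances from the dividing point to \<open>c\<close>
      and \<open>c'\<close> at most q' and q.\<close>
    define t where "t = (if q + q' = 0 then 0 else q' / (q + q'))"
    have t: "0 \<le> t" "t \<le> 1" using q by (auto simp: t_def divide_le_eq)
    define z0 where "z0 = (1 - t) *\<^sub>R c + t *\<^sub>R c'"
    have "z0 \<in> closed_segment c c'" using t by (auto simp: z0_def in_segment)
    moreover have "2 * d < r0" "6 * K * d \<le> 1"
    proof -
      show "2 * d < r0" using d qb Rcap(2,3) pos(4) by linarith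
      have "K * d \<le> K * (2 * Rcap)" using K d qb by (intro mult_left_mono) auto
      then show "6 * K * d \<le> 1" using Rcap(4) by linarith
    qed
    ultimately obtain z where z: "z \<in> frontier \<Omega>" "dist z z0 \<le> 6 * K * d\<^sup>2"
      using frontier_near_segment[OF y, of z0] by (auto simp: d_def)
    have "6 * K * d\<^sup>2 \<le> (Fc - 1) * (q + q')"
    proof -
      have "K * d \<le> K * (2 * Rcap)" using K d qb by (intro mult_left_mono) auto
      then have "6 * K * d \<le> Fc - 1" using Fc(3) Fc(1) by linarith
      then have "(6 * K * d) * d \<le> (Fc - 1) * (q + q')" using d q K Fc(1) by (intro mult_mono) (auto simp: d_def)
      then show ?thesis by (simp add: power2_eq_square mult.assoc)
    qed
    then have zz: "dist z z0 \<le> Fc * (q + q') - (q + q')" using z(2) by (simp add: algebra_simps)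
    have d1: "dist z0 c \<le> q'" "dist z0 c' \<le> q"
    proof -
      have "dist z0 c = t * d"
      proof -
        have "z0 - c = t *\<^sub>R (c' - c)" by (simp add: z0_def algebra_simps)
        then show ?thesis using t by (simp add: dist_norm d_def norm_minus_commute)
      qed
      moreover have "dist z0 c' = (1 - t) * d"
      proof -
        have "z0 - c' = (1 - t) *\<^sub>R (c - c')" by (simp add: z0_def algebra_simps)
        then show ?thesis using t by (simp add: dist_norm d_def)
      qed
      moreover have "t * (q + q') = q'" "(1 - t) * (q + q') = q"
      proof -
        show 1: "t * (q + q') = q'" using q by (auto simp: t_def)
        show "(1 - t) * (q + q') = q" unfolding left_diff_distrib 1 by simp
      qed
      moreover have "t * d \<le> t * (q + q')" "(1 - t) * d \<le> (1 - t) * (q + q')" using d t by (auto intro: mult_left_mono)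
      ultimately show "dist z0 c \<le> q'" "dist z0 c' \<le> q" by auto
    qed
    show thesis
    proof (rule that[of True z])
      show "dist z c + Fc ^ n * R * wt b \<le> Fc ^ (n + n') * (R + R') * wt True"
        using dist_triangle[of z c z0] d1 zz le2 b by (simp add: q_def wt_def)
      show "dist z c' + Fc ^ n' * R' * wt b' \<le> Fc ^ (n + n') * (R + R') * wt True"
        using dist_triangle[of z c' z0] d1 zz le2 b by (simp add: q'_def wt_def)
    qed (use b z in auto)
  next
    case False
    show thesis
    proof (cases "b \<or> b'")
      case True
      show thesis
      proof (cases b)
        case b: True
        then have b': "\<not> b'" using False by simp
        show thesis
          by (rule that[of True c]) (use b b' fr touch le q in \<open>auto simp: wt_def q_def q'_def\<close>)
      next
        case b: False
        then have b': "b'" using True by simp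
        show thesis
          by (rule that[of True c']) (use b b' fr touch le q in \<open>auto simp: wt_def q_def q'_def dist_commute\<close>)
      qed
    next
      case bb: False
      define t where "t = (if q + q' = 0 then 0 else q' / (q + q'))"
      have t: "0 \<le> t" "t \<le> 1" using q by (auto simp: t_def divide_le_eq)
      define z where "z = (1 - t) *\<^sub>R c + t *\<^sub>R c'"
      have d: "dist c c' \<le> (q + q') / 2" using touch bb by (simp add: q_def q'_def wt_def)
      have "dist z c = t * dist c c'"
      proof -
        have "z - c = t *\<^sub>R (c' - c)" by (simp add: z_def algebra_simps)
        then show ?thesis using t by (simp add: dist_norm norm_minus_commute)
      qed
      moreover have "dist z c' = (1 - t) * dist c c'"
      proof -
        have "z - c' = (1 - t) *\<^sub>R (c - c')" by (simp add: z_def algebra_simps)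
        then show ?thesis using t by (simp add: dist_norm)
      qed
      moreover have "t * ((q + q') / 2) = q' / 2" "(1 - t) * ((q + q') / 2) = q / 2"
      proof -
        show 1: "t * ((q + q') / 2) = q' / 2" using q by (auto simp: t_def)
        show "(1 - t) * ((q + q') / 2) = q / 2" unfolding left_diff_distrib 1 by (simp add: field_simps)
      qed
      moreover have "t * dist c c' \<le> t * ((q + q') / 2)" "(1 - t) * dist c c' \<le> (1 - t) * ((q + q') / 2)"
        using d t by (intro mult_left_mono; simp)+
      ultimately have "dist z c \<le> q' / 2" "dist z c' \<le> q / 2" by auto
      then show thesis
        by (intro that[of False z]) (use bb le in \<open>auto simp: wt_def q_def q'_def\<close>)
    qed
  qed
qed

text \<open>As long as two clusters touch or an interior one meets the boundary, the offending
  clusters are replaced, and \<open>cweight\<close> falls. The last alternative records that a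
  violation was really repaired, which later drives the induction.\<close>

lemma clusters_exist:
  assumes p: "pre s S" and s: "0 < s" "s \<le> s1"
    and C: "clusters S C"
  shows "\<exists>C'. clusters S C' \<and> cseparated C' \<and> cweight C' \<le> cweight C \<and> (cseparated C \<or> cweight C' < cweight C)"
  using C
proof (induction "cweight C" arbitrary: C rule: less_induct)
  case less
  note C = less.prems
  have cn: "1 \<le> cnt i" if "i \<in> S" for i using p that by (auto simp: pre_def)
  have finC: "finite C" and finS: "finite S" using C p by (auto simp: clusters_def pre_def)
  have TS: "T \<subseteq> S" "finite T" "T \<noteq> {}" "b \<Longrightarrow> c \<in> frontier \<Omega>" "\<And>i. i \<in> T \<Longrightarrow> dist c (ctr i) + rad i \<le> crad b T"
    if "(c, b, T) \<in> C" for c b T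
  proof -
    show "T \<subseteq> S" using C that unfolding clusters_def by blast
    then show "finite T" using finS finite_subset by blast
    show "T \<noteq> {}" "b \<Longrightarrow> c \<in> frontier \<Omega>" "\<And>i. i \<in> T \<Longrightarrow> dist c (ctr i) + rad i \<le> crad b T"
      using C that unfolding clusters_def by blast+
  qed
  have sp: "siz i > 0" if "i \<in> S" for i
  proof -
    have "2 * (rmin + gap) \<le> siz i" using p that by (auto simp: pre_def)
    then show ?thesis using pos(1,5) by simp
  qed
  have disj: "T \<inter> T' = {}" if "(c,b,T) \<in> C" "(c',b',T') \<in> C" "(c,b,T) \<noteq> (c',b',T')" for c b T c' b' T'
  proof -
    have "\<forall>x\<in>C. \<forall>x'\<in>C. x \<noteq> x' \<longrightarrow> snd (snd x) \<inter> snd (snd x') = {}"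
      using C unfolding clusters_def case_prod_unfold by simp
    then show ?thesis using that by fastforce
  qed
  have cov: "(\<Union>(c,b,T)\<in>C. T) = S" using C unfolding clusters_def by blast
  have cz: "0 \<le> csiz T" if "T \<subseteq> S" for T unfolding csiz_def using sp that by (intro sum_nonneg) (auto simp: less_imp_le subset_iff)
  show ?case
  proof (cases "cseparated C")
    case True then show ?thesis using C by blast
  next
    case False
    have "\<exists>C'. clusters S C' \<and> cweight C' < cweight C"
    proof (cases "\<exists>(c,b,T)\<in>C. \<not> b \<and> cball c (crad b T) \<inter> frontier \<Omega> \<noteq> {}")
      case True
      then obtain c T y where cT: "(c, False, T) \<in> C" and y: "y \<in> cball c (crad False T)" "y \<in> frontier \<Omega>"
        by force
      \<comment> \<open>The cluster is recentred at a point \<open>y\<close> where it meets the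
        boundary. Its radius doubles, since the factor \<open>wt\<close> passes from 1/2 to 1, so it
        still contains all its items.\<close>
      define C' where "C' = insert (y, True, T) (C - {(c, False, T)})"
      have nin: "(y, True, T) \<notin> C"
      proof
        assume a: "(y, True, T) \<in> C"
        have "T \<inter> T = {}" by (rule disj[OF a cT]) simp
        then show False using TS(3)[OF cT] by simp
      qed
      have d: "U \<inter> T = {}" if "(x,b,U) \<in> C - {(c, False, T)}" for x b U
        using disj[of x b U c False T] cT that by blast
      have "clusters S C'"
      proof (rule clusters_I)
        show "finite C'" using finC by (simp add: C'_def)
        have Ceq: "C = insert (c, False, T) (C - {(c, False, T)})" using cT by auto
        then have "S = T \<union> (\<Union>(c,b,T)\<in>C - {(c, False, T)}. T)" using cov by (metis (no_types, lifting) UN_insert case_prod_conv)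
        then show "(\<Union>(c,b,T)\<in>C'. T) = S" by (simp add: C'_def)
      next
        fix x b U assume "(x,b,U) \<in> C'"
        then show "U \<noteq> {}" using TS(3)[OF cT] TS(3)[of x b U] unfolding C'_def by blast
      next
        fix x U assume "(x,True,U) \<in> C'"
        then show "x \<in> frontier \<Omega>" using y(2) TS(4)[of x True U] unfolding C'_def by blast
      next
        fix x b U i assume a: "(x,b,U) \<in> C'" "i \<in> U"
        show "dist x (ctr i) + rad i \<le> crad b U"
        proof (cases "(x,b,U) = (y,True,T)")
          case True
          then show ?thesis
            using TS(5)[OF cT, of i] a y(1) dist_triangle[of y "ctr i" c] by (simp add: crad_def wt_def dist_commute)
        next
          case False
          then show ?thesis using a TS(5)[of x b U i] unfolding C'_def by blast
        qed
      next
        fix x b U x' b' U'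
        assume "(x,b,U) \<in> C'" "(x',b',U') \<in> C'" "(x,b,U) \<noteq> (x',b',U')"
        then show "U \<inter> U' = {}"
          using d[of x b U] d[of x' b' U'] disj[of x b U x' b' U'] unfolding C'_def by blast
      qed
      moreover have "cweight C' < cweight C"
      proof -
        have "cweight C = 2 + (\<Sum>(c,b,T)\<in>C - {(c, False, T)}. if b then 1 else 2)"
          unfolding cweight_def by (subst sum.remove[OF finC cT]) simp
        moreover have "cweight C' = 1 + (\<Sum>(c,b,T)\<in>C - {(c, False, T)}. if b then 1 else 2)"
          unfolding cweight_def C'_def using nin finC by (subst sum.insert) auto
        ultimately show ?thesis by simp
      qed
      ultimately show ?thesis by blast
    next
      case nofr: False
      have "\<exists>x\<in>C. \<exists>x'\<in>C. x \<noteq> x' \<and>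
          dist (fst x) (fst x') \<le> crad (fst (snd x)) (snd (snd x)) + crad (fst (snd x')) (snd (snd x'))"
      proof (rule ccontr)
        assume "\<not> ?thesis"
        moreover have "\<forall>x\<in>C. \<not> fst (snd x) \<longrightarrow> cball (fst x) (crad (fst (snd x)) (snd (snd x))) \<inter> frontier \<Omega> = {}"
          using nofr unfolding case_prod_unfold by blast
        ultimately have "cseparated C" unfolding cseparated_def case_prod_unfold by (force simp: not_le)
        then show False using False by simp
      qed
      then have "\<exists>c b T c' b' T'. (c,b,T) \<in> C \<and> (c',b',T') \<in> C \<and> (c,b,T) \<noteq> (c',b',T') \<and> dist c c' \<le> crad b T + crad b' T'"
        by (metis prod.collapse)
      then obtain c b T c' b' T' where cc: "(c,b,T) \<in> C" "(c',b',T') \<in> C" "(c,b,T) \<noteq> (c',b',T')"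
        "dist c c' \<le> crad b T + crad b' T'" by blast
      have TT: "T \<inter> T' = {}" using disj cc by blast
      have sub: "T \<union> T' \<subseteq> S" using TS cc by blast
      have csum: "csiz (T \<union> T') = csiz T + csiz T'" "ccnt (T \<union> T') = ccnt T + ccnt T'"
        unfolding csiz_def ccnt_def using TS(2)[OF cc(1)] TS(2)[OF cc(2)] TT by (auto intro: sum.union_disjoint)
      have tot: "csiz T + csiz T' \<le> Rcap"
      proof -
        have "csiz (T \<union> T') \<le> (\<Sum>i\<in>S. siz i)"
          unfolding csiz_def using sub finS sp by (intro sum_mono2) (auto simp: less_imp_le)
        then show ?thesis using pre_total[OF p s] csum by simp
      qed
      have cntot: "ccnt T + ccnt T' \<le> N0"
      proof -
        have "ccnt (T \<union> T') \<le> (\<Sum>i\<in>S. cnt i)" unfolding ccnt_def using sub finS by (intro sum_mono2) auto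
        then show ?thesis using p csum by (simp add: pre_def)
      qed
      have cn1: "1 \<le> ccnt T" if inC: "(c,b,T) \<in> C" for c b T
      proof -
        obtain i where i: "i \<in> T" using TS(3)[OF inC] by blast
        then have "cnt i \<le> ccnt T" unfolding ccnt_def using TS(2)[OF inC] by (intro member_le_sum) auto
        moreover have "1 \<le> cnt i" using cn[of i] TS(1)[OF inC] i by blast
        ultimately show ?thesis by simp
      qed
      obtain c'' b'' where m: "b'' \<Longrightarrow> c'' \<in> frontier \<Omega>" "b'' \<longleftrightarrow> b \<or> b'"
        "dist c'' c + crad b T \<le> crad b'' (T \<union> T')" "dist c'' c' + crad b' T' \<le> crad b'' (T \<union> T')"
        by (rule merge_two[OF cz[of T] cz[of T'] tot cn1[OF cc(1)] cn1[OF cc(2)] cntot TS(4)[OF cc(1)] TS(4)[OF cc(2)]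
              cc(4)[unfolded crad_def]])
           (use TS(1)[OF cc(1)] TS(1)[OF cc(2)] in \<open>auto simp: crad_def csum\<close>)
      define C0 where "C0 = C - {(c,b,T)} - {(c',b',T')}"
      define C' where "C' = insert (c'', b'', T \<union> T') C0"
      have Ceq: "C = insert (c,b,T) (insert (c',b',T') C0)" using cc by (auto simp: C0_def)
      have Tne: "T \<noteq> {}" "T' \<noteq> {}" using TS cc by blast+
      have nin: "(c'', b'', T \<union> T') \<notin> C0"
      proof
        assume a: "(c'', b'', T \<union> T') \<in> C0"
        then have "(c'', b'', T \<union> T') \<in> C" "(c'', b'', T \<union> T') \<noteq> (c,b,T)" by (auto simp: C0_def)
        then have "(T \<union> T') \<inter> T = {}" using disj cc(1) by blast
        then show False using Tne by blast
      qed
      have d0: "U \<inter> (T \<union> T') = {}" if "(x,y,U) \<in> C0" for x y U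
      proof -
        have "(x,y,U) \<in> C" "(x,y,U) \<noteq> (c,b,T)" "(x,y,U) \<noteq> (c',b',T')" using that by (auto simp: C0_def)
        then show ?thesis using disj[of x y U c b T] disj[of x y U c' b' T'] cc by blast
      qed
      have C0C: "(x,y,U) \<in> C" if "(x,y,U) \<in> C0" for x y U using that by (simp add: C0_def)
      have "clusters S C'"
      proof (rule clusters_I)
        show "finite C'" using finC by (simp add: C'_def C0_def)
        have "S = T \<union> (T' \<union> (\<Union>(c,b,T)\<in>C0. T))" using cov Ceq by (metis (no_types, lifting) UN_insert case_prod_conv)
        then show "(\<Union>(c,b,T)\<in>C'. T) = S" by (simp add: C'_def Un_assoc)
      next
        fix x y U assume "(x,y,U) \<in> C'"
        then show "U \<noteq> {}" using Tne TS(3)[of x y U] C0C unfolding C'_def by blast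
      next
        fix x U assume "(x,True,U) \<in> C'"
        then show "x \<in> frontier \<Omega>" using m(1) TS(4)[of x True U] C0C unfolding C'_def by blast
      next
        fix x y U i assume a: "(x,y,U) \<in> C'" "i \<in> U"
        show "dist x (ctr i) + rad i \<le> crad y U"
        proof (cases "(x,y,U) = (c'',b'',T \<union> T')")
          case True
          show ?thesis
          proof (cases "i \<in> T")
            case iT: True
            then show ?thesis using TS(5)[OF cc(1) iT] m(3) dist_triangle[of c'' "ctr i" c] True by force
          next
            case False
            then have "i \<in> T'" using a True by blast
            then show ?thesis using TS(5)[OF cc(2)] m(4) dist_triangle[of c'' "ctr i" c'] True by force
          qed
        next
          case False
          then show ?thesis using a TS(5)[of x y U i] C0C unfolding C'_def by blast
        qed
      next
        fix x y U x' y' U'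
        assume "(x,y,U) \<in> C'" "(x',y',U') \<in> C'" "(x,y,U) \<noteq> (x',y',U')"
        then show "U \<inter> U' = {}"
          using d0[of x y U] d0[of x' y' U'] disj[of x y U x' y' U'] C0C unfolding C'_def by blast
      qed
      moreover have "cweight C' < cweight C"
      proof -
        have "(c',b',T') \<notin> C0" "(c,b,T) \<notin> insert (c',b',T') C0" "finite C0" using cc finC by (auto simp: C0_def)
        then have "cweight C = (if b then 1 else 2) + ((if b' then 1 else 2) + cweight C0)"
          unfolding Ceq cweight_def by simp
        moreover have "cweight C' = (if b'' then 1 else 2) + cweight C0"
          unfolding C'_def cweight_def using nin \<open>finite C0\<close> by simp
        ultimately show ?thesis using m(2) by auto
      qed
      ultimately show ?thesis by blast
    qed
    then obtain C' where C': "clusters S C'" "cweight C' < cweight C" by blast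
    from less.hyps[OF C'(2) C'(1)] C'(2) show ?thesis by fastforce
  qed
qed

end

section \<open>Merging and growing the balls until the final scale\<close>

context ball_construction
begin

lemma preD:
  assumes "pre s S" "i \<in> S"
  shows "bdr i \<Longrightarrow> ctr i \<in> frontier \<Omega>" "ctr i \<in> closure \<Omega>" "1 \<le> cnt i" "lab i \<le> 2" "2 * (rmin + gap) \<le> siz i"
    "s * lab i \<le> siz i" "siz i * Lam s \<le> s * \<mu> (reg i)" "reg i \<in> sets borel" "reg i \<subseteq> cball (ctr i) (rad i - gap)"
    "\<And>\<rho>. rad i - gap < \<rho> \<Longrightarrow> \<rho> < rad i \<Longrightarrow> cert f (lab i) (ctr i) \<rho>"
  using assms unfolding pre_def by blast+

lemma pre_globalD:
  assumes "pre s S"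
  shows "finite S" "(\<Sum>i\<in>S. cnt i) \<le> N0" "Z \<inter> closure \<Omega> \<subseteq> (\<Union>i\<in>S. cball (ctr i) (rad i - gap))"
    "\<And>i j. i \<in> S \<Longrightarrow> j \<in> S \<Longrightarrow> i \<noteq> j \<Longrightarrow> reg i \<inter> reg j = {}"
    "\<And>i j. i \<in> S \<Longrightarrow> j \<in> S \<Longrightarrow> i \<noteq> j \<Longrightarrow> lab i < 2 \<Longrightarrow> lab j < 2 \<Longrightarrow> rad i + rad j \<le> dist (ctr i) (ctr j)"
  using assms unfolding pre_def by blast+

lemma siz_pos: "pre s S \<Longrightarrow> i \<in> S \<Longrightarrow> 0 < siz i" using preD(5)[of s S i] pos(1,5) by simp

lemma rad_gap: "pre s S \<Longrightarrow> i \<in> S \<Longrightarrow> rmin + gap \<le> rad i" using rad_lower preD(5) by blast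

text \<open>Every item starts as a cluster of its own. The final clusters are turned back into
  items, whose labels are the sums of the old ones, capped at 2; \<open>cert_glue\<close> certifies
  them.\<close>

lemma merge_step:
  assumes p: "pre s S" and s: "0 < s" "s \<le> s1"
  shows "\<exists>S'. pre s S' \<and> separated S' \<and> weight S' \<le> weight S \<and> (separated S \<or> weight S' < weight S)"
proof -
  note P = preD[OF p] and P2 = pre_globalD[OF p]
  define C0 where "C0 = (\<lambda>i. (ctr i, bdr i, {i})) ` S"
  have inj0: "inj_on (\<lambda>i. (ctr i, bdr i, {i})) S" by (auto simp: inj_on_def)
  have cr0: "crad (bdr i) {i} = rad i" for i by (simp add: crad_def ccnt_def csiz_def rad_def)
  have "clusters S C0"
  proof (rule clusters_I)
    show "(\<Union>(c,b,T)\<in>C0. T) = S" by (auto simp: C0_def)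
  qed (use P P2 cr0 in \<open>auto simp: C0_def\<close>)
  from clusters_exist[OF p s this] obtain C where C: "clusters S C" and sepC: "cseparated C"
    and w: "cweight C \<le> cweight C0" and w': "cseparated C0 \<or> cweight C < cweight C0" by blast
  have finC: "finite C" and cov: "(\<Union>x\<in>C. snd (snd x)) = S"
    and CD: "\<And>x. x \<in> C \<Longrightarrow> snd (snd x) \<noteq> {}" "\<And>x. x \<in> C \<Longrightarrow> fst (snd x) \<Longrightarrow> fst x \<in> frontier \<Omega>"
      "\<And>x i. x \<in> C \<Longrightarrow> i \<in> snd (snd x) \<Longrightarrow> dist (fst x) (ctr i) + rad i \<le> crad (fst (snd x)) (snd (snd x))"
    and Cdis: "\<And>x x'. x \<in> C \<Longrightarrow> x' \<in> C \<Longrightarrow> x \<noteq> x' \<Longrightarrow> snd (snd x) \<inter> snd (snd x') = {}"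
    using C unfolding clusters_def case_prod_unfold by auto
  have Csep: "\<And>x x'. x \<in> C \<Longrightarrow> x' \<in> C \<Longrightarrow> x \<noteq> x' \<Longrightarrow>
      crad (fst (snd x)) (snd (snd x)) + crad (fst (snd x')) (snd (snd x')) < dist (fst x) (fst x')"
    and Cfr: "\<And>x. x \<in> C \<Longrightarrow> \<not> fst (snd x) \<Longrightarrow> cball (fst x) (crad (fst (snd x)) (snd (snd x))) \<inter> frontier \<Omega> = {}"
    using sepC unfolding cseparated_def case_prod_unfold by auto
  have sub: "snd (snd x) \<subseteq> S" "finite (snd (snd x))" if "x \<in> C" for x
  proof -
    show "snd (snd x) \<subseteq> S" using cov that by blast
    then show "finite (snd (snd x))" using P2(1) finite_subset by blast
  qed
  define mk where "mk x = \<lparr>ctr = fst x, bdr = fst (snd x), siz = csiz (snd (snd x)), cnt = ccnt (snd (snd x)),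
      lab = min 2 (\<Sum>i\<in>snd (snd x). lab i), reg = (\<Union>i\<in>snd (snd x). reg i)\<rparr>" for x
  have mk: "ctr (mk x) = fst x" "bdr (mk x) = fst (snd x)" "siz (mk x) = csiz (snd (snd x))"
    "cnt (mk x) = ccnt (snd (snd x))" "lab (mk x) = min 2 (\<Sum>i\<in>snd (snd x). lab i)"
    "reg (mk x) = (\<Union>i\<in>snd (snd x). reg i)" "rad (mk x) = crad (fst (snd x)) (snd (snd x))" for x
    by (simp_all add: mk_def rad_def crad_def)
  have cpos: "0 < crad (fst (snd x)) (snd (snd x))" if x: "x \<in> C" for x
  proof -
    obtain i where i: "i \<in> snd (snd x)" using CD(1)[OF x] by blast
    have "0 < rad i" using rad_pos siz_pos[OF p] sub(1)[OF x] i by blast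
    then show ?thesis using CD(3)[OF x i] zero_le_dist[of "fst x" "ctr i"] by linarith
  qed
  have injmk: "inj_on mk C"
  proof
    fix x x' assume a: "x \<in> C" "x' \<in> C" "mk x = mk x'"
    show "x = x'"
    proof (rule ccontr)
      assume "x \<noteq> x'"
      from Csep[OF a(1,2) this] have "0 < dist (fst x) (fst x')" using cpos[OF a(1)] cpos[OF a(2)] by linarith
      then show False using mk(1)[of x] mk(1)[of x'] a(3) by simp
    qed
  qed
  define S' where "S' = mk ` C"
  have sumS: "(\<Sum>x\<in>C. \<Sum>i\<in>snd (snd x). h i) = (\<Sum>i\<in>S. h i)" for h :: "item \<Rightarrow> nat"
    unfolding cov[symmetric] using finC sub(2) Cdis by (intro sum.UNION_disjoint[symmetric]) auto
  have inside: "cball (fst x) (crad (fst (snd x)) (snd (snd x))) \<subseteq> \<Omega>" if x: "x \<in> C" "\<not> fst (snd x)" for x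
  proof -
    obtain i where i: "i \<in> snd (snd x)" using CD(1)[OF x(1)] by blast
    have iS: "i \<in> S" using sub(1)[OF x(1)] i by blast
    have "0 < rad i" using rad_pos siz_pos[OF p] iS by blast
    then have "ctr i \<in> cball (fst x) (crad (fst (snd x)) (snd (snd x)))" using CD(3)[OF x(1) i] by simp
    then show ?thesis using P(2)[OF iS] Cfr[OF x] by (rule cball_inside)
  qed
  have sep: "separated S'"
    unfolding separated_def
  proof (intro conjI ballI impI)
    fix i j assume "i \<in> S'" "j \<in> S'" "i \<noteq> j"
    then obtain x y where "x \<in> C" "i = mk x" "y \<in> C" "j = mk y" "x \<noteq> y" unfolding S'_def by blast
    then show "rad i + rad j < dist (ctr i) (ctr j)" using Csep[of x y] by (simp add: mk)
  next
    fix i assume "i \<in> S'" "\<not> bdr i"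
    then obtain x where "x \<in> C" "i = mk x" "\<not> fst (snd x)" by (auto simp: S'_def mk)
    then show "cball (ctr i) (rad i) \<subseteq> \<Omega>" using inside[of x] by (simp add: mk)
  qed
  have certs: "cert f (lab (mk x)) (fst x) \<rho>"
    if x: "x \<in> C" and \<rho>: "rad (mk x) - gap < \<rho>" "\<rho> < rad (mk x)" for x \<rho>
  proof (cases "2 \<le> (\<Sum>i\<in>snd (snd x). lab i)")
    case True then show ?thesis by (simp add: mk cert_2)
  next
    case False
    let ?T = "snd (snd x)"
    \<comment> \<open>Half of the excess of \<open>\<rho>\<close> over the inner radius is given to
      each item. So its radius lies in the range where a certificate is known, the closed balls
      remain disjoint, and they fit into the open ball of radius \<open>\<rho>\<close>.\<close>
    define t where "t = \<rho> - (rad (mk x) - gap)"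
    have t: "0 < t" "t < gap" using \<rho> by (auto simp: t_def)
    have lab2: "lab i < 2" if "i \<in> ?T" for i
      using member_le_sum[OF that, of lab] sub(2)[OF x] False by simp
    show ?thesis
    proof (rule cert_glue[where L="?T" and ctr=ctr and rad="\<lambda>i. rad i - gap + t/2" and lab=lab])
      show "finite ?T" by (rule sub(2)[OF x])
      show "continuous_on (closure \<Omega>) f" by (rule f)
      \<comment> \<open>A point of \<open>Z\<close> is covered by some item; an item of another
        cluster is excluded because the clusters are separated.\<close>
      have zf: "y \<notin> Z" if y: "y \<in> cball (fst x) \<rho>" "y \<in> closure \<Omega>" "\<And>i. i \<in> ?T \<Longrightarrow> y \<notin> ball (ctr i) (rad i - gap + t/2)" for y
      proof
        assume "y \<in> Z"
        then obtain j where j: "j \<in> S" "y \<in> cball (ctr j) (rad j - gap)" using P2(3) y(2) by blast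
        then have "j \<notin> ?T" using y(3)[of j] t by auto
        moreover obtain x' where x': "x' \<in> C" "j \<in> snd (snd x')" using cov j by blast
        ultimately have "x \<noteq> x'" by blast
        from Csep[OF x x'(1) this] have lt: "crad (fst (snd x)) ?T + crad (fst (snd x')) (snd (snd x')) < dist (fst x) (fst x')" .
        have "dist (fst x') y \<le> crad (fst (snd x')) (snd (snd x'))"
          using CD(3)[OF x'] j(2) dist_triangle[of "fst x'" y "ctr j"] pos(1) by simp
        moreover have "dist (fst x) y < crad (fst (snd x)) ?T" using y(1) \<rho>(2) mk(7)[of x] by simp
        ultimately show False using lt dist_triangle[of "fst x" "fst x'" y] by (simp add: dist_commute)
      qed
      show "f y \<noteq> 0" if "y \<in> cball (fst x) \<rho>" "y \<in> closure \<Omega>" "\<And>i. i \<in> ?T \<Longrightarrow> y \<notin> ball (ctr i) (rad i - gap + t/2)" for y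
        using nz[of y] zf[OF that] that(2) by blast
      show "\<bar>f y \<bullet> \<nu> y\<bar> \<le> 1/2 * norm (f y)" if "y \<in> cball (fst x) \<rho>" "y \<in> frontier \<Omega>"
        "\<And>i. i \<in> ?T \<Longrightarrow> y \<notin> ball (ctr i) (rad i - gap + t/2)" for y
        using tg[of y] zf[of y] that frontier_subset_closure by blast
      show "cball (ctr i) (rad i - gap + t/2) \<subseteq> ball (fst x) \<rho>" if i: "i \<in> ?T" for i
      proof
        fix y assume "y \<in> cball (ctr i) (rad i - gap + t/2)"
        then have "dist (ctr i) y \<le> rad i - gap + t/2" by simp
        then have "dist (fst x) y < \<rho>"
          using CD(3)[OF x i] dist_triangle[of "fst x" y "ctr i"] t(1) mk(7)[of x] t_def by linarith
        then show "y \<in> ball (fst x) \<rho>" by simp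
      qed
      show "cball (ctr i) (rad i - gap + t/2) \<inter> cball (ctr j) (rad j - gap + t/2) = {}"
        if ij: "i \<in> ?T" "j \<in> ?T" "i \<noteq> j" for i j
      proof -
        have "rad i + rad j \<le> dist (ctr i) (ctr j)"
          using P2(5)[of i j] ij lab2 sub(1)[OF x] by blast
        then show ?thesis using t by (intro disjoint_cballI) auto
      qed
      show "cert f (lab i) (ctr i) (rad i - gap + t/2)" if i: "i \<in> ?T" for i
        using P(10)[of i "rad i - gap + t/2"] i sub(1)[OF x] t by auto
      show "(\<Sum>i\<in>?T. lab i) \<le> lab (mk x)" using False by (simp add: mk)
    qed
  qed
  have "pre s S'" unfolding pre_def
  proof (intro conjI ballI allI impI)
    show "finite S'" using finC by (simp add: S'_def)
    have "(\<Sum>i\<in>S'. cnt i) = (\<Sum>x\<in>C. ccnt (snd (snd x)))" unfolding S'_def by (simp add: sum.reindex[OF injmk] mk)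
    then show "(\<Sum>i\<in>S'. cnt i) \<le> N0" using P2(2) sumS[of cnt] by (simp add: ccnt_def)
    show "Z \<inter> closure \<Omega> \<subseteq> (\<Union>i\<in>S'. cball (ctr i) (rad i - gap))"
    proof
      fix y assume "y \<in> Z \<inter> closure \<Omega>"
      then obtain j where j: "j \<in> S" "y \<in> cball (ctr j) (rad j - gap)" using P2(3) by blast
      obtain x where x: "x \<in> C" "j \<in> snd (snd x)" using cov j by blast
      have "y \<in> cball (ctr (mk x)) (rad (mk x) - gap)"
        using CD(3)[OF x] j(2) dist_triangle[of "fst x" y "ctr j"] by (simp add: mk)
      then show "y \<in> (\<Union>i\<in>S'. cball (ctr i) (rad i - gap))" using x by (auto simp: S'_def)
    qed
  next
    fix i assume "i \<in> S'"
    then obtain x where x: "x \<in> C" "i = mk x" by (auto simp: S'_def)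
    let ?T = "snd (snd x)"
    obtain j where j: "j \<in> ?T" using CD(1)[OF x(1)] by blast
    have TS: "k \<in> S" if "k \<in> ?T" for k using sub(1)[OF x(1)] that by blast
    show "ctr i \<in> frontier \<Omega>" if "bdr i" using CD(2)[OF x(1)] that x by (simp add: mk)
    show "ctr i \<in> closure \<Omega>"
    proof (cases "fst (snd x)")
      case True then show ?thesis using CD(2)[OF x(1)] frontier_subset_closure x by (auto simp: mk)
    next
      case False
      have "fst x \<in> cball (fst x) (crad (fst (snd x)) ?T)" using cpos[OF x(1)] by simp
      then have "fst x \<in> \<Omega>" using inside[OF x(1) False] by blast
      then show ?thesis using closure_subset[of \<Omega>] x by (auto simp: mk)
    qed
    have "cnt j \<le> ccnt ?T" unfolding ccnt_def using sub(2)[OF x(1)] j by (intro member_le_sum) auto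
    then show "1 \<le> cnt i" using P(3)[OF TS[OF j]] x by (simp add: mk)
    show "lab i \<le> 2" using x by (simp add: mk)
    have "siz j \<le> csiz ?T" unfolding csiz_def using sub(2)[OF x(1)] j siz_pos[OF p] TS
      by (intro member_le_sum) (auto simp: less_imp_le)
    then show "2 * (rmin + gap) \<le> siz i" using P(5)[OF TS[OF j]] x by (simp add: mk)
    have "s * real (min 2 (\<Sum>i\<in>?T. lab i)) \<le> s * real (\<Sum>i\<in>?T. lab i)" using s by (intro mult_left_mono of_nat_mono) auto
    also have "\<dots> = (\<Sum>i\<in>?T. s * real (lab i))" by (simp add: sum_distrib_left)
    also have "\<dots> \<le> csiz ?T" unfolding csiz_def using P(6) TS by (intro sum_mono) auto
    finally show "s * lab i \<le> siz i" using x by (simp add: mk)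
    have "csiz ?T * Lam s = (\<Sum>i\<in>?T. siz i * Lam s)" by (simp add: csiz_def sum_distrib_right)
    also have "\<dots> \<le> (\<Sum>i\<in>?T. s * \<mu> (reg i))" using P(7) TS by (intro sum_mono) auto
    also have "\<dots> = s * (\<Sum>i\<in>?T. \<mu> (reg i))" by (simp add: sum_distrib_left)
    also have "\<dots> \<le> s * \<mu> (\<Union>i\<in>?T. reg i)"
      using s sub(2)[OF x(1)] P(8) P2(4) TS by (intro mult_left_mono mu_sum) auto
    finally show "siz i * Lam s \<le> s * \<mu> (reg i)" using x by (simp add: mk)
    show "reg i \<in> sets borel" using x sub(2)[OF x(1)] P(8) TS by (auto simp: mk intro!: sets.finite_UN)
    show "reg i \<subseteq> cball (ctr i) (rad i - gap)"
    proof
      fix y assume "y \<in> reg i"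
      then obtain k where k: "k \<in> ?T" "y \<in> reg k" using x by (auto simp: mk)
      then have "dist (ctr k) y \<le> rad k - gap" using P(9)[OF TS[OF k(1)]] by auto
      then show "y \<in> cball (ctr i) (rad i - gap)"
        using CD(3)[OF x(1) k(1)] dist_triangle[of "fst x" y "ctr k"] x by (simp add: mk)
    qed
    show "cert f (lab i) (ctr i) \<rho>" if "rad i - gap < \<rho>" "\<rho> < rad i" for \<rho>
      using certs[OF x(1), of \<rho>] that x(2) by (simp add: mk(1))
    fix i' assume i': "i' \<in> S'" "i \<noteq> i'"
    then obtain x' where x': "x' \<in> C" "i' = mk x'" "x \<noteq> x'" using x by (auto simp: S'_def)
    show "reg i \<inter> reg i' = {}"
    proof -
      have "reg k \<inter> reg k' = {}" if "k \<in> ?T" "k' \<in> snd (snd x')" for k k'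
        using P2(4)[of k k'] that TS sub(1)[OF x'(1)] Cdis[OF x(1) x'(1,3)] by blast
      then show ?thesis using x x' by (auto simp: mk)
    qed
    show "rad i + rad i' \<le> dist (ctr i) (ctr i')" if "lab i < 2" "lab i' < 2"
      using Csep[OF x(1) x'(1,3)] x x' by (simp add: mk)
  qed
  moreover have cw0: "cweight C0 + (\<Sum>i\<in>S. lab i) = weight S"
    unfolding cweight_def C0_def weight_def by (simp add: sum.reindex[OF inj0] sum.distrib)
  moreover have "weight S' \<le> cweight C + (\<Sum>i\<in>S. lab i)"
  proof -
    have "weight S' = (\<Sum>x\<in>C. (if fst (snd x) then 1 else 2) + min 2 (\<Sum>i\<in>snd (snd x). lab i))"
      unfolding weight_def S'_def by (simp add: sum.reindex[OF injmk] mk)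
    also have "\<dots> \<le> (\<Sum>x\<in>C. (if fst (snd x) then 1 else 2) + (\<Sum>i\<in>snd (snd x). lab i))"
      by (intro sum_mono add_left_mono) auto
    also have "\<dots> = cweight C + (\<Sum>i\<in>S. lab i)"
      unfolding sum.distrib sumS cweight_def case_prod_unfold by simp
    finally show ?thesis .
  qed
  moreover have "separated S" if "cseparated C0"
  proof -
    have 1: "rad i + rad j < dist (ctr i) (ctr j)" if "i \<in> S" "j \<in> S" "i \<noteq> j" for i j
    proof -
      have "(ctr i, bdr i, {i}) \<in> C0" "(ctr j, bdr j, {j}) \<in> C0" "(ctr i, bdr i, {i}) \<noteq> (ctr j, bdr j, {j})"
        using that by (auto simp: C0_def)
      then show ?thesis using \<open>cseparated C0\<close> unfolding cseparated_def case_prod_unfold cr0[symmetric] by fastforce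
    qed
    have 2: "cball (ctr i) (rad i) \<subseteq> \<Omega>" if "i \<in> S" "\<not> bdr i" for i
    proof (rule cball_inside[of "ctr i"])
      show "ctr i \<in> cball (ctr i) (rad i)" using rad_pos[OF siz_pos[OF p that(1)]] by simp
      have "(ctr i, bdr i, {i}) \<in> C0" using that by (auto simp: C0_def)
      then show "cball (ctr i) (rad i) \<inter> frontier \<Omega> = {}"
        using \<open>cseparated C0\<close> that(2) unfolding cseparated_def case_prod_unfold cr0[symmetric] by fastforce
    qed (use P that in auto)
    show ?thesis unfolding separated_def using 1 2 by blast
  qed
  ultimately show ?thesis using sep w w' by (intro exI[of _ S']) auto
qed

text \<open>The radius at parameter \<open>t\<close>. An item larger than \<open>t * lab i\<close>
  has collected more energy than it owes; it waits until \<open>t\<close> catches up, and items of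
  label 0 never grow.\<close>

definition rr :: "real \<Rightarrow> item \<Rightarrow> real" where "rr t i = Fc ^ cnt i * max (siz i) (t * lab i) * wt (bdr i)"

definition grow :: "real \<Rightarrow> item \<Rightarrow> item" where
  "grow t i = i\<lparr>siz := max (siz i) (t * lab i),
     reg := reg i \<union> {x. rad i - gap < dist (ctr i) x \<and> dist (ctr i) x < rr t i - gap}\<rparr>"

lemma grow_simps [simp]: "ctr (grow t i) = ctr i" "bdr (grow t i) = bdr i" "cnt (grow t i) = cnt i" "lab (grow t i) = lab i"
  "siz (grow t i) = max (siz i) (t * lab i)" "rad (grow t i) = rr t i"
  by (simp_all add: grow_def rad_def rr_def)

lemma rr_ge: "rad i \<le> rr t i"
  using Fc(1) by (auto simp: rad_def rr_def wt_def intro!: mult_right_mono mult_left_mono)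

lemma continuous_on_rr: "continuous_on U (\<lambda>t. rr t i)" unfolding rr_def by (intro continuous_intros)

lemma rr_start: "s * real (lab i) \<le> siz i \<Longrightarrow> rr s i = rad i" by (simp add: rr_def rad_def)

text \<open>As long as all items are good, every item with a positive label collects energy at its full rate. The parameter at which
  this first fails is a contact of two balls, a contact of an interior ball with the frontier, or a drop of a label.\<close>

definition good :: "item set \<Rightarrow> real \<Rightarrow> bool" where
  "good S t \<longleftrightarrow> (\<forall>i\<in>S. \<forall>j\<in>S. i \<noteq> j \<longrightarrow> rr t i + rr t j < dist (ctr i) (ctr j)) \<and>
     (\<forall>i\<in>S. \<not> bdr i \<longrightarrow> cball (ctr i) (rr t i) \<subseteq> \<Omega>) \<and>
     (\<forall>i\<in>S. 1 \<le> lab i \<longrightarrow> (\<exists>\<rho>. rr t i - gap < \<rho> \<and> \<rho> < rr t i \<and> \<not> cert f (lab i - 1) (ctr i) \<rho>))"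

text \<open>\<open>cert_glue\<close> with a single inner ball: in the shell between the two spheres
  \<open>f\<close> itself is admissible.\<close>

lemma cert_up:
  assumes c: "cert f n c \<rho>" and lt: "\<rho> < \<rho>'" and Zf: "cball c \<rho>' \<inter> closure \<Omega> \<inter> Z \<subseteq> ball c \<rho>"
  shows "cert f n c \<rho>'"
proof (rule cert_glue[where L="{()}" and ctr="\<lambda>_. c" and rad="\<lambda>_. \<rho>" and lab="\<lambda>_. n"])
  show "f x \<noteq> 0" if "x \<in> cball c \<rho>'" "x \<in> closure \<Omega>" "\<And>l. l \<in> {()} \<Longrightarrow> x \<notin> ball c \<rho>" for x
    using nz[of x] Zf that by blast
  show "\<bar>f x \<bullet> \<nu> x\<bar> \<le> 1/2 * norm (f x)" if "x \<in> cball c \<rho>'" "x \<in> frontier \<Omega>" "\<And>l. l \<in> {()} \<Longrightarrow> x \<notin> ball c \<rho>" for x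
    using tg[of x] Zf that frontier_subset_closure by blast
  show "cball c \<rho> \<subseteq> ball c \<rho>'" using lt by auto
qed (use f c in auto)

text \<open>An item that has not yet begun to grow keeps its energy bound because
  \<open>Lam s\<close> / \<open>s\<close> decreases. A growing item collects the cost of all circles
  that it sweeps, each at a distance \<open>gap\<close> behind its sphere.\<close>

lemma grow_pre:
  assumes p: "pre s S" and sep: "separated S" and s: "0 < s" "s \<le> T" "T \<le> s1"
    and gd: "\<And>t. s \<le> t \<Longrightarrow> t < T \<Longrightarrow> good S t"
  shows "pre T (grow T ` S)"
proof -
  note P = preD[OF p] and P2 = pre_globalD[OF p]
  have rs: "rr s i = rad i" if "i \<in> S" for i by (rule rr_start[OF P(6)[OF that]])
  \<comment> \<open>Goodness is known only before \<open>T\<close>; continuity in the parameter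
    carries the non-strict versions of its inequalities to \<open>T\<close>.\<close>
  have lim: "h T \<le> d" if h: "continuous_on UNIV h" "h s \<le> d" "\<And>t. s \<le> t \<Longrightarrow> t < T \<Longrightarrow> h t \<le> d" for h :: "real \<Rightarrow> real" and d
  proof (cases "s = T")
    case True then show ?thesis using h(2) by simp
  next
    case False
    then have "closure {s..<T} = {s..T}" using s by simp
    then show ?thesis
      using continuous_le_on_closure[of "{s..<T}" h T d] continuous_on_subset[OF h(1)] h(3) s by simp
  qed
  have dT: "rr T i + rr T j \<le> dist (ctr i) (ctr j)" if "i \<in> S" "j \<in> S" "i \<noteq> j" for i j
  proof (rule lim[of "\<lambda>t. rr t i + rr t j"])
    show "rr s i + rr s j \<le> dist (ctr i) (ctr j)" using sep that rs by (force simp: separated_def less_imp_le)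
    show "rr t i + rr t j \<le> dist (ctr i) (ctr j)" if "s \<le> t" "t < T" for t
      using gd[OF that] \<open>i \<in> S\<close> \<open>j \<in> S\<close> \<open>i \<noteq> j\<close> by (force simp: good_def less_imp_le)
  qed (intro continuous_intros continuous_on_rr)
  have inT: "ball (ctr i) (rr T i) \<subseteq> \<Omega>" if i: "i \<in> S" "\<not> bdr i" for i
  proof
    fix x assume x: "x \<in> ball (ctr i) (rr T i)"
    show "x \<in> \<Omega>"
    proof (rule ccontr)
      assume nx: "x \<notin> \<Omega>"
      have "rr T i \<le> dist (ctr i) x"
      proof (rule lim[of "\<lambda>t. rr t i"])
        show "rr s i \<le> dist (ctr i) x"
          using sep i nx rs[OF i(1)] by (force simp: separated_def)
        show "rr t i \<le> dist (ctr i) x" if "s \<le> t" "t < T" for t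
          using gd[OF that] i nx by (force simp: good_def)
      qed (rule continuous_on_rr)
      then show False using x by simp
    qed
  qed
  have Zsub: "cball (ctr i) \<rho> \<inter> closure \<Omega> \<inter> Z \<subseteq> cball (ctr i) (rad i - gap)" if i: "i \<in> S" and \<rho>: "\<rho> < rr T i" for i \<rho>
  proof
    fix y assume y: "y \<in> cball (ctr i) \<rho> \<inter> closure \<Omega> \<inter> Z"
    then obtain j where j: "j \<in> S" "y \<in> cball (ctr j) (rad j - gap)" using P2(3) by blast
    show "y \<in> cball (ctr i) (rad i - gap)"
    proof (cases "i = j")
      case False
      have "dist (ctr i) (ctr j) \<le> dist (ctr i) y + dist (ctr j) y"
        using dist_triangle[of "ctr i" "ctr j" y] by (simp add: dist_commute)
      also have "\<dots> < rr T i + rr T j" using y j(2) \<rho> rr_ge[of j T] pos(1) by auto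
      finally show ?thesis using dT[OF i j(1) False] by simp
    qed (use j in simp)
  qed
  have cnt: "Fc ^ cnt i \<le> 2" if "i \<in> S" for i
  proof -
    have "cnt i \<le> (\<Sum>i\<in>S. cnt i)" using P2(1) that by (intro member_le_sum) auto
    then show ?thesis using P2(2) pow_mono[of "cnt i" N0] Fc(2) by simp
  qed
  have certsT: "cert f (lab i) (ctr i) \<rho>" if i: "i \<in> S" and \<rho>: "rad i - gap < \<rho>" "\<rho> < rr T i" for i \<rho>
  proof (cases "\<rho> < rad i")
    case True then show ?thesis using P(10)[OF i \<rho>(1)] by simp
  next
    case False
    have "cert f (lab i) (ctr i) (rad i - gap/2)" using pos(1) by (intro P(10)[OF i]) auto
    then show ?thesis
    proof (rule cert_up)
      show "rad i - gap/2 < \<rho>" using False pos(1) by simp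
      have "cball (ctr i) (rad i - gap) \<subseteq> ball (ctr i) (rad i - gap/2)" using pos(1) by auto
      then show "cball (ctr i) \<rho> \<inter> closure \<Omega> \<inter> Z \<subseteq> ball (ctr i) (rad i - gap/2)" using Zsub[OF i \<rho>(2)] by blast
    qed
  qed
  have E0: "siz i * Lam t \<le> t * \<mu> (reg i)" if i: "i \<in> S" and t: "s \<le> t" for i t
  proof -
    have "s * (siz i * Lam t) = siz i * (s * Lam t)" by simp
    also have "\<dots> \<le> siz i * (t * Lam s)" using Lam_ratio[OF s(1) t] siz_pos[OF p i] by (intro mult_left_mono) auto
    also have "\<dots> = t * (siz i * Lam s)" by simp
    also have "\<dots> \<le> t * (s * \<mu> (reg i))" using P(7)[OF i] t s(1) by (intro mult_left_mono) auto
    also have "\<dots> = s * (t * \<mu> (reg i))" by simp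
    finally show ?thesis using s(1) by simp
  qed
  have bor: "{x. a < dist c x \<and> dist c x < b} \<in> sets borel" for a b and c :: "real^2"
    by (intro borel_open open_Collect_conj open_Collect_less continuous_intros)
  have regT: "reg (grow T i) \<in> sets borel" if "i \<in> S" for i
    using P(8)[OF that] bor by (auto simp: grow_def)
  have ET: "max (siz i) (T * lab i) * Lam T \<le> T * \<mu> (reg (grow T i))" if i: "i \<in> S" for i
  proof (cases "T * lab i \<le> siz i")
    case True
    have "T * \<mu> (reg i) \<le> T * \<mu> (reg (grow T i))"
      using s regT[OF i] P(8)[OF i] by (intro mult_left_mono mu_mono) (auto simp: grow_def)
    then show ?thesis using True E0[OF i s(2)] by simp
  next
    case False
    define n where "n = lab i"
    define c where "c = ctr i"
    have n1: "1 \<le> n"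
    proof (rule ccontr)
      assume "\<not> 1 \<le> n"
      then have "n = 0" by simp
      then show False using False siz_pos[OF p i] by (simp add: n_def)
    qed
    have n2: "n \<le> 2" using P(4)[OF i] by (simp add: n_def)
    \<comment> \<open>The parameter at which the item begins to grow.\<close>
    define t0 where "t0 = siz i / n"
    have t0: "s \<le> t0" "t0 < T" "siz i = t0 * n"
      using P(6)[OF i] False n1 by (auto simp: t0_def n_def field_simps)
    define \<phi> where "\<phi> = Fc ^ cnt i * n * wt (bdr i)"
    have rrt: "rr t i = \<phi> * t" if "t0 \<le> t" for t
    proof -
      have "siz i \<le> t * lab i" using t0(3) that n1 by (simp add: n_def mult_right_mono)
      then show ?thesis by (simp add: rr_def \<phi>_def n_def)
    qed
    have radt: "rad i = \<phi> * t0" using t0(3) by (simp add: rad_def \<phi>_def)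
    have \<phi>0: "\<phi> > 0" using Fc(1) n1 by (simp add: \<phi>_def wt_def)
    have rT: "rr T i = \<phi> * T" using rrt t0 by simp
    \<comment> \<open>At the parameter where the radius is rho + gap, goodness provides a nearby
      larger radius at which the smaller label cannot be certified. It cannot be certified at rho
      either, since \<open>cert_up\<close> would carry it outwards.\<close>
    have key: "sphere c \<rho> \<inter> Z \<inter> closure \<Omega> = {} \<and> \<not> cert f (n - 1) c \<rho> \<and>
        (\<exists>\<rho>'. \<rho>' < \<rho> + gap \<and> \<rho> < \<rho>' \<and> \<rho>' < rr T i \<and> \<not> cert f (n - 1) c \<rho>')"
      if \<rho>: "rad i - gap < \<rho>" "\<rho> < rr T i - gap" for \<rho>
    proof -
      define t where "t = (\<rho> + gap) / \<phi>"
      have \<phi>t: "\<phi> * t = \<rho> + gap" using \<phi>0 by (simp add: t_def)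
      have "\<phi> * t0 < \<phi> * t" "\<phi> * t < \<phi> * T" using \<rho> \<phi>t radt rT by auto
      then have t: "t0 < t" "t < T" using \<phi>0 by auto
      have rt: "rr t i = \<rho> + gap" using rrt[of t] t \<phi>t by simp
      obtain \<rho>' where r': "\<rho> < \<rho>'" "\<rho>' < \<rho> + gap" "\<not> cert f (n - 1) c \<rho>'"
        using gd[of t] t t0 i n1 rt unfolding good_def n_def c_def by force
      have r'T: "\<rho>' < rr T i" using r'(2) \<rho>(2) by simp
      have Zb: "cball c \<rho>' \<inter> closure \<Omega> \<inter> Z \<subseteq> cball c (rad i - gap)" using Zsub[OF i r'T] by (simp add: c_def)
      have "\<not> cert f (n - 1) c \<rho>"
      proof
        assume "cert f (n - 1) c \<rho>"
        then have "cert f (n - 1) c \<rho>'"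
          by (rule cert_up) (use r' Zb \<rho>(1) in auto)
        then show False using r' by simp
      qed
      moreover have "sphere c \<rho> \<inter> Z \<inter> closure \<Omega> = {}" using Zb \<rho>(1) r'(1) by force
      ultimately show ?thesis using r' r'T by blast
    qed
    define A where "A = {x. rad i - gap < dist c x \<and> dist c x < rr T i - gap}"
    have r0m: "rmin \<le> rad i - gap" using rad_gap[OF p i] by simp
    have r01: "rad i - gap < rr T i - gap" using rT radt \<phi>0 t0(2) by simp
    have rc: "rr T i - gap \<le> 2 * Rcap"
    proof -
      have "T * real n \<le> s1 * 2" using s n2 by (intro mult_mono) auto
      then have Tn: "T * real n \<le> Rcap" using Rcap(2) by simp
      have "\<phi> * T = Fc ^ cnt i * ((T * n) * wt (bdr i))" by (simp add: \<phi>_def)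
      also have "\<dots> \<le> 2 * (Rcap * 1)"
        using cnt[OF i] Tn s Fc(1) Rcap(2) pos(4) by (intro mult_mono) (auto simp: wt_def)
      finally show ?thesis using rT pos(1) by simp
    qed
    have ann: "real n * (Lam (\<phi> * T - gap) - Lam (\<phi> * t0 - gap)) \<le> \<mu> A \<and> 1 \<le> \<phi>"
    proof (cases "bdr i")
      case True
      have "(real (n - 1) + 1) * (c1 * ln (1 + \<kappa> * (rr T i - gap)) - c1 * ln (1 + \<kappa> * (rad i - gap))) \<le> \<mu> A"
        unfolding A_def
      proof (rule cost_bd[OF r0m r01 rc])
        show "c \<in> frontier \<Omega>" using P(1)[OF i True] by (simp add: c_def)
        show "n - 1 \<le> 1" using n2 by simp
        show "sphere c \<rho> \<inter> Z \<inter> closure \<Omega> = {} \<and> \<not> cert f (n - 1) c \<rho>" if "rad i - gap < \<rho>" "\<rho> < rr T i - gap" for \<rho>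
          using key[OF that] by blast
      qed
      moreover have "real (n - 1) + 1 = real n" using n1 by simp
      moreover have "1 * 1 \<le> Fc ^ cnt i * real n" using pow_ge_1[of "cnt i"] n1 by (intro mult_mono) auto
      ultimately show ?thesis using True by (simp add: Lam_def rT radt \<phi>_def wt_def)
    next
      case int: False
      have bO: "ball c (rr T i) \<subseteq> \<Omega>" using inT[OF i int] by (simp add: c_def)
      \<comment> \<open>For a ball inside the domain a certificate of label 1 is one of label 0, as
        there is no boundary condition to tell them apart. So a growing interior ball has label 2,
        and its full circles cost as much as two half circles.\<close>
      have "n = 2"
      proof (rule ccontr)
        assume "n \<noteq> 2"
        then have n: "n = 1" using n1 n2 by simp
        define \<rho> where "\<rho> = ((rad i - gap) + (rr T i - gap)) / 2"
        have "rad i - gap < \<rho>" "\<rho> < rr T i - gap" using r01 by (auto simp: \<rho>_def)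
        from key[OF this] obtain \<rho>' where r': "\<rho> < \<rho>'" "\<rho>' < rr T i" "\<not> cert f 0 c \<rho>'" using n by auto
        have "cert f 1 c \<rho>'" using certsT[OF i, of \<rho>'] r' \<open>rad i - gap < \<rho>\<close> n by (simp add: n_def c_def)
        moreover have "cball c \<rho>' \<inter> frontier \<Omega> = {}"
        proof -
          have "cball c \<rho>' \<subseteq> \<Omega>" using bO r'(2) by auto
          then show ?thesis using frontier_iff by blast
        qed
        ultimately have "cert f 0 c \<rho>'" unfolding cert_def filling_def by auto
        then show False using r' by simp
      qed
      have "2 * (c1 * ln (1 + \<kappa> * (rr T i - gap)) - c1 * ln (1 + \<kappa> * (rad i - gap))) \<le> \<mu> A"
        unfolding A_def
      proof (rule cost_int[OF r0m r01 rc])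
        show "ball c (rr T i - gap + gap) \<subseteq> \<Omega>" using bO by simp
        show "sphere c \<rho> \<inter> Z \<inter> closure \<Omega> = {} \<and> \<not> cert f 0 c \<rho>" if "rad i - gap < \<rho>" "\<rho> < rr T i - gap" for \<rho>
          using key[OF that] cert_mono[of f 0 c \<rho> "n - 1"] by auto
      qed
      moreover have "1 \<le> Fc ^ cnt i" by (rule pow_ge_1)
      ultimately show ?thesis using int \<open>n = 2\<close> by (simp add: Lam_def rT radt \<phi>_def wt_def)
    qed
    \<comment> \<open>Here phi >= 1 also for an interior ball: its radius is half its size, but its
      label is 2.\<close>
    have "Lam T - Lam t0 \<le> Lam (\<phi> * T - gap) - Lam (\<phi> * t0 - gap)"
      using ann t0 s r0m pos(5) radt by (intro Lam_scaled_increment) auto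
    then have "real n * (Lam T - Lam t0) \<le> real n * (Lam (\<phi> * T - gap) - Lam (\<phi> * t0 - gap))"
      by (intro mult_left_mono) auto
    then have 1: "real n * (Lam T - Lam t0) \<le> \<mu> A" using ann by linarith
    have "t0 * (real n * Lam t0) \<le> t0 * \<mu> (reg i)" using E0[OF i t0(1)] t0(3) by (simp add: mult_ac)
    then have 2: "real n * Lam t0 \<le> \<mu> (reg i)" using t0(1) s(1) by simp
    have "reg i \<inter> A = {}" using P(9)[OF i] by (auto simp: A_def c_def)
    then have "\<mu> (reg i) + \<mu> A \<le> \<mu> (reg i \<union> A)" using P(8)[OF i] bor by (intro mu_add) (auto simp: A_def)
    moreover have "reg (grow T i) = reg i \<union> A" by (simp add: grow_def A_def c_def)
    ultimately have "real n * Lam T \<le> \<mu> (reg (grow T i))" using 1 2 by (simp add: algebra_simps)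
    then have "T * (real n * Lam T) \<le> T * \<mu> (reg (grow T i))" using s by (intro mult_left_mono) auto
    then show ?thesis using False by (simp add: n_def max_def)
  qed
  have regsub: "reg (grow T i) \<subseteq> cball (ctr i) (rr T i - gap)" if "i \<in> S" for i
    using P(9)[OF that] rr_ge[of i T] by (force simp: grow_def)
  have inj: "inj_on (grow T) S"
  proof
    fix i j assume a: "i \<in> S" "j \<in> S" "grow T i = grow T j"
    show "i = j"
    proof (rule ccontr)
      assume "i \<noteq> j"
      then have "0 < dist (ctr i) (ctr j)"
        using sep a rad_pos[OF siz_pos[OF p]] unfolding separated_def by (metis add_pos_pos less_trans)
      moreover have "ctr i = ctr j" using grow_simps(1) a(3) by metis
      ultimately show False by simp
    qed
  qed
  show ?thesis unfolding pre_def
  proof (intro conjI ballI allI impI)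
    show "finite (grow T ` S)" using P2 by simp
    show "(\<Sum>i\<in>grow T ` S. cnt i) \<le> N0" using P2(2) by (simp add: sum.reindex[OF inj])
    show "Z \<inter> closure \<Omega> \<subseteq> (\<Union>i\<in>grow T ` S. cball (ctr i) (rad i - gap))"
    proof
      fix y assume "y \<in> Z \<inter> closure \<Omega>"
      then obtain j where j: "j \<in> S" "y \<in> cball (ctr j) (rad j - gap)" using P2(3) by blast
      then have "y \<in> cball (ctr (grow T j)) (rad (grow T j) - gap)" using rr_ge[of j T] by simp
      then show "y \<in> (\<Union>i\<in>grow T ` S. cball (ctr i) (rad i - gap))" using j by blast
    qed
  next
    fix i' assume "i' \<in> grow T ` S"
    then obtain i where i: "i \<in> S" "i' = grow T i" by blast
    show "ctr i' \<in> frontier \<Omega>" if "bdr i'" using P(1)[OF i(1)] that i by simp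
    show "ctr i' \<in> closure \<Omega>" "1 \<le> cnt i'" "lab i' \<le> 2" using P(2,3,4)[OF i(1)] i by auto
    show "2 * (rmin + gap) \<le> siz i'" using P(5)[OF i(1)] i by simp
    show "T * lab i' \<le> siz i'" using i by simp
    show "siz i' * Lam T \<le> T * \<mu> (reg i')" using ET[OF i(1)] i by simp
    show "reg i' \<in> sets borel" using regT i by simp
    show "reg i' \<subseteq> cball (ctr i') (rad i' - gap)" using regsub i by simp
    show "cert f (lab i') (ctr i') \<rho>" if "rad i' - gap < \<rho>" "\<rho> < rad i'" for \<rho>
      using certsT[OF i(1), of \<rho>] that i rr_ge[of i T] by simp
    fix j' assume "j' \<in> grow T ` S" "i' \<noteq> j'"
    then obtain j where j: "j \<in> S" "j' = grow T j" "i \<noteq> j" using i by blast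
    show "rad i' + rad j' \<le> dist (ctr i') (ctr j')" if "lab i' < 2" "lab j' < 2" using dT i j by simp
    have "cball (ctr i) (rr T i - gap) \<inter> cball (ctr j) (rr T j - gap) = {}"
      using dT[OF i(1) j(1,3)] pos(1) by (intro disjoint_cballI) auto
    then show "reg i' \<inter> reg j' = {}" using regsub[OF i(1)] regsub[OF j(1)] i j by blast
  qed
qed

text \<open>Goodness consists of finitely many strict conditions on continuous radii, so it is open;
  hence a first parameter at which it fails exists.\<close>

lemma closed_not_good: "closed {t. \<not> good S t}" if fin: "finite S" for S
proof -
  have "open {t. good S t}"
  proof -
    have 1: "open {t. rr t i + rr t j < d}" for i j d
      by (intro open_Collect_less continuous_intros continuous_on_rr)
    have 2: "open {t. cball (ctr i) (rr t i) \<subseteq> \<Omega>}" if "i \<in> S" for i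
    proof (cases "\<Omega> = UNIV")
      case False
      have "{t. cball (ctr i) (rr t i) \<subseteq> \<Omega>} = {t. rr t i < 0 \<or> rr t i < infdist (ctr i) (- \<Omega>)}"
      proof -
        have "cball (ctr i) r \<subseteq> \<Omega> \<longleftrightarrow> r < infdist (ctr i) (- \<Omega>)" if "0 \<le> r" for r
        proof
          assume sub: "cball (ctr i) r \<subseteq> \<Omega>"
          have cl: "closed (- \<Omega>)" using open_dom by (simp add: closed_def)
          obtain x where x: "x \<in> - \<Omega>" "infdist (ctr i) (- \<Omega>) = dist (ctr i) x"
            using infdist_attains_inf[OF cl, of "ctr i"] False by auto
          then have "x \<notin> cball (ctr i) r" using sub by blast
          then show "r < infdist (ctr i) (- \<Omega>)" using x by simp
        next
          assume lt: "r < infdist (ctr i) (- \<Omega>)"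
          show "cball (ctr i) r \<subseteq> \<Omega>"
          proof
            fix x assume x: "x \<in> cball (ctr i) r"
            show "x \<in> \<Omega>"
            proof (rule ccontr)
              assume "x \<notin> \<Omega>"
              then have "infdist (ctr i) (- \<Omega>) \<le> dist (ctr i) x" by (intro infdist_le) auto
              then show False using lt x by simp
            qed
          qed
        qed
        moreover have "cball (ctr i) r \<subseteq> \<Omega>" if "r < 0" for r using that by simp
        ultimately show ?thesis by (intro Collect_cong) (metis linorder_not_less)
      qed
      then show ?thesis by (auto intro!: open_Collect_disj open_Collect_less continuous_on_rr continuous_intros)
    qed simp
    have 3: "open {t. \<exists>\<rho>. rr t i - gap < \<rho> \<and> \<rho> < rr t i \<and> \<not> cert f n c \<rho>}" for i n c
    proof -
      have "{t. \<exists>\<rho>. rr t i - gap < \<rho> \<and> \<rho> < rr t i \<and> \<not> cert f n c \<rho>}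
          = (\<Union>\<rho>\<in>{\<rho>. \<not> cert f n c \<rho>}. {t. rr t i - gap < \<rho> \<and> \<rho> < rr t i})" by auto
      also have "open \<dots>"
        by (intro open_UN ballI open_Collect_conj open_Collect_less continuous_intros continuous_on_rr)
      finally show ?thesis .
    qed
    have "{t. good S t} = (\<Inter>i\<in>S. \<Inter>j\<in>S. {t. i \<noteq> j \<longrightarrow> rr t i + rr t j < dist (ctr i) (ctr j)}) \<inter>
        (\<Inter>i\<in>S. {t. \<not> bdr i \<longrightarrow> cball (ctr i) (rr t i) \<subseteq> \<Omega>}) \<inter>
        (\<Inter>i\<in>S. {t. 1 \<le> lab i \<longrightarrow> (\<exists>\<rho>. rr t i - gap < \<rho> \<and> \<rho> < rr t i \<and> \<not> cert f (lab i - 1) (ctr i) \<rho>)})"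
      by (auto simp: good_def)
    moreover have "open {t. i \<noteq> j \<longrightarrow> rr t i + rr t j < dist (ctr i) (ctr j)}" for i j using 1[of i j "dist (ctr i) (ctr j)"] by (cases "i = j") auto
    moreover have "open {t. \<not> bdr i \<longrightarrow> cball (ctr i) (rr t i) \<subseteq> \<Omega>}" if "i \<in> S" for i using 2[OF that] by (cases "bdr i") auto
    moreover have "open {t. 1 \<le> lab i \<longrightarrow> (\<exists>\<rho>. rr t i - gap < \<rho> \<and> \<rho> < rr t i \<and> \<not> cert f (lab i - 1) (ctr i) \<rho>)}" for i
      using 3[of i "lab i - 1" "ctr i"] by (cases "1 \<le> lab i") auto
    ultimately show ?thesis using fin by (auto intro!: open_Int open_INT)
  qed
  then show ?thesis by (simp add: Collect_neg_eq closed_Compl)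
qed

text \<open>Induction on \<open>weight\<close>: the items grow to the first bad parameter, and the
  event there lowers the weight.\<close>

theorem ball_construction:
  assumes "pre s S" "separated S" "0 < s" "s \<le> s1"
  shows "\<exists>S'. pre s1 S' \<and> separated S'"
  using assms
proof (induction "weight S" arbitrary: S s rule: less_induct)
  case less
  note p = less.prems(1) and sep = less.prems(2) and s = less.prems(3,4)
  have fin: "finite S" using p by (simp add: pre_def)
  have inj: "inj_on ctr S"
  proof
    fix i j assume a: "i \<in> S" "j \<in> S" "ctr i = ctr j"
    show "i = j"
    proof (rule ccontr)
      assume "i \<noteq> j"
      then have "0 < dist (ctr i) (ctr j)"
        using sep a rad_pos[OF siz_pos[OF p]] unfolding separated_def by (metis add_pos_pos less_trans)
      then show False using a by simp
    qed
  qed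
  have injh: "inj_on h S" if "\<And>i. ctr (h i) = ctr i" for h
    using inj that by (auto simp: inj_on_def) metis
  define B where "B = {s..s1} \<inter> {t. \<not> good S t}"
  have wg: "weight (grow t ` S) = weight S" for t
    unfolding weight_def by (simp add: sum.reindex[OF injh])
  show ?case
  proof (cases "B = {}")
    case True
    then have g: "good S t" if "s \<le> t" "t \<le> s1" for t using that by (auto simp: B_def)
    have "pre s1 (grow s1 ` S)" by (rule grow_pre[OF p sep s(1,2)]) (use g in auto)
    moreover have "separated (grow s1 ` S)"
      using g[OF s(2) order_refl] unfolding separated_def good_def by auto
    ultimately show ?thesis by blast
  next
    case False
    have clB: "closed B" unfolding B_def using closed_not_good[OF fin] by (intro closed_Int) auto
    have bb: "bdd_below B" by (auto simp: B_def intro: bdd_belowI[of _ s])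
    define T where "T = Inf B"
    have TB: "T \<in> B" unfolding T_def by (rule closed_contains_Inf[OF False bb clB])
    have Tmin: "T \<le> t" if "t \<in> B" for t unfolding T_def by (rule cInf_lower[OF that bb])
    have T: "s \<le> T" "T \<le> s1" "\<not> good S T" using TB by (auto simp: B_def)
    have gd: "good S t" if "s \<le> t" "t < T" for t
      using Tmin[of t] that T by (force simp: B_def)
    have pT: "pre T (grow T ` S)" by (rule grow_pre[OF p sep s(1) T(1,2) gd])
    show ?thesis
    proof (cases "separated (grow T ` S)")
      case nsep: False
      obtain S' where S': "pre T S'" "separated S'" "weight S' < weight (grow T ` S)"
        using merge_step[OF pT] s T nsep by auto
      show ?thesis by (rule less.hyps[of S' T]) (use S' wg s T in auto)
    next
      case septrue: True
      \<comment> \<open>Since the balls are still separated at \<open>T\<close>, the first two parts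
        of goodness hold, so the third fails and some label can be lowered.\<close>
      have "\<exists>i\<in>S. 1 \<le> lab i \<and> (\<forall>\<rho>. rr T i - gap < \<rho> \<longrightarrow> \<rho> < rr T i \<longrightarrow> cert f (lab i - 1) (ctr i) \<rho>)"
      proof (rule ccontr)
        assume neg: "\<not> ?thesis"
        have "rr T i + rr T j < dist (ctr i) (ctr j)" if "i \<in> S" "j \<in> S" "i \<noteq> j" for i j
        proof -
          have "grow T i \<noteq> grow T j" using injh[of "grow T"] that by (auto simp: inj_on_def)
          then show ?thesis using septrue that unfolding separated_def by force
        qed
        moreover have "cball (ctr i) (rr T i) \<subseteq> \<Omega>" if "i \<in> S" "\<not> bdr i" for i
          using septrue that unfolding separated_def by force
        ultimately have "good S T" using neg unfolding good_def by blast
        then show False using T by simp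
      qed
      then obtain i where i: "i \<in> S" "1 \<le> lab i" "\<And>\<rho>. rr T i - gap < \<rho> \<Longrightarrow> \<rho> < rr T i \<Longrightarrow> cert f (lab i - 1) (ctr i) \<rho>"
        by blast
      define h where "h j = (if j = i then (grow T j)\<lparr>lab := lab i - 1\<rparr> else grow T j)" for j
      have hs: "ctr (h j) = ctr j" "bdr (h j) = bdr j" "cnt (h j) = cnt j" "siz (h j) = max (siz j) (T * lab j)"
        "rad (h j) = rr T j" "reg (h j) = reg (grow T j)" "lab (h j) = (if j = i then lab i - 1 else lab j)" for j
        by (auto simp: h_def rad_def rr_def)
      note P = preD[OF pT] and P2 = pre_globalD[OF pT]
      have gi: "grow T j \<in> grow T ` S" if "j \<in> S" for j using that by blast
      have septr: "rr T j + rr T k < dist (ctr j) (ctr k)" if "j \<in> S" "k \<in> S" "j \<noteq> k" for j k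
      proof -
        have "grow T j \<noteq> grow T k" using injh[of "grow T"] that by (auto simp: inj_on_def)
        then show ?thesis using septrue that unfolding separated_def by force
      qed
      have ph: "pre T (h ` S)" unfolding pre_def
      proof (intro conjI ballI allI impI)
        show "finite (h ` S)" using fin by simp
        show "(\<Sum>i\<in>h ` S. cnt i) \<le> N0"
          using P2(2) by (simp add: sum.reindex[OF injh] hs)
        show "Z \<inter> closure \<Omega> \<subseteq> (\<Union>i\<in>h ` S. cball (ctr i) (rad i - gap))" using P2(3) by (simp add: hs)
      next
        fix j' assume "j' \<in> h ` S"
        then obtain j where j: "j \<in> S" "j' = h j" by blast
        note Pj = P[OF gi[OF j(1)]]
        show "ctr j' \<in> frontier \<Omega>" if "bdr j'" using Pj(1) that j by (simp add: hs)
        show "ctr j' \<in> closure \<Omega>" "1 \<le> cnt j'" using Pj j by (auto simp: hs)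
        show "lab j' \<le> 2" using Pj(4) j by (auto simp: hs)
        show "2 * (rmin + gap) \<le> siz j'" using Pj(5) j by (simp add: hs)
        show "T * lab j' \<le> siz j'"
        proof -
          have "T * real (lab j') \<le> T * real (lab j)" using j s T by (intro mult_left_mono) (auto simp: hs)
          then show ?thesis using j by (simp add: hs)
        qed
        show "siz j' * Lam T \<le> T * \<mu> (reg j')" using Pj(7) j by (simp add: hs)
        show "reg j' \<in> sets borel" "reg j' \<subseteq> cball (ctr j') (rad j' - gap)" using Pj(8,9) j by (simp_all add: hs)
        show "cert f (lab j') (ctr j') \<rho>" if "rad j' - gap < \<rho>" "\<rho> < rad j'" for \<rho>
          using Pj(10)[of \<rho>] i(3)[of \<rho>] that j by (auto simp: hs)
        fix k' assume k': "k' \<in> h ` S" "j' \<noteq> k'"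
        then obtain k where k: "k \<in> S" "k' = h k" "j \<noteq> k" using j by blast
        have "grow T j \<noteq> grow T k" using injh[of "grow T"] j k by (auto simp: inj_on_def)
        then show "reg j' \<inter> reg k' = {}" using P2(4)[OF gi[OF j(1)] gi[OF k(1)]] j k by (simp add: hs)
        show "rad j' + rad k' \<le> dist (ctr j') (ctr k')" if "lab j' < 2" "lab k' < 2"
          using septr[OF j(1) k(1,3)] j k by (simp add: hs)
      qed
      have seph: "separated (h ` S)"
        unfolding separated_def
      proof (intro conjI ballI impI)
        fix j' k' assume "j' \<in> h ` S" "k' \<in> h ` S" "j' \<noteq> k'"
        then obtain j k where "j \<in> S" "j' = h j" "k \<in> S" "k' = h k" "j \<noteq> k" by blast
        then show "rad j' + rad k' < dist (ctr j') (ctr k')" using septr by (simp add: hs)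
      next
        fix j' assume "j' \<in> h ` S" "\<not> bdr j'"
        then obtain j where "j \<in> S" "j' = h j" "\<not> bdr j" by (auto simp: hs)
        then show "cball (ctr j') (rad j') \<subseteq> \<Omega>" using septrue unfolding separated_def by (force simp: hs)
      qed
      have "weight (h ` S) < weight S"
      proof -
        have "weight (h ` S) = (\<Sum>j\<in>S. (if bdr j then 1 else 2) + (if j = i then lab i - 1 else lab j))"
          unfolding weight_def by (simp add: sum.reindex[OF injh] hs)
        also have "\<dots> < weight S" unfolding weight_def
          by (rule sum_strict_mono_ex1[OF fin]) (use i in \<open>auto intro!: bexI[of _ i]\<close>)
        finally show ?thesis .
      qed
      then show ?thesis using less.hyps[of "h ` S" T] ph seph s T by auto
    qed
  qed
qed

text \<open>Otherwise all items could be glued into a certificate of label at most 1 on a ball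
  around the whole domain, against \<open>no_global_cert\<close>.\<close>

lemma labels_sum_ge_2:
  assumes p: "pre s S" and sep: "separated S" and sc: "simply_connected \<Omega>" "\<Omega> \<noteq> {}"
  shows "2 \<le> (\<Sum>i\<in>S. lab i)"
proof (rule ccontr)
  assume lt: "\<not> ?thesis"
  note P = preD[OF p] and P2 = pre_globalD[OF p]
  define M where "M = insert 0 ((\<lambda>i. norm (ctr i) + rad i) ` S)"
  obtain B where B: "\<And>x. x \<in> closure \<Omega> \<Longrightarrow> norm x \<le> B" using bounded_closure[OF bounded_dom] by (auto simp: bounded_iff)
  define \<rho> where "\<rho> = 1 + max B (Max M)"
  have finM: "finite M" using P2(1) by (simp add: M_def)
  have sub: "closure \<Omega> \<subseteq> ball 0 \<rho>" using B by (force simp: \<rho>_def)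
  have "cert f (\<Sum>i\<in>S. lab i) 0 \<rho>"
  proof (rule cert_glue[where L=S and ctr=ctr and rad="\<lambda>i. rad i - gap/2" and lab=lab])
    show "finite S" "continuous_on (closure \<Omega>) f" using P2 f by auto
    have zf: "x \<notin> Z" if "x \<in> closure \<Omega>" "\<And>l. l \<in> S \<Longrightarrow> x \<notin> ball (ctr l) (rad l - gap/2)" for x
      using P2(3) that pos(1) by force
    show "f x \<noteq> 0" if "x \<in> closure \<Omega>" "\<And>l. l \<in> S \<Longrightarrow> x \<notin> ball (ctr l) (rad l - gap/2)" for x
      using nz zf that by blast
    show "\<bar>f x \<bullet> \<nu> x\<bar> \<le> 1/2 * norm (f x)" if "x \<in> frontier \<Omega>" "\<And>l. l \<in> S \<Longrightarrow> x \<notin> ball (ctr l) (rad l - gap/2)" for x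
      using tg zf that frontier_subset_closure by blast
    show "cball (ctr i) (rad i - gap/2) \<subseteq> ball 0 \<rho>" if "i \<in> S" for i
    proof
      fix x assume x: "x \<in> cball (ctr i) (rad i - gap/2)"
      have "norm (ctr i) + rad i \<le> Max M" using finM that by (intro Max_ge) (auto simp: M_def)
      moreover have "norm x \<le> norm (ctr i) + dist (ctr i) x"
        using norm_triangle_ineq[of "ctr i" "x - ctr i"] by (simp add: dist_norm norm_minus_commute)
      ultimately show "x \<in> ball 0 \<rho>" using x pos(1) by (simp add: \<rho>_def)
    qed
    show "cball (ctr i) (rad i - gap/2) \<inter> cball (ctr j) (rad j - gap/2) = {}" if "i \<in> S" "j \<in> S" "i \<noteq> j" for i j
      using sep that pos(1) unfolding separated_def by (intro disjoint_cballI) force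
    show "cert f (lab i) (ctr i) (rad i - gap/2)" if "i \<in> S" for i
      using pos(1) by (intro P(10)[OF that]) auto
  qed auto
  then show False using no_global_cert[OF sc sub, of "\<Sum>i\<in>S. lab i" f] lt by simp
qed

end

lemma norm_matrix_vector_mult_le: "norm (A *v x) \<le> norm A * norm x" for A :: "real^'n^'m"
proof -
  have "(A *v x) $ i = A $ i \<bullet> x" for i by (simp add: inner_vec_def matrix_vector_mult_def)
  then have "(norm (A *v x))\<^sup>2 = (\<Sum>i\<in>UNIV. (A $ i \<bullet> x)\<^sup>2)"
    unfolding power2_norm_eq_inner inner_vec_def[of "A *v x"] by (simp add: power2_eq_square)
  also have "\<dots> \<le> (\<Sum>i\<in>UNIV. (norm (A $ i))\<^sup>2 * (norm x)\<^sup>2)"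
    by (intro sum_mono) (metis Cauchy_Schwarz_ineq power2_norm_eq_inner)
  also have "\<dots> = (norm A * norm x)\<^sup>2"
    by (simp add: power_mult_distrib power2_norm_eq_inner inner_vec_def[of A] sum_distrib_right)
  finally show ?thesis by (rule power2_le_imp_le) simp
qed

section \<open>The field on the scale of the coherence length\<close>

locale gl_field = regular_domain +
  fixes w :: "real^2 \<Rightarrow> real^2" and \<epsilon> :: real
  assumes C1w: "C1_on UNIV w" and eps: "0 < \<epsilon>"
begin

lemma contw: "continuous_on S w" using continuous_on_gl_dens(1)[OF C1w] continuous_on_subset by blast

text \<open>The cut-off at the boundary of \<open>\<Omega>\<close> allows integration over whole
  balls and circles.\<close>

definition dens :: "real^2 \<Rightarrow> real" where "dens x = indicat_real \<Omega> x * gl_dens \<epsilon> w x"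

definition E :: "(real^2) set \<Rightarrow> ennreal" where "E A = (\<integral>\<^sup>+x\<in>A. ennreal (dens x) \<partial>lborel)"

text \<open>The energy on a circle. The starting angle is free so that the arc of interest is not
  cut in two.\<close>

definition slice :: "real \<Rightarrow> real^2 \<Rightarrow> real \<Rightarrow> ennreal" where
  "slice \<alpha> c \<rho> = (\<integral>\<^sup>+\<theta>\<in>{\<alpha><..<\<alpha> + 2 * pi}. ennreal (\<rho> * dens (circ c \<rho> \<theta>)) \<partial>lborel)"

definition u :: "real^2 \<Rightarrow> real \<Rightarrow> real \<Rightarrow> complex" where "u c \<rho> \<theta> = cx (w (circ c \<rho> \<theta>))"

definition u' :: "real^2 \<Rightarrow> real \<Rightarrow> real \<Rightarrow> complex" where
  "u' c \<rho> \<theta> = cx (jacobian w (at (circ c \<rho> \<theta>)) *v (\<rho> *\<^sub>R rv (\<i> * cis \<theta>)))"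

definition cost :: "real^2 \<Rightarrow> real \<Rightarrow> real \<Rightarrow> real \<Rightarrow> real" where
  "cost c \<rho> a b = integral {a..b} (arc_energy \<rho> \<epsilon> (u c \<rho>) (u' c \<rho>))"

lemma dens_nonneg: "0 \<le> dens x" by (simp add: dens_def gl_dens_nonneg)

lemma borel_dens [measurable]: "dens \<in> borel_measurable borel"
proof -
  have "gl_dens \<epsilon> w \<in> borel_measurable borel"
    using continuous_on_gl_dens(2)[OF C1w] by (rule borel_measurable_continuous_onI)
  moreover have "\<Omega> \<in> sets borel" using open_dom by simp
  ultimately show ?thesis unfolding dens_def[abs_def] by (intro borel_measurable_times borel_measurable_indicator)
qed

lemma E_eq: "E A = (\<integral>\<^sup>+x\<in>A \<inter> \<Omega>. ennreal (gl_dens \<epsilon> w x) \<partial>lborel)"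
  unfolding E_def dens_def by (intro nn_integral_cong) (auto simp: indicator_def)

lemma E_mono: "A \<subseteq> B \<Longrightarrow> E A \<le> E B"
  unfolding E_def by (intro nn_integral_mono) (auto simp: indicator_def)

lemma E_add:
  assumes "A \<in> sets borel" "B \<in> sets borel" "A \<inter> B = {}" shows "E (A \<union> B) = E A + E B"
proof -
  have "E (A \<union> B) = (\<integral>\<^sup>+x. ennreal (dens x) * indicator A x + ennreal (dens x) * indicator B x \<partial>lborel)"
    unfolding E_def using assms(3) by (intro nn_integral_cong) (auto simp: indicator_def)
  also have "\<dots> = E A + E B" unfolding E_def using assms(1,2) by (intro nn_integral_add) auto
  finally show ?thesis .
qed

lemma dens_bounded: assumes "bounded S" obtains B where "\<And>x. x \<in> S \<Longrightarrow> dens x \<le> B"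
proof -
  have "compact (gl_dens \<epsilon> w ` closure S)"
    using assms continuous_on_gl_dens(2)[OF C1w, of \<epsilon>]
    by (intro compact_continuous_image) (auto intro: continuous_on_subset)
  then have "bounded (gl_dens \<epsilon> w ` closure S)" by (rule compact_imp_bounded)
  then obtain B where B: "\<And>y. y \<in> closure S \<Longrightarrow> norm (gl_dens \<epsilon> w y) \<le> B"
    unfolding bounded_iff by blast
  have "dens x \<le> B" if "x \<in> S" for x
  proof -
    have "dens x \<le> gl_dens \<epsilon> w x" using gl_dens_nonneg[of \<epsilon> w x] by (simp add: dens_def indicator_def)
    also have "\<dots> \<le> B" using B[of x] that closure_subset[of S] by auto
    finally show ?thesis .
  qed
  then show thesis by (rule that)
qed

lemma slice_le:
  assumes "0 \<le> r1"
  shows "(\<integral>\<^sup>+\<rho>\<in>{r1<..<r2}. slice \<alpha> c \<rho> \<partial>lborel) \<le> E {x. r1 < dist c x \<and> dist c x < r2}"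
proof -
  obtain B where "\<And>x. x \<in> ball c r2 \<Longrightarrow> dens x \<le> B" using dens_bounded[OF bounded_ball] by blast
  then show ?thesis using polar_le[of dens c r2 B r1 \<alpha>] borel_dens dens_nonneg assms
    by (simp add: slice_def E_def)
qed

text \<open>Outside \<open>T\<close> there remain radii of measure at least r2 - r1 - sigma; if all
  their slices were larger, the energy of the annulus would reach \<open>e\<close>.\<close>

lemma good_radius:
  assumes r: "0 \<le> r1" and T: "T \<in> sets borel" "emeasure lborel T \<le> ennreal \<sigma>" and \<sigma>: "0 \<le> \<sigma>" "\<sigma> < r2 - r1"
    and e: "0 \<le> e" "E {x. r1 < dist c x \<and> dist c x < r2} < ennreal e"
  obtains \<rho> where "r1 < \<rho>" "\<rho> < r2" "\<rho> \<notin> T" "slice \<alpha> c \<rho> \<le> ennreal (e / (r2 - r1 - \<sigma>))"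
proof -
  have "\<exists>\<rho>. r1 < \<rho> \<and> \<rho> < r2 \<and> \<rho> \<notin> T \<and> slice \<alpha> c \<rho> \<le> ennreal (e / (r2 - r1 - \<sigma>))"
  proof (rule ccontr)
    assume neg: "\<not> ?thesis"
    then have gt: "ennreal (e / (r2 - r1 - \<sigma>)) \<le> slice \<alpha> c \<rho>" if "\<rho> \<in> {r1<..<r2} - T" for \<rho>
      using that neg by (metis DiffE greaterThanLessThan_iff linorder_le_cases)
    let ?l = "e / (r2 - r1 - \<sigma>)" and ?S = "{r1<..<r2} - T"
    have "emeasure lborel {r1<..<r2} \<le> emeasure lborel ?S + emeasure lborel T"
    proof -
      have "emeasure lborel {r1<..<r2} \<le> emeasure lborel (?S \<union> T)" using T by (intro emeasure_mono) auto
      also have "\<dots> \<le> emeasure lborel ?S + emeasure lborel T" using T by (intro emeasure_subadditive) auto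
      finally show ?thesis .
    qed
    also have "\<dots> \<le> emeasure lborel ?S + ennreal \<sigma>" using T by (intro add_left_mono) auto
    finally have "ennreal (r2 - r1) \<le> emeasure lborel ?S + ennreal \<sigma>" using \<sigma> by simp
    then have S: "ennreal (r2 - r1 - \<sigma>) \<le> emeasure lborel ?S"
      using \<sigma> by (subst ennreal_minus[symmetric]) (auto simp: ennreal_minus_le_iff add.commute)
    have "ennreal e = ennreal ?l * ennreal (r2 - r1 - \<sigma>)" using \<sigma> e by (simp add: ennreal_mult[symmetric])
    also have "\<dots> \<le> ennreal ?l * emeasure lborel ?S" by (intro mult_left_mono S) auto
    also have "\<dots> = (\<integral>\<^sup>+\<rho>\<in>?S. ennreal ?l \<partial>lborel)" using T by (simp add: nn_integral_cmult_indicator)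
    also have "\<dots> \<le> (\<integral>\<^sup>+\<rho>\<in>{r1<..<r2}. slice \<alpha> c \<rho> \<partial>lborel)"
      by (intro nn_integral_mono) (use gt in \<open>auto simp: indicator_def\<close>)
    also have "\<dots> \<le> E {x. r1 < dist c x \<and> dist c x < r2}" by (rule slice_le[OF r])
    finally show False using e by simp
  qed
  then show thesis using that by blast
qed

lemma has_derivative_w: "(w has_derivative (\<lambda>h. jacobian w (at x) *v h)) (at x)"
  using C1w jacobian_works[of w "at x"] by (auto simp: C1_on_def)

lemma continuous_on_jacobian: "continuous_on S (\<lambda>x. jacobian w (at x))"
  using C1w continuous_on_subset by (auto simp: C1_on_def)

lemma arc_is_C1: assumes "0 < \<rho>" shows "C1_arc (u c \<rho>) (u' c \<rho>) a b \<rho> \<epsilon>"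
proof
  show "0 < \<rho>" "0 < \<epsilon>" using assms eps by auto
  fix t
  have 1: "(circ c \<rho> has_vector_derivative \<rho> *\<^sub>R rv (\<i> * cis t)) (at t within {a..b})"
  proof -
    have "((\<lambda>\<theta>. cis \<theta>) has_vector_derivative \<i> * cis t) (at t within {a..b})"
      unfolding has_vector_derivative_def
      by (auto intro!: derivative_eq_intros has_derivative_cis simp: scaleR_conv_of_real mult_ac)
    then have "((\<lambda>\<theta>. rv (cis \<theta>)) has_vector_derivative rv (\<i> * cis t)) (at t within {a..b})"
      by (rule bounded_linear.has_vector_derivative[OF bounded_linear_rv])
    then show ?thesis unfolding circ_def[abs_def] by (auto intro!: derivative_eq_intros)
  qed
  have "((\<lambda>\<theta>. w (circ c \<rho> \<theta>)) has_vector_derivative jacobian w (at (circ c \<rho> t)) *v (\<rho> *\<^sub>R rv (\<i> * cis t))) (at t within {a..b})"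
    using vector_derivative_diff_chain_within[OF 1, of w "\<lambda>h. jacobian w (at (circ c \<rho> t)) *v h"]
      has_derivative_w[of "circ c \<rho> t"] by (simp add: has_derivative_at_withinI comp_def)
  then show "(u c \<rho> has_vector_derivative u' c \<rho> t) (at t within {a..b})"
    unfolding u_def[abs_def] u'_def by (rule bounded_linear.has_vector_derivative[OF bounded_linear_cx])
next
  have "continuous_on {a..b} (\<lambda>\<theta>. jacobian w (at (circ c \<rho> \<theta>)) *v (\<rho> *\<^sub>R rv (\<i> * cis \<theta>)))"
  proof -
    have 1: "continuous_on {a..b} (\<lambda>\<theta>. jacobian w (at (circ c \<rho> \<theta>)))"
      by (rule continuous_on_compose2[OF continuous_on_jacobian[of UNIV]]) (auto intro!: continuous_intros)
    have 2: "continuous_on {a..b} (\<lambda>\<theta>. \<rho> *\<^sub>R rv (\<i> * cis \<theta>))" by (intro continuous_intros)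
    show ?thesis
      unfolding matrix_vector_mult_def by (intro continuous_intros 1 2)
  qed
  then show "continuous_on {a..b} (u' c \<rho>)" unfolding u'_def[abs_def] by (intro continuous_intros)
qed

lemma norm_u'_le: assumes "0 < \<rho>" shows "norm (u' c \<rho> \<theta>) \<le> \<rho> * norm (jacobian w (at (circ c \<rho> \<theta>)))"
proof -
  have "norm (u' c \<rho> \<theta>) \<le> norm (jacobian w (at (circ c \<rho> \<theta>))) * norm (\<rho> *\<^sub>R rv (\<i> * cis \<theta>))"
    unfolding u'_def norm_cx by (rule norm_matrix_vector_mult_le)
  then show ?thesis using assms by (simp add: norm_mult mult.commute)
qed

lemma cost_le_slice:
  assumes \<rho>: "0 < \<rho>" and ab: "\<alpha> \<le> a" "b \<le> \<alpha> + 2 * pi" and ins: "\<And>\<theta>. a < \<theta> \<Longrightarrow> \<theta> < b \<Longrightarrow> circ c \<rho> \<theta> \<in> \<Omega>"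
  shows "ennreal (cost c \<rho> a b) \<le> slice \<alpha> c \<rho>"
proof -
  interpret C1_arc "u c \<rho>" "u' c \<rho>" a b \<rho> \<epsilon> by (rule arc_is_C1[OF \<rho>])
  have le: "arc_energy \<rho> \<epsilon> (u c \<rho>) (u' c \<rho>) \<theta> \<le> \<rho> * dens (circ c \<rho> \<theta>)" if "\<theta> \<in> {a<..<b}" for \<theta>
  proof -
    have "(norm (u' c \<rho> \<theta>))\<^sup>2 / \<rho> \<le> (\<rho> * norm (jacobian w (at (circ c \<rho> \<theta>))))\<^sup>2 / \<rho>"
      using \<rho> by (intro divide_right_mono power_mono norm_u'_le) auto
    also have "\<dots> = \<rho> * (norm (jacobian w (at (circ c \<rho> \<theta>))))\<^sup>2" using \<rho> by (simp add: power2_eq_square)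
    finally show ?thesis using ins[of \<theta>] that by (simp add: arc_energy_def dens_def gl_dens_def u_def algebra_simps)
  qed
  let ?e = "arc_energy \<rho> \<epsilon> (u c \<rho>) (u' c \<rho>)"
  have "(?e has_integral cost c \<rho> a b) {a..b}"
    unfolding cost_def by (rule integrable_integral[OF int]) auto
  then have "(?e has_integral cost c \<rho> a b) {a<..<b}"
    using has_integral_open_interval[of ?e "cost c \<rho> a b" a b] by simp
  then have "ennreal (cost c \<rho> a b) = (\<integral>\<^sup>+\<theta>. ennreal (indicator {a<..<b} \<theta> * ?e \<theta>) \<partial>lborel)"
    using arc_energy_nonneg[OF \<rho>] by (intro nn_integral_has_integral_lebesgue[symmetric]) auto
  also have "\<dots> \<le> slice \<alpha> c \<rho>"
    unfolding slice_def using ab by (intro nn_integral_mono) (auto simp: indicator_def intro!: ennreal_leI le)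
  finally show ?thesis .
qed

end

lemma connected_sphere_crosses:
  fixes z q A B :: "real^2"
  assumes "A \<in> sphere z r" "B \<in> sphere z r" "dist q B \<le> \<rho>" "\<rho> \<le> dist q A"
  obtains x where "x \<in> sphere z r" "dist q x = \<rho>"
proof -
  have "connected ((\<lambda>x. dist q x) ` sphere z r)"
    by (intro connected_continuous_image continuous_intros connected_sphere) simp
  moreover have "dist q B \<in> (\<lambda>x. dist q x) ` sphere z r" "dist q A \<in> (\<lambda>x. dist q x) ` sphere z r" using assms by auto
  ultimately have "\<rho> \<in> (\<lambda>x. dist q x) ` sphere z r"
    using assms(3,4) by (rule connectedD_interval)
  then show thesis using that by blast
qed

lemma dist_circ_circ: assumes "0 \<le> \<rho>" shows "dist (circ c \<rho> s) (circ c \<rho> t) = 2 * \<rho> * \<bar>sin ((s - t) / 2)\<bar>"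
proof -
  have "(cmod (cis s - cis t))\<^sup>2 = (2 * sin ((s - t) / 2))\<^sup>2"
  proof -
    have "(cmod (cis s - cis t))\<^sup>2 = (cos s - cos t)\<^sup>2 + (sin s - sin t)\<^sup>2" by (simp add: cmod_power2)
    also have "\<dots> = 2 - 2 * cos (s - t)"
      using sin_cos_squared_add[of s] sin_cos_squared_add[of t] by (simp add: power2_diff cos_diff algebra_simps)
    also have "\<dots> = (2 * sin ((s - t) / 2))\<^sup>2"
    proof -
      have "2 * ((s - t) / 2) = s - t" by simp
      then show ?thesis using cos_double_sin[of "(s - t) / 2"] by (simp only: power_mult_distrib) simp
    qed
    finally show ?thesis .
  qed
  then have "cmod (cis s - cis t) = 2 * \<bar>sin ((s - t) / 2)\<bar>"
    by (metis abs_mult abs_numeral norm_ge_zero power2_abs power2_eq_imp_eq abs_ge_zero)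
  moreover have "dist (circ c \<rho> s) (circ c \<rho> t) = \<rho> * cmod (cis s - cis t)"
    using assms by (simp add: circ_def dist_norm flip: scaleR_diff_right rv_diff)
  ultimately show ?thesis by simp
qed

text \<open>So small that the errors of a chain of 1000 comparisons, about 3010 * eta, stay below
  1/250.\<close>

definition eta :: real where "eta = 1 / 10^6"
text \<open>A circle of radius at most 7 * epsilon and cost at most c0 / epsilon lets
  \<open>w\<close> vary by at most the square root of 49 * c0, which is eta.\<close>

definition c0 :: real where "c0 = (eta / 7)\<^sup>2"

lemma eta_pos: "0 < eta" by (simp add: eta_def)
lemma c0_eta: "49 * c0 = eta\<^sup>2" by (simp add: c0_def power2_eq_square)
lemma c0_pos: "0 < c0" using eta_pos by (simp add: c0_def)

context gl_field
begin

lemma circle_oscillation: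
  assumes "0 < \<rho>" "s \<in> {a..b}" "t \<in> {a..b}"
  shows "(norm (w (circ c \<rho> t) - w (circ c \<rho> s)))\<^sup>2 \<le> \<rho> * \<bar>t - s\<bar> * cost c \<rho> a b"
proof -
  interpret C1_arc "u c \<rho>" "u' c \<rho>" a b \<rho> \<epsilon> by (rule arc_is_C1[OF assms(1)])
  show ?thesis using oscillation[OF assms(2,3)] by (simp add: cost_def u_def flip: cx_diff)
qed

lemma circle_modulus:
  assumes "0 < \<rho>" "t \<in> {a..b}" "\<epsilon> / \<rho> \<le> b - a" "cost c \<rho> a b \<le> c0 / \<epsilon>"
  shows "1 - eta \<le> norm (w (circ c \<rho> t))"
proof -
  interpret C1_arc "u c \<rho>" "u' c \<rho>" a b \<rho> \<epsilon> by (rule arc_is_C1[OF assms(1)])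
  have "(max 0 (1 - norm (w (circ c \<rho> t))))\<^sup>2 \<le> 4 * \<epsilon> * cost c \<rho> a b"
    using modulus[OF assms(2,3)] by (simp add: cost_def u_def)
  also have "\<dots> \<le> 4 * \<epsilon> * (c0 / \<epsilon>)" using assms(4) eps by (intro mult_left_mono) auto
  also have "\<dots> \<le> eta\<^sup>2" using c0_eta c0_pos eps by simp
  finally have "max 0 (1 - norm (w (circ c \<rho> t))) \<le> eta" using eta_pos by (auto intro: power2_le_imp_le)
  then show ?thesis by simp
qed

lemma cost_nonneg: "0 < \<rho> \<Longrightarrow> 0 \<le> cost c \<rho> a b"
  unfolding cost_def by (rule integral_nonneg[OF C1_arc.int[OF arc_is_C1]]) (auto intro: arc_energy_nonneg)

lemma good_circle:
  assumes "0 \<le> r1" "r1 < r2" "ball c r2 \<subseteq> \<Omega>" "E (ball c r2) < ennreal e" "0 \<le> e"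
  obtains \<rho> where "r1 < \<rho>" "\<rho> < r2" "cost c \<rho> 0 (2 * pi) \<le> e / (r2 - r1)"
proof -
  have "E {x. r1 < dist c x \<and> dist c x < r2} \<le> E (ball c r2)" by (intro E_mono) auto
  then have lt: "E {x. r1 < dist c x \<and> dist c x < r2} < ennreal e" using assms(4) by (rule le_less_trans)
  obtain \<rho> where \<rho>: "r1 < \<rho>" "\<rho> < r2" "slice 0 c \<rho> \<le> ennreal (e / (r2 - r1 - 0))"
    by (rule good_radius[OF assms(1) _ _ _ _ assms(5) lt, of "{}" 0]) (use assms in auto)
  have "circ c \<rho> \<theta> \<in> \<Omega>" for \<theta> using dist_circ[of \<rho> c \<theta>] \<rho> assms(1,3) by auto
  then have "ennreal (cost c \<rho> 0 (2 * pi)) \<le> slice 0 c \<rho>" using \<rho> assms(1) by (intro cost_le_slice) auto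
  also note \<rho>(3)
  finally have "cost c \<rho> 0 (2 * pi) \<le> e / (r2 - r1)" using assms by (subst (asm) ennreal_le_iff) auto
  then show thesis using that \<rho> by blast
qed

lemma sphere_oscillation:
  assumes "0 < \<rho>" "cost c \<rho> 0 (2 * pi) \<le> k" "x \<in> sphere c \<rho>" "y \<in> sphere c \<rho>"
  shows "(norm (w x - w y))\<^sup>2 \<le> 7 * \<rho> * k"
proof -
  obtain s where s: "x = circ c \<rho> s" "0 \<le> s" "s < 0 + 2 * pi" using sphere_circ[of c x \<rho> 0] assms(3) by auto
  obtain t where t: "y = circ c \<rho> t" "0 \<le> t" "t < 0 + 2 * pi" using sphere_circ[of c y \<rho> 0] assms(4) by auto
  have "(norm (w x - w y))\<^sup>2 \<le> \<rho> * \<bar>s - t\<bar> * cost c \<rho> 0 (2 * pi)"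
    unfolding s(1) t(1) by (rule circle_oscillation) (use s t assms in auto)
  also have "\<dots> \<le> \<rho> * 7 * k"
    using assms cost_nonneg[of \<rho> c 0 "2 * pi"] s t pi_less_4 pi_approx by (intro mult_mono) auto
  finally show ?thesis by simp
qed

text \<open>The radius leaves room for the comparison circles of \<open>nearval_step\<close>, which
  reach 6 + 7/2 units of epsilon away from \<open>p\<close>.\<close>

definition deep :: "real^2 \<Rightarrow> bool" where
  "deep p \<longleftrightarrow> ball p (10 * \<epsilon>) \<subseteq> \<Omega> \<and> E (ball p (10 * \<epsilon>)) < ennreal c0"

text \<open>The value \<open>b\<close> that \<open>w\<close> takes near a point \<open>p\<close> surrounded by little energy. Values at neighbouring points are compared along a
  circle that crosses the two circles on which they are taken.\<close>

definition nearval :: "real^2 \<Rightarrow> real^2 \<Rightarrow> bool" where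
  "nearval p b \<longleftrightarrow> (\<exists>\<rho>. 6 * \<epsilon> < \<rho> \<and> \<rho> < 7 * \<epsilon> \<and> (\<forall>x. dist p x = \<rho> \<longrightarrow> norm (w x - b) \<le> eta))"

lemma nearval_exists: assumes "deep p" obtains b where "nearval p b" "1 - eta \<le> norm b"
proof -
  have "ball p (7 * \<epsilon>) \<subseteq> ball p (10 * \<epsilon>)" using eps by (intro subset_ball) simp
  then have sub: "ball p (7 * \<epsilon>) \<subseteq> \<Omega>" "E (ball p (7 * \<epsilon>)) < ennreal c0"
    using assms E_mono unfolding deep_def by (blast, meson le_less_trans)
  obtain \<rho> where \<rho>: "6 * \<epsilon> < \<rho>" "\<rho> < 7 * \<epsilon>" "cost p \<rho> 0 (2 * pi) \<le> c0 / (7 * \<epsilon> - 6 * \<epsilon>)"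
    by (rule good_circle[OF _ _ sub, of "6 * \<epsilon>"]) (use eps c0_pos in auto)
  have \<rho>0: "0 < \<rho>" and c: "cost p \<rho> 0 (2 * pi) \<le> c0 / \<epsilon>" using \<rho> eps by auto
  define b where "b = w (circ p \<rho> 0)"
  have "norm (w x - b) \<le> eta" if x: "dist p x = \<rho>" for x
  proof -
    have "(norm (w x - b))\<^sup>2 \<le> 7 * \<rho> * (c0 / \<epsilon>)"
      unfolding b_def by (rule sphere_oscillation[OF \<rho>0 c]) (use x \<rho>0 dist_circ[of \<rho> p 0] in auto)
    also have "\<dots> \<le> 7 * (7 * \<epsilon>) * (c0 / \<epsilon>)" using \<rho> eps c0_pos by (intro mult_right_mono) auto
    also have "\<dots> = eta\<^sup>2" using eps c0_eta by simp
    finally show ?thesis using eta_pos by (auto intro: power2_le_imp_le)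
  qed
  then have "nearval p b" using \<rho> unfolding nearval_def by blast
  moreover have "1 - eta \<le> norm b"
  proof -
    have "\<epsilon> / \<rho> \<le> 1" using \<rho> eps by simp
    then have "\<epsilon> / \<rho> \<le> 2 * pi - 0" using pi_gt3 by linarith
    then show ?thesis unfolding b_def using \<rho>0 c by (intro circle_modulus[where a=0 and b="2 * pi"]) auto
  qed
  ultimately show thesis by (rule that)
qed

text \<open>A third circle of small cost crosses both circles on which the values were taken. The
  error is eta on each of the three.\<close>

lemma nearval_step:
  assumes d: "deep p" and n: "nearval p b" "nearval p' b'" and close: "dist p p' < 2 * \<epsilon>"
  shows "norm (b - b') \<le> 3 * eta"
proof -
  obtain r where r: "6 * \<epsilon> < r" "r < 7 * \<epsilon>" "\<And>x. dist p x = r \<Longrightarrow> norm (w x - b) \<le> eta"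
    using n(1) unfolding nearval_def by blast
  obtain r' where r': "6 * \<epsilon> < r'" "r' < 7 * \<epsilon>" "\<And>x. dist p' x = r' \<Longrightarrow> norm (w x - b') \<le> eta"
    using n(2) unfolding nearval_def by blast
  define e where "e = rv 1"
  have e: "norm e = 1" by (simp add: e_def)
  \<comment> \<open>A circle around \<open>z\<close> of radius between 3 and 7/2 units of epsilon
    has antipodal points at distance more than 9 and less than 3 units from \<open>p\<close>, so it
    crosses the circles of radius between 6 and 7 units around all points within 2 units of
    \<open>p\<close>.\<close>
  define z where "z = p + (6 * \<epsilon>) *\<^sub>R e"
  have sub: "ball z (7/2 * \<epsilon>) \<subseteq> ball p (10 * \<epsilon>)"
  proof
    fix x assume "x \<in> ball z (7/2 * \<epsilon>)"
    moreover have "dist p z = 6 * \<epsilon>" using e eps by (simp add: z_def dist_norm)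
    ultimately show "x \<in> ball p (10 * \<epsilon>)" using dist_triangle[of p x z] eps by simp
  qed
  then have sub': "ball z (7/2 * \<epsilon>) \<subseteq> \<Omega>" "E (ball z (7/2 * \<epsilon>)) < ennreal c0"
    using d E_mono unfolding deep_def by (blast, meson le_less_trans)
  obtain \<rho> where \<rho>: "3 * \<epsilon> < \<rho>" "\<rho> < 7/2 * \<epsilon>" "cost z \<rho> 0 (2 * pi) \<le> c0 / (7/2 * \<epsilon> - 3 * \<epsilon>)"
    by (rule good_circle[OF _ _ sub', of "3 * \<epsilon>"]) (use eps c0_pos in auto)
  have \<rho>0: "0 < \<rho>" and c: "cost z \<rho> 0 (2 * pi) \<le> 2 * c0 / \<epsilon>" using \<rho> eps by (auto simp: field_simps)
  define A where "A = z + \<rho> *\<^sub>R e"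
  define B where "B = z - \<rho> *\<^sub>R e"
  have AB: "A \<in> sphere z \<rho>" "B \<in> sphere z \<rho>" using e \<rho>0 by (auto simp: A_def B_def dist_norm)
  have "A - p = (6 * \<epsilon> + \<rho>) *\<^sub>R e" "B - p = (6 * \<epsilon> - \<rho>) *\<^sub>R e"
    by (simp_all add: A_def B_def z_def algebra_simps)
  then have dp: "dist p A = 6 * \<epsilon> + \<rho>" "dist p B = 6 * \<epsilon> - \<rho>"
    unfolding dist_norm norm_minus_commute[of p] using e \<rho> eps by simp_all
  obtain x where x: "x \<in> sphere z \<rho>" "dist p x = r"
    by (rule connected_sphere_crosses[OF AB, of p r]) (use dp r \<rho> in auto)
  have dA: "r' \<le> dist p' A" using dist_triangle[of p A p'] dp close r' \<rho> by simp
  have dB: "dist p' B \<le> r'" using dist_triangle[of p' B p] dp close r' \<rho> by (simp add: dist_commute)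
  obtain x' where x': "x' \<in> sphere z \<rho>" "dist p' x' = r'"
    by (rule connected_sphere_crosses[OF AB dB dA])
  have "(norm (w x - w x'))\<^sup>2 \<le> 7 * \<rho> * (2 * c0 / \<epsilon>)" by (rule sphere_oscillation[OF \<rho>0 c x(1) x'(1)])
  also have "\<dots> \<le> 7 * (7/2 * \<epsilon>) * (2 * c0 / \<epsilon>)" using \<rho> eps c0_pos by (intro mult_right_mono) auto
  also have "\<dots> = eta\<^sup>2" using eps c0_eta by simp
  finally have "norm (w x - w x') \<le> eta" using eta_pos by (auto intro: power2_le_imp_le)
  moreover have "b - b' = (w x - w x') - (w x - b) + (w x' - b')" by simp
  ultimately show ?thesis using r(3)[OF x(2)] r'(3)[OF x'(2)]
    norm_triangle_ineq[of "(w x - w x') - (w x - b)" "w x' - b'"] norm_triangle_ineq4[of "w x - w x'" "w x - b"]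
    by (smt (verit))
qed

text \<open>The segment is cut into 1000 steps shorter than 2 * epsilon; with the comparison at the
  starting point this makes 1001 errors of 3 * eta.\<close>

lemma nearval_chain:
  assumes S: "convex S" "p \<in> S" "q \<in> S" and d: "\<And>z. z \<in> S \<Longrightarrow> deep z"
    and n: "nearval p b" "nearval q b'" and close: "dist p q \<le> 1900 * \<epsilon>"
  shows "norm (b - b') \<le> 3003 * eta"
proof -
  define z where "z k = p + (real k / 1000) *\<^sub>R (q - p)" for k
  have zS: "z k \<in> S" if "k \<le> 1000" for k
  proof -
    have "z k = (1 - real k / 1000) *\<^sub>R p + (real k / 1000) *\<^sub>R q" by (simp add: z_def algebra_simps)
    then show ?thesis using S that convexD_alt[of S p q "real k / 1000"] by simp
  qed
  have step: "dist (z k) (z (Suc k)) < 2 * \<epsilon>" for k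
  proof -
    have "z (Suc k) - z k = (1 / 1000) *\<^sub>R (q - p)" by (simp add: z_def algebra_simps add_divide_distrib)
    then have "dist (z k) (z (Suc k)) = dist p q / 1000"
      unfolding dist_norm norm_minus_commute[of "z k"] norm_minus_commute[of p] by simp
    then show ?thesis using close eps by simp
  qed
  have "norm (b - b'') \<le> 3 * eta * (k + 1)" if "k \<le> 1000" "nearval (z k) b''" for k b''
    using that
  proof (induction k arbitrary: b'')
    case 0
    then have "nearval p b''" by (simp add: z_def)
    then show ?case using nearval_step[OF d[OF S(2)] n(1), of p b''] eps by simp
  next
    case (Suc k)
    obtain c where c: "nearval (z k) c" using nearval_exists[OF d[OF zS[of k]]] Suc.prems by auto
    have "norm (b - c) \<le> 3 * eta * (k + 1)" using Suc.IH[OF _ c] Suc.prems by simp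
    moreover have "norm (c - b'') \<le> 3 * eta"
      using nearval_step[OF d[OF zS[of k]] c Suc.prems(2) step] Suc.prems by simp
    ultimately show ?case using norm_triangle_ineq[of "b - c" "c - b''"] by (simp add: algebra_simps)
  qed
  from this[of 1000 b'] n(2) show ?thesis by (simp add: z_def)
qed

text \<open>The arc leaves the point at \<open>t0\<close> by more than 7 * epsilon and so crosses
  the circle on which \<open>v\<close> is the value of \<open>w\<close>; the cost bounds the
  oscillation from there to \<open>s\<close>.\<close>

lemma nearval_arc:
  assumes \<rho>: "1500 * \<epsilon> \<le> \<rho>" and ab: "2 \<le> b - a" and c: "cost c \<rho> a b \<le> c0 / \<epsilon>"
    and t: "s \<in> {a..b}" "t0 \<in> {a..b}" "\<rho> * \<bar>t0 - s\<bar> \<le> 200 * \<epsilon>" and n: "nearval (circ c \<rho> t0) v"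
  shows "norm (w (circ c \<rho> s) - v) \<le> 4 * eta"
proof -
  have \<rho>0: "0 < \<rho>" using \<rho> eps by (smt (verit) mult_pos_pos)
  \<comment> \<open>Arc length 14 * epsilon, whose chord is at least half as long.\<close>
  define d where "d = 14 * \<epsilon> / \<rho>"
  have d: "0 < d" "d \<le> 1" "\<rho> * d = 14 * \<epsilon>" using \<rho> \<rho>0 eps by (auto simp: d_def)
  define t1 where "t1 = (if t0 + d \<le> b then t0 + d else t0 - d)"
  have t1: "t1 \<in> {a..b}" "\<bar>t1 - t0\<bar> = d" using t d ab by (auto simp: t1_def)
  let ?q = "circ c \<rho> t0"
  obtain r where r: "6 * \<epsilon> < r" "r < 7 * \<epsilon>" "\<And>x. dist ?q x = r \<Longrightarrow> norm (w x - v) \<le> eta"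
    using n unfolding nearval_def by blast
  have "7 * \<epsilon> \<le> dist ?q (circ c \<rho> t1)"
  proof -
    have "\<bar>(t0 - t1) / 2\<bar> \<le> 2 * \<bar>sin ((t0 - t1) / 2)\<bar>"
      using t1 d pi_gt3 by (intro abs_le_2_abs_sin) (auto simp: abs_minus_commute)
    then have "\<rho> * (d / 2) \<le> \<rho> * (2 * \<bar>sin ((t0 - t1) / 2)\<bar>)" using \<rho>0 t1(2)
      by (intro mult_left_mono) (auto simp: abs_minus_commute)
    then show ?thesis using \<rho>0 d by (simp add: dist_circ_circ)
  qed
  moreover have "dist ?q (circ c \<rho> t0) \<le> r" using r eps by simp
  moreover have "closed_segment t0 t1 \<subseteq> {a..b}" using t t1 by (intro closed_segment_subset) auto
  moreover have "connected ((\<lambda>t. dist ?q (circ c \<rho> t)) ` closed_segment t0 t1)"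
    by (intro connected_continuous_image continuous_intros connected_segment)
  moreover have "dist ?q (circ c \<rho> t0) \<in> (\<lambda>t. dist ?q (circ c \<rho> t)) ` closed_segment t0 t1"
    "dist ?q (circ c \<rho> t1) \<in> (\<lambda>t. dist ?q (circ c \<rho> t)) ` closed_segment t0 t1"
    by (intro imageI ends_in_segment)+
  ultimately have "r \<in> (\<lambda>t. dist ?q (circ c \<rho> t)) ` closed_segment t0 t1"
    using r(2) by (meson connectedD_interval less_imp_le order_trans)
  then obtain t2 where t2: "t2 \<in> closed_segment t0 t1" "dist ?q (circ c \<rho> t2) = r" by blast
  have t2': "t2 \<in> {a..b}" "\<bar>t2 - t0\<bar> \<le> d"
    using t2(1) t1 t(2) by (auto simp: closed_segment_eq_real_ivl split: if_splits)
  have "(norm (w (circ c \<rho> t2) - w (circ c \<rho> s)))\<^sup>2 \<le> \<rho> * \<bar>t2 - s\<bar> * cost c \<rho> a b"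
    by (rule circle_oscillation[OF \<rho>0 t(1) t2'(1)])
  also have "\<dots> \<le> (214 * \<epsilon>) * (c0 / \<epsilon>)"
  proof (rule mult_mono)
    show "cost c \<rho> a b \<le> c0 / \<epsilon>" by (rule c)
    have "\<rho> * \<bar>t2 - s\<bar> \<le> \<rho> * (d + \<bar>t0 - s\<bar>)" using t2' \<rho>0 by (intro mult_left_mono) auto
    then show "\<rho> * \<bar>t2 - s\<bar> \<le> 214 * \<epsilon>" using t(3) d by (simp add: distrib_left)
  qed (use cost_nonneg[OF \<rho>0] eps in auto)
  also have "\<dots> \<le> (3 * eta)\<^sup>2" using eps c0_eta c0_pos by (simp add: power_mult_distrib)
  finally have "norm (w (circ c \<rho> t2) - w (circ c \<rho> s)) \<le> 3 * eta" using eta_pos by (auto intro: power2_le_imp_le)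
  then show ?thesis using r(3)[OF t2(2)]
    norm_triangle_ineq4[of "w (circ c \<rho> t2) - v" "w (circ c \<rho> t2) - w (circ c \<rho> s)"] by simp
qed

end

lemma cos_ge_quadratic: "1 - x\<^sup>2 / 2 \<le> cos x" for x :: real
proof -
  have "\<bar>sin (x / 2)\<bar> \<le> \<bar>x / 2\<bar>" by (rule abs_sin_x_le_abs_x)
  then have "(sin (x / 2))\<^sup>2 \<le> (x / 2)\<^sup>2" using abs_le_square_iff by blast
  moreover have "cos x = 1 - 2 * (sin (x / 2))\<^sup>2" using cos_double_sin[of "x / 2"] by simp
  ultimately show ?thesis by (simp add: power_divide)
qed

lemma sin_ge_half: assumes "pi / 6 \<le> x" "x \<le> 5 * pi / 6" shows "1 / 2 \<le> sin x"
proof (cases "x \<le> pi / 2")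
  case True
  then have "sin (pi / 6) \<le> sin x" using assms pi_gt_zero by (intro sin_monotone_2pi_le) linarith+
  then show ?thesis by (simp add: sin_30)
next
  case False
  then have "sin (pi / 6) \<le> sin (pi - x)" using assms pi_gt_zero by (intro sin_monotone_2pi_le) linarith+
  then show ?thesis by (simp add: sin_30)
qed

text \<open>This is the nearness of directions that \<open>compare_angle\<close> requires.\<close>

lemma inner_ge_of_close:
  fixes v z :: "'a::real_inner"
  assumes "norm (v - z) \<le> 1/200" "9/10 \<le> norm z" shows "99/100 * (norm v * norm z) \<le> v \<bullet> z" "v \<noteq> 0"
proof -
  have n: "norm z \<le> norm v + 1/200" using assms(1) norm_triangle_ineq2[of z v] by (simp add: norm_minus_commute)
  then have v: "89/100 \<le> norm v" using assms(2) by simp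
  then show "v \<noteq> 0" by auto
  have "89/100 * (9/10) \<le> norm v * norm z" using v assms(2) by (intro mult_mono) auto
  moreover have "(norm (v - z))\<^sup>2 \<le> (1/200)\<^sup>2" using assms(1) by (intro power_mono) auto
  moreover have "(norm (v - z))\<^sup>2 = (norm v)\<^sup>2 - 2 * (v \<bullet> z) + (norm z)\<^sup>2"
    by (simp add: power2_norm_eq_inner inner_diff inner_commute)
  moreover have "0 \<le> (norm v - norm z)\<^sup>2" by simp
  ultimately show "99/100 * (norm v * norm z) \<le> v \<bullet> z"
    by (simp add: power2_diff power_divide mult.assoc)
qed

text \<open>\<open>N\<close> extends the normal continuously and stays close to it on the scale
  \<open>r1\<close>. The length 50 * epsilon of the exceptional set is half of the range of radii
  from which a good circle is chosen in \<open>field_tangential\<close>.\<close>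

locale normal_field = gl_field +
  fixes N :: "real^2 \<Rightarrow> real^2" and r1 a :: real
  assumes contN: "continuous_on UNIV N" and N_le: "\<And>x. norm (N x) \<le> 1"
    and N_near: "\<And>x y. x \<in> closure \<Omega> \<Longrightarrow> y \<in> frontier \<Omega> \<Longrightarrow> dist x y < r1 \<Longrightarrow> norm (N x - \<nu> y) \<le> 1/8"
    and r1: "0 < r1" "2 * r1 \<le> r0" "K * r1 \<le> 1/200" and eps_small: "4000 * \<epsilon> \<le> r1"
    and a: "0 < a" "a \<le> 1/1000"
    and small_trace: "hausdorff1_outer {y \<in> frontier \<Omega>. a \<le> \<bar>w y \<bullet> \<nu> y\<bar>} \<le> ennreal (50 * \<epsilon>)"
begin

text \<open>Near the frontier, \<open>w\<close> is sampled at a point \<open>P x\<close> that is shifted inwards; \<open>wedge y x\<close> is a convex set of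
  points through which one can pass from there to other points without leaving the domain.\<close>

definition P :: "real^2 \<Rightarrow> real^2" where "P x = x - (40 * \<epsilon>) *\<^sub>R N x"

text \<open>The radius covers every place where \<open>f\<close> is compared with \<open>w\<close>
  around \<open>x\<close>: chains of points up to 1900 * epsilon away and circles of radius between
  1500 * epsilon and 1600 * epsilon.\<close>

definition low :: "real^2 \<Rightarrow> bool" where "low x \<longleftrightarrow> E (ball x (2000 * \<epsilon>)) < ennreal c0"

definition bad :: "(real^2) set" where "bad = {y \<in> frontier \<Omega>. a \<le> \<bar>w y \<bullet> \<nu> y\<bar>}"

definition wedge :: "real^2 \<Rightarrow> real^2 \<Rightarrow> (real^2) set" where
  "wedge y x = {z. (z - x) \<bullet> \<nu> y \<le> - (1/2) * norm (z - x) \<and> (z - x) \<bullet> \<nu> y \<le> - (30 * \<epsilon>)}"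

text \<open>Only the direction of \<open>f\<close> matters for zeros, angles and tangency, so a
  positive factor \<open>W\<close> is left free. Outside the points with \<open>low\<close> nothing
  but continuity is required.\<close>

definition field :: "(real^2 \<Rightarrow> real^2) \<Rightarrow> bool" where
  "field f \<longleftrightarrow> continuous_on UNIV f \<and> (\<forall>x\<in>closure \<Omega>. low x \<longrightarrow>
     (\<exists>W v. 0 < W \<and> f x = W *\<^sub>R v \<and> (\<forall>b. nearval (P x) b \<longrightarrow> norm (v - b) \<le> 3 * eta)))"

lemma convex_wedge: "convex (wedge y x)"
proof -
  have "convex {z. (z - x) \<bullet> \<nu> y + (1/2) * norm (z - x) \<le> 0}"
  proof (rule convexI)
    fix z z' :: "real^2" and p q :: real
    assume z: "z \<in> {z. (z - x) \<bullet> \<nu> y + (1/2) * norm (z - x) \<le> 0}" "z' \<in> {z. (z - x) \<bullet> \<nu> y + (1/2) * norm (z - x) \<le> 0}"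
      and pq: "0 \<le> p" "0 \<le> q" "p + q = 1"
    have "x = p *\<^sub>R x + q *\<^sub>R x" using pq(3) by (metis scaleR_add_left scaleR_one)
    then have e: "p *\<^sub>R z + q *\<^sub>R z' - x = p *\<^sub>R (z - x) + q *\<^sub>R (z' - x)" by (simp add: algebra_simps)
    have n: "norm (p *\<^sub>R (z - x) + q *\<^sub>R (z' - x)) \<le> p * norm (z - x) + q * norm (z' - x)"
      using norm_triangle_ineq[of "p *\<^sub>R (z - x)" "q *\<^sub>R (z' - x)"] pq by simp
    have "p * ((z - x) \<bullet> \<nu> y + (1/2) * norm (z - x)) \<le> 0" "q * ((z' - x) \<bullet> \<nu> y + (1/2) * norm (z' - x)) \<le> 0"
      using z pq by (auto intro: mult_nonneg_nonpos)
    then have "p * ((z - x) \<bullet> \<nu> y) + (1/2) * (p * norm (z - x)) \<le> 0" "q * ((z' - x) \<bullet> \<nu> y) + (1/2) * (q * norm (z' - x)) \<le> 0"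
      by (simp_all add: algebra_simps)
    then show "p *\<^sub>R z + q *\<^sub>R z' \<in> {z. (z - x) \<bullet> \<nu> y + (1/2) * norm (z - x) \<le> 0}"
      unfolding mem_Collect_eq e inner_add_left inner_scaleR_left using n by linarith
  qed
  moreover have "convex {z. \<nu> y \<bullet> z \<le> \<nu> y \<bullet> x - 30 * \<epsilon>}" by (rule convex_halfspace_le)
  moreover have "wedge y x = {z. (z - x) \<bullet> \<nu> y + (1/2) * norm (z - x) \<le> 0} \<inter> {z. \<nu> y \<bullet> z \<le> \<nu> y \<bullet> x - 30 * \<epsilon>}"
    by (auto simp: wedge_def inner_diff inner_commute)
  ultimately show ?thesis by (simp add: convex_Int)
qed

text \<open>At depth h >= 30 * epsilon with |z - x| <= 2 * h, moving by 10 * epsilon leaves an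
  inward slope of at least 1/8, so \<open>cone\<close> at \<open>x\<close> applies.\<close>

lemma wedge_ball:
  assumes y: "y \<in> frontier \<Omega>" and x: "x \<in> closure \<Omega>" "dist y x < r1" and z: "z \<in> wedge y x" "dist x z \<le> 1900 * \<epsilon>"
  shows "ball z (10 * \<epsilon>) \<subseteq> \<Omega>"
proof
  fix z' assume z': "z' \<in> ball z (10 * \<epsilon>)"
  have "\<bar>(z' - z) \<bullet> \<nu> y\<bar> \<le> norm (z' - z)" using Cauchy_Schwarz_ineq2[of "z' - z" "\<nu> y"] norm_normal[OF y] by simp
  moreover have nz: "norm (z' - z) \<le> 10 * \<epsilon>" using z' by (simp add: dist_norm norm_minus_commute)
  moreover have "(z' - x) \<bullet> \<nu> y = (z - x) \<bullet> \<nu> y + (z' - z) \<bullet> \<nu> y" by (simp add: inner_diff)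
  moreover have "norm (z' - x) \<le> norm (z - x) + norm (z' - z)" using norm_triangle_ineq[of "z - x" "z' - z"] by simp
  ultimately have c: "(z' - x) \<bullet> \<nu> y \<le> - (1/8) * norm (z' - x)" and neg: "(z' - x) \<bullet> \<nu> y < 0"
    using z(1) eps unfolding wedge_def by auto
  have r: "r1 + 2000 * \<epsilon> < r0" using eps_small r1 by simp
  show "z' \<in> \<Omega>"
  proof (rule cone[OF y _ _ x(1) _ c])
    show "x \<in> ball y r0" using x r eps by simp
    have "dist y z' \<le> dist y x + dist x z + dist z z'" using dist_triangle[of y z' x] dist_triangle[of x z' z] by simp
    then show "z' \<in> ball y r0" using x z z' r eps by simp
    show "x \<noteq> z'" using neg by auto
  qed
qed

lemma P_wedge:
  assumes y: "y \<in> frontier \<Omega>" and x: "x \<in> closure \<Omega>" "dist y x < r1"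
  shows "P x \<in> wedge y x"
proof -
  have 1: "norm (P x - x) \<le> 40 * \<epsilon>" using N_le[of x] eps by (simp add: P_def)
  have "\<bar>(N x - \<nu> y) \<bullet> \<nu> y\<bar> \<le> 1/8"
    using Cauchy_Schwarz_ineq2[of "N x - \<nu> y" "\<nu> y"] norm_normal[OF y] N_near[OF x(1) y] x(2) by (simp add: dist_commute)
  moreover have "(N x - \<nu> y) \<bullet> \<nu> y = N x \<bullet> \<nu> y - 1"
    using norm_normal[OF y] by (simp add: inner_diff_left norm_eq_1)
  ultimately have "7/8 \<le> N x \<bullet> \<nu> y" by linarith
  then have "40 * \<epsilon> * (7/8) \<le> 40 * \<epsilon> * (N x \<bullet> \<nu> y)" using eps by (intro mult_left_mono) auto
  then have "(P x - x) \<bullet> \<nu> y \<le> - (35 * \<epsilon>)" by (simp add: P_def)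
  then show ?thesis using 1 eps unfolding wedge_def by simp
qed

lemma dist_P: "dist x (P x) \<le> 40 * \<epsilon>" using N_le[of x] eps by (simp add: P_def dist_norm)

lemma deepI: assumes "low x" "ball z (10 * \<epsilon>) \<subseteq> \<Omega>" "dist x z \<le> 1900 * \<epsilon>" shows "deep z"
proof -
  have "ball z (10 * \<epsilon>) \<subseteq> ball x (2000 * \<epsilon>)"
  proof
    fix z' assume "z' \<in> ball z (10 * \<epsilon>)"
    then show "z' \<in> ball x (2000 * \<epsilon>)" using dist_triangle[of x z' z] assms(3) eps by simp
  qed
  then show ?thesis using assms E_mono unfolding deep_def low_def by (meson le_less_trans)
qed

lemma P_deep: assumes x: "x \<in> closure \<Omega>" "low x" shows "deep (P x)"
proof (cases "cball x (60 * \<epsilon>) \<inter> frontier \<Omega> = {}")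
  case True
  then have "cball x (60 * \<epsilon>) \<subseteq> \<Omega>" using x(1) eps by (intro cball_inside[of x]) auto
  moreover have "ball (P x) (10 * \<epsilon>) \<subseteq> cball x (60 * \<epsilon>)"
  proof
    fix z assume "z \<in> ball (P x) (10 * \<epsilon>)"
    then show "z \<in> cball x (60 * \<epsilon>)" using dist_triangle[of x z "P x"] dist_P[of x] eps by simp
  qed
  ultimately show ?thesis using dist_P[of x] eps by (intro deepI[OF x(2)]) auto
next
  case False
  then obtain y where y: "y \<in> frontier \<Omega>" "dist x y \<le> 60 * \<epsilon>" by auto
  then have y: "y \<in> frontier \<Omega>" "dist y x < r1" using eps eps_small by (auto simp: dist_commute[of y])
  show ?thesis using wedge_ball[OF y(1) x(1) y(2) P_wedge[OF y(1) x(1) y(2)]] dist_P[of x] eps by (intro deepI[OF x(2)]) auto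
qed

text \<open>A weighted sum of sampled values with tent functions of width epsilon around finitely
  many sample points. Only samples close to \<open>P x\<close> contribute at \<open>x\<close>, and
  by \<open>nearval_step\<close> these are within 3 * eta of each other's nearby values.\<close>

lemma field_exists: obtains f where "field f"
proof -
  define L where "L = P ` {x \<in> closure \<Omega>. low x}"
  have contP: "continuous_on UNIV P" unfolding P_def[abs_def] by (intro continuous_intros contN)
  have "compact (P ` closure \<Omega>)"
    using bounded_dom contP by (intro compact_continuous_image) (auto intro: continuous_on_subset)
  then have "bounded L" unfolding L_def by (rule bounded_subset[OF compact_imp_bounded]) auto
  then have "compact (closure L)" by simp
  moreover have "closure L \<subseteq> (\<Union>p\<in>L. ball p \<epsilon>)"
  proof
    fix q assume "q \<in> closure L"
    then obtain p where "p \<in> L" "dist p q < \<epsilon>" using eps by (meson closure_approachable)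
    then show "q \<in> (\<Union>p\<in>L. ball p \<epsilon>)" by auto
  qed
  ultimately obtain D where D: "D \<subseteq> L" "finite D" "closure L \<subseteq> (\<Union>p\<in>D. ball p \<epsilon>)"
    using compactE_image[of "closure L" L "\<lambda>p. ball p \<epsilon>"] by auto
  have deepL: "deep p" if "p \<in> L" for p using that P_deep by (auto simp: L_def)
  define bv where "bv p = (SOME b. nearval p b)" for p
  have bv: "nearval p (bv p)" if "p \<in> L" for p
    unfolding bv_def using nearval_exists[OF deepL[OF that]] by (metis someI_ex)
  define lam where "lam p x = max 0 (\<epsilon> - dist (P x) p)" for p x
  define f where "f x = (\<Sum>p\<in>D. lam p x *\<^sub>R bv p)" for x
  have "continuous_on UNIV f"
    unfolding f_def[abs_def] lam_def by (intro continuous_intros contP)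
  moreover have "\<exists>W v. 0 < W \<and> f x = W *\<^sub>R v \<and> (\<forall>b. nearval (P x) b \<longrightarrow> norm (v - b) \<le> 3 * eta)"
    if x: "x \<in> closure \<Omega>" "low x" for x
  proof -
    define W where "W = (\<Sum>p\<in>D. lam p x)"
    have PL: "P x \<in> L" using x by (auto simp: L_def)
    then obtain p where p: "p \<in> D" "P x \<in> ball p \<epsilon>" using D(3) closure_subset[of L] by blast
    have lam0: "0 \<le> lam q x" for q by (simp add: lam_def)
    have "0 < lam p x" using p by (simp add: lam_def dist_commute)
    then have W: "0 < W" unfolding W_def using p lam0 D(2) by (intro sum_pos2[of D p]) auto
    define v where "v = (1 / W) *\<^sub>R f x"
    have "norm (v - b) \<le> 3 * eta" if b: "nearval (P x) b" for b
    proof -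
      have "W *\<^sub>R (v - b) = f x - W *\<^sub>R b" using W by (simp add: v_def scaleR_diff_right)
      also have "\<dots> = (\<Sum>p\<in>D. lam p x *\<^sub>R (bv p - b))"
        by (simp add: f_def W_def scaleR_diff_right sum_subtractf scaleR_sum_left)
      also have "norm \<dots> \<le> (\<Sum>p\<in>D. lam p x * (3 * eta))"
      proof (rule sum_norm_le)
        fix q assume q: "q \<in> D"
        show "norm (lam q x *\<^sub>R (bv q - b)) \<le> lam q x * (3 * eta)"
        proof (cases "lam q x = 0")
          case False
          then have "dist (P x) q < 2 * \<epsilon>" using eps by (auto simp: lam_def split: if_splits simp: max_def)
          then have "norm (b - bv q) \<le> 3 * eta"
            using q D(1) by (intro nearval_step[OF deepL[OF PL] b bv]) auto
          then show ?thesis using lam0[of q] by (simp add: norm_minus_commute mult_left_mono)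
        qed simp
      qed
      also have "\<dots> = W * (3 * eta)" by (simp add: W_def sum_distrib_right)
      finally show ?thesis using W by simp
    qed
    moreover have "f x = W *\<^sub>R v" using W by (simp add: v_def)
    ultimately show ?thesis using W by blast
  qed
  ultimately have "field f" unfolding field_def by blast
  then show thesis by (rule that)
qed

text \<open>Away from the boundary both \<open>x\<close> and \<open>P x\<close> lie in a ball of
  deep points, so the sampled value is carried to \<open>x\<close> by a chain and to the circle by
  \<open>nearval_arc\<close>.\<close>

lemma field_interior:
  assumes f: "field f" and low: "low (circ c \<rho> s)" and ins: "ball (circ c \<rho> s) (200 * \<epsilon>) \<subseteq> \<Omega>"
    and \<rho>: "1500 * \<epsilon> \<le> \<rho>" and ab: "2 \<le> b' - a'" "s \<in> {a'..b'}" and c: "cost c \<rho> a' b' \<le> c0 / \<epsilon>"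
  shows "\<exists>W v. 0 < W \<and> f (circ c \<rho> s) = W *\<^sub>R v \<and> norm (v - w (circ c \<rho> s)) \<le> 1/200"
proof -
  let ?x = "circ c \<rho> s"
  have x: "?x \<in> closure \<Omega>" using ins eps closure_subset[of \<Omega>] by (auto dest!: subsetD[of _ _ ?x])
  obtain W v where W: "0 < W" "f ?x = W *\<^sub>R v" "\<And>b. nearval (P ?x) b \<Longrightarrow> norm (v - b) \<le> 3 * eta"
    using f low x unfolding field_def by blast
  have deep: "deep z" if z: "z \<in> cball ?x (100 * \<epsilon>)" for z
  proof (rule deepI[OF low])
    show "ball z (10 * \<epsilon>) \<subseteq> \<Omega>"
    proof
      fix z' assume "z' \<in> ball z (10 * \<epsilon>)"
      then have "z' \<in> ball ?x (200 * \<epsilon>)" using z dist_triangle[of ?x z' z] eps by simp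
      then show "z' \<in> \<Omega>" using ins by blast
    qed
  qed (use z eps in auto)
  have S: "P ?x \<in> cball ?x (100 * \<epsilon>)" "?x \<in> cball ?x (100 * \<epsilon>)" using dist_P[of ?x] eps by auto
  obtain b where b: "nearval (P ?x) b" using nearval_exists[OF deep[OF S(1)]] by blast
  obtain b' where b': "nearval ?x b'" using nearval_exists[OF deep[OF S(2)]] by blast
  have "norm (b - b') \<le> 3003 * eta"
    using dist_P[of ?x] eps by (intro nearval_chain[OF convex_cball S deep b b']) (auto simp: dist_commute)
  moreover have "norm (w ?x - b') \<le> 4 * eta"
    by (rule nearval_arc[OF \<rho> ab(1) c ab(2,2) _ b']) (use eps in simp)
  moreover have "norm (v - b) \<le> 3 * eta" by (rule W(3)[OF b])
  moreover have "norm (v - w ?x) \<le> norm (v - b) + norm (b - b') + norm (w ?x - b')"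
    using norm_triangle_ineq[of "v - b" "b - w ?x"] norm_triangle_ineq4[of "b - b'" "w ?x - b'"] by simp
  ultimately have "norm (v - w ?x) \<le> 3010 * eta" by simp
  then show ?thesis using W unfolding eta_def by (intro exI[of _ W] exI[of _ v]) simp
qed

text \<open>If \<open>x\<close> is too close to the boundary to be deep, the chain runs inside the
  wedge to another point of the circle, and the comparison returns along the circle.\<close>

lemma field_wedge:
  assumes f: "field f" and x: "x \<in> closure \<Omega>" "low x" and y: "y \<in> frontier \<Omega>" "dist y x < r1"
    and \<rho>: "1500 * \<epsilon> \<le> \<rho>" and ab: "2 \<le> b' - a'" "s \<in> {a'..b'}" "t \<in> {a'..b'}" "\<rho> * \<bar>t - s\<bar> \<le> 200 * \<epsilon>"
    and c: "cost c \<rho> a' b' \<le> c0 / \<epsilon>" and q: "circ c \<rho> t \<in> wedge y x" "dist x (circ c \<rho> t) \<le> 1800 * \<epsilon>"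
  shows "\<exists>W v. 0 < W \<and> f x = W *\<^sub>R v \<and> norm (v - w (circ c \<rho> s)) \<le> 1/250 \<and> 9/10 \<le> norm v"
proof -
  obtain W v where W: "0 < W" "f x = W *\<^sub>R v" "\<And>b. nearval (P x) b \<Longrightarrow> norm (v - b) \<le> 3 * eta"
    using f x unfolding field_def by blast
  let ?S = "wedge y x \<inter> cball x (1850 * \<epsilon>)" and ?q = "circ c \<rho> t"
  have S: "convex ?S" "P x \<in> ?S" "?q \<in> ?S"
    using convex_wedge P_wedge[OF y(1) x(1) y(2)] dist_P[of x] q eps by (auto intro!: convex_Int)
  have deep: "deep z" if z: "z \<in> ?S" for z
    using z eps by (intro deepI[OF x(2)] wedge_ball[OF y(1) x(1) y(2)]) auto
  obtain b where b: "nearval (P x) b" "1 - eta \<le> norm b" using nearval_exists[OF deep[OF S(2)]] by blast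
  obtain b' where b': "nearval ?q b'" using nearval_exists[OF deep[OF S(3)]] by blast
  have "dist (P x) ?q \<le> 1900 * \<epsilon>"
    using dist_triangle[of "P x" ?q x] dist_P[of x] q eps by (simp add: dist_commute)
  then have "norm (b - b') \<le> 3003 * eta" by (intro nearval_chain[OF S deep b(1) b'])
  moreover have "norm (w (circ c \<rho> s) - b') \<le> 4 * eta" by (rule nearval_arc[OF \<rho> ab(1) c ab(2,3,4) b'])
  moreover have vb: "norm (v - b) \<le> 3 * eta" by (rule W(3)[OF b(1)])
  moreover have "norm (v - w (circ c \<rho> s)) \<le> norm (v - b) + norm (b - b') + norm (w (circ c \<rho> s) - b')"
    using norm_triangle_ineq[of "v - b" "b - w (circ c \<rho> s)"] norm_triangle_ineq4[of "b - b'" "w (circ c \<rho> s) - b'"] by simp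
  ultimately have "norm (v - w (circ c \<rho> s)) \<le> 3010 * eta" by simp
  moreover have "norm b \<le> norm v + norm (v - b)" using norm_triangle_ineq4[of v "v - b"] by simp
  ultimately show ?thesis using W b(2) vb unfolding eta_def by (intro exI[of _ W] exI[of _ v]) simp
qed

lemma circ_normal:
  assumes "cx (\<nu> y) = - \<i> * cis \<omega>"
  shows "(circ y \<rho> s - y) \<bullet> \<nu> y = - \<rho> * sin (s - \<omega>)"
proof -
  have "(circ y \<rho> s - y) \<bullet> \<nu> y = Re ((\<rho> *\<^sub>R cis s) * cnj (- \<i> * cis \<omega>))"
    unfolding circ_def by (simp only: add_diff_cancel_left' inner_cx cx_scaleR cx_rv assms)
  also have "\<dots> = \<rho> * Re (cis s * cnj (- \<i> * cis \<omega>))" by (simp only: mult_scaleR_left scaleR_complex.sel)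
  also have "Re (cis s * cnj (- \<i> * cis \<omega>)) = - sin (s - \<omega>)" by (simp add: sin_diff)
  finally show ?thesis by simp
qed

text \<open>Points high above the tangent are treated by \<open>field_interior\<close>. Near the
  ends of the arc the circle runs almost along the inward normal, so a short way along it leads from
  \<open>circ y \<rho> s\<close> into the wedge.\<close>

lemma field_boundary:
  assumes f: "field f" and y: "y \<in> frontier \<Omega>" and \<omega>: "cx (\<nu> y) = - \<i> * cis \<omega>"
    and \<rho>: "1500 * \<epsilon> \<le> \<rho>" "\<rho> < r1"
    and ab: "\<bar>a' - \<omega>\<bar> \<le> 2 * K * \<rho>" "\<bar>b' - (\<omega> + pi)\<bar> \<le> 2 * K * \<rho>" and s: "s \<in> {a'..b'}"
    and cl: "circ y \<rho> s \<in> closure \<Omega>" and low: "low (circ y \<rho> s)" and c: "cost y \<rho> a' b' \<le> c0 / \<epsilon>"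
  shows "\<exists>W v. 0 < W \<and> f (circ y \<rho> s) = W *\<^sub>R v \<and> norm (v - w (circ y \<rho> s)) \<le> 1/200"
proof -
  let ?x = "circ y \<rho> s"
  have \<rho>0: "0 < \<rho>" using \<rho> eps by linarith
  have "K * \<rho> \<le> K * r1" using K \<rho> by (intro mult_left_mono) auto
  then have K\<rho>: "2 * K * \<rho> \<le> 1/100" using r1 by simp
  have ab2: "2 \<le> b' - a'" using ab K\<rho> pi_gt3 by linarith
  have dx: "dist y ?x = \<rho>" using \<rho>0 by (simp add: dist_circ)
  show ?thesis
  proof (cases "1/2 \<le> sin (s - \<omega>)")
    case True
    have "ball ?x (200 * \<epsilon>) \<subseteq> \<Omega>"
    proof
      fix z assume z: "z \<in> ball ?x (200 * \<epsilon>)"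
      have nz: "norm (z - ?x) < 200 * \<epsilon>" using z by (simp add: dist_norm norm_minus_commute)
      have "\<bar>(z - ?x) \<bullet> \<nu> y\<bar> \<le> norm (z - ?x)" using Cauchy_Schwarz_ineq2[of "z - ?x" "\<nu> y"] norm_normal[OF y] by simp
      moreover have "(z - y) \<bullet> \<nu> y = (z - ?x) \<bullet> \<nu> y + (?x - y) \<bullet> \<nu> y" by (simp add: inner_diff)
      moreover have "\<rho> * (1/2) \<le> \<rho> * sin (s - \<omega>)" using True \<rho>0 by (intro mult_left_mono) auto
      ultimately have in1: "(z - y) \<bullet> \<nu> y \<le> 200 * \<epsilon> - \<rho> / 2" using nz circ_normal[OF \<omega>, of \<rho> s] by simp
      have nzy: "norm (z - y) \<le> \<rho> + 200 * \<epsilon>"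
        using norm_triangle_ineq[of "z - ?x" "?x - y"] nz dx by (simp add: dist_norm norm_minus_commute)
      show "z \<in> \<Omega>"
      proof (rule cone[OF y])
        show "y \<in> ball y r0" using r0 by simp
        show "z \<in> ball y r0" using nzy \<rho> r1 eps_small eps by (simp add: dist_norm norm_minus_commute)
        show "y \<in> closure \<Omega>" using y frontier_subset_closure by blast
        show "y \<noteq> z" using in1 \<rho> eps by auto
        show "(z - y) \<bullet> \<nu> y \<le> - (1/8) * norm (z - y)" using in1 nzy \<rho> eps by simp
      qed
    qed
    then show ?thesis using field_interior[OF f low _ \<rho>(1) ab2 s c] by blast
  next
    case False
    \<comment> \<open>Arc length 80 * epsilon: the chord is at least 40 * epsilon, and 4/5 of it
      exceeds the depth 30 * epsilon of the wedge.\<close>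
    define d where "d = 80 * \<epsilon> / \<rho>"
    have d: "0 < d" "d \<le> 6/100" "\<rho> * d = 80 * \<epsilon>" using \<rho> \<rho>0 eps by (auto simp: d_def field_simps)
    have pi: "pi \<le> 315/100" using pi_approx by simp
    have ab3: "\<bar>a' - \<omega>\<bar> \<le> 1/100" "\<bar>b' - (\<omega> + pi)\<bar> \<le> 1/100" using ab K\<rho> by linarith+
    have s': "a' \<le> s" "s \<le> b'" using s by auto
    then have s3: "- 1/100 \<le> s - \<omega>" "s - \<omega> \<le> pi + 1/100" using ab3 by linarith+
    have s4: "s - \<omega> < pi / 6 \<or> 5 * pi / 6 < s - \<omega>" using sin_ge_half[of "s - \<omega>"] False by linarith
    define e :: real where "e = (if s - \<omega> < pi / 6 then 1 else -1)"
    define t where "t = s + e * d"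
    \<comment> \<open>The mean of the two angles, reduced by pi at the far end; its cosine is the
      inward slope of the chord.\<close>
    define m where "m = (if s - \<omega> < pi / 6 then s - \<omega> + d / 2 else s - \<omega> - pi - d / 2)"
    have m: "\<bar>m\<bar> \<le> 6/10"
    proof (cases "s - \<omega> < pi / 6")
      case True
      then have "m = s - \<omega> + d / 2" by (simp add: m_def)
      then show ?thesis using True s3 d pi by (intro abs_leI) linarith+
    next
      case False
      then have "m = s - \<omega> - pi - d / 2" by (simp add: m_def)
      then show ?thesis using False s4 s3 d pi by (intro abs_leI) linarith+
    qed
    have t: "t \<in> {a'..b'}" "\<bar>t - s\<bar> = d"
    proof -
      show "\<bar>t - s\<bar> = d" using d by (simp add: t_def e_def)
      have "a' \<le> t \<and> t \<le> b'"
      proof (cases "s - \<omega> < pi / 6")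
        case True
        then have "t = s + d" by (simp add: t_def e_def)
        then show ?thesis using True s' ab3 d pi_gt3 by (intro conjI) linarith+
      next
        case False
        then have "t = s - d" by (simp add: t_def e_def)
        then show ?thesis using False s4 s' ab3 d pi_gt3 by (intro conjI) linarith+
      qed
      then show "t \<in> {a'..b'}" by simp
    qed
    let ?q = "circ y \<rho> t"
    have "\<bar>(t - s) / 2\<bar> \<le> 2 * \<bar>sin ((t - s) / 2)\<bar>" using t d pi_gt3 by (intro abs_le_2_abs_sin) auto
    then have "\<rho> * (d / 2) \<le> \<rho> * (2 * \<bar>sin ((t - s) / 2)\<bar>)" using \<rho>0 t(2) by (intro mult_left_mono) auto
    moreover have chord: "dist ?x ?q = 2 * \<rho> * \<bar>sin ((t - s) / 2)\<bar>"
      using \<rho>0 by (subst dist_commute) (simp add: dist_circ_circ)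
    ultimately have lo: "40 * \<epsilon> \<le> dist ?x ?q" using d by simp
    have "\<bar>sin ((t - s) / 2)\<bar> \<le> \<bar>(t - s) / 2\<bar>" by (rule abs_sin_x_le_abs_x)
    then have "2 * \<rho> * \<bar>sin ((t - s) / 2)\<bar> \<le> 2 * \<rho> * (d / 2)" using \<rho>0 t(2) by (intro mult_left_mono) auto
    then have hi: "dist ?x ?q \<le> 80 * \<epsilon>" using chord d by simp
    have cosm: "4/5 \<le> cos m"
    proof -
      have "m\<^sup>2 \<le> (6/10)\<^sup>2" using m by (metis abs_le_square_iff abs_of_nonneg zero_le_divide_iff zero_le_numeral)
      then show ?thesis using cos_ge_quadratic[of m] by (simp add: power2_eq_square)
    qed
    have "(?q - ?x) \<bullet> \<nu> y = - \<rho> * (sin (t - \<omega>) - sin (s - \<omega>))"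
    proof -
      have "(?q - ?x) \<bullet> \<nu> y = (?q - y) \<bullet> \<nu> y - (?x - y) \<bullet> \<nu> y" by (simp add: inner_diff)
      then show ?thesis unfolding circ_normal[OF \<omega>] by (simp add: algebra_simps)
    qed
    also have "\<dots> = - (dist ?x ?q) * cos m"
    proof -
      have "sin (t - \<omega>) - sin (s - \<omega>) = 2 * sin ((t - s) / 2) * cos ((t - \<omega> + (s - \<omega>)) / 2)"
        using sin_diff_sin[of "t - \<omega>" "s - \<omega>"] by simp
      also have "\<dots> = 2 * \<bar>sin ((t - s) / 2)\<bar> * cos m"
      proof (cases "s - \<omega> < pi / 6")
        case True
        then have "0 \<le> sin ((t - s) / 2)" using d pi_gt3 by (auto simp: t_def e_def intro!: sin_ge_zero)
        moreover have "(t - \<omega> + (s - \<omega>)) / 2 = m" using True by (simp add: t_def e_def m_def field_simps)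
        ultimately show ?thesis by simp
      next
        case False
        then have "0 \<le> sin (d / 2)" using d pi_gt3 by (auto intro!: sin_ge_zero)
        moreover have e1: "(t - s) / 2 = - (d / 2)" using False by (simp add: t_def e_def)
        moreover have e2: "(t - \<omega> + (s - \<omega>)) / 2 = m + pi" using False by (simp add: t_def e_def m_def field_simps)
        ultimately show ?thesis unfolding e1 e2 by simp
      qed
      finally show ?thesis using chord by simp
    qed
    also have "\<dots> \<le> - (dist ?x ?q) * (4/5)" using cosm by (intro mult_left_mono_neg) auto
    finally have in1: "(?q - ?x) \<bullet> \<nu> y \<le> - (dist ?x ?q) * (4/5)" .
    have "norm (?q - ?x) = dist ?x ?q" by (simp add: dist_norm norm_minus_commute)
    then have q: "?q \<in> wedge y ?x" using in1 lo eps unfolding wedge_def by simp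
    obtain W v where "0 < W" "f ?x = W *\<^sub>R v" "norm (v - w ?x) \<le> 1/250"
      using field_wedge[OF f cl low y _ \<rho>(1) ab2 s t(1) _ c q] dx \<rho> t(2) d hi eps by auto
    then show ?thesis by (intro exI[of _ W] exI[of _ v]) auto
  qed
qed

lemma compact_bad: "compact bad"
proof -
  have "K-lipschitz_on (frontier \<Omega>) \<nu>" using lipschitz_normal K by (auto simp: lipschitz_on_def dist_norm)
  then have "continuous_on (frontier \<Omega>) \<nu>" by (rule lipschitz_on_continuous_on)
  then have "continuous_on (frontier \<Omega>) (\<lambda>y. \<bar>w y \<bullet> \<nu> y\<bar>)" by (intro continuous_intros contw)
  then have "closed (frontier \<Omega> \<inter> (\<lambda>y. \<bar>w y \<bullet> \<nu> y\<bar>) -` {a..})"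
    by (rule continuous_closed_preimage) auto
  then have "compact (frontier \<Omega> \<inter> (frontier \<Omega> \<inter> (\<lambda>y. \<bar>w y \<bullet> \<nu> y\<bar>) -` {a..}))"
    by (rule compact_Int_closed[OF compact_frontier_dom])
  then have "compact (frontier \<Omega> \<inter> (\<lambda>y. \<bar>w y \<bullet> \<nu> y\<bar>) -` {a..})" by (simp add: Int_assoc[symmetric])
  moreover have "bad = frontier \<Omega> \<inter> (\<lambda>y. \<bar>w y \<bullet> \<nu> y\<bar>) -` {a..}" by (auto simp: bad_def)
  ultimately show ?thesis by simp
qed

lemma field_nonzero: assumes f: "field f" and x: "x \<in> closure \<Omega>" "low x" shows "f x \<noteq> 0"
proof -
  obtain W v where W: "0 < W" "f x = W *\<^sub>R v" "\<And>b. nearval (P x) b \<Longrightarrow> norm (v - b) \<le> 3 * eta"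
    using f x unfolding field_def by blast
  obtain b where b: "nearval (P x) b" "1 - eta \<le> norm b" using nearval_exists[OF P_deep[OF x]] by blast
  have "norm b \<le> norm v + norm (v - b)" using norm_triangle_ineq4[of v "v - b"] by simp
  then have "v \<noteq> 0" using W(3)[OF b(1)] b(2) unfolding eta_def by auto
  then show ?thesis using W by simp
qed

lemma normal_angle: assumes "y \<in> frontier \<Omega>" obtains \<omega> where "cx (\<nu> y) = - \<i> * cis \<omega>"
proof -
  have "cmod (\<i> * cx (\<nu> y)) = 1" using norm_normal[OF assms] by (simp add: norm_mult)
  then have "\<i> * cx (\<nu> y) = cis (Arg (\<i> * cx (\<nu> y)))" by (metis cis_Arg complex_sgn_def inverse_1 norm_zero scaleR_one zero_neq_one)
  then have "cx (\<nu> y) = - \<i> * cis (Arg (\<i> * cx (\<nu> y)))" by (metis i_squared minus_mult_minus mult.assoc mult_1 mult_minus_left power2_eq_square)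
  then show thesis by (rule that)
qed

text \<open>Some circle around \<open>y\<close> has small cost and ends outside \<open>bad\<close>.
  The value \<open>f y\<close> is carried through the wedge to the top of the circle and along it to
  an end, where \<open>w\<close> is almost tangential and the normal has hardly turned.\<close>

lemma field_tangential:
  assumes f: "field f" and y: "y \<in> frontier \<Omega>" "low y" shows "\<bar>f y \<bullet> \<nu> y\<bar> \<le> 1/2 * norm (f y)"
proof -
  have clO: "y \<in> closure \<Omega>" using y frontier_subset_closure by blast
  obtain \<omega> where \<omega>: "cx (\<nu> y) = - \<i> * cis \<omega>" using normal_angle[OF y(1)] by blast
  \<comment> \<open>The radii to be avoided; 50 * epsilon of them at most, out of a range of 100 *
    epsilon.\<close>
  define T where "T = {\<rho>. \<exists>z\<in>bad \<inter> UNIV. dist y z = \<rho>}"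
  have T: "T \<in> sets borel" "emeasure lborel T \<le> ennreal (50 * \<epsilon>)"
  proof -
    have "T = dist y ` bad" by (auto simp: T_def)
    moreover have "compact (dist y ` bad)" by (intro compact_continuous_image compact_bad continuous_intros)
    ultimately show T: "T \<in> sets borel" by (simp add: borel_compact)
    show "emeasure lborel T \<le> ennreal (50 * \<epsilon>)"
      by (rule lebesgue_dist_image_le_hausdorff1[OF compact_bad _ T_def T]) (use small_trace in \<open>simp add: bad_def\<close>)
  qed
  have E: "E {x. 1500 * \<epsilon> < dist y x \<and> dist y x < 1600 * \<epsilon>} < ennreal c0"
  proof -
    have "{x. 1500 * \<epsilon> < dist y x \<and> dist y x < 1600 * \<epsilon>} \<subseteq> ball y (2000 * \<epsilon>)" using eps by auto
    then show ?thesis using y(2) E_mono unfolding low_def by (meson le_less_trans)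
  qed
  obtain \<rho> where \<rho>: "1500 * \<epsilon> < \<rho>" "\<rho> < 1600 * \<epsilon>" "\<rho> \<notin> T"
    "slice (\<omega> - pi / 2) y \<rho> \<le> ennreal (c0 / (1600 * \<epsilon> - 1500 * \<epsilon> - 50 * \<epsilon>))"
    by (rule good_radius[OF _ T _ _ _ E]) (use eps c0_pos in auto)
  have \<rho>0: "0 < \<rho>" "\<rho> < r1" "\<rho> < r0" using \<rho> eps eps_small r1 by linarith+
  have "K * \<rho> \<le> K * r1" using K \<rho>0 by (intro mult_left_mono) auto
  then have K\<rho>: "2 * K * \<rho> \<le> 1/100" "K * \<rho> \<le> 1/8" using r1 by simp_all
  obtain a' b' where ab: "\<bar>a' - \<omega>\<bar> \<le> 2 * K * \<rho>" "\<bar>b' - (\<omega> + pi)\<bar> \<le> 2 * K * \<rho>"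
    and ends: "circ y \<rho> a' \<in> frontier \<Omega>" "circ y \<rho> b' \<in> frontier \<Omega>" and ins: "\<And>\<theta>. a' < \<theta> \<Longrightarrow> \<theta> < b' \<Longrightarrow> circ y \<rho> \<theta> \<in> \<Omega>"
    and sph: "sphere y \<rho> \<inter> closure \<Omega> = circ y \<rho> ` {a'..b'}"
    by (rule sphere_Int_closure_arc[OF y(1) \<rho>0(1,3) K\<rho>(2) \<omega>]) (rule that, (assumption | blast)+)
  have ab2: "2 \<le> b' - a'" "b' - a' \<le> 4" using ab K\<rho> pi_gt3 pi_approx by auto
  have "ennreal (cost y \<rho> a' b') \<le> slice (\<omega> - pi / 2) y \<rho>"
    by (rule cost_le_slice[OF \<rho>0(1) _ _ ins]) (use ab K\<rho> pi_gt3 in \<open>auto\<close>)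
  also note \<rho>(4)
  finally have c: "cost y \<rho> a' b' \<le> c0 / (50 * \<epsilon>)" using eps c0_pos by (subst (asm) ennreal_le_iff) (auto)
  then have c': "cost y \<rho> a' b' \<le> c0 / \<epsilon>" using eps c0_pos by (simp add: field_simps)
  \<comment> \<open>The top of the circle, straight inwards from \<open>y\<close> and hence in the
    wedge.\<close>
  define t where "t = \<omega> + pi / 2"
  have t: "t \<in> {a'..b'}" using ab K\<rho> pi_gt3 by (auto simp: t_def)
  let ?x = "circ y \<rho> a'" and ?q = "circ y \<rho> t"
  have "(?q - y) \<bullet> \<nu> y = - \<rho>" using circ_normal[OF \<omega>, of \<rho> t] by (simp add: t_def)
  moreover have dq: "dist y ?q = \<rho>" "dist y ?x = \<rho>" using \<rho>0 by (simp_all add: dist_circ)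
  ultimately have q: "?q \<in> wedge y y" using \<rho> eps unfolding wedge_def by (simp add: dist_norm norm_minus_commute)
  obtain W v where W: "0 < W" "f y = W *\<^sub>R v" "norm (v - w ?q) \<le> 1/250" "9/10 \<le> norm v"
    using field_wedge[OF f clO y(2) y(1) _ less_imp_le[OF \<rho>(1)] ab2(1) t t _ c' q] r1 dq \<rho> eps by auto
  have "(norm (w ?q - w ?x))\<^sup>2 \<le> \<rho> * \<bar>t - a'\<bar> * cost y \<rho> a' b'"
    by (rule circle_oscillation[OF \<rho>0(1) _ t]) (use ab2 in auto)
  also have "\<dots> \<le> (1600 * \<epsilon> * 4) * (c0 / (50 * \<epsilon>))"
    using \<rho> \<rho>0 t ab2 eps c cost_nonneg[OF \<rho>0(1)] by (intro mult_mono mult_nonneg_nonneg) auto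
  also have "\<dots> \<le> (2 * eta)\<^sup>2" using eps c0_eta c0_pos by (simp add: power_mult_distrib)
  finally have osc: "norm (w ?q - w ?x) \<le> 2 * eta" using eta_pos by (auto intro: power2_le_imp_le)
  have "?x \<notin> bad" using \<rho>(3) dq by (auto simp: T_def)
  then have small: "\<bar>w ?x \<bullet> \<nu> ?x\<bar> \<le> 1/1000" using ends a by (auto simp: bad_def)
  have vx: "norm (v - w ?x) \<le> 1/200"
    using norm_triangle_ineq[of "v - w ?q" "w ?q - w ?x"] W(3) osc unfolding eta_def by simp
  have 1: "\<bar>v \<bullet> \<nu> y\<bar> \<le> \<bar>(v - w ?x) \<bullet> \<nu> y\<bar> + \<bar>w ?x \<bullet> (\<nu> y - \<nu> ?x)\<bar> + \<bar>w ?x \<bullet> \<nu> ?x\<bar>"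
    by (simp add: inner_diff)
  have 2: "\<bar>(v - w ?x) \<bullet> \<nu> y\<bar> \<le> 1/200"
    using Cauchy_Schwarz_ineq2[of "v - w ?x" "\<nu> y"] norm_normal[OF y(1)] vx by simp
  have 3: "\<bar>w ?x \<bullet> (\<nu> y - \<nu> ?x)\<bar> \<le> (norm v + 1/200) * (1/100)"
  proof -
    have "norm (\<nu> y - \<nu> ?x) \<le> K * dist y ?x" by (rule lipschitz_normal[OF y(1) ends(1)])
    then have "norm (\<nu> y - \<nu> ?x) \<le> 1/100" using dq K\<rho> K \<rho>0 by simp
    moreover have "norm (w ?x) \<le> norm v + 1/200" using norm_triangle_ineq4[of v "v - w ?x"] vx by simp
    ultimately show ?thesis using Cauchy_Schwarz_ineq2[of "w ?x" "\<nu> y - \<nu> ?x"]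
        mult_mono[of "norm (w ?x)" "norm v + 1/200" "norm (\<nu> y - \<nu> ?x)" "1/100"] by simp
  qed
  have "x \<le> 1/2 * n" if "x \<le> p + q + r" "p \<le> 1/200" "q \<le> (n + 1/200) * (1/100)" "r \<le> 1/1000" "9/10 \<le> n"
    for x p q r n :: real using that by (simp add: field_simps)
  from this[OF 1 2 3 small W(4)] have "\<bar>v \<bullet> \<nu> y\<bar> \<le> 1/2 * norm v" .
  then have "W * \<bar>v \<bullet> \<nu> y\<bar> \<le> W * (1/2 * norm v)" using W(1) by (intro mult_left_mono) auto
  then show ?thesis using W(1,2) by (simp add: abs_mult)
qed

end

text \<open>The constant absorbs all effects on the scale epsilon: the summand 4 * epsilon of
  \<open>rotation_cost\<close>, the circles whose cost exceeds c0 / epsilon, the energy owed by the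
  initial balls, which becomes at most c0, and the total compensation for \<open>bad\<close>, which
  becomes at most 1.\<close>

definition bb :: real where "bb = 8400 * pi / c0"

lemma bb_ge: "8 * pi \<le> bb" "2 * pi \<le> bb * c0" "0 < bb"
proof -
  have "c0 \<le> 1" by (simp add: c0_def eta_def power_divide)
  then have "8 * pi * c0 \<le> 8400 * pi" using pi_gt_zero c0_pos mult_mono[of "8 * pi" "8400 * pi" c0 1] by simp
  then show "8 * pi \<le> bb" using c0_pos by (simp add: bb_def field_simps)
  then show "0 < bb" using pi_gt_zero by linarith
  show "2 * pi \<le> bb * c0" using c0_pos pi_gt_zero by (simp add: bb_def)
qed

text \<open>On a curved boundary the arc may be longer than a half circle and the rotation shorter
  than a multiple of pi, each by 4 * x; this costs a factor 1 + 8 * x in Cauchy-Schwarz.\<close>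

lemma arc_defect:
  fixes m x L D :: real
  assumes m: "1 \<le> m" and x: "0 \<le> x" "x \<le> 1/100" and L: "L \<le> pi + 4 * x" and D: "D = m * pi - 4 * x"
  shows "m * pi * L \<le> (1 + 8 * x) * D\<^sup>2"
proof -
  have p: "0 \<le> pi - 4 * x" using x pi_gt3 by linarith
  have "m * (4 * x) \<ge> 1 * (4 * x)" using m x by (intro mult_right_mono) auto
  then have "m * (pi - 4 * x) \<le> D" by (simp add: D right_diff_distrib)
  then have D2: "(m * (pi - 4 * x))\<^sup>2 \<le> D\<^sup>2" using m p by (intro power_mono mult_nonneg_nonneg) auto
  have "pi * (pi + 4 * x) \<le> (1 + 8 * x) * (pi - 4 * x)\<^sup>2"
  proof -
    have "(1 + 8 * x) * (pi - 4 * x)\<^sup>2 - pi * (pi + 4 * x)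
        = x * (4 * pi * (2 * pi - 3) + 16 * x - 64 * pi * x + 128 * x\<^sup>2)"
      by (simp add: power2_eq_square algebra_simps)
    also have "\<dots> \<ge> 0"
    proof (rule mult_nonneg_nonneg[OF x(1)])
      have "12 * 3 \<le> 4 * pi * (2 * pi - 3)" using pi_gt3 by (intro mult_mono) auto
      moreover have "64 * pi * x \<le> 64 * 4 * (1/100)" using pi_less_4 x by (intro mult_mono) auto
      moreover have "0 \<le> 128 * x\<^sup>2" by simp
      ultimately show "0 \<le> 4 * pi * (2 * pi - 3) + 16 * x - 64 * pi * x + 128 * x\<^sup>2" using x by linarith
    qed
    finally show ?thesis by simp
  qed
  then have "m * (pi * (pi + 4 * x)) \<le> m * ((1 + 8 * x) * (pi - 4 * x)\<^sup>2)" using m by (intro mult_left_mono) auto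
  also have "\<dots> \<le> m * (m * ((1 + 8 * x) * (pi - 4 * x)\<^sup>2))"
  proof -
    have "1 * ((1 + 8 * x) * (pi - 4 * x)\<^sup>2) \<le> m * ((1 + 8 * x) * (pi - 4 * x)\<^sup>2)"
      using m x by (intro mult_right_mono) auto
    then show ?thesis using m by (intro mult_left_mono) auto
  qed
  also have "\<dots> = (1 + 8 * x) * (m * (pi - 4 * x))\<^sup>2" by (simp add: power_mult_distrib power2_eq_square)
  also have "\<dots> \<le> (1 + 8 * x) * D\<^sup>2" using D2 x by (intro mult_left_mono) auto
  finally have 1: "m * (pi * (pi + 4 * x)) \<le> (1 + 8 * x) * D\<^sup>2" .
  have "m * pi * L \<le> m * pi * (pi + 4 * x)" using L m pi_gt_zero by (intro mult_left_mono) auto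
  then show ?thesis using 1 by (simp add: mult.assoc)
qed

context gl_field
begin

lemma rotation_lower_bound:
  assumes \<rho>: "0 < \<rho>" and nz: "\<And>t. t \<in> {a..b} \<Longrightarrow> w (circ c \<rho> t) \<noteq> 0" and ab: "\<epsilon> / \<rho> \<le> b - a" "a < b"
  obtains \<phi> where "continuous_on {a..b} \<phi>"
    "\<And>t. t \<in> {a..b} \<Longrightarrow> cx (w (circ c \<rho> t)) = norm (w (circ c \<rho> t)) * cis (\<phi> t)"
    "\<And>D. 0 < D \<Longrightarrow> D \<le> \<bar>\<phi> b - \<phi> a\<bar> \<Longrightarrow> 1 / (\<rho> * (b - a) / D\<^sup>2 + 4 * \<epsilon>) \<le> cost c \<rho> a b"
proof -
  interpret C1_arc "u c \<rho>" "u' c \<rho>" a b \<rho> \<epsilon> by (rule arc_is_C1[OF \<rho>])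
  have nz': "u c \<rho> t \<noteq> 0" if "t \<in> {a..b}" for t using nz[OF that] by (simp add: u_def)
  have lf: "(lift has_vector_derivative u' c \<rho> t / u c \<rho> t) (at t within {a..b})" "exp (lift t) = u c \<rho> t"
    if "t \<in> {a..b}" for t
    using lift[OF nz'] that ab by auto
  show thesis
  proof (rule that[of "\<lambda>t. Im (lift t)"])
    have "continuous_on {a..b} lift" using lf(1) by (rule continuous_on_vector_derivative)
    then show "continuous_on {a..b} (\<lambda>t. Im (lift t))" by (intro continuous_intros)
    show "cx (w (circ c \<rho> t)) = norm (w (circ c \<rho> t)) * cis (Im (lift t))" if "t \<in> {a..b}" for t
    proof -
      have "cx (w (circ c \<rho> t)) = exp (lift t)" using lf(2)[OF that] by (simp add: u_def)
      moreover from this have "norm (w (circ c \<rho> t)) = exp (Re (lift t))" by (metis norm_cx norm_exp_eq_Re)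
      ultimately show ?thesis by (simp add: exp_eq_polar)
    qed
    show "1 / (\<rho> * (b - a) / D\<^sup>2 + 4 * \<epsilon>) \<le> cost c \<rho> a b" if "0 < D" "D \<le> \<bar>Im (lift b) - Im (lift a)\<bar>" for D
      unfolding cost_def using rotation_cost[OF nz' ab(1) that] by simp
  qed
qed

end

section \<open>Lower bounds for the energy on circles and annuli\<close>

context normal_field
begin

text \<open>A cost above c0 / epsilon is enough by itself. Otherwise \<open>w\<close> is close to
  unit norm and to the direction of \<open>f\<close>, so it turns by at least 2 * pi, and
  \<open>rotation_cost\<close> applies.\<close>

lemma interior_cost_pointwise:
  assumes f: "field f" and \<rho>: "1500 * \<epsilon> \<le> \<rho>" and ins: "ball c (\<rho> + 200 * \<epsilon>) \<subseteq> \<Omega>"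
    and low: "\<And>x. x \<in> sphere c \<rho> \<Longrightarrow> low x" and nc: "\<not> cert f 0 c \<rho>" and \<delta>: "0 \<le> \<delta>"
  shows "2 * pi / (bb * \<epsilon> + (1 + \<delta>) * \<rho>) \<le> cost c \<rho> 0 (2 * pi)"
proof (cases "cost c \<rho> 0 (2 * pi) \<le> c0 / \<epsilon>")
  case False
  have \<rho>0: "0 \<le> (1 + \<delta>) * \<rho>" using \<rho> eps \<delta> by auto
  have "2 * pi / (bb * \<epsilon> + (1 + \<delta>) * \<rho>) \<le> 2 * pi / (bb * \<epsilon>)"
    using \<rho>0 bb_ge eps by (intro divide_left_mono mult_pos_pos add_pos_nonneg) auto
  also have "\<dots> \<le> bb * c0 / (bb * \<epsilon>)" using bb_ge eps by (intro divide_right_mono) auto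
  also have "\<dots> = c0 / \<epsilon>" using bb_ge by simp
  finally show ?thesis using False by simp
next
  case True
  have \<rho>0: "0 < \<rho>" using \<rho> eps by linarith
  have sub: "cball c \<rho> \<subseteq> \<Omega>" using ins eps by (auto intro!: subsetD[OF ins])
  have near: "f x \<noteq> 0 \<and> w x \<noteq> 0 \<and> 99/100 * (norm (f x) * norm (w x)) \<le> f x \<bullet> w x" if x: "x \<in> sphere c \<rho>" for x
  proof -
    obtain s where s: "x = circ c \<rho> s" "0 \<le> s" "s < 0 + 2 * pi" using sphere_circ[of c x \<rho> 0] x by auto
    have "ball x (200 * \<epsilon>) \<subseteq> \<Omega>"
    proof
      fix z assume "z \<in> ball x (200 * \<epsilon>)"
      then have "z \<in> ball c (\<rho> + 200 * \<epsilon>)" using x dist_triangle[of c z x] by simp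
      then show "z \<in> \<Omega>" using ins by blast
    qed
    then obtain W v where W: "0 < W" "f x = W *\<^sub>R v" "norm (v - w x) \<le> 1/200"
      using field_interior[OF f _ _ \<rho> _ _ True, of s] low[OF x] s pi_gt3 by auto
    have "\<epsilon> / \<rho> \<le> 1" using \<rho> \<rho>0 eps by simp
    then have "\<epsilon> / \<rho> \<le> 2 * pi - 0" using pi_gt3 by linarith
    then have "1 - eta \<le> norm (w x)" unfolding s(1) by (intro circle_modulus[OF \<rho>0 _ _ True]) (use s in auto)
    then have n: "9/10 \<le> norm (w x)" unfolding eta_def by simp
    have "W * (99/100 * (norm v * norm (w x))) \<le> W * (v \<bullet> w x)" using inner_ge_of_close(1)[OF W(3) n] W(1) by (intro mult_left_mono) auto
    then show ?thesis using W inner_ge_of_close(2)[OF W(3) n] n by (auto simp: mult_ac)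
  qed
  have sph: "circ c \<rho> t \<in> sphere c \<rho>" for t using \<rho>0 by (simp add: dist_circ)
  have len: "\<epsilon> / \<rho> \<le> 2 * pi - 0"
  proof -
    have "\<epsilon> / \<rho> \<le> 1" using \<rho> \<rho>0 eps by simp
    then show ?thesis using pi_gt3 by linarith
  qed
  obtain \<phi> where \<phi>: "continuous_on {0..2 * pi} \<phi>"
    "\<And>t. t \<in> {0..2 * pi} \<Longrightarrow> cx (w (circ c \<rho> t)) = norm (w (circ c \<rho> t)) * cis (\<phi> t)"
    "\<And>D. 0 < D \<Longrightarrow> D \<le> \<bar>\<phi> (2 * pi) - \<phi> 0\<bar> \<Longrightarrow> 1 / (\<rho> * (2 * pi - 0) / D\<^sup>2 + 4 * \<epsilon>) \<le> cost c \<rho> 0 (2 * pi)"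
    by (rule rotation_lower_bound[OF \<rho>0 _ len]) (use near sph pi_gt_zero in \<open>auto\<close>)
  have contf: "continuous_on (closure \<Omega>) f" using f continuous_on_subset unfolding field_def by blast
  have "2 * pi \<le> \<bar>\<phi> (2 * pi) - \<phi> 0\<bar>"
    by (rule interior_rotation[OF contf contw \<rho>0 sub \<phi>(1,2) _ _ _ _ nc]) (use near in auto)
  then have "1 / (\<rho> * (2 * pi - 0) / (2 * pi)\<^sup>2 + 4 * \<epsilon>) \<le> cost c \<rho> 0 (2 * pi)" by (intro \<phi>(3)) auto
  moreover have "2 * pi / (bb * \<epsilon> + (1 + \<delta>) * \<rho>) \<le> 1 / (\<rho> * (2 * pi - 0) / (2 * pi)\<^sup>2 + 4 * \<epsilon>)"
  proof -
    have e: "\<rho> * (2 * pi - 0) / (2 * pi)\<^sup>2 + 4 * \<epsilon> = (\<rho> + 8 * pi * \<epsilon>) / (2 * pi)"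
      by (simp add: field_simps power2_eq_square)
    have pos: "0 < \<rho> + 8 * pi * \<epsilon>" using \<rho>0 eps by (simp add: add_pos_pos)
    have "\<rho> + 8 * pi * \<epsilon> \<le> bb * \<epsilon> + (1 + \<delta>) * \<rho>"
    proof -
      have "8 * pi * \<epsilon> \<le> bb * \<epsilon>" using bb_ge eps by (intro mult_right_mono) auto
      moreover have "1 * \<rho> \<le> (1 + \<delta>) * \<rho>" using \<delta> \<rho>0 by (intro mult_right_mono) auto
      ultimately show ?thesis by simp
    qed
    then have "2 * pi / (bb * \<epsilon> + (1 + \<delta>) * \<rho>) \<le> 2 * pi / (\<rho> + 8 * pi * \<epsilon>)"
      using \<rho>0 eps pos by (intro divide_left_mono mult_pos_pos) auto
    then show ?thesis unfolding e by simp
  qed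
  ultimately show ?thesis by linarith
qed

text \<open>The argument of \<open>interior_cost_pointwise\<close> for an arc, with
  \<open>boundary_rotation\<close>; \<open>arc_defect\<close> shows that \<open>\<delta>\<close>
  outweighs the curvature and the imperfect tangency.\<close>

lemma boundary_cost_pointwise:
  assumes f: "field f" and y: "y \<in> frontier \<Omega>" and \<omega>: "cx (\<nu> y) = - \<i> * cis \<omega>" and \<rho>: "1500 * \<epsilon> \<le> \<rho>" "\<rho> < r1"
    and ab: "\<bar>a' - \<omega>\<bar> \<le> 2 * K * \<rho>" "\<bar>b' - (\<omega> + pi)\<bar> \<le> 2 * K * \<rho>"
    and ends: "circ y \<rho> a' \<in> frontier \<Omega>" "circ y \<rho> b' \<in> frontier \<Omega>" and ins: "\<And>\<theta>. a' < \<theta> \<Longrightarrow> \<theta> < b' \<Longrightarrow> circ y \<rho> \<theta> \<in> \<Omega>"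
    and sph: "sphere y \<rho> \<inter> closure \<Omega> = circ y \<rho> ` {a'..b'}"
    and low: "\<And>x. x \<in> sphere y \<rho> \<inter> closure \<Omega> \<Longrightarrow> low x" and good: "\<And>x. x \<in> sphere y \<rho> \<Longrightarrow> x \<notin> bad"
    and n: "n \<le> 1" and nc: "\<not> cert f n y \<rho>" and \<delta>: "8 * (2 * a + K * \<rho>) \<le> \<delta>"
  shows "(real n + 1) * pi / (bb * \<epsilon> + (1 + \<delta>) * \<rho>) \<le> cost y \<rho> a' b'"
proof -
  have \<rho>0: "0 < \<rho>" using \<rho> eps by linarith
  define x where "x = 2 * a + K * \<rho>"
  have K\<rho>: "0 \<le> K * \<rho>" "K * \<rho> \<le> 1/200"
  proof -
    show "0 \<le> K * \<rho>" using K \<rho>0 by simp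
    have "K * \<rho> \<le> K * r1" using K \<rho> by (intro mult_left_mono) auto
    then show "K * \<rho> \<le> 1/200" using r1 by simp
  qed
  have x: "0 \<le> x" "x \<le> 1/100" "8 * x \<le> \<delta>" using a K\<rho> \<delta> by (auto simp: x_def)
  have \<delta>0: "0 \<le> \<delta>" using x by simp
  have den: "0 < bb * \<epsilon>" "0 \<le> (1 + \<delta>) * \<rho>" using bb_ge eps \<delta>0 \<rho>0 by auto
  let ?m = "real n + 1"
  have m: "1 \<le> ?m" "?m \<le> 2" using n by auto
  show ?thesis
  proof (cases "cost y \<rho> a' b' \<le> c0 / \<epsilon>")
    case False
    have "?m * pi / (bb * \<epsilon> + (1 + \<delta>) * \<rho>) \<le> ?m * pi / (bb * \<epsilon>)"
      using den m by (intro divide_left_mono mult_pos_pos[OF add_pos_nonneg]) auto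
    also have "\<dots> \<le> 2 * pi / (bb * \<epsilon>)" using den m by (intro divide_right_mono mult_right_mono) auto
    also have "\<dots> \<le> bb * c0 / (bb * \<epsilon>)" using bb_ge den by (intro divide_right_mono) auto
    also have "\<dots> = c0 / \<epsilon>" using bb_ge by simp
    finally show ?thesis using False by simp
  next
    case True
    have ab': "\<bar>a' - \<omega>\<bar> \<le> 1/100" "\<bar>b' - (\<omega> + pi)\<bar> \<le> 1/100" using ab K\<rho> by linarith+
    have ab2: "2 \<le> b' - a'" "b' - a' \<le> pi + 4 * x" "b' - a' \<le> pi + 1"
    proof -
      show "2 \<le> b' - a'" using ab' pi_gt3 by linarith
      have "b' - a' \<le> pi + 4 * (K * \<rho>)" using ab by linarith
      then show "b' - a' \<le> pi + 4 * x" "b' - a' \<le> pi + 1" using K\<rho> a by (auto simp: x_def)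
    qed
    have near: "f z \<noteq> 0 \<and> w z \<noteq> 0 \<and> 99/100 * (norm (f z) * norm (w z)) \<le> f z \<bullet> w z \<and> 9/10 \<le> norm (w z)"
      if z: "z \<in> sphere y \<rho> \<inter> closure \<Omega>" for z
    proof -
      obtain s where s: "z = circ y \<rho> s" "s \<in> {a'..b'}" using z sph by auto
      have cl: "circ y \<rho> s \<in> closure \<Omega>" "low (circ y \<rho> s)" using low[OF z] z s by auto
      obtain W v where W: "0 < W" "f z = W *\<^sub>R v" "norm (v - w z) \<le> 1/200"
        using field_boundary[OF f y \<omega> \<rho> ab s(2) cl True] s by auto
      have "\<epsilon> / \<rho> \<le> 1" using \<rho> \<rho>0 eps by simp
      then have "1 - eta \<le> norm (w z)" unfolding s(1) by (intro circle_modulus[OF \<rho>0 _ _ True]) (use s ab2 in auto)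
      then have n: "9/10 \<le> norm (w z)" unfolding eta_def by simp
      have "W * (99/100 * (norm v * norm (w z))) \<le> W * (v \<bullet> w z)" using inner_ge_of_close(1)[OF W(3) n] W(1) by (intro mult_left_mono) auto
      then show ?thesis using W inner_ge_of_close(2)[OF W(3) n] n by (auto simp: mult_ac)
    qed
    have sphI: "circ y \<rho> t \<in> sphere y \<rho> \<inter> closure \<Omega>" if "t \<in> {a'..b'}" for t using that sph by blast
    have len: "\<epsilon> / \<rho> \<le> b' - a'" "a' < b'"
    proof -
      have "\<epsilon> / \<rho> \<le> 1" using \<rho> \<rho>0 eps by simp
      then show "\<epsilon> / \<rho> \<le> b' - a'" using ab2 by linarith
      show "a' < b'" using ab2 by linarith
    qed
    obtain \<phi> where \<phi>: "continuous_on {a'..b'} \<phi>"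
      "\<And>t. t \<in> {a'..b'} \<Longrightarrow> cx (w (circ y \<rho> t)) = norm (w (circ y \<rho> t)) * cis (\<phi> t)"
      "\<And>D. 0 < D \<Longrightarrow> D \<le> \<bar>\<phi> b' - \<phi> a'\<bar> \<Longrightarrow> 1 / (\<rho> * (b' - a') / D\<^sup>2 + 4 * \<epsilon>) \<le> cost y \<rho> a' b'"
      by (rule rotation_lower_bound[OF \<rho>0 _ len]) (use near sphI in blast)+
    have contf: "continuous_on (closure \<Omega>) f" using f continuous_on_subset unfolding field_def by blast
    define D where "D = ?m * pi - 4 * x"
    have "?m * pi - 4 * (2 * a + K * \<rho>) \<le> \<bar>\<phi> b' - \<phi> a'\<bar>"
    proof (rule boundary_rotation[OF contf contw y \<rho>0 _ \<omega> len(2) _ ends ins sph \<phi>(1,2) _ _ _ _ _ n nc])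
      show "K * \<rho> \<le> 1/100" "2 * a + K * \<rho> \<le> 1/100" using K\<rho> x by (auto simp: x_def)
      show "b' < a' + 2 * pi" using ab2 pi_gt3 by linarith
      \<comment> \<open>Since |w| >= 9/10, the absolute bound \<open>a\<close> becomes a relative
        bound 2 * a.\<close>
      show "\<bar>w z \<bullet> \<nu> z\<bar> \<le> 2 * a * norm (w z)" if z: "z \<in> sphere y \<rho> \<inter> frontier \<Omega>" for z
      proof -
        have "\<bar>w z \<bullet> \<nu> z\<bar> < a" using good[of z] z by (auto simp: bad_def)
        moreover have "z \<in> sphere y \<rho> \<inter> closure \<Omega>" using z frontier_subset_closure by blast
        then have "a * (2 * (9/10)) \<le> a * (2 * norm (w z))" using near[of z] a by (intro mult_left_mono) auto
        moreover have "a \<le> a * (2 * (9/10))" using a by simp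
        ultimately have "\<bar>w z \<bullet> \<nu> z\<bar> \<le> a * (2 * norm (w z))" by linarith
        then show ?thesis by (simp add: mult.commute mult.left_commute)
      qed
    qed (use near in blast)+
    then have D: "D \<le> \<bar>\<phi> b' - \<phi> a'\<bar>" by (simp add: D_def x_def)
    have "1 * pi \<le> ?m * pi" using m pi_gt_zero by (intro mult_right_mono) auto
    then have D0: "0 < D" using x pi_gt3 unfolding D_def by linarith
    have "1 / (\<rho> * (b' - a') / D\<^sup>2 + 4 * \<epsilon>) \<le> cost y \<rho> a' b'" by (rule \<phi>(3)[OF D0 D])
    moreover have "?m * pi / (bb * \<epsilon> + (1 + \<delta>) * \<rho>) \<le> 1 / (\<rho> * (b' - a') / D\<^sup>2 + 4 * \<epsilon>)"
    proof -
      have "?m * pi * (b' - a') \<le> (1 + 8 * x) * D\<^sup>2" by (rule arc_defect[OF m(1) x(1,2) ab2(2) D_def])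
      also have "\<dots> \<le> (1 + \<delta>) * D\<^sup>2" using x by (intro mult_right_mono) auto
      finally have "?m * pi * (b' - a') / D\<^sup>2 \<le> 1 + \<delta>" using D0 by (simp add: divide_le_eq)
      then have "\<rho> * (?m * pi * (b' - a') / D\<^sup>2) \<le> \<rho> * (1 + \<delta>)" using \<rho>0 by (intro mult_left_mono) auto
      moreover have "?m * pi * (4 * \<epsilon>) \<le> 2 * pi * (4 * \<epsilon>)" using m eps by (intro mult_right_mono) auto
      moreover have "8 * pi * \<epsilon> \<le> bb * \<epsilon>" using bb_ge eps by (intro mult_right_mono) auto
      ultimately have "\<rho> * (?m * pi * (b' - a') / D\<^sup>2) + ?m * pi * (4 * \<epsilon>) \<le> bb * \<epsilon> + (1 + \<delta>) * \<rho>"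
        unfolding mult.commute[of "1 + \<delta>"] by linarith
      moreover have "?m * pi * (\<rho> * (b' - a') / D\<^sup>2 + 4 * \<epsilon>) = \<rho> * (?m * pi * (b' - a') / D\<^sup>2) + ?m * pi * (4 * \<epsilon>)"
        by (simp add: algebra_simps)
      ultimately have le: "?m * pi * (\<rho> * (b' - a') / D\<^sup>2 + 4 * \<epsilon>) \<le> bb * \<epsilon> + (1 + \<delta>) * \<rho>"
        by (simp only:)
      have "0 < \<rho> * (b' - a') / D\<^sup>2 + 4 * \<epsilon>" using \<rho>0 len eps D0 by (intro add_pos_pos divide_pos_pos mult_pos_pos) auto
      then show ?thesis using le den by (simp add: pos_divide_le_eq pos_le_divide_eq mult.commute)
    qed
    ultimately show ?thesis by linarith
  qed
qed

text \<open>The function \<open>growth \<delta>\<close> is the antiderivative of the cost \<open>\<pi> / (bb \<epsilon> + (1 + \<delta>) \<rho>)\<close> that vanishes at 0. The circles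
  that meet \<open>bad\<close> escape the bound on the cost, for which the length of \<open>bad\<close> makes up in \<open>mass\<close>.\<close>

definition speed :: "real \<Rightarrow> real" where "speed \<delta> = pi / (1 + \<delta>)"
definition scale :: "real \<Rightarrow> real" where "scale \<delta> = (1 + \<delta>) / (bb * \<epsilon>)"
definition growth :: "real \<Rightarrow> real \<Rightarrow> real" where "growth \<delta> s = speed \<delta> * ln (1 + scale \<delta> * s)"

definition mass :: "real \<Rightarrow> (real^2) set \<Rightarrow> real" where
  "mass \<delta> A = enn2real (E A) + 2 * speed \<delta> * scale \<delta> * measure hausdorff1 (bad \<inter> A)"

lemma hausdorff1_bad_finite: "A \<in> sets borel \<Longrightarrow> emeasure hausdorff1 (bad \<inter> A) < \<infinity>"
proof -
  assume A: "A \<in> sets borel"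
  have b: "bad \<in> sets borel" using compact_bad by (rule borel_compact)
  have "emeasure hausdorff1 (bad \<inter> A) \<le> emeasure hausdorff1 bad" using A b by (intro emeasure_mono) auto
  also have "\<dots> \<le> ennreal (50 * \<epsilon>)" using emeasure_hausdorff1[OF b] small_trace by (simp add: bad_def)
  also have "\<dots> < \<infinity>" by simp
  finally show ?thesis .
qed

lemma mass_properties:
  assumes \<delta>: "0 \<le> \<delta>" and fin: "E UNIV < \<infinity>"
  shows "0 \<le> mass \<delta> A"
    and "A \<in> sets borel \<Longrightarrow> B \<in> sets borel \<Longrightarrow> A \<subseteq> B \<Longrightarrow> mass \<delta> A \<le> mass \<delta> B"
    and "A \<in> sets borel \<Longrightarrow> B \<in> sets borel \<Longrightarrow> A \<inter> B = {} \<Longrightarrow> mass \<delta> A + mass \<delta> B \<le> mass \<delta> (A \<union> B)"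
proof -
  have c: "0 \<le> 2 * speed \<delta> * scale \<delta>" using \<delta> bb_ge eps by (auto simp: speed_def scale_def)
  have b: "bad \<in> sets borel" using compact_bad by (rule borel_compact)
  have finE: "E A < \<infinity>" for A using E_mono[of A UNIV] fin by (simp add: le_less_trans)
  show "0 \<le> mass \<delta> A" using c by (simp add: mass_def)
  show "mass \<delta> A \<le> mass \<delta> B" if "A \<in> sets borel" "B \<in> sets borel" "A \<subseteq> B"
  proof -
    have "measure hausdorff1 (bad \<inter> A) \<le> measure hausdorff1 (bad \<inter> B)"
      using that b hausdorff1_bad_finite[OF that(2)] by (intro measure_mono_fmeasurable) (auto simp: fmeasurable_def)
    then show ?thesis unfolding mass_def using c E_mono[OF that(3)] finE
      by (intro add_mono mult_left_mono enn2real_mono) auto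
  qed
  show "mass \<delta> A + mass \<delta> B \<le> mass \<delta> (A \<union> B)" if "A \<in> sets borel" "B \<in> sets borel" "A \<inter> B = {}"
  proof -
    have "enn2real (E (A \<union> B)) = enn2real (E A) + enn2real (E B)"
      using E_add[OF that] finE by (simp add: enn2real_plus)
    moreover have "measure hausdorff1 (bad \<inter> (A \<union> B)) = measure hausdorff1 (bad \<inter> A) + measure hausdorff1 (bad \<inter> B)"
    proof -
      have "measure hausdorff1 ((bad \<inter> A) \<union> (bad \<inter> B)) = measure hausdorff1 (bad \<inter> A) + measure hausdorff1 (bad \<inter> B)"
        using that b hausdorff1_bad_finite[OF that(1)] hausdorff1_bad_finite[OF that(2)]
        by (intro measure_Union) auto
      then show ?thesis by (simp add: Int_Un_distrib)
    qed
    ultimately show ?thesis by (simp add: mass_def distrib_left)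
  qed
qed

text \<open>The lower bounds are integrated over the radii whose circles avoid \<open>bad\<close>.
  On the other radii the bound is at most its value M at radius 0, and these radii have at most the
  length of the part of \<open>bad\<close> in the annulus.\<close>

lemma integrate_slices:
  assumes \<delta>: "0 \<le> \<delta>" and k: "0 \<le> k" "k \<le> 2" and r: "0 \<le> \<rho>0" "\<rho>0 < \<rho>1" and fin: "E UNIV < \<infinity>"
    and le: "\<And>\<rho>. \<rho>0 < \<rho> \<Longrightarrow> \<rho> < \<rho>1 \<Longrightarrow> (\<And>x. x \<in> sphere c \<rho> \<Longrightarrow> x \<notin> bad) \<Longrightarrow>
      ennreal (k * pi / (bb * \<epsilon> + (1 + \<delta>) * \<rho>)) \<le> slice \<alpha> c \<rho>"
  shows "k * (growth \<delta> \<rho>1 - growth \<delta> \<rho>0) \<le> mass \<delta> {x. \<rho>0 < dist c x \<and> dist c x < \<rho>1}"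
proof -
  let ?A = "{x. \<rho>0 < dist c x \<and> dist c x < \<rho>1}"
  define h where "h \<rho> = k * pi / (bb * \<epsilon> + (1 + \<delta>) * \<rho>)" for \<rho>
  define T where "T = {\<rho>. \<exists>y\<in>bad \<inter> ?A. dist c y = \<rho>}"
  have den: "0 < bb * \<epsilon>" using bb_ge eps by simp
  have A: "?A \<in> sets borel"
    by (intro borel_open open_Collect_conj open_Collect_less continuous_intros)
  have b: "bad \<in> sets borel" using compact_bad by (rule borel_compact)
  have T: "T \<in> sets borel"
  proof -
    have "T = dist c ` bad \<inter> {\<rho>0<..<\<rho>1}" by (auto simp: T_def)
    moreover have "compact (dist c ` bad)" by (intro compact_continuous_image compact_bad continuous_intros)
    ultimately show ?thesis by (auto intro: borel_compact)
  qed
  have eT: "emeasure lborel T \<le> emeasure hausdorff1 (bad \<inter> ?A)"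
    by (rule lebesgue_dist_image_le_hausdorff1[OF compact_bad _ T_def T]) (use A b in \<open>simp add: emeasure_hausdorff1\<close>)
  define \<tau> where "\<tau> = measure hausdorff1 (bad \<inter> ?A)"
  have eT': "emeasure lborel T \<le> ennreal \<tau>"
    using eT hausdorff1_bad_finite[OF A] by (simp add: \<tau>_def emeasure_eq_ennreal_measure less_top)
  define M where "M = k * pi / (bb * \<epsilon>)"
  have M0: "0 \<le> M" using k den by (simp add: M_def)
  have h: "0 \<le> h \<rho>" "h \<rho> \<le> M" if "0 \<le> \<rho>" for \<rho>
  proof -
    have "0 \<le> (1 + \<delta>) * \<rho>" using that \<delta> by simp
    then have d: "bb * \<epsilon> \<le> bb * \<epsilon> + (1 + \<delta>) * \<rho>" by simp
    show "h \<rho> \<le> M" unfolding h_def M_def using den k d by (intro divide_left_mono mult_pos_pos[OF order.strict_trans2[OF den d] den]) auto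
    show "0 \<le> h \<rho>" unfolding h_def using den k d by (intro divide_nonneg_nonneg) auto
  qed
  have hm: "h \<in> borel_measurable borel" unfolding h_def[abs_def] by measurable
  have FTC: "(\<integral>\<^sup>+\<rho>\<in>{\<rho>0..\<rho>1}. ennreal (h \<rho>) \<partial>lborel) = ennreal (k * growth \<delta> \<rho>1 - k * growth \<delta> \<rho>0)"
  proof (rule nn_integral_FTC_Icc[OF hm])
    show "\<rho>0 \<le> \<rho>1" using r by simp
    show "0 \<le> h \<rho>" if "\<rho> \<in> {\<rho>0..\<rho>1}" for \<rho> using h(1)[of \<rho>] that r by simp
    show "((\<lambda>\<rho>. k * growth \<delta> \<rho>) has_field_derivative h \<rho>) (at \<rho>)" if "\<rho> \<in> {\<rho>0..\<rho>1}" for \<rho>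
    proof -
      have p: "0 < 1 + scale \<delta> * \<rho>" using that r \<delta> den by (auto simp: scale_def intro!: add_pos_nonneg)
      have "((\<lambda>\<rho>. k * growth \<delta> \<rho>) has_field_derivative k * (speed \<delta> * (scale \<delta> / (1 + scale \<delta> * \<rho>)))) (at \<rho>)"
        unfolding growth_def using p by (auto intro!: derivative_eq_intros)
      moreover have "k * (speed \<delta> * (scale \<delta> / (1 + scale \<delta> * \<rho>))) = h \<rho>"
      proof -
        have "bb * \<epsilon> * (1 + scale \<delta> * \<rho>) = bb * \<epsilon> + (1 + \<delta>) * \<rho>" using bb_ge(3) eps by (simp add: scale_def distrib_left)
        moreover have "speed \<delta> * scale \<delta> = pi / (bb * \<epsilon>)" using \<delta> by (simp add: speed_def scale_def)
        ultimately show ?thesis unfolding h_def by (metis (no_types, lifting) divide_divide_eq_left times_divide_eq_right)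
      qed
      ultimately show ?thesis by simp
    qed
  qed
  have "(\<integral>\<^sup>+\<rho>\<in>{\<rho>0..\<rho>1}. ennreal (h \<rho>) \<partial>lborel) = (\<integral>\<^sup>+\<rho>\<in>{\<rho>0<..<\<rho>1}. ennreal (h \<rho>) \<partial>lborel)"
  proof (rule nn_integral_cong_AE)
    have "AE \<rho> in lborel. \<rho> \<noteq> \<rho>0" "AE \<rho> in lborel. \<rho> \<noteq> \<rho>1" by (rule AE_lborel_singleton)+
    then show "AE \<rho> in lborel. ennreal (h \<rho>) * indicator {\<rho>0..\<rho>1} \<rho> = ennreal (h \<rho>) * indicator {\<rho>0<..<\<rho>1} \<rho>"
      by eventually_elim (auto simp: indicator_def)
  qed
  also have "\<dots> = (\<integral>\<^sup>+\<rho>. ennreal (h \<rho>) * indicator ({\<rho>0<..<\<rho>1} - T) \<rho> + ennreal (h \<rho>) * indicator ({\<rho>0<..<\<rho>1} \<inter> T) \<rho> \<partial>lborel)"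
    by (intro nn_integral_cong) (auto simp: indicator_def)
  also have "\<dots> = (\<integral>\<^sup>+\<rho>\<in>{\<rho>0<..<\<rho>1} - T. ennreal (h \<rho>) \<partial>lborel) + (\<integral>\<^sup>+\<rho>\<in>{\<rho>0<..<\<rho>1} \<inter> T. ennreal (h \<rho>) \<partial>lborel)"
    using hm T by (intro nn_integral_add) auto
  also have "\<dots> \<le> (\<integral>\<^sup>+\<rho>\<in>{\<rho>0<..<\<rho>1}. slice \<alpha> c \<rho> \<partial>lborel) + (\<integral>\<^sup>+\<rho>. ennreal M * indicator T \<rho> \<partial>lborel)"
  proof (intro add_mono nn_integral_mono)
    fix \<rho>
    show "ennreal (h \<rho>) * indicator ({\<rho>0<..<\<rho>1} - T) \<rho> \<le> slice \<alpha> c \<rho> * indicator {\<rho>0<..<\<rho>1} \<rho>"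
    proof (cases "\<rho> \<in> {\<rho>0<..<\<rho>1} - T")
      case True
      then have "x \<notin> bad" if "x \<in> sphere c \<rho>" for x using that by (auto simp: T_def)
      then show ?thesis using le[of \<rho>] True by (simp add: h_def)
    qed simp
    show "ennreal (h \<rho>) * indicator ({\<rho>0<..<\<rho>1} \<inter> T) \<rho> \<le> ennreal M * indicator T \<rho>"
    proof (cases "\<rho> \<in> {\<rho>0<..<\<rho>1} \<inter> T")
      case True
      then show ?thesis using h(2)[of \<rho>] r by (simp add: ennreal_leI)
    qed simp
  qed
  also have "\<dots> \<le> E ?A + ennreal M * ennreal \<tau>"
  proof (rule add_mono[OF slice_le[OF r(1)]])
    have "(\<integral>\<^sup>+\<rho>. ennreal M * indicator T \<rho> \<partial>lborel) = ennreal M * emeasure lborel T"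
      using T by (simp add: nn_integral_cmult_indicator)
    then show "(\<integral>\<^sup>+\<rho>. ennreal M * indicator T \<rho> \<partial>lborel) \<le> ennreal M * ennreal \<tau>"
      using mult_left_mono[OF eT'] by simp
  qed
  also have "\<dots> = ennreal (enn2real (E ?A) + M * \<tau>)"
  proof -
    have "E ?A < \<infinity>" using E_mono[of ?A UNIV] fin by (simp add: le_less_trans)
    then show ?thesis using M0 by (simp add: \<tau>_def ennreal_mult[symmetric] ennreal_plus less_top)
  qed
  finally have "k * growth \<delta> \<rho>1 - k * growth \<delta> \<rho>0 \<le> enn2real (E ?A) + M * \<tau>"
    unfolding FTC using M0 by (subst (asm) ennreal_le_iff) (auto simp: \<tau>_def)
  also have "M * \<tau> \<le> 2 * speed \<delta> * scale \<delta> * \<tau>"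
  proof (rule mult_right_mono)
    have "speed \<delta> * scale \<delta> = pi / (bb * \<epsilon>)" using \<delta> by (simp add: speed_def scale_def)
    moreover have "k * (pi / (bb * \<epsilon>)) \<le> 2 * (pi / (bb * \<epsilon>))" using k den by (intro mult_right_mono) auto
    ultimately show "M \<le> 2 * speed \<delta> * scale \<delta>" by (simp add: M_def mult.assoc)
  qed (simp add: \<tau>_def)
  finally show ?thesis by (simp add: mass_def \<tau>_def right_diff_distrib)
qed

lemma cost_interior:
  assumes f: "field f" and \<delta>: "0 \<le> \<delta>" and fin: "E UNIV < \<infinity>"
    and r: "1500 * \<epsilon> \<le> \<rho>0" "\<rho>0 < \<rho>1" and ins: "ball c (\<rho>1 + 200 * \<epsilon>) \<subseteq> \<Omega>"
    and nc: "\<And>\<rho>. \<rho>0 < \<rho> \<Longrightarrow> \<rho> < \<rho>1 \<Longrightarrow> sphere c \<rho> \<inter> {x \<in> closure \<Omega>. \<not> low x} \<inter> closure \<Omega> = {} \<and> \<not> cert f 0 c \<rho>"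
  shows "2 * (growth \<delta> \<rho>1 - growth \<delta> \<rho>0) \<le> mass \<delta> {x. \<rho>0 < dist c x \<and> dist c x < \<rho>1}"
proof (rule integrate_slices[OF \<delta> _ _ _ r(2) fin])
  show "0 \<le> \<rho>0" using r eps by linarith
  fix \<rho> assume \<rho>: "\<rho>0 < \<rho>" "\<rho> < \<rho>1"
  have \<rho>0: "0 < \<rho>" "1500 * \<epsilon> \<le> \<rho>" using \<rho> r eps by linarith+
  have ins': "ball c (\<rho> + 200 * \<epsilon>) \<subseteq> \<Omega>" using ins subset_ball[of "\<rho> + 200 * \<epsilon>" "\<rho>1 + 200 * \<epsilon>" c] \<rho> by auto
  have sub: "cball c \<rho> \<subseteq> \<Omega>" using eps by (auto intro!: subsetD[OF ins'])
  have low: "low x" if "x \<in> sphere c \<rho>" for x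
    using nc[OF \<rho>] that sub sphere_cball[of c \<rho>] closure_subset[of \<Omega>] by blast
  have "2 * pi / (bb * \<epsilon> + (1 + \<delta>) * \<rho>) \<le> cost c \<rho> 0 (2 * pi)"
    by (rule interior_cost_pointwise[OF f \<rho>0(2) ins' low _ \<delta>]) (use nc[OF \<rho>] in auto)
  then have "ennreal (2 * pi / (bb * \<epsilon> + (1 + \<delta>) * \<rho>)) \<le> ennreal (cost c \<rho> 0 (2 * pi))" by (rule ennreal_leI)
  also have "\<dots> \<le> slice 0 c \<rho>"
  proof (rule cost_le_slice[OF \<rho>0(1)])
    show "circ c \<rho> \<theta> \<in> \<Omega>" for \<theta> using sub dist_circ[of \<rho> c \<theta>] \<rho>0 by (auto intro!: subsetD[OF sub])
  qed auto
  finally show "ennreal (2 * pi / (bb * \<epsilon> + (1 + \<delta>) * \<rho>)) \<le> slice 0 c \<rho>" .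
qed auto

lemma cost_boundary:
  assumes f: "field f" and fin: "E UNIV < \<infinity>" and y: "y \<in> frontier \<Omega>" and n: "n \<le> 1"
    and r: "1500 * \<epsilon> \<le> \<rho>0" "\<rho>0 < \<rho>1" "\<rho>1 \<le> r1" and \<delta>: "8 * (2 * a + K * \<rho>1) \<le> \<delta>"
    and nc: "\<And>\<rho>. \<rho>0 < \<rho> \<Longrightarrow> \<rho> < \<rho>1 \<Longrightarrow> sphere y \<rho> \<inter> {x \<in> closure \<Omega>. \<not> low x} \<inter> closure \<Omega> = {} \<and> \<not> cert f n y \<rho>"
  shows "(real n + 1) * (growth \<delta> \<rho>1 - growth \<delta> \<rho>0) \<le> mass \<delta> {x. \<rho>0 < dist y x \<and> dist y x < \<rho>1}"
proof -
  obtain \<omega> where \<omega>: "cx (\<nu> y) = - \<i> * cis \<omega>" using normal_angle[OF y] by blast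
  have "0 \<le> K * \<rho>1" using K r eps by auto
  then have \<delta>0: "0 \<le> \<delta>" using \<delta> a by auto
  show ?thesis
  proof (rule integrate_slices[OF \<delta>0 _ _ _ r(2) fin])
    show "0 \<le> \<rho>0" using r eps by linarith
    show "real n + 1 \<le> 2" using n by simp
    fix \<rho> assume \<rho>: "\<rho>0 < \<rho>" "\<rho> < \<rho>1" and good: "\<And>x. x \<in> sphere y \<rho> \<Longrightarrow> x \<notin> bad"
    have \<rho>0: "0 < \<rho>" "1500 * \<epsilon> \<le> \<rho>" "\<rho> < r1" "\<rho> < r0" using \<rho> r eps r1 by linarith+
    have "K * \<rho> \<le> K * r1" "K * \<rho> \<le> K * \<rho>1" using K \<rho> \<rho>0 by (auto intro!: mult_left_mono)
    then have K\<rho>: "2 * K * \<rho> \<le> 1/100" "K * \<rho> \<le> 1/8" "8 * (2 * a + K * \<rho>) \<le> \<delta>" using r1 \<delta> by auto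
    obtain a' b' where ab: "\<bar>a' - \<omega>\<bar> \<le> 2 * K * \<rho>" "\<bar>b' - (\<omega> + pi)\<bar> \<le> 2 * K * \<rho>"
      and ends: "circ y \<rho> a' \<in> frontier \<Omega>" "circ y \<rho> b' \<in> frontier \<Omega>" and ins: "\<And>\<theta>. a' < \<theta> \<Longrightarrow> \<theta> < b' \<Longrightarrow> circ y \<rho> \<theta> \<in> \<Omega>"
      and sph: "sphere y \<rho> \<inter> closure \<Omega> = circ y \<rho> ` {a'..b'}"
      by (rule sphere_Int_closure_arc[OF y \<rho>0(1,4) K\<rho>(2) \<omega>]) (rule that, (assumption | blast)+)
    have low: "low x" if "x \<in> sphere y \<rho> \<inter> closure \<Omega>" for x using nc[OF \<rho>] that by blast
    have "(real n + 1) * pi / (bb * \<epsilon> + (1 + \<delta>) * \<rho>) \<le> cost y \<rho> a' b'"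
      using nc[OF \<rho>] by (intro boundary_cost_pointwise[OF f y \<omega> \<rho>0(2,3) ab ends ins sph low good n _ K\<rho>(3)]) auto
    then have "ennreal ((real n + 1) * pi / (bb * \<epsilon> + (1 + \<delta>) * \<rho>)) \<le> ennreal (cost y \<rho> a' b')" by (rule ennreal_leI)
    also have "\<dots> \<le> slice (\<omega> - pi / 2) y \<rho>"
    proof (rule cost_le_slice[OF \<rho>0(1) _ _ ins])
      show "\<omega> - pi / 2 \<le> a'" "b' \<le> \<omega> - pi / 2 + 2 * pi" using ab K\<rho>(1) pi_gt3 by linarith+
    qed
    finally show "ennreal ((real n + 1) * pi / (bb * \<epsilon> + (1 + \<delta>) * \<rho>)) \<le> slice (\<omega> - pi / 2) y \<rho>" .
  qed auto
qed

end

section \<open>Concentration of the energy\<close>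

context regular_domain
begin

text \<open>If \<open>c\<close> is close to the frontier, but not close enough for a ball centred there, the ball around \<open>c\<close> is shifted inwards
  along the normal.\<close>

lemma relocate:
  assumes c: "c \<in> closure \<Omega>" and r: "0 < r" "3 * r < r0" "40 * (K * r) < 1"
  shows "(\<exists>x. ball x r \<subseteq> \<Omega> \<and> cball c (6/100 * r) \<subseteq> ball x r) \<or> (\<exists>y\<in>frontier \<Omega>. cball c (6/100 * r) \<subseteq> ball y r)"
proof (cases "\<exists>y\<in>frontier \<Omega>. dist y c < 94/100 * r")
  case True
  then obtain y where y: "y \<in> frontier \<Omega>" "dist y c < 94/100 * r" by blast
  have "cball c (6/100 * r) \<subseteq> ball y r"
  proof
    fix x assume "x \<in> cball c (6/100 * r)"
    then show "x \<in> ball y r" using y(2) dist_triangle[of y x c] by simp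
  qed
  then show ?thesis using y(1) by blast
next
  case far: False
  show ?thesis
  proof (cases "cball c r \<inter> frontier \<Omega> = {}")
    case True
    then have "cball c r \<subseteq> \<Omega>" using c r by (intro cball_inside[of c]) auto
    then have "ball c r \<subseteq> \<Omega>" using ball_subset_cball by blast
    moreover have "cball c (6/100 * r) \<subseteq> ball c r" using r by auto
    ultimately show ?thesis by blast
  next
    case False
    then have ne: "frontier \<Omega> \<noteq> {}" by blast
    obtain y where y: "y \<in> frontier \<Omega>" "\<And>z. z \<in> frontier \<Omega> \<Longrightarrow> dist c y \<le> dist c z"
      using distance_attains_inf[of "frontier \<Omega>" c] compact_frontier_dom ne by (auto dest: compact_imp_closed)
    define D where "D = dist c y"
    obtain z where "z \<in> frontier \<Omega>" "dist c z \<le> r" using False by auto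
    then have D: "94/100 * r \<le> D" "D \<le> r" using y(2)[of z] far y(1) by (auto simp: D_def dist_commute not_less)
    have inball: "ball c D \<subseteq> \<Omega>"
    proof
      fix x assume x: "x \<in> ball c D"
      have "cball c (dist c x) \<inter> frontier \<Omega> = {}" using y(2) x by (force simp: D_def)
      then have "cball c (dist c x) \<subseteq> \<Omega>" using c by (intro cball_inside[of c]) auto
      then show "x \<in> \<Omega>" by auto
    qed
    have D0: "0 < D" using D r by linarith
    have clball: "cball c D \<subseteq> closure \<Omega>"
      using closure_mono[OF inball] D0 by (simp add: closure_ball)
    have ny: "norm (\<nu> y) = 1" "\<nu> y \<bullet> \<nu> y = 1" using norm_normal[OF y(1)] by (simp_all add: norm_eq_1)
    \<comment> \<open>The ball of radius D around \<open>c\<close> touches the boundary at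
      \<open>y\<close> from inside. Its point in direction of the normal is in the closure, so by
      \<open>outside\<close> it lies hardly above the tangent; this makes the segment from
      \<open>y\<close> to \<open>c\<close> almost normal.\<close>
    have cy: "(c - y) \<bullet> \<nu> y \<le> - D + 4 * (K * r) * r"
    proof -
      define x where "x = c + D *\<^sub>R \<nu> y"
      have dxy: "dist y x \<le> 2 * r"
        using dist_triangle[of y x c] ny D D0 by (simp add: x_def D_def dist_commute dist_norm)
      have "x \<in> closure \<Omega>" using clball ny D0 by (auto simp: x_def dist_norm intro!: subsetD[OF clball])
      then have "\<not> K * (dist y x)\<^sup>2 < (x - y) \<bullet> \<nu> y" using outside[OF y(1), of x] dxy r by auto
      moreover have "(x - y) \<bullet> \<nu> y = (c - y) \<bullet> \<nu> y + D" using ny by (simp add: x_def inner_diff inner_add)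
      moreover have "K * (dist y x)\<^sup>2 \<le> K * (2 * r)\<^sup>2" using K dxy by (intro mult_left_mono power_mono) auto
      ultimately show ?thesis by (simp add: power2_eq_square mult_ac)
    qed
    \<comment> \<open>A shift by r/2 turns the distance of at least 94/100 * r from the boundary
      into a margin of 44/100 * r for a ball of radius r, more than the curvature terms of about
      26/100 * r.\<close>
    define x1 where "x1 = c - (r / 2) *\<^sub>R \<nu> y"
    have "ball x1 r \<subseteq> \<Omega>"
    proof
      fix x assume x: "x \<in> ball x1 r"
      have nh: "norm (x - x1) < r" using x by (simp add: dist_norm norm_minus_commute)
      have "\<bar>(x - x1) \<bullet> \<nu> y\<bar> \<le> norm (x - x1)" using Cauchy_Schwarz_ineq2[of "x - x1" "\<nu> y"] ny by simp
      moreover have "(x - y) \<bullet> \<nu> y = (x - x1) \<bullet> \<nu> y + (c - y) \<bullet> \<nu> y - r / 2"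
        using ny by (simp add: x1_def inner_diff inner_add)
      ultimately have 1: "(x - y) \<bullet> \<nu> y < - (44/100) * r + 4 * (K * r) * r" using nh cy D by linarith
      have "dist y x1 \<le> 3/2 * r"
        using dist_triangle[of y x1 c] ny D r by (simp add: x1_def D_def dist_commute dist_norm)
      then have 2: "dist y x \<le> 5/2 * r" using x dist_triangle[of y x x1] by simp
      show "x \<in> \<Omega>"
      proof (rule inside[OF y(1)])
        show "x \<in> ball y r0" using 2 r by simp
        have "K * (dist y x)\<^sup>2 \<le> K * (5/2 * r)\<^sup>2" using K 2 by (intro mult_left_mono power_mono) auto
        also have "\<dots> = 25/4 * (K * r) * r" by (simp add: power2_eq_square)
        finally have "K * (dist y x)\<^sup>2 \<le> 25/4 * (K * r) * r" .
        moreover have "(K * r) * r \<le> (1/40) * r" using r by (intro mult_right_mono) auto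
        ultimately have "(x - y) \<bullet> \<nu> y < - (K * (dist y x)\<^sup>2)" using 1 r(1) by linarith
        then show "(x - y) \<bullet> \<nu> y < - K * (dist y x)\<^sup>2" by simp
      qed
    qed
    moreover have "cball c (6/100 * r) \<subseteq> ball x1 r"
    proof
      fix x assume "x \<in> cball c (6/100 * r)"
      moreover have "dist x1 c = r / 2" using ny r by (simp add: x1_def dist_norm)
      ultimately show "x \<in> ball x1 r" using dist_triangle[of x1 x c] r by simp
    qed
    ultimately show ?thesis by blast
  qed
qed

lemma cert_interior:
  assumes "cert f 1 c \<rho>" "cball c \<rho> \<subseteq> \<Omega>" shows "cert f 0 c \<rho>"
proof -
  have "cball c \<rho> \<inter> frontier \<Omega> = {}" using assms(2) frontier_iff by blast
  then show ?thesis using assms(1) unfolding cert_def filling_def by auto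
qed

end

context normal_field
begin

text \<open>Three units of label would need more energy than available, two are enforced by
  topology. So the final items contain either one of label 2 or two of label 1, and the latter lie
  on the boundary.\<close>

lemma concentration:
  assumes sc: "simply_connected \<Omega>" "\<Omega> \<noteq> {}" and fin: "E UNIV \<le> ennreal e" "0 \<le> e"
    and s1: "4200 * \<epsilon> \<le> s1" "6 * s1 \<le> r1" "24 * s1 < r0" "72 * K * s1 \<le> 1"
    and \<delta>: "8 * (2 * a + K * (6 * s1)) \<le> \<delta>" and pw: "(1 + 72 * K * s1) ^ nat \<lfloor>e / c0\<rfloor> \<le> 2"
    and lt: "e + 1 < 3 * growth \<delta> s1"
  shows "(\<exists>c\<in>closure \<Omega>. 2 * growth \<delta> s1 - 1 \<le> enn2real (E (cball c (6 * s1)))) \<or>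
    (\<exists>y\<in>frontier \<Omega>. \<exists>z\<in>frontier \<Omega>. 2 * growth \<delta> s1 - 1 \<le> enn2real (E (cball y (6 * s1) \<union> cball z (6 * s1))))"
proof -
  obtain f where f: "field f" by (rule field_exists)
  have s0: "0 < s1" using s1 eps by linarith
  have Ks: "0 \<le> K * s1" using K s0 by simp
  have \<delta>0: "0 \<le> \<delta>" using \<delta> a Ks by simp
  have fin': "E UNIV < \<infinity>" using fin by (simp add: le_less_trans)
  have finE: "E A < \<infinity>" for A using E_mono[of A UNIV] fin' by (simp add: le_less_trans)
  define Z where "Z = {x \<in> closure \<Omega>. \<not> low x}"
  define N0 where "N0 = nat \<lfloor>e / c0\<rfloor>"
  define gap where "gap = 200 * \<epsilon>"
  have sp: "0 < speed \<delta>" "0 < scale \<delta>" "speed \<delta> * scale \<delta> = pi / (bb * \<epsilon>)"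
    using \<delta>0 bb_ge eps by (auto simp: speed_def scale_def)
  \<comment> \<open>The compensation for \<open>bad\<close> amounts to at most 2 * (pi / (bb *
    epsilon)) * 50 * epsilon, hence to 1.\<close>
  have extra: "2 * speed \<delta> * scale \<delta> * measure hausdorff1 (bad \<inter> A) \<le> 1" if A: "A \<in> sets borel" for A
  proof -
    have b: "bad \<in> sets borel" using compact_bad by (rule borel_compact)
    have "emeasure hausdorff1 (bad \<inter> A) \<le> emeasure hausdorff1 bad" using A b by (intro emeasure_mono) auto
    also have "\<dots> \<le> ennreal (50 * \<epsilon>)" using emeasure_hausdorff1[OF b] small_trace by (simp add: bad_def)
    finally have "measure hausdorff1 (bad \<inter> A) \<le> 50 * \<epsilon>"
      using hausdorff1_bad_finite[OF A] eps by (simp add: emeasure_eq_ennreal_measure less_top)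
    then have "2 * (speed \<delta> * scale \<delta>) * measure hausdorff1 (bad \<inter> A) \<le> 2 * (speed \<delta> * scale \<delta>) * (50 * \<epsilon>)"
      using mult_pos_pos[OF sp(1,2)] by (intro mult_left_mono) auto
    also have "\<dots> = 100 * pi / bb" unfolding sp(3) using eps by simp
    also have "\<dots> \<le> 1" using c0_pos by (simp add: bb_def c0_def eta_def power_divide)
    finally show ?thesis by (simp add: mult.assoc)
  qed
  have mass_le: "mass \<delta> A \<le> enn2real (E A) + 1" if "A \<in> sets borel" for A
    using extra[OF that] by (simp add: mass_def)
  have tot: "mass \<delta> UNIV \<le> e + 1"
  proof -
    have "enn2real (E UNIV) \<le> e" using fin by (simp add: enn2real_leI)
    then show ?thesis using mass_le[of UNIV] by simp
  qed
  interpret ball_construction \<Omega> \<nu> K r0 f Z "mass \<delta>" gap "1 + 72 * K * s1" "speed \<delta>" "scale \<delta>" s1 "3 * s1" "e + 1" "1500 * \<epsilon>" N0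
  proof
    show "continuous_on (closure \<Omega>) f" using f continuous_on_subset unfolding field_def by blast
    show "f x \<noteq> 0" if "x \<in> closure \<Omega>" "x \<notin> Z" for x using field_nonzero[OF f] that by (simp add: Z_def)
    show "\<bar>f x \<bullet> \<nu> x\<bar> \<le> 1/2 * norm (f x)" if "x \<in> frontier \<Omega>" "x \<notin> Z" for x
      using field_tangential[OF f that(1)] that frontier_subset_closure by (auto simp: Z_def)
    show "0 \<le> mass \<delta> A" for A by (rule mass_properties(1)[OF \<delta>0 fin'])
    show "mass \<delta> A \<le> mass \<delta> B" if "A \<in> sets borel" "B \<in> sets borel" "A \<subseteq> B" for A B
      by (rule mass_properties(2)[OF \<delta>0 fin' that])
    show "mass \<delta> A + mass \<delta> B \<le> mass \<delta> (A \<union> B)" if "A \<in> sets borel" "B \<in> sets borel" "A \<inter> B = {}" for A B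
      by (rule mass_properties(3)[OF \<delta>0 fin' that])
    show "mass \<delta> UNIV \<le> e + 1" by (rule tot)
    show "0 < gap" "0 < speed \<delta>" "0 < scale \<delta>" "0 < s1" "0 \<le> 1500 * \<epsilon>" using sp eps s0 by (auto simp: gap_def)
    show "1 \<le> 1 + 72 * K * s1" "(1 + 72 * K * s1) ^ N0 \<le> 2" "24 * K * (3 * s1) \<le> 1 + 72 * K * s1 - 1"
      using Ks pw by (auto simp: N0_def mult.assoc)
    have "s1 * (e + 1) \<le> s1 * (3 * growth \<delta> s1)" using lt s0 by (intro mult_left_mono) auto
    then show "s1 * (e + 1) \<le> 3 * s1 * (speed \<delta> * ln (1 + scale \<delta> * s1))" by (simp add: growth_def)
    show "2 * s1 \<le> 3 * s1" "8 * (3 * s1) < r0" "24 * K * (3 * s1) \<le> 1" using s0 s1 by auto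
    show "2 * (speed \<delta> * ln (1 + scale \<delta> * \<rho>1) - speed \<delta> * ln (1 + scale \<delta> * \<rho>0)) \<le> mass \<delta> {x. \<rho>0 < dist c x \<and> dist c x < \<rho>1}"
      if "1500 * \<epsilon> \<le> \<rho>0" "\<rho>0 < \<rho>1" "ball c (\<rho>1 + gap) \<subseteq> \<Omega>"
        "\<And>\<rho>. \<rho>0 < \<rho> \<Longrightarrow> \<rho> < \<rho>1 \<Longrightarrow> sphere c \<rho> \<inter> Z \<inter> closure \<Omega> = {} \<and> \<not> cert f 0 c \<rho>" for c \<rho>0 \<rho>1
      using cost_interior[OF f \<delta>0 fin' that(1,2), of c] that(3,4) unfolding growth_def Z_def gap_def by blast
    show "(real n + 1) * (speed \<delta> * ln (1 + scale \<delta> * \<rho>1) - speed \<delta> * ln (1 + scale \<delta> * \<rho>0)) \<le> mass \<delta> {x. \<rho>0 < dist c x \<and> dist c x < \<rho>1}"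
      if h: "1500 * \<epsilon> \<le> \<rho>0" "\<rho>0 < \<rho>1" "\<rho>1 \<le> 2 * (3 * s1)" "c \<in> frontier \<Omega>" "n \<le> 1"
        "\<And>\<rho>. \<rho>0 < \<rho> \<Longrightarrow> \<rho> < \<rho>1 \<Longrightarrow> sphere c \<rho> \<inter> Z \<inter> closure \<Omega> = {} \<and> \<not> cert f n c \<rho>" for c \<rho>0 \<rho>1 n
    proof -
      have "K * \<rho>1 \<le> K * (6 * s1)" using K h(3) by (intro mult_left_mono) auto
      then have "8 * (2 * a + K * \<rho>1) \<le> 8 * (2 * a + K * (6 * s1))" by (rule mult_left_mono[OF add_left_mono]) simp
      then have "8 * (2 * a + K * \<rho>1) \<le> \<delta>" using \<delta> by (rule order_trans)
      moreover have "\<rho>1 \<le> r1" using h(3) s1 by simp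
      ultimately show ?thesis
        using cost_boundary[OF f fin' h(4,5,1,2)] h(6) unfolding growth_def Z_def by blast
    qed
  qed
  have Lam: "Lam s = growth \<delta> s" for s by (simp add: Lam_def growth_def)
  \<comment> \<open>Each of these balls contains energy at least c0, which limits their number to e
    / c0. In a largest packing the balls of twice the radius cover \<open>Z\<close>.\<close>
  define packing where "packing X \<longleftrightarrow> finite X \<and> X \<subseteq> Z \<and> (\<forall>x\<in>X. \<forall>y\<in>X. x \<noteq> y \<longrightarrow> ball x (2000 * \<epsilon>) \<inter> ball y (2000 * \<epsilon>) = {})" for X
  have high: "c0 \<le> enn2real (E (ball x (2000 * \<epsilon>)))" if "x \<in> Z" for x
  proof -
    have "ennreal c0 \<le> E (ball x (2000 * \<epsilon>))" using that by (simp add: Z_def low_def not_less)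
    then have "enn2real (ennreal c0) \<le> enn2real (E (ball x (2000 * \<epsilon>)))" using finE by (intro enn2real_mono) auto
    then show ?thesis using c0_pos by simp
  qed
  have card: "card X \<le> N0" if X: "packing X" for X
  proof -
    have "(\<Sum>x\<in>X. E (ball x (2000 * \<epsilon>))) \<le> E UNIV"
      using X unfolding packing_def
    proof -
      assume X: "finite X \<and> X \<subseteq> Z \<and> (\<forall>x\<in>X. \<forall>y\<in>X. x \<noteq> y \<longrightarrow> ball x (2000 * \<epsilon>) \<inter> ball y (2000 * \<epsilon>) = {})"
      then have "finite X" "\<forall>x\<in>X. \<forall>y\<in>X. x \<noteq> y \<longrightarrow> ball x (2000 * \<epsilon>) \<inter> ball y (2000 * \<epsilon>) = {}" by auto
      then have "(\<Sum>x\<in>X. E (ball x (2000 * \<epsilon>))) \<le> E (\<Union>x\<in>X. ball x (2000 * \<epsilon>))"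
      proof (induction X rule: finite_induct)
        case (insert x X)
        have "(\<Sum>x\<in>insert x X. E (ball x (2000 * \<epsilon>))) \<le> E (ball x (2000 * \<epsilon>)) + E (\<Union>x\<in>X. ball x (2000 * \<epsilon>))"
          using insert by (simp add: add_left_mono)
        also have "\<dots> = E (ball x (2000 * \<epsilon>) \<union> (\<Union>x\<in>X. ball x (2000 * \<epsilon>)))"
        proof (rule E_add[symmetric])
          show "ball x (2000 * \<epsilon>) \<inter> (\<Union>x\<in>X. ball x (2000 * \<epsilon>)) = {}" proof -
            have "ball x (2000 * \<epsilon>) \<inter> ball y (2000 * \<epsilon>) = {}" if "y \<in> X" for y
            proof -
              have "x \<noteq> y" using insert.hyps(2) that by blast
              then show ?thesis using insert.prems that by (meson insertI1 insertI2)
            qed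
            then show ?thesis by blast
          qed
          show "(\<Union>x\<in>X. ball x (2000 * \<epsilon>)) \<in> sets borel" by (intro borel_open open_UN) auto
        qed auto
        finally show ?case by simp
      qed simp
      also have "\<dots> \<le> E UNIV" by (intro E_mono) auto
      finally show ?thesis .
    qed
    moreover have "(\<Sum>x\<in>X. ennreal c0) \<le> (\<Sum>x\<in>X. E (ball x (2000 * \<epsilon>)))"
      using X by (intro sum_mono) (auto simp: packing_def Z_def low_def not_less)
    moreover have "ennreal (real (card X) * c0) = (\<Sum>x\<in>X. ennreal c0)"
      using c0_pos by (simp add: ennreal_mult ennreal_of_nat_eq_real_of_nat)
    ultimately have "ennreal (real (card X) * c0) \<le> ennreal e" using fin(1) by (metis order_trans)
    then have "real (card X) * c0 \<le> e" using fin(2) by simp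
    then have "real (card X) \<le> e / c0" using c0_pos by (simp add: pos_le_divide_eq)
    then show ?thesis unfolding N0_def by (simp add: le_nat_floor)
  qed
  have "packing {}" by (simp add: packing_def)
  then obtain X where X: "packing X" "\<And>Y. packing Y \<Longrightarrow> card Y \<le> card X"
    using ex_has_greatest_nat[of packing "{}" card "Suc N0"] card by (metis le_imp_less_Suc)
  \<comment> \<open>The size is two label units at parameter 4200 * epsilon, and the radius at least
    4200 * epsilon = 4000 * epsilon + gap. The energy owed, twice \<open>growth\<close> at 4200 *
    epsilon, is at most c0 by the choice of \<open>bb\<close>. Label 2 needs no certificate.\<close>
  define mk where "mk x = \<lparr>ctr = x, bdr = False, siz = 8400 * \<epsilon>, cnt = 1, lab = 2, reg = ball x (2000 * \<epsilon>)\<rparr>" for x :: "real^2"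
  have mk: "ctr (mk x) = x" "bdr (mk x) = False" "siz (mk x) = 8400 * \<epsilon>" "cnt (mk x) = 1" "lab (mk x) = 2"
    "reg (mk x) = ball x (2000 * \<epsilon>)" for x by (simp_all add: mk_def)
  have rad: "4200 * \<epsilon> \<le> rad (mk x)" for x unfolding rad_def mk wt_def using Ks eps by (simp add: mult.assoc)
  have inj: "inj_on mk X" using mk(1) by (metis inj_onI)
  have cover: "\<exists>x\<in>X. z \<in> cball x (4000 * \<epsilon>)" if z: "z \<in> Z" for z
  proof (rule ccontr)
    assume neg: "\<not> ?thesis"
    then have d: "ball x (2000 * \<epsilon>) \<inter> ball z (2000 * \<epsilon>) = {}" if "x \<in> X" for x
      using that by (intro disjoint_ballI) (auto simp: not_le)
    have zX: "z \<notin> X" using neg eps by force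
    have "packing (insert z X)" using X(1) z d unfolding packing_def by (auto simp: Int_commute)
    from X(2)[OF this] show False using zX X(1) by (simp add: packing_def)
  qed
  have "pre (4200 * \<epsilon>) (mk ` X)" unfolding pre_def
  proof (intro conjI ballI allI impI)
    show "finite (mk ` X)" using X(1) by (simp add: packing_def)
    show "(\<Sum>i\<in>mk ` X. cnt i) \<le> N0" using card[OF X(1)] by (simp add: sum.reindex[OF inj] mk)
    show "Z \<inter> closure \<Omega> \<subseteq> (\<Union>i\<in>mk ` X. cball (ctr i) (rad i - gap))"
    proof
      fix z assume "z \<in> Z \<inter> closure \<Omega>"
      then obtain x where x: "x \<in> X" "dist x z \<le> 4000 * \<epsilon>" using cover by auto
      then have "dist x z \<le> rad (mk x) - gap" using rad[of x] by (simp add: gap_def)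
      then show "z \<in> (\<Union>i\<in>mk ` X. cball (ctr i) (rad i - gap))" using x(1) by (auto simp: mk)
    qed
  next
    fix i assume "i \<in> mk ` X"
    then obtain x where x: "x \<in> X" "i = mk x" by blast
    have xZ: "x \<in> Z" using X(1) x by (auto simp: packing_def)
    show "ctr i \<in> frontier \<Omega>" if "bdr i" using that x by (simp add: mk)
    show "ctr i \<in> closure \<Omega>" using xZ x by (simp add: mk Z_def)
    show "1 \<le> cnt i" "lab i \<le> 2" "reg i \<in> sets borel" using x by (simp_all add: mk)
    show "2 * (1500 * \<epsilon> + gap) \<le> siz i" "4200 * \<epsilon> * lab i \<le> siz i" using x eps by (simp_all add: mk gap_def)
    show "siz i * Lam (4200 * \<epsilon>) \<le> 4200 * \<epsilon> * mass \<delta> (reg i)"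
    proof -
      have "0 < 1 + scale \<delta> * (4200 * \<epsilon>)" using sp eps by (simp add: add_pos_pos)
      then have "ln (1 + scale \<delta> * (4200 * \<epsilon>)) \<le> scale \<delta> * (4200 * \<epsilon>)" using ln_le_minus_one[of "1 + scale \<delta> * (4200 * \<epsilon>)"] by simp
      then have "growth \<delta> (4200 * \<epsilon>) \<le> speed \<delta> * (scale \<delta> * (4200 * \<epsilon>))" unfolding growth_def using sp by (intro mult_left_mono) auto
      also have "\<dots> = speed \<delta> * scale \<delta> * (4200 * \<epsilon>)" by simp
      also have "\<dots> = c0 / 2" unfolding sp(3) using eps c0_pos by (simp add: bb_def)
      finally have "2 * growth \<delta> (4200 * \<epsilon>) \<le> enn2real (E (ball x (2000 * \<epsilon>)))" using high[OF xZ] by simp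
      also have "\<dots> \<le> mass \<delta> (ball x (2000 * \<epsilon>))" using sp by (simp add: mass_def)
      finally have "4200 * \<epsilon> * (2 * growth \<delta> (4200 * \<epsilon>)) \<le> 4200 * \<epsilon> * mass \<delta> (ball x (2000 * \<epsilon>))"
        using eps by (intro mult_left_mono) auto
      then show ?thesis using x by (simp add: mk Lam)
    qed
    show "reg i \<subseteq> cball (ctr i) (rad i - gap)"
    proof
      fix z assume "z \<in> reg i"
      then have "dist x z < 2000 * \<epsilon>" using x by (simp add: mk)
      then have "dist x z \<le> rad (mk x) - gap" using rad[of x] eps by (simp add: gap_def)
      then show "z \<in> cball (ctr i) (rad i - gap)" using x by (simp add: mk)
    qed
    show "cert f (lab i) (ctr i) \<rho>" for \<rho> using x by (simp add: mk cert_2)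
    fix j assume "j \<in> mk ` X" "i \<noteq> j"
    then obtain x' where x': "x' \<in> X" "j = mk x'" "x \<noteq> x'" using x by blast
    show "reg i \<inter> reg j = {}" using X(1) x x' by (simp add: mk packing_def)
    show "rad i + rad j \<le> dist (ctr i) (ctr j)" if "lab i < 2" using that x by (simp add: mk)
  qed
  from merge_step[OF this] obtain S0 where "pre (4200 * \<epsilon>) S0" "separated S0" using eps s1 by auto
  from ball_construction[OF this] obtain S where S: "pre s1 S" "separated S" using eps s1 by auto
  \<comment> \<open>Interior balls of label 1 are really of label 0 by \<open>cert_interior\<close>;
    after this correction every label 1 belongs to a boundary ball.\<close>
  define fx where "fx i = (if \<not> bdr i \<and> lab i = 1 then i\<lparr>lab := 0\<rparr> else i)" for i :: item
  have fx: "ctr (fx i) = ctr i" "bdr (fx i) = bdr i" "siz (fx i) = siz i" "cnt (fx i) = cnt i" "reg (fx i) = reg i"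
    "rad (fx i) = rad i" "lab (fx i) = (if \<not> bdr i \<and> lab i = 1 then 0 else lab i)" for i
    by (auto simp: fx_def rad_def)
  note PS = preD[OF S(1)] and PS2 = pre_globalD[OF S(1)]
  have radp: "0 < rad i" if "i \<in> S" for i using rad_pos[OF siz_pos[OF S(1) that]] .
  have injS: "inj_on fx S"
  proof
    fix i j assume ij: "i \<in> S" "j \<in> S" "fx i = fx j"
    show "i = j"
    proof (rule ccontr)
      assume "i \<noteq> j"
      then have "rad i + rad j < dist (ctr i) (ctr j)" using S(2) ij unfolding separated_def by blast
      then have "ctr i \<noteq> ctr j" using radp[OF ij(1)] radp[OF ij(2)] by auto
      then show False using ij(3) fx(1)[of i] fx(1)[of j] by simp
    qed
  qed
  have pre': "pre s1 (fx ` S)" unfolding pre_def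
  proof (intro conjI ballI allI impI)
    show "finite (fx ` S)" using PS2(1) by simp
    show "(\<Sum>i\<in>fx ` S. cnt i) \<le> N0" using PS2(2) by (simp add: sum.reindex[OF injS] fx)
    show "Z \<inter> closure \<Omega> \<subseteq> (\<Union>i\<in>fx ` S. cball (ctr i) (rad i - gap))" using PS2(3) by (simp add: fx)
  next
    fix i' assume "i' \<in> fx ` S"
    then obtain i where i: "i \<in> S" "i' = fx i" by blast
    show "ctr i' \<in> frontier \<Omega>" if "bdr i'" using PS(1)[OF i(1)] that i by (simp add: fx)
    show "ctr i' \<in> closure \<Omega>" "1 \<le> cnt i'" "lab i' \<le> 2" "2 * (1500 * \<epsilon> + gap) \<le> siz i'"
      "siz i' * Lam s1 \<le> s1 * mass \<delta> (reg i')" "reg i' \<in> sets borel" "reg i' \<subseteq> cball (ctr i') (rad i' - gap)"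
      using PS(2-5,7-9)[OF i(1)] i by (simp_all add: fx)
    have "s1 * real (lab i') \<le> s1 * real (lab i)" using s0 i by (intro mult_left_mono) (auto simp: fx)
    then show "s1 * lab i' \<le> siz i'" using PS(6)[OF i(1)] i by (simp add: fx)
    show "cert f (lab i') (ctr i') \<rho>" if \<rho>: "rad i' - gap < \<rho>" "\<rho> < rad i'" for \<rho>
    proof (cases "\<not> bdr i \<and> lab i = 1")
      case True
      have "cball (ctr i) \<rho> \<subseteq> cball (ctr i) (rad i)" using \<rho> i by (auto simp: fx)
      then have "cball (ctr i) \<rho> \<subseteq> \<Omega>" using S(2) i(1) True unfolding separated_def by blast
      then show ?thesis using True cert_interior[of f "ctr i" \<rho>] PS(10)[OF i(1), of \<rho>] \<rho> i by (simp add: fx)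
    next
      case False
      then show ?thesis using PS(10)[OF i(1), of \<rho>] \<rho> i by (auto simp: fx)
    qed
    fix j' assume "j' \<in> fx ` S" "i' \<noteq> j'"
    then obtain j where j: "j \<in> S" "j' = fx j" "i \<noteq> j" using i by blast
    show "reg i' \<inter> reg j' = {}" using PS2(4)[OF i(1) j(1,3)] i j by (simp add: fx)
    have "rad i + rad j < dist (ctr i) (ctr j)" using S(2) i(1) j(1,3) unfolding separated_def by blast
    then show "rad i' + rad j' \<le> dist (ctr i') (ctr j')" using i j by (simp add: fx)
  qed
  have sep': "separated (fx ` S)"
    unfolding separated_def
  proof (intro conjI ballI impI)
    fix i' j' assume "i' \<in> fx ` S" "j' \<in> fx ` S" "i' \<noteq> j'"
    then obtain i j where "i \<in> S" "j \<in> S" "i' = fx i" "j' = fx j" "i \<noteq> j" by blast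
    then show "rad i' + rad j' < dist (ctr i') (ctr j')" using S(2) unfolding separated_def by (simp add: fx)
  next
    fix i' assume "i' \<in> fx ` S" "\<not> bdr i'"
    then obtain i where "i \<in> S" "i' = fx i" "\<not> bdr i" by (auto simp: fx)
    then show "cball (ctr i') (rad i') \<subseteq> \<Omega>" using S(2) unfolding separated_def by (simp add: fx)
  qed
  define T where "T = fx ` S"
  note P = preD[OF pre'[folded T_def]] and P2 = pre_globalD[OF pre'[folded T_def]]
  have lab1: "bdr i" if "i \<in> T" "lab i = 1" for i using that by (auto simp: T_def fx split: if_splits)
  have ge2: "2 \<le> (\<Sum>i\<in>T. lab i)" unfolding T_def by (rule labels_sum_ge_2[OF pre' sep' sc])
  have gpos: "0 < growth \<delta> s1" using Lam_pos[OF s0] by (simp add: Lam)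
  have labE: "real (lab i) * growth \<delta> s1 \<le> mass \<delta> (reg i)" if i: "i \<in> T" for i
  proof -
    have "s1 * real (lab i) * growth \<delta> s1 \<le> siz i * growth \<delta> s1" using P(6)[OF i] gpos by (intro mult_right_mono) auto
    also have "\<dots> \<le> s1 * mass \<delta> (reg i)" using P(7)[OF i] by (simp add: Lam)
    finally have "s1 * (real (lab i) * growth \<delta> s1) \<le> s1 * mass \<delta> (reg i)" by (simp add: mult.assoc)
    then show ?thesis using s0 by simp
  qed
  \<comment> \<open>Here the upper bound on the energy enters, through the assumption
    \<open>e + 1 < 3 * growth \<delta> s1\<close>.\<close>
  have le2: "(\<Sum>i\<in>T. lab i) < 3"
  proof -
    have "real (\<Sum>i\<in>T. lab i) * growth \<delta> s1 = (\<Sum>i\<in>T. real (lab i) * growth \<delta> s1)" by (simp add: sum_distrib_right)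
    also have "\<dots> \<le> (\<Sum>i\<in>T. mass \<delta> (reg i))" by (intro sum_mono labE)
    also have "\<dots> \<le> mass \<delta> (\<Union>i\<in>T. reg i)" using P2 P(8) by (intro mu_sum) auto
    also have "\<dots> \<le> mass \<delta> UNIV" using P2 P(8) by (intro mu_mono sets.finite_UN) auto
    also have "\<dots> < 3 * growth \<delta> s1" using tot lt by simp
    finally have "real (\<Sum>i\<in>T. lab i) < 3" using gpos by (simp only: mult_less_cancel_right_pos)
    then show ?thesis by linarith
  qed
  \<comment> \<open>The size is at most 3 * s1 by \<open>pre_total\<close>, and the curvature factor
    at most 2.\<close>
  have regs: "reg i \<subseteq> cball (ctr i) (6 * s1)" if i: "i \<in> T" for i
  proof -
    have sz: "siz i \<le> 3 * s1"
    proof -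
      have "siz i \<le> (\<Sum>i\<in>T. siz i)"
        using P2(1) i siz_pos[OF pre'[folded T_def]] by (intro member_le_sum) (auto intro: less_imp_le)
      also have "\<dots> \<le> 3 * s1" using pre_total[OF pre'[folded T_def] s0] by simp
      finally show ?thesis .
    qed
    have s: "0 < siz i" by (rule siz_pos[OF pre'[folded T_def] i])
    have "cnt i \<le> (\<Sum>i\<in>T. cnt i)" using P2(1) i by (intro member_le_sum) auto
    then have "(1 + 72 * K * s1) ^ cnt i \<le> (1 + 72 * K * s1) ^ N0" using P2(2) by (intro pow_mono) simp
    then have "(1 + 72 * K * s1) ^ cnt i \<le> 2" using Fc(2) by simp
    then have "(1 + 72 * K * s1) ^ cnt i * siz i * wt (bdr i) \<le> 2 * siz i * 1"
      using s Fc(1) by (intro mult_mono) (auto simp: wt_def)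
    then have "rad i \<le> 6 * s1" using sz by (simp add: rad_def)
    then show ?thesis using P(9)[OF i] pos(1) by (auto simp: gap_def)
  qed
  have finT: "finite T" using P2(1) .
  consider i where "i \<in> T" "lab i = 2" | i j where "i \<in> T" "j \<in> T" "i \<noteq> j" "lab i = 1" "lab j = 1"
  proof (cases "\<exists>i\<in>T. lab i = 2")
    case True then show ?thesis using that(1) by blast
  next
    case False
    then have l1: "lab i \<le> 1" if "i \<in> T" for i using P(4)[OF that] that False by (cases "lab i = 2") auto
    have "(\<Sum>i\<in>T. lab i) = (\<Sum>i\<in>{i\<in>T. lab i = 1}. 1)"
    proof -
      have "(\<Sum>i\<in>T. lab i) = (\<Sum>i\<in>T. if lab i = 1 then 1 else 0)"
        using l1 by (intro sum.cong) (auto simp: le_Suc_eq)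
      also have "\<dots> = (\<Sum>i\<in>{i\<in>T. lab i = 1}. 1)" using finT by (intro sum.inter_filter[symmetric])
      finally show ?thesis .
    qed
    then have "card {i\<in>T. lab i = 1} = 2" using ge2 le2 by simp
    then obtain i j where "{i\<in>T. lab i = 1} = {i, j}" "i \<noteq> j" by (meson card_2_iff)
    then show ?thesis using that(2)[of i j] by blast
  qed
  then show ?thesis
  proof cases
    case (1 i)
    have "2 * growth \<delta> s1 \<le> enn2real (E (reg i)) + 1" using labE[OF 1(1)] mass_le[OF P(8)[OF 1(1)]] 1(2) by simp
    also have "enn2real (E (reg i)) \<le> enn2real (E (cball (ctr i) (6 * s1)))"
      using finE by (intro enn2real_mono E_mono regs[OF 1(1)]) auto
    finally show ?thesis using P(2)[OF 1(1)] by (intro disjI1 bexI[of _ "ctr i"]) auto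
  next
    case (2 i j)
    have "2 * growth \<delta> s1 \<le> mass \<delta> (reg i) + mass \<delta> (reg j)" using labE[OF 2(1)] labE[OF 2(2)] 2 by simp
    also have "\<dots> \<le> mass \<delta> (reg i \<union> reg j)" by (rule mu_add[OF P(8)[OF 2(1)] P(8)[OF 2(2)] P2(4)[OF 2(1-3)]])
    also have "\<dots> \<le> enn2real (E (reg i \<union> reg j)) + 1" using P(8)[OF 2(1)] P(8)[OF 2(2)] by (intro mass_le) auto
    also have "enn2real (E (reg i \<union> reg j)) \<le> enn2real (E (cball (ctr i) (6 * s1) \<union> cball (ctr j) (6 * s1)))"
      using finE by (intro enn2real_mono E_mono Un_mono regs[OF 2(1)] regs[OF 2(2)]) auto
    finally show ?thesis using P(1)[OF 2(1) lab1[OF 2(1,4)]] P(1)[OF 2(2) lab1[OF 2(2,5)]]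
      by (intro disjI2 bexI[of _ "ctr i"] bexI[of _ "ctr j"]) auto
  qed
qed

end

text \<open>\<open>L\<close> stands for |log epsilon|. The last inequality compares 2 * pi * (1 +
  alpha) * L with 3 * pi * L and needs alpha < 1/2; the one with ln 2 bounds the number of initial
  balls times the curvature loss of each.\<close>

lemma eventually_small_parameters:
  fixes K r0 r1 q \<beta> c \<alpha> :: real
  assumes pos: "0 < K" "0 < r0" "0 < r1" "0 < c" and \<alpha>: "\<alpha> < 1/2"
  shows "\<forall>\<^sub>F L in at_top. 1 \<le> L \<and> 4000 * exp (- L) \<le> r1 \<and> 1 / L^3 \<le> 1/1000 \<and> 420000 * exp (- L) \<le> 1 / L^3 \<and>
     6/100 * (1 / L^3) \<le> r1 \<and> 24/100 * (1 / L^3) < r0 \<and> 72/100 * K * (1 / L^3) \<le> 1 \<and> 3 * (1 / L^3) < r0 \<and> 40 * (K * (1 / L^3)) < 1 \<and>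
     \<beta> * (1 / L^3) * L \<le> 1 \<and> (2 * pi * (1 + \<alpha>) * L + 1) / c * (72/100 * K * (1 / L^3)) \<le> ln 2 \<and>
     0 \<le> L - 3 * ln L - q \<and> 2 * pi * (1 + \<alpha>) * L + 2 < 3 * (pi * (L - 3 * ln L - q) - pi)"
proof -
  define k where "k = pi * (1 - 2 * \<alpha>)"
  have k: "0 < k" using \<alpha> pi_gt_zero by (simp add: k_def)
  have "\<forall>\<^sub>F L in at_top. 2 + 9 * pi * ln L + 3 * pi * q + 3 * pi < k * L" using k by real_asymp
  moreover have "3 * (pi * (L - 3 * ln L - q) - pi) - (2 * pi * (1 + \<alpha>) * L + 2)
      = k * L - (2 + 9 * pi * ln L + 3 * pi * q + 3 * pi)" for L by (simp add: k_def algebra_simps)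
  ultimately have 1: "\<forall>\<^sub>F L in at_top. 2 * pi * (1 + \<alpha>) * L + 2 < 3 * (pi * (L - 3 * ln L - q) - pi)"
    by (smt (verit) eventually_mono)
  have 2: "\<forall>\<^sub>F L in at_top. 0 \<le> L - 3 * ln L - q" by real_asymp
  have 3: "\<forall>\<^sub>F L in at_top. (2 * pi * (1 + \<alpha>) * L + 1) / c * (72/100 * K * (1 / L^3)) \<le> ln 2"
  proof -
    have "((\<lambda>L. (2 * pi * (1 + \<alpha>) * L + 1) / c * (72/100 * K * (1 / L^3))) \<longlongrightarrow> 0) at_top" using pos by real_asymp
    then have "\<forall>\<^sub>F L in at_top. (2 * pi * (1 + \<alpha>) * L + 1) / c * (72/100 * K * (1 / L^3)) < ln 2"
      by (rule order_tendstoD) simp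
    then show ?thesis by eventually_elim simp
  qed
  have 4: "\<forall>\<^sub>F L in at_top. \<beta> * (1 / L^3) * L \<le> 1"
  proof -
    have "((\<lambda>L. \<beta> * (1 / L^3) * L) \<longlongrightarrow> 0) at_top" by real_asymp
    then have "\<forall>\<^sub>F L in at_top. \<beta> * (1 / L^3) * L < 1" by (rule order_tendstoD) simp
    then show ?thesis by eventually_elim simp
  qed
  have 5: "\<forall>\<^sub>F L in at_top. (1::real) \<le> L" by (rule eventually_ge_at_top)
  have 6: "\<forall>\<^sub>F L in at_top. 4000 * exp (- L) \<le> r1" "\<forall>\<^sub>F L in at_top. 1 / L^3 \<le> (1/1000::real)"
    "\<forall>\<^sub>F L in at_top. 420000 * exp (- L) \<le> 1 / (L::real)^3" "\<forall>\<^sub>F L in at_top. 6/100 * (1 / L^3) \<le> r1"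
    "\<forall>\<^sub>F L in at_top. 24/100 * (1 / L^3) < r0" "\<forall>\<^sub>F L in at_top. 72/100 * K * (1 / L^3) \<le> 1"
    "\<forall>\<^sub>F L in at_top. 3 * (1 / L^3) < r0" "\<forall>\<^sub>F L in at_top. 40 * (K * (1 / L^3)) < 1"
    using pos by real_asymp+
  from 1 2 3 4 5 6 show ?thesis by eventually_elim auto
qed

text \<open>The factor 1 / (1 + delta) costs at most pi, because delta * M <= 1.\<close>

lemma growth_lower_bound:
  fixes \<delta> L q g s :: real
  assumes \<delta>: "0 \<le> \<delta>" "\<delta> * L \<le> 1" and M: "0 \<le> M" "M \<le> L" and s: "exp M \<le> s"
  shows "pi * M - pi \<le> pi / (1 + \<delta>) * ln (1 + s)"
proof -
  have "M \<le> ln s" using s by (metis exp_gt_zero ln_exp ln_mono order_less_le_trans)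
  also have "\<dots> \<le> ln (1 + s)" using s exp_gt_zero[of M] by (intro ln_mono) linarith+
  finally have "pi / (1 + \<delta>) * M \<le> pi / (1 + \<delta>) * ln (1 + s)" using \<delta> by (intro mult_left_mono) auto
  moreover have "pi * M - pi \<le> pi / (1 + \<delta>) * M"
  proof -
    have "\<delta> * M \<le> \<delta> * L" using \<delta> M by (intro mult_left_mono) auto
    then have "(M - 1) * (1 + \<delta>) \<le> M" using \<delta> by (simp add: algebra_simps)
    then have "M - 1 \<le> M / (1 + \<delta>)" using \<delta> by (simp add: pos_le_divide_eq)
    then have "pi * (M - 1) \<le> pi * (M / (1 + \<delta>))" by (intro mult_left_mono) auto
    then show ?thesis by (simp add: algebra_simps)
  qed
  ultimately show ?thesis by linarith
qed

lemma ennreal_le_add_oneD: assumes "ennreal t \<le> Y + 1" shows "ennreal (t - 1) \<le> Y"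
proof (cases Y)
  case (real y)
  then have "ennreal (y + 1) = Y + 1" by (simp add: ennreal_plus)
  then have "ennreal t \<le> ennreal (y + 1)" using assms by simp
  then have "t \<le> y + 1" using real by (subst (asm) ennreal_le_iff) auto
  then show ?thesis using real by (simp add: ennreal_leI)
qed simp

theorem theorem3:
  fixes \<alpha> :: real and \<Omega> :: "(real^2) set"
  assumes "0 < \<alpha>" and "\<alpha> < 1 / 2"
    and "open \<Omega>" and "connected \<Omega>" and "\<Omega> \<noteq> {}" and "bounded \<Omega>"
    and "simply_connected \<Omega>" and "C11_boundary \<Omega>"
  shows "\<exists>\<epsilon>\<^sub>0>0. \<exists>C>0. \<forall>\<epsilon> rstar. \<forall>m :: real^2 \<Rightarrow> real^2.
    0 < \<epsilon> \<longrightarrow> \<epsilon> < \<epsilon>\<^sub>0 \<longrightarrow> rstar = 1 / \<bar>ln \<epsilon>\<bar> ^ 3 \<longrightarrow>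
    m ` \<Omega> \<subseteq> cball 0 1 \<longrightarrow> C1_on \<Omega> m \<longrightarrow> normal_trace_zero \<Omega> m \<longrightarrow>
    gl_energy \<epsilon> m \<Omega> \<le> ennreal (2 * pi * (1 + \<alpha>) * \<bar>ln \<epsilon>\<bar>) \<longrightarrow>
    (\<exists>x1. ball x1 rstar \<subseteq> \<Omega> \<and>
       gl_energy \<epsilon> m (ball x1 rstar) \<ge> ennreal (2 * pi * \<bar>ln (rstar / \<epsilon>)\<bar> - C)) \<or>
    (\<exists>x2\<in>frontier \<Omega>. \<exists>x3\<in>frontier \<Omega>.
       gl_energy \<epsilon> m ((ball x2 rstar \<union> ball x3 rstar) \<inter> \<Omega>)
         \<ge> ennreal (2 * pi * \<bar>ln (rstar / \<epsilon>)\<bar> - C))"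
proof -
  let ?\<nu> = "outer_unit_normal \<Omega>"
  obtain K r0 where dom: "regular_domain \<Omega> ?\<nu> K r0"
    using C11_boundary_regular_domain[OF \<open>open \<Omega>\<close> \<open>bounded \<Omega>\<close> \<open>C11_boundary \<Omega>\<close>] by blast
  interpret regular_domain \<Omega> ?\<nu> K r0 by (rule dom)
  obtain N where N: "continuous_on UNIV N" "\<And>x. norm (N x) \<le> 1" "\<And>y. y \<in> frontier \<Omega> \<Longrightarrow> N y = ?\<nu> y"
    by (rule normal_extension) (rule that, (assumption | blast)+)
  have "uniformly_continuous_on (closure \<Omega>) N"
    using N(1) bounded_dom by (intro compact_uniformly_continuous) (auto intro: continuous_on_subset)
  then obtain d where d: "0 < d" "\<And>x y. x \<in> closure \<Omega> \<Longrightarrow> y \<in> closure \<Omega> \<Longrightarrow> dist x y < d \<Longrightarrow> dist (N x) (N y) < 1/8"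
    unfolding uniformly_continuous_on_def by (metis dist_commute zero_less_divide_1_iff zero_less_numeral)
  define r1 where "r1 = min d (min (r0 / 2) (1 / (200 * K)))"
  have r1: "0 < r1" "2 * r1 \<le> r0" "K * r1 \<le> 1/200"
  proof -
    show "0 < r1" "2 * r1 \<le> r0" using d r0 K by (auto simp: r1_def)
    have "K * r1 \<le> K * (1 / (200 * K))" using K by (intro mult_left_mono) (auto simp: r1_def)
    then show "K * r1 \<le> 1/200" using K by simp
  qed
  \<comment> \<open>The scale in \<open>growth\<close> is bb * epsilon and the final parameter is
    rstar / 100, so the logarithm loses this constant.\<close>
  define q where "q = ln (100 * bb)"
  have bb1: "1 \<le> bb" using bb_ge(1) pi_gt3 by linarith
  have q0: "0 \<le> q" using bb1 by (simp add: q_def)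
  define \<beta> where "\<beta> = 16 + 48/100 * K"
  obtain L0 where L0: "\<And>L. L0 \<le> L \<Longrightarrow> 1 \<le> L \<and> 4000 * exp (- L) \<le> r1 \<and> 1 / L^3 \<le> 1/1000 \<and> 420000 * exp (- L) \<le> 1 / L^3 \<and>
     6/100 * (1 / L^3) \<le> r1 \<and> 24/100 * (1 / L^3) < r0 \<and> 72/100 * K * (1 / L^3) \<le> 1 \<and> 3 * (1 / L^3) < r0 \<and> 40 * (K * (1 / L^3)) < 1 \<and>
     \<beta> * (1 / L^3) * L \<le> 1 \<and> (2 * pi * (1 + \<alpha>) * L + 1) / c0 * (72/100 * K * (1 / L^3)) \<le> ln 2 \<and>
     0 \<le> L - 3 * ln L - q \<and> 2 * pi * (1 + \<alpha>) * L + 2 < 3 * (pi * (L - 3 * ln L - q) - pi)"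
    using eventually_small_parameters[OF K r0 r1(1) c0_pos \<open>\<alpha> < 1/2\<close>, of \<beta> q] unfolding eventually_at_top_linorder by blast
  \<comment> \<open>The part with \<open>q\<close> comes from the scale of \<open>growth\<close>,
    the second 2 * pi from \<open>growth_lower_bound\<close>, and the last 2 from the compensation
    for \<open>bad\<close> and the approximation of \<open>m\<close>, 1 each.\<close>
  define C where "C = 2 * pi * q + 2 * pi + 2"
  have C: "0 < C" using q0 pi_gt_zero by (simp add: C_def add_nonneg_pos)
  show ?thesis
  proof (rule exI[of _ "exp (- max L0 1)"], rule conjI[OF exp_gt_zero], rule exI[of _ C], intro conjI[OF C] allI impI)
    fix \<epsilon> rstar :: real and m :: "real^2 \<Rightarrow> real^2"
    assume eps: "0 < \<epsilon>" "\<epsilon> < exp (- max L0 1)" and rs: "rstar = 1 / \<bar>ln \<epsilon>\<bar> ^ 3" and m: "m ` \<Omega> \<subseteq> cball 0 1" "C1_on \<Omega> m"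
      and tr: "normal_trace_zero \<Omega> m" and en: "gl_energy \<epsilon> m \<Omega> \<le> ennreal (2 * pi * (1 + \<alpha>) * \<bar>ln \<epsilon>\<bar>)"
    define L where "L = - ln \<epsilon>"
    have "ln \<epsilon> < - max L0 1" using eps by (metis exp_gt_zero ln_exp ln_less_cancel_iff)
    then have L: "L0 \<le> L" "\<bar>ln \<epsilon>\<bar> = L" by (auto simp: L_def)
    have eL: "exp (- L) = \<epsilon>" using eps by (simp add: L_def)
    have r: "rstar = 1 / L^3" using rs L by simp
    note P = L0[OF L(1), unfolded eL, folded r]
    define s1 where "s1 = rstar / 100"
    define e where "e = 2 * pi * (1 + \<alpha>) * L + 1"
    define \<delta> where "\<delta> = \<beta> * rstar"
    have L1: "1 \<le> L" using P by simp
    have r0': "0 < rstar" using r L1 by simp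
    have e0: "0 \<le> 2 * pi * (1 + \<alpha>) * L" using L1 \<open>0 < \<alpha>\<close> by simp
    obtain w where w: "C1_on UNIV w"
      "\<And>A. A \<in> sets borel \<Longrightarrow> A \<subseteq> \<Omega> \<Longrightarrow> (\<integral>\<^sup>+x\<in>A. ennreal (gl_dens \<epsilon> w x) \<partial>lborel) \<le> gl_energy \<epsilon> m A + 1"
      "hausdorff1_outer {y \<in> frontier \<Omega>. rstar \<le> \<bar>w y \<bullet> ?\<nu> y\<bar>} \<le> ennreal (50 * \<epsilon>)"
      using C1_approximation[OF open_dom bounded_dom eps(1) m(2,1) tr _ r0' _ norm_normal, of "50 * \<epsilon>"] en eps(1)
      by (auto simp: le_less_trans)
    \<comment> \<open>The tolerance for the normal component of \<open>w\<close> is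
      \<open>rstar\<close> itself, so that it enters \<open>\<delta>\<close> on the same footing as
      the curvature.\<close>
    interpret normal_field \<Omega> ?\<nu> K r0 w \<epsilon> N r1 rstar
    proof
      show "norm (N x - ?\<nu> y) \<le> 1/8" if "x \<in> closure \<Omega>" "y \<in> frontier \<Omega>" "dist x y < r1" for x y
        using d(2)[of x y] that N(3)[of y] frontier_subset_closure by (auto simp: r1_def dist_norm)
    qed (use w eps N r1 P r0' in auto)
    have E_le: "E A \<le> gl_energy \<epsilon> m (A \<inter> \<Omega>) + 1" if "A \<in> sets borel" for A
      unfolding E_eq using that open_dom by (intro w(2)) auto
    have fin: "E UNIV \<le> ennreal e"
    proof -
      have "E UNIV \<le> ennreal (2 * pi * (1 + \<alpha>) * L) + 1" using E_le[of UNIV] en L(2) by (simp add: add_right_mono order_trans)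
      also have "\<dots> = ennreal e" using e0 by (simp add: e_def ennreal_plus)
      finally show ?thesis .
    qed
    define M where "M = L - 3 * ln L - q"
    have lnL: "0 \<le> ln L" using L1 by simp
    have \<delta>0: "0 \<le> \<delta>" using r0' K by (simp add: \<delta>_def \<beta>_def)
    have gl: "pi * M - pi \<le> growth \<delta> s1"
      unfolding growth_def speed_def
    proof (rule growth_lower_bound[OF \<delta>0])
      show "\<delta> * L \<le> 1" "0 \<le> M" using P by (auto simp: \<delta>_def M_def)
      show "M \<le> L" using lnL q0 by (simp add: M_def)
      have "exp M = exp L * exp (- (3 * ln L)) * exp (- q)" unfolding M_def by (simp flip: exp_add)
      also have "exp (- (3 * ln L)) = rstar"
      proof -
        have "exp (3 * ln L) = L^3" using L1 by (simp add: exp_of_nat_mult[of 3, simplified])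
        then show ?thesis by (simp add: r exp_minus inverse_eq_divide)
      qed
      also have "exp (- q) = 1 / (100 * bb)" using bb1 by (simp add: q_def exp_minus inverse_eq_divide)
      also have "exp L = 1 / \<epsilon>" using eL by (metis exp_minus inverse_eq_divide inverse_inverse_eq)
      also have "1 / \<epsilon> * rstar * (1 / (100 * bb)) = 1 / (bb * \<epsilon>) * s1" by (simp add: s1_def)
      also have "\<dots> \<le> scale \<delta> * s1"
        unfolding scale_def using \<delta>0 r0' bb1 eps(1) by (intro mult_right_mono divide_right_mono) (auto simp: s1_def)
      finally show "exp M \<le> scale \<delta> * s1" .
    qed
    have pw: "(1 + 72 * K * s1) ^ nat \<lfloor>e / c0\<rfloor> \<le> 2"
    proof -
      have x: "0 \<le> 72 * K * s1" using K r0' by (simp add: s1_def)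
      have "(1 + 72 * K * s1) ^ nat \<lfloor>e / c0\<rfloor> \<le> exp (72 * K * s1) ^ nat \<lfloor>e / c0\<rfloor>"
        using x exp_ge_add_one_self[of "72 * K * s1"] by (intro power_mono) auto
      also have "\<dots> = exp (real (nat \<lfloor>e / c0\<rfloor>) * (72 * K * s1))" by (simp add: exp_of_nat_mult)
      also have "\<dots> \<le> exp (ln 2)"
      proof -
        have "0 \<le> e / c0" using e0 c0_pos by (simp add: e_def)
        then have "real (nat \<lfloor>e / c0\<rfloor>) \<le> e / c0" by (simp add: of_nat_floor)
        then have "real (nat \<lfloor>e / c0\<rfloor>) * (72 * K * s1) \<le> e / c0 * (72 * K * s1)" using x by (intro mult_right_mono) auto
        also have "\<dots> \<le> ln 2" using P by (simp add: e_def s1_def)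
        finally show ?thesis by (simp only: exp_le_cancel_iff)
      qed
      finally show ?thesis by simp
    qed
    have conc: "(\<exists>c\<in>closure \<Omega>. 2 * growth \<delta> s1 - 1 \<le> enn2real (E (cball c (6 * s1)))) \<or>
      (\<exists>y\<in>frontier \<Omega>. \<exists>z\<in>frontier \<Omega>. 2 * growth \<delta> s1 - 1 \<le> enn2real (E (cball y (6 * s1) \<union> cball z (6 * s1))))"
    proof (rule concentration[OF \<open>simply_connected \<Omega>\<close> \<open>\<Omega> \<noteq> {}\<close> fin _ _ _ _ _ _ pw])
      show "0 \<le> e" using e0 by (simp add: e_def)
      show "4200 * \<epsilon> \<le> s1" "6 * s1 \<le> r1" "24 * s1 < r0" "72 * K * s1 \<le> 1" using P by (auto simp: s1_def)
      show "8 * (2 * rstar + K * (6 * s1)) \<le> \<delta>" by (simp add: \<delta>_def \<beta>_def s1_def algebra_simps)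
      show "e + 1 < 3 * growth \<delta> s1" using P gl by (simp add: e_def M_def)
    qed
    have transfer: "ennreal (2 * pi * \<bar>ln (rstar / \<epsilon>)\<bar> - C) \<le> gl_energy \<epsilon> m (B \<inter> \<Omega>)"
      if A: "2 * growth \<delta> s1 - 1 \<le> enn2real (E A)" "A \<subseteq> B" "B \<in> sets borel" for A B
    proof -
      have "ln (rstar / \<epsilon>) = ln rstar - ln \<epsilon>" using r0' eps(1) by (simp add: ln_div)
      also have "ln rstar = - (3 * ln L)" using L1 by (simp add: r ln_div ln_realpow)
      finally have "ln (rstar / \<epsilon>) = L - 3 * ln L" by (simp add: L_def)
      moreover have "0 \<le> L - 3 * ln L" using P q0 by linarith
      ultimately have "\<bar>ln (rstar / \<epsilon>)\<bar> = L - 3 * ln L" by simp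
      then have "2 * pi * \<bar>ln (rstar / \<epsilon>)\<bar> - C = 2 * (pi * M - pi) - 2"
        unfolding C_def M_def by (simp only:) (simp add: algebra_simps)
      also have "\<dots> \<le> (2 * growth \<delta> s1 - 1) - 1" using gl by simp
      finally have 1: "2 * pi * \<bar>ln (rstar / \<epsilon>)\<bar> - C \<le> (2 * growth \<delta> s1 - 1) - 1" .
      have "E A < \<infinity>" using E_mono[of A UNIV] fin by (simp add: le_less_trans)
      then have "ennreal (2 * growth \<delta> s1 - 1) \<le> E A" using A(1) by (metis ennreal_enn2real ennreal_leI infinity_ennreal_def)
      also have "\<dots> \<le> E B" by (rule E_mono[OF A(2)])
      also have "\<dots> \<le> gl_energy \<epsilon> m (B \<inter> \<Omega>) + 1" by (rule E_le[OF A(3)])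
      finally have "ennreal ((2 * growth \<delta> s1 - 1) - 1) \<le> gl_energy \<epsilon> m (B \<inter> \<Omega>)" by (rule ennreal_le_add_oneD)
      then show ?thesis using ennreal_leI[OF 1] order_trans by blast
    qed
    have s6: "6 * s1 = 6/100 * rstar" by (simp add: s1_def)
    from conc show "(\<exists>x1. ball x1 rstar \<subseteq> \<Omega> \<and>
         gl_energy \<epsilon> m (ball x1 rstar) \<ge> ennreal (2 * pi * \<bar>ln (rstar / \<epsilon>)\<bar> - C)) \<or>
      (\<exists>x2\<in>frontier \<Omega>. \<exists>x3\<in>frontier \<Omega>.
         gl_energy \<epsilon> m ((ball x2 rstar \<union> ball x3 rstar) \<inter> \<Omega>) \<ge> ennreal (2 * pi * \<bar>ln (rstar / \<epsilon>)\<bar> - C))"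
    proof (elim disjE bexE)
      fix c assume c: "c \<in> closure \<Omega>" "2 * growth \<delta> s1 - 1 \<le> enn2real (E (cball c (6 * s1)))"
      \<comment> \<open>A concentration near the boundary may admit no ball of radius
        \<open>rstar\<close> inside the domain; then one boundary ball contains it and is used twice
        in the second alternative.\<close>
      have "(\<exists>x. ball x rstar \<subseteq> \<Omega> \<and> cball c (6/100 * rstar) \<subseteq> ball x rstar) \<or> (\<exists>y\<in>frontier \<Omega>. cball c (6/100 * rstar) \<subseteq> ball y rstar)"
        using P by (intro relocate[OF c(1) r0']) auto
      then show ?thesis
      proof (elim disjE exE bexE conjE)
        fix x assume "ball x rstar \<subseteq> \<Omega>" "cball c (6/100 * rstar) \<subseteq> ball x rstar"
        then show ?thesis using transfer[OF c(2), of "ball x rstar"] unfolding s6 by (auto simp: Int_absorb2)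
      next
        fix y assume "y \<in> frontier \<Omega>" "cball c (6/100 * rstar) \<subseteq> ball y rstar"
        then show ?thesis using transfer[OF c(2), of "ball y rstar"] unfolding s6
          by (intro disjI2 bexI[of _ y]) auto
      qed
    next
      fix y z assume yz: "y \<in> frontier \<Omega>" "z \<in> frontier \<Omega>"
        "2 * growth \<delta> s1 - 1 \<le> enn2real (E (cball y (6 * s1) \<union> cball z (6 * s1)))"
      have "cball y (6 * s1) \<union> cball z (6 * s1) \<subseteq> ball y rstar \<union> ball z rstar" using r0' unfolding s6 by auto
      then show ?thesis using transfer[OF yz(3), of "ball y rstar \<union> ball z rstar"] yz
        by (intro disjI2 bexI[of _ y] bexI[of _ z]) auto
    qed
  qed
qed

end
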